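(* Let $D\subset\mathbb{R}^3$ be a bounded domain with $C^1$-smooth boundary $S$ and outward unit normal $N$, and let $k>0$. Suppose $u$ solves $$(\nabla^2+k^2)u=c \text{ in } D,\qquad u|_S=u_N|_S=0,$$ with a constant $c\neq 0$. Let $\{u_j\}_{j=1}^J$ be a maximal linearly independent set of solutions to $(\nabla^2+k^2)u_j=0$ in $D$, $u_j|_S=0$, normalized in $L^2(D)$. Then there exist constant vectors $c_1,\dots,c_J\in\mathbb{R}^3$ such that $$[s,N(s)]=\sum_{j=1}^J c_j\,u_{jN}(s)\qquad\text{for all } s\in S.$$
   Context: $[s,N]$ denotes the cross product of the position vector $s$ and the normal $N(s)$; $u_N$, $u_{jN}$ denote outward normal derivatives on $S$. *)

theory Defs
  imports "HOL-Analysis.Analysis" "HOL-Analysis.Cross3"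
begin

definition bounded_domain :: "(real^3) set \<Rightarrow> bool" where
  "bounded_domain D \<longleftrightarrow> D \<noteq> {} \<and> open D \<and> connected D \<and> bounded D"

definition C1_boundary_outward_normal :: "(real^3) set \<Rightarrow> (real^3 \<Rightarrow> real^3) \<Rightarrow> bool" where
  "C1_boundary_outward_normal D N \<longleftrightarrow>
     (\<forall>s\<in>frontier D. \<exists>r>0. \<exists>(phi::real^3 \<Rightarrow> real) (g::real^3 \<Rightarrow> real^3).
        (\<forall>x\<in>ball s r. (phi has_derivative (\<lambda>h. g x \<bullet> h)) (at x)) \<and>
        continuous_on (ball s r) g \<and> g s \<noteq> 0 \<and>
        D \<inter> ball s r = {x \<in> ball s r. phi x < 0} \<and>
        N s = (1 / norm (g s)) *\<^sub>R g s)"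

definition has_laplacian_on :: "(real^3 \<Rightarrow> real) \<Rightarrow> (real^3 \<Rightarrow> real) \<Rightarrow> (real^3) set \<Rightarrow> bool" where
  "has_laplacian_on u L D \<longleftrightarrow>
     (\<exists>(g::real^3 \<Rightarrow> real^3) (H::real^3 \<Rightarrow> real^3^3).
        continuous_on D H \<and>
        (\<forall>x\<in>D. (u has_derivative (\<lambda>h. g x \<bullet> h)) (at x) \<and>
                 (g has_derivative (\<lambda>h. H x *v h)) (at x) \<and>
                 L x = trace (H x)))"

definition C1_on_closure :: "(real^3 \<Rightarrow> real) \<Rightarrow> (real^3) set \<Rightarrow> bool" where
  "C1_on_closure u D \<longleftrightarrow>
     (\<exists>G::real^3 \<Rightarrow> real^3. continuous_on (closure D) G \<and>
        (\<forall>x\<in>closure D. (u has_derivative (\<lambda>h. G x \<bullet> h)) (at x within closure D)))"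

definition normal_deriv :: "(real^3) set \<Rightarrow> (real^3 \<Rightarrow> real^3) \<Rightarrow> (real^3 \<Rightarrow> real) \<Rightarrow> real^3 \<Rightarrow> real" where
  "normal_deriv D N u s = frechet_derivative u (at s within closure D) (N s)"

definition helmholtz_sol :: "(real^3) set \<Rightarrow> real \<Rightarrow> real \<Rightarrow> (real^3 \<Rightarrow> real) \<Rightarrow> bool" where
  "helmholtz_sol D k c u \<longleftrightarrow>
     C1_on_closure u D \<and> has_laplacian_on u (\<lambda>x. c - k\<^sup>2 * u x) D"

definition dirichlet_sol :: "(real^3) set \<Rightarrow> real \<Rightarrow> (real^3 \<Rightarrow> real) \<Rightarrow> bool" where
  "dirichlet_sol D k w \<longleftrightarrow> helmholtz_sol D k 0 w \<and> (\<forall>s\<in>frontier D. w s = 0)"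

end

(* Let w = x \<times> \<nabla>u. Componentwise w is a derivative of u along rotations, so it solves the homogeneous
   Helmholtz equation in D, and it vanishes on S because \<nabla>u does. Hence w is a combination of the u_j. On S
   the Hessian of u is c N N^T, so the normal derivative of w is c [s,N]: comparing normal derivatives
   gives the claim.

   What needs work is that w is C^1 up to S, that is, that the Hessian of u extends continuously
   to S by c N N^T, although u is only assumed C^1 up to S and S is only C^1. Extended by zero, u is C^1 on the
   whole space and its weak Laplacian is (c - k^2 u) 1_D. Subtract the one-dimensional solution in the half-space
   tangent to D at a boundary point s. The difference has a weak Laplacian which near s is small outside
   a thin cone around the tangent plane. Pairing it with a third difference of the Newtonian potential,
   whose poles other than x lie outside D and the half-space, and which is therefore integrable
   with total mass O(d^2), shows that the difference is o(d^2) at distance d from s, uniformly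
   in s. Interior estimates for the Helmholtz equation then bound the difference of the Hessians by o(1). *)
theory Submission
  imports Defs
begin

section \<open>Integrals of derivatives and measure of thin sets\<close>

text \<open>Near a merely C^1 boundary only the trace of the Hessian of u is bounded beforehand, so
  u is compared with a model whose Hessian at S is already c N N^T. The comparison takes place at
  the scale d of the distance to S. The interior estimate divides by d^2, which is why an error
  o(d^2) is needed and O(d^2) is useless. The order of the difference is forced: an m-th difference
  of 1/r with step d decays like d^m / r^(m+1). Against a density in R^3 that is merely bounded on a
  cone, the second difference still gives d^2 log(1/d), while the third converges. The extra poles,
  at distance about 10 d, 20 d, 30 d on the outer side, cost nothing because the compared function
  is 0 there. All constants are uniform in s because one defining function near s0 serves every
  boundary point close to s0. Only then do the limits at different boundary points fit together to a
  continuous Hessian. Integrals are estimated without charts or polar coordinates: thin sets by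
  packing disjoint translates, radial integrals by dyadic balls.\<close>

lemma bounded_continuous_support:
  fixes f :: "'a::euclidean_space \<Rightarrow> real"
  assumes "continuous_on UNIV f" "\<And>x. x \<notin> cball p R \<Longrightarrow> f x = 0"
  obtains B where "B \<ge> 0" "\<And>x. \<bar>f x\<bar> \<le> B"
proof -
  have "compact (f ` cball p R)"
    by (intro compact_continuous_image continuous_on_subset[OF assms(1)]) auto
  then obtain B where B: "\<And>x. x \<in> cball p R \<Longrightarrow> \<bar>f x\<bar> \<le> B"
    using compact_imp_bounded bounded_iff by (metis imageI real_norm_def)
  have "\<bar>f x\<bar> \<le> max B 0" for x
    using B[of x] assms(2)[of x] by (cases "x \<in> cball p R") auto
  then show ?thesis using that[of "max B 0"] by auto
qed

lemma integrable_continuous_support: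
  fixes f :: "'a::euclidean_space \<Rightarrow> real"
  assumes "continuous_on UNIV f" "\<And>x. x \<notin> cball p R \<Longrightarrow> f x = 0"
  shows "integrable lborel f"
proof -
  have "integrable lborel (\<lambda>x. indicator (cball p R) x *\<^sub>R f x)"
    by (intro borel_integrable_compact continuous_on_subset[OF assms(1)]) auto
  moreover have "(\<lambda>x. indicator (cball p R) x *\<^sub>R f x) = f"
    using assms(2) by (auto simp: indicator_def fun_eq_iff)
  ultimately show ?thesis by simp
qed

lemma integral_translate:
  fixes f :: "'a::euclidean_space \<Rightarrow> real"
  assumes "f \<in> borel_measurable borel"
  shows "(LINT x|lborel. f (x + v)) = (LINT x|lborel. f x)"
proof -
  have "(LINT x|lborel. f x) = (LINT x|distr lborel borel ((+) v). f x)"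
    by (subst lborel_distr_plus) simp
  also have "\<dots> = (LINT x|lborel. f (v + x))"
    using assms by (intro integral_distr) auto
  finally show ?thesis by (simp add: add.commute)
qed

text \<open>Translation invariance makes every difference quotient of \<open>f\<close> integrate to
  0, and dominated convergence passes this on to the derivative. Since one direction
  \<open>e\<close> is treated at a time, the integrations by parts below need no iterated
  integrals.\<close>

lemma integral_directional_derivative_eq_0:
  fixes f f' :: "'a::euclidean_space \<Rightarrow> real"
  assumes der: "\<And>x. ((\<lambda>t. f (x + t *\<^sub>R e)) has_real_derivative f' x) (at 0)"
    and cf: "continuous_on UNIV f" and cf': "continuous_on UNIV f'"
    and supp: "\<And>x. x \<notin> cball p R \<Longrightarrow> f x = 0"
  shows "(LINT x|lborel. f' x) = 0"
proof -
  have supp': "f' x = 0" if "x \<notin> cball p R" for x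
  proof -
    have op: "open ((\<lambda>t::real. x + t *\<^sub>R e) -` (- cball p R))"
      by (intro open_vimage continuous_intros) auto
    have "((\<lambda>t::real. 0::real) has_real_derivative f' x) (at 0)"
      using der[of x]
      by (rule has_field_derivative_transform_within_open[OF _ op]) (use that supp in auto)
    then show ?thesis using DERIV_unique DERIV_const by blast
  qed
  obtain B where B: "B \<ge> 0" "\<And>x. \<bar>f' x\<bar> \<le> B"
    using bounded_continuous_support[OF cf' supp'] by blast
  have der2: "((\<lambda>t. f (x + t *\<^sub>R e)) has_real_derivative f' (x + t *\<^sub>R e)) (at t)" for x t
    using DERIV_shift[of "\<lambda>t. f (x + t *\<^sub>R e)" "f' (x + t *\<^sub>R e)" 0 t] der[of "x + t *\<^sub>R e"]
    by (simp add: algebra_simps)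
  have lip: "\<bar>f (x + h *\<^sub>R e) - f x\<bar> \<le> B * h" if "h \<ge> 0" for x h
  proof (cases "h = 0")
    case False
    then have "h > 0" using that by simp
    from MVT2[OF this, of "\<lambda>t. f (x + t *\<^sub>R e)" "\<lambda>t. f' (x + t *\<^sub>R e)"] der2
    obtain z where "f (x + h *\<^sub>R e) - f x = h * f' (x + z *\<^sub>R e)" by auto
    then have "\<bar>f (x + h *\<^sub>R e) - f x\<bar> = \<bar>f' (x + z *\<^sub>R e)\<bar> * h"
      using that by (simp add: abs_mult)
    then show ?thesis using mult_right_mono[OF B(2) that] by simp
  qed simp
  define q where "q n x = (f (x + (1 / real (Suc n)) *\<^sub>R e) - f x) * real (Suc n)" for n x
  have mf: "f \<in> borel_measurable borel" using cf by (rule borel_measurable_continuous_onI)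
  have intf: "integrable lborel f" by (rule integrable_continuous_support[OF cf supp])
  have cft: "continuous_on UNIV (\<lambda>x. f (x + v))" for v
    by (intro continuous_on_compose2[OF cf] continuous_intros) auto
  have supp_t: "f (x + v) = 0" if "x \<notin> cball p (R + norm v)" for x v
  proof (rule supp)
    have "norm (p - x) \<le> norm (p - (x + v)) + norm v"
      using norm_triangle_ineq[of "p - (x + v)" v] by (simp add: algebra_simps)
    then show "x + v \<notin> cball p R" using that by (simp add: dist_norm)
  qed
  have intft: "integrable lborel (\<lambda>x. f (x + v))" for v
    by (rule integrable_continuous_support[OF cft supp_t])
  have q0: "(LINT x|lborel. q n x) = 0" for n
    unfolding q_def using intf intft integral_translate[OF mf] by simp
  have "(\<lambda>n. LINT x|lborel. q n x) \<longlonglongrightarrow> (LINT x|lborel. f' x)"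
  \<comment> \<open>The mean value theorem bounds the quotients by \<open>B\<close>, and steps of
    length at most 1 enlarge the support by at most \<open>norm e\<close>. The absolute value covers
    a negative \<open>R\<close>.\<close>
  proof (rule integral_dominated_convergence[where w = "\<lambda>x. B * indicator (cball p (\<bar>R\<bar> + norm e)) x"])
    show "f' \<in> borel_measurable lborel"
      using borel_measurable_continuous_onI[OF cf'] by simp
    show "q n \<in> borel_measurable lborel" for n
      unfolding q_def using mf borel_measurable_continuous_onI[OF cft] by simp
    show "integrable lborel (\<lambda>x. B * indicator (cball p (\<bar>R\<bar> + norm e)) x)"
      by (intro integrable_mult_right integrable_real_indicator)
        (auto simp: emeasure_lborel_cball_finite[unfolded infinity_ennreal_def])
    show "AE x in lborel. (\<lambda>n. q n x) \<longlonglongrightarrow> f' x"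
    proof (rule AE_I2)
      fix x
      have "((\<lambda>h. (f (x + h *\<^sub>R e) - f x) / h) \<longlongrightarrow> f' x) (at 0)"
        using der[of x, unfolded DERIV_def] by simp
      moreover have "filterlim (\<lambda>n. 1 / real (Suc n)) (at 0) sequentially"
        using LIMSEQ_Suc[OF lim_1_over_n] by (auto simp: filterlim_at)
      ultimately show "(\<lambda>n. q n x) \<longlonglongrightarrow> f' x"
        unfolding q_def using filterlim_compose by fastforce
    qed
    show "AE x in lborel. norm (q n x) \<le> B * indicator (cball p (\<bar>R\<bar> + norm e)) x" for n
    proof (rule AE_I2)
      fix x
      have h: "1 / real (Suc n) \<le> 1" by simp
      show "norm (q n x) \<le> B * indicator (cball p (\<bar>R\<bar> + norm e)) x"
      proof (cases "x \<in> cball p (\<bar>R\<bar> + norm e)")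
        case True
        have "norm (q n x) = \<bar>f (x + (1 / real (Suc n)) *\<^sub>R e) - f x\<bar> * real (Suc n)"
          by (simp add: q_def abs_mult)
        also have "\<dots> \<le> B * (1 / real (Suc n)) * real (Suc n)"
          by (intro mult_right_mono lip) auto
        finally show ?thesis using True by simp
      next
        case False
        have "norm ((1 / real (Suc n)) *\<^sub>R e) \<le> norm e"
          using h mult_right_mono[of "1 / real (Suc n)" 1 "norm e"] by simp
        moreover have "norm (p - x) \<le> norm (p - (x + (1 / real (Suc n)) *\<^sub>R e)) + norm ((1 / real (Suc n)) *\<^sub>R e)"
          using norm_triangle_ineq[of "p - (x + (1 / real (Suc n)) *\<^sub>R e)" "(1 / real (Suc n)) *\<^sub>R e"] by (simp add: algebra_simps)
        ultimately have "x + (1 / real (Suc n)) *\<^sub>R e \<notin> cball p R" 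
          using False by (auto simp: dist_norm)
        moreover have "x \<notin> cball p R"
        proof -
          have "R \<le> \<bar>R\<bar> + norm e" by (simp add: add_increasing2)
          then show ?thesis using False by force
        qed
        ultimately show ?thesis using supp B by (simp add: q_def)
      qed
    qed
  qed
  then show ?thesis by (simp add: q0 LIMSEQ_const_iff)
qed

text \<open>Packing argument: the sets \<open>A + j v\<close> with \<open>j < m\<close> are
  disjoint, have equal measure and lie in one larger ball. It takes the place of Fubini when strips
  and slabs are measured.\<close>

lemma measure_disjoint_translates:
  fixes A :: "'a::euclidean_space set"
  assumes A: "A \<in> sets borel" "A \<subseteq> cball p \<rho>"
    and disj: "\<And>x j. x \<in> A \<Longrightarrow> j > 0 \<Longrightarrow> j < m \<Longrightarrow> x + real j *\<^sub>R v \<notin> A"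
    and m: "real m * norm v \<le> \<rho>'"
  shows "real m * measure lborel A \<le> measure lborel (cball p (\<rho> + \<rho>'))"
proof -
  define T where "T j = (\<lambda>x. real j *\<^sub>R v + x) ` A" for j
  have lm: "A \<in> lmeasurable"
    using A bounded_subset[OF bounded_cball A(2)] by (simp add: bounded_set_imp_lmeasurable)
  have T: "T j \<in> lmeasurable" "measure lebesgue (T j) = measure lebesgue A" for j
    unfolding T_def using lm by (auto intro: measurable_translation simp: measure_translation)
  have dj: "T i \<inter> T j = {}" if "i < j" "j < m" for i j
  proof (rule ccontr)
    assume "T i \<inter> T j \<noteq> {}"
    then obtain x y where "x \<in> A" "y \<in> A" "real i *\<^sub>R v + x = real j *\<^sub>R v + y"
      by (auto simp: T_def)
    then have "y + real (j - i) *\<^sub>R v = x"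
      using that by (simp add: of_nat_diff algebra_simps)
    then show False using disj[OF \<open>y \<in> A\<close>, of "j - i"] that \<open>x \<in> A\<close> less_imp_diff_less[of j m i] by auto
  qed
  have pw: "pairwise (\<lambda>i j. disjnt (T i) (T j)) {..<m}"
    unfolding pairwise_def disjnt_def using dj by (metis Int_commute lessThan_iff linorder_neqE_nat)
  have sub: "(\<Union>j<m. T j) \<subseteq> cball p (\<rho> + \<rho>')"
  proof
    fix y assume "y \<in> (\<Union>j<m. T j)"
    then obtain j x where jx: "j < m" "x \<in> A" "y = real j *\<^sub>R v + x" by (auto simp: T_def)
    have "norm (p - y) \<le> norm (p - x) + real j * norm v"
      using norm_triangle_ineq4[of "p - x" "real j *\<^sub>R v"] jx by (simp add: algebra_simps)
    moreover have "real j * norm v \<le> real m * norm v" using jx by (intro mult_right_mono) auto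
    ultimately show "y \<in> cball p (\<rho> + \<rho>')" using A jx m by (force simp: dist_norm)
  qed
  have "real m * measure lebesgue A = (\<Sum>j<m. measure lebesgue (T j))" using T by simp
  also have "\<dots> = measure lebesgue (\<Union>j<m. T j)"
    by (rule measure_UNION'[symmetric]) (use T pw in auto)
  also have "\<dots> \<le> measure lebesgue (cball p (\<rho> + \<rho>'))"
    by (rule measure_mono_fmeasurable[OF sub]) (use T in \<open>auto intro!: fmeasurable.finite_UN\<close>)
  finally show ?thesis using A by simp
qed

section \<open>A twice continuously differentiable step function\<close>

lemma DERIV_max_0_power:
  "((\<lambda>x::real. (max 0 x) ^ Suc (Suc n)) has_real_derivative real (Suc (Suc n)) * (max 0 x) ^ Suc n) (at x)"
proof -
  consider "x > 0" | "x < 0" | "x = 0" by linarith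
  then show ?thesis
  proof cases
    case 1
    have "((\<lambda>x::real. x ^ Suc (Suc n)) has_real_derivative real (Suc (Suc n)) * x ^ Suc n) (at x)"
      using DERIV_pow[of "Suc (Suc n)" x] by (simp del: power_Suc)
    then have "((\<lambda>x::real. (max 0 x) ^ Suc (Suc n)) has_real_derivative real (Suc (Suc n)) * x ^ Suc n) (at x)"
      by (rule has_field_derivative_transform_within_open[of _ _ _ "{0<..}"]) (use 1 in auto)
    with 1 show ?thesis by simp
  next
    case 2
    have "((\<lambda>x::real. 0) has_real_derivative 0) (at x)" by simp
    then have "((\<lambda>x::real. (max 0 x) ^ Suc (Suc n)) has_real_derivative 0) (at x)"
      by (rule has_field_derivative_transform_within_open[of _ _ _ "{..<0}"]) (use 2 in auto)
    with 2 show ?thesis by simp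
  next
    case 3
    have "((\<lambda>h::real. (max 0 h) ^ Suc (Suc n) / h) \<longlongrightarrow> 0) (at 0)"
    proof (rule Lim_null_comparison[where g = "\<lambda>h. \<bar>h\<bar> ^ Suc n"])
      have "norm ((max 0 h) ^ Suc (Suc n) / h) \<le> \<bar>h\<bar> ^ Suc n" for h :: real
      proof (cases "h > 0")
        case False
        then have "max 0 h = 0" by simp
        then show ?thesis by (simp del: power_Suc add: zero_power)
      qed (simp add: max_def)
      then show "\<forall>\<^sub>F h in at 0. norm ((max 0 h) ^ Suc (Suc n) / h) \<le> \<bar>h\<bar> ^ Suc n"
        by (intro always_eventually allI)
      show "((\<lambda>h::real. \<bar>h\<bar> ^ Suc n) \<longlongrightarrow> 0) (at 0)"
        by (rule tendsto_eq_intros | simp)+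
    qed
    then show ?thesis using 3 by (simp add: DERIV_def)
  qed
qed

text \<open>Third difference of the truncated cubic t^3/6, that is, the integral of the quadratic
  B-spline. It rises from 0 to 1 on [0,3] and is C^2, as a cut-off with continuous Hessian
  requires.\<close>

definition step :: "real \<Rightarrow> real" where
  "step t = ((max 0 t)^3 - 3 * (max 0 (t - 1))^3 + 3 * (max 0 (t - 2))^3 - (max 0 (t - 3))^3) / 6"

definition step' :: "real \<Rightarrow> real" where
  "step' t = ((max 0 t)^2 - 3 * (max 0 (t - 1))^2 + 3 * (max 0 (t - 2))^2 - (max 0 (t - 3))^2) / 2"

definition step'' :: "real \<Rightarrow> real" where
  "step'' t = max 0 t - 3 * max 0 (t - 1) + 3 * max 0 (t - 2) - max 0 (t - 3)"

lemma DERIV_max_0_cube: "((\<lambda>x::real. (max 0 (x - a)) ^ 3) has_real_derivative 3 * (max 0 (x - a))^2) (at x)"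
proof -
  have g: "((\<lambda>x. x - a) has_real_derivative 1) (at x)"
    by (auto intro!: derivative_eq_intros)
  have f: "((\<lambda>y. max 0 y ^ 3) has_real_derivative 3 * (max 0 (x - a))^2) (at (x - a))"
    using DERIV_max_0_power[of 1 "x - a"] by (simp add: numeral_eq_Suc)
  show ?thesis using DERIV_chain2[OF f g] by simp
qed

lemma DERIV_max_0_square: "((\<lambda>x::real. (max 0 (x - a)) ^ 2) has_real_derivative 2 * max 0 (x - a)) (at x)"
proof -
  have g: "((\<lambda>x. x - a) has_real_derivative 1) (at x)"
    by (auto intro!: derivative_eq_intros)
  have f: "((\<lambda>y. max 0 y ^ 2) has_real_derivative 2 * max 0 (x - a)) (at (x - a))"
    using DERIV_max_0_power[of 0 "x - a"] by (simp add: numeral_eq_Suc)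
  show ?thesis using DERIV_chain2[OF f g] by simp
qed

lemma DERIV_step: "(step has_real_derivative step' t) (at t)"
proof -
  note d = DERIV_max_0_cube[of 0 t, simplified] DERIV_max_0_cube[of _ t]
  show ?thesis
    unfolding step_def[abs_def] step'_def
    by (rule DERIV_cong[OF DERIV_cdivide[OF DERIV_diff[OF DERIV_add[OF DERIV_diff[OF d(1)
            DERIV_cmult[OF d(2)]] DERIV_cmult[OF d(2)]] d(2)]]]) simp
qed

lemma DERIV_step': "(step' has_real_derivative step'' t) (at t)"
proof -
  note d = DERIV_max_0_square[of 0 t, simplified] DERIV_max_0_square[of _ t]
  show ?thesis
    unfolding step'_def[abs_def] step''_def
    by (rule DERIV_cong[OF DERIV_cdivide[OF DERIV_diff[OF DERIV_add[OF DERIV_diff[OF d(1)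
            DERIV_cmult[OF d(2)]] DERIV_cmult[OF d(2)]] d(2)]]]) simp
qed

lemma step_eq_0: "t \<le> 0 \<Longrightarrow> step t = 0"
  and step'_eq_0: "t \<le> 0 \<or> t \<ge> 3 \<Longrightarrow> step' t = 0"
  and step''_eq_0: "t \<le> 0 \<or> t \<ge> 3 \<Longrightarrow> step'' t = 0"
  and step_eq_1: "t \<ge> 3 \<Longrightarrow> step t = 1"
  by (auto simp: step_def step'_def step''_def max_def power2_eq_square power3_eq_cube algebra_simps)

lemma continuous_step: "continuous_on UNIV step" "continuous_on UNIV step'" "continuous_on UNIV step''"
  unfolding step_def[abs_def] step'_def[abs_def] step''_def[abs_def]
  by (intro continuous_intros; simp)+

lemma step'_nonneg: "step' t \<ge> 0"
proof -
  consider "t \<le> 0" | "0 \<le> t" "t \<le> 1" | "1 \<le> t" "t \<le> 2" | "2 \<le> t" "t \<le> 3" | "3 \<le> t" by linarith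
  then show ?thesis
  proof cases
    case 3
    have "3 * (t - 1)^2 \<le> t^2"
    proof -
      \<comment> \<open>On [1,2] the difference t^2 - 3 (t - 1)^2 equals 2 (t - 1)(2 - t) +
        1.\<close>
      have "(t - 1) * (2 - t) \<ge> 0" using 3 by simp
      then show ?thesis using 3 by (simp add: power2_eq_square algebra_simps)
    qed
    then show ?thesis using 3 by (simp add: step'_def max_def)
  next
    case 4
    have "step' t = (3 - t)^2 / 2" using 4 by (auto simp: step'_def max_def power2_eq_square field_simps)
    then show ?thesis using zero_le_power2[of "3 - t"] by linarith
  qed (auto simp: step'_eq_0, simp add: step'_def max_def)
qed

lemma step_bounds: "0 \<le> step t" "step t \<le> 1"
proof -
  have mono: "step a \<le> step b" if "a \<le> b" for a b
    using DERIV_nonneg_imp_nondecreasing[OF that] DERIV_step step'_nonneg by blast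
  show "0 \<le> step t" using mono[of "min 0 t" t] by (simp add: step_eq_0)
  show "step t \<le> 1" using mono[of t "max 3 t"] by (simp add: step_eq_1)
qed

lemma step'_step''_bounded: obtains B where "B > 0" "\<And>t. \<bar>step' t\<bar> \<le> B" "\<And>t. \<bar>step'' t\<bar> \<le> B"
proof -
  have o: "t \<le> 0 \<or> t \<ge> 3" if "t \<notin> cball (3/2) (3/2)" for t :: real
    using that by (auto simp: dist_real_def abs_if split: if_splits)
  obtain B1 where B1: "\<And>t. \<bar>step' t\<bar> \<le> B1"
    using bounded_continuous_support[OF continuous_step(2) step'_eq_0[OF o]] by blast
  obtain B2 where B2: "\<And>t. \<bar>step'' t\<bar> \<le> B2"
    using bounded_continuous_support[OF continuous_step(3) step''_eq_0[OF o]] by blast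
  show ?thesis
    by (rule that[of "\<bar>B1\<bar> + \<bar>B2\<bar> + 1"])
      (use B1 B2 in \<open>auto intro: order_trans[OF B1] order_trans[OF B2]\<close>)
qed

lemma has_derivative_radial:
  fixes z :: "'a::real_inner"
  assumes "(e has_real_derivative e') (at (z \<bullet> z))"
  shows "((\<lambda>z. e (z \<bullet> z)) has_derivative (\<lambda>h. 2 * e' * (z \<bullet> h))) (at z)"
proof -
  have "((\<lambda>z. z \<bullet> z) has_derivative (\<lambda>h. 2 * (z \<bullet> h))) (at z)"
    by (auto intro!: derivative_eq_intros simp: inner_commute)
  from has_derivative_compose[OF this, of e "\<lambda>h. e' * h"] assms
  show ?thesis by (simp add: has_field_derivative_def mult.assoc mult.left_commute)
qed

section \<open>Singular and tail integrals by dyadic balls\<close>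

definition unit_ball_volume :: real where
  "unit_ball_volume = measure lborel (cball (0::real^3) 1)"

lemma measure_cball3: "r \<ge> 0 \<Longrightarrow> measure lborel (cball (p::real^3) r) = unit_ball_volume * r^3"
  using content_cball[of r p] content_cball[of 1 "0::real^3"] by (simp add: unit_ball_volume_def)

lemma unit_ball_volume_nonneg: "unit_ball_volume \<ge> 0"
  by (simp add: unit_ball_volume_def)

lemma emeasure_cball3: "r \<ge> 0 \<Longrightarrow> emeasure lborel (cball (p::real^3) r) = ennreal (unit_ball_volume * r^3)"
  using measure_cball3[of r p] emeasure_eq_ennreal_measure[of lborel "cball p r"] emeasure_lborel_cball_finite[of p r]
  by (metis infinity_ennreal_def less_irrefl)

text \<open>Pointwise \<open>f\<close> is at most the sum of
  \<open>a n * indicator (cball p (r n))\<close>, because one summand alone is already large enough.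
  With geometric radii this estimates radial integrals.\<close>

lemma integral_le_sum_cballs:
  fixes f :: "real^3 \<Rightarrow> real"
  assumes mf: "f \<in> borel_measurable borel" and nn: "\<And>x. 0 \<le> f x"
    and cover: "\<And>x. f x > 0 \<Longrightarrow> \<exists>n. x \<in> cball p (r n) \<and> f x \<le> a n"
    and a: "\<And>n. a n \<ge> 0" and r: "\<And>n. r n \<ge> 0"
    and b: "(\<lambda>n. a n * (unit_ball_volume * r n ^ 3)) sums S"
  shows "integrable lborel f" "(LINT x|lborel. f x) \<le> S"
proof -
  have pos: "0 \<le> a n * (unit_ball_volume * r n ^ 3)" for n
    using a r unit_ball_volume_nonneg by simp
  have S0: "S \<ge> 0" using sums_le[OF _ sums_zero b] pos by auto
  have "ennreal (f x) \<le> (\<Sum>n. ennreal (a n) * indicator (cball p (r n)) x)" for x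
  proof (cases "f x > 0")
    case True
    then obtain n where n: "x \<in> cball p (r n)" "f x \<le> a n" using cover by blast
    have "ennreal (f x) \<le> ennreal (a n) * indicator (cball p (r n)) x"
      using n by (simp add: ennreal_leI)
    also have "\<dots> \<le> (\<Sum>n. ennreal (a n) * indicator (cball p (r n)) x)"
      using sum_le_suminf[OF summableI, of "{n}" "\<lambda>n. ennreal (a n) * indicator (cball p (r n)) x"]
      by (simp only: sum.insert sum.empty finite.intros empty_iff not_False_eq_True add_0_right simp_thms zero_le)
    finally show ?thesis .
  qed (use nn[of x] in auto)
  then have "(\<integral>\<^sup>+x. ennreal (f x) \<partial>lborel) \<le> (\<integral>\<^sup>+x. (\<Sum>n. ennreal (a n) * indicator (cball p (r n)) x) \<partial>lborel)"
    by (intro nn_integral_mono) auto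
  also have "\<dots> = (\<Sum>n. \<integral>\<^sup>+x. ennreal (a n) * indicator (cball p (r n)) x \<partial>lborel)"
    by (intro nn_integral_suminf borel_measurable_times_ennreal borel_measurable_const borel_measurable_indicator) auto
  also have "\<dots> = (\<Sum>n. ennreal (a n * (unit_ball_volume * r n ^ 3)))"
    using a r by (simp add: nn_integral_cmult_indicator emeasure_cball3 ennreal_mult')
  also have "\<dots> = ennreal S"
    using suminf_ennreal2[OF pos sums_summable[OF b]] sums_unique[OF b] by simp
  finally have le: "(\<integral>\<^sup>+x. ennreal (f x) \<partial>lborel) \<le> ennreal S" .
  show int: "integrable lborel f"
    by (rule integrableI_bounded) (use mf nn le in \<open>auto simp: order_le_less_trans\<close>)
  show "(LINT x|lborel. f x) \<le> S"
    using le nn_integral_eq_integral[OF int] nn S0 by simp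
qed

lemma integral_inverse_norm:
  fixes p :: "real^3"
  assumes "\<rho> > 0"
  shows "integrable lborel (\<lambda>x. indicator (cball p \<rho>) x / norm (x - p))"
    "(LINT x|lborel. indicator (cball p \<rho>) x / norm (x - p)) \<le> 3 * unit_ball_volume * \<rho>\<^sup>2"
proof -
  define f where "f x = indicator (cball p \<rho>) x / norm (x - p)" for x :: "real^3"
  \<comment> \<open>On the shell from radius rho/2^(n+1) to rho/2^n the integrand is below 2 * 2^n /
    rho. The centre needs no shell, since division by zero gives \<open>f p = 0\<close>. The series
    sums to the factor 8/3, later rounded up to 3.\<close>
  define a r where "a n = 2 * 2 ^ n / \<rho>" and "r n = \<rho> / 2 ^ n" for n :: nat
  have mf: "f \<in> borel_measurable borel" unfolding f_def[abs_def]
    by (intro borel_measurable_divide borel_measurable_indicator borel_measurable_continuous_onI continuous_intros) auto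
  have nn: "0 \<le> f x" for x by (simp add: f_def)
  have cover: "\<exists>n. x \<in> cball p (r n) \<and> f x \<le> a n" if "f x > 0" for x
  proof -
    define t where "t = norm (x - p)"
    have t: "t > 0" "t \<le> \<rho>" using that
      by (cases "x \<in> cball p \<rho>"; auto simp: f_def t_def dist_norm norm_minus_commute)+
    define n where "n = nat \<lfloor>log 2 (\<rho> / t)\<rfloor>"
    have l0: "log 2 (\<rho> / t) \<ge> 0" using t assms by simp
    have "real n \<le> log 2 (\<rho> / t)" "log 2 (\<rho> / t) < real n + 1"
      unfolding n_def using l0 by linarith+
    then have "2 ^ n \<le> \<rho> / t" "\<rho> / t < 2 ^ Suc n"
      using t assms by (auto simp: le_log_iff log_less_iff powr_realpow powr_add)
    then have "t \<le> \<rho> / 2 ^ n" "1 / t < 2 * 2 ^ n / \<rho>" using t assms by (auto simp: field_simps)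
    moreover have "f x = 1 / t" using t by (simp add: f_def t_def dist_norm norm_minus_commute)
    ultimately show ?thesis
      by (intro exI[of _ n]) (auto simp: a_def r_def t_def dist_norm norm_minus_commute)
  qed
  have m1: "(\<lambda>n. 2 * unit_ball_volume * \<rho>\<^sup>2 * (1/4) ^ n) sums (2 * unit_ball_volume * \<rho>\<^sup>2 * (1 / (1 - 1/4)))"
    by (intro sums_mult geometric_sums) auto
  have m2: "2 * unit_ball_volume * \<rho>\<^sup>2 * (1/4) ^ n = a n * (unit_ball_volume * r n ^ 3)" for n
  proof -
    have "(4::real) ^ n = 2 ^ n * 2 ^ n" by (simp add: power_mult_distrib[symmetric])
    then show ?thesis using assms by (simp add: a_def r_def field_simps power2_eq_square power3_eq_cube)
  qed
  have "2 * unit_ball_volume * \<rho>\<^sup>2 * (1 / (1 - 1/4)) = 8/3 * unit_ball_volume * \<rho>\<^sup>2" by simp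
  with m1 have b: "(\<lambda>n. a n * (unit_ball_volume * r n ^ 3)) sums (8/3 * unit_ball_volume * \<rho>\<^sup>2)"
    by (simp only: m2)
  have a: "a n \<ge> 0" "r n \<ge> 0" for n using assms by (auto simp: a_def r_def)
  note R = integral_le_sum_cballs[OF mf nn cover a b]
  show "integrable lborel (\<lambda>x. indicator (cball p \<rho>) x / norm (x - p))"
    using R(1) by (simp add: f_def[abs_def])
  have "8/3 * unit_ball_volume * \<rho>\<^sup>2 \<le> 3 * unit_ball_volume * \<rho>\<^sup>2"
    using unit_ball_volume_nonneg by (intro mult_right_mono) auto
  then show "(LINT x|lborel. indicator (cball p \<rho>) x / norm (x - p)) \<le> 3 * unit_ball_volume * \<rho>\<^sup>2"
    using R(2) by (simp add: f_def[abs_def])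
qed

lemma integral_inverse_norm_power4:
  fixes p :: "real^3"
  assumes "\<rho> > 0"
  shows "integrable lborel (\<lambda>x. indicator (- ball p \<rho>) x / norm (x - p) ^ 4)"
    "(LINT x|lborel. indicator (- ball p \<rho>) x / norm (x - p) ^ 4) \<le> 16 * unit_ball_volume / \<rho>"
proof -
  define f where "f x = indicator (- ball p \<rho>) x / norm (x - p) ^ 4" for x :: "real^3"
  \<comment> \<open>Now the shells grow outwards: \<open>a n\<close> is the integrand at the inner
    radius \<open>\<rho> * 2 ^ n\<close>, and \<open>r n\<close> is the outer radius. The resulting
    series has ratio 1/2.\<close>
  define a r where "a n = 1 / (\<rho> * 2 ^ n) ^ 4" and "r n = \<rho> * 2 ^ Suc n" for n :: nat
  have mf: "f \<in> borel_measurable borel" unfolding f_def[abs_def]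
    by (intro borel_measurable_divide borel_measurable_indicator borel_measurable_continuous_onI continuous_intros) auto
  have nn: "0 \<le> f x" for x by (simp add: f_def)
  have cover: "\<exists>n. x \<in> cball p (r n) \<and> f x \<le> a n" if "f x > 0" for x
  proof -
    define t where "t = norm (x - p)"
    have t: "t > 0" "t \<ge> \<rho>" using that assms
      by (cases "x \<in> ball p \<rho>"; auto simp: f_def t_def dist_norm norm_minus_commute)+
    define n where "n = nat \<lfloor>log 2 (t / \<rho>)\<rfloor>"
    have l0: "log 2 (t / \<rho>) \<ge> 0" using t assms by simp
    have "real n \<le> log 2 (t / \<rho>)" "log 2 (t / \<rho>) < real n + 1"
      unfolding n_def using l0 by linarith+
    then have "2 ^ n \<le> t / \<rho>" "t / \<rho> < 2 ^ Suc n"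
      using t assms by (auto simp: le_log_iff log_less_iff powr_realpow powr_add)
    then have *: "\<rho> * 2 ^ n \<le> t" "t \<le> \<rho> * 2 ^ Suc n" using t assms by (auto simp: field_simps)
    have "f x = 1 / t ^ 4" using t by (simp add: f_def t_def dist_norm norm_minus_commute)
    moreover have "1 / t ^ 4 \<le> 1 / (\<rho> * 2 ^ n) ^ 4"
      using * assms t by (intro divide_left_mono power_mono) auto
    ultimately show ?thesis using *
      by (intro exI[of _ n]) (auto simp: a_def r_def t_def dist_norm norm_minus_commute)
  qed
  have m1: "(\<lambda>n. 8 * unit_ball_volume / \<rho> * (1/2) ^ n) sums (8 * unit_ball_volume / \<rho> * (1 / (1 - 1/2)))"
    by (intro sums_mult geometric_sums) auto
  have m2: "8 * unit_ball_volume / \<rho> * (1/2) ^ n = a n * (unit_ball_volume * r n ^ 3)" for n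
    using assms by (simp add: a_def r_def field_simps power4_eq_xxxx power3_eq_cube)
  have "8 * unit_ball_volume / \<rho> * (1 / (1 - 1/2)) = 16 * unit_ball_volume / \<rho>" by simp
  with m1 have b: "(\<lambda>n. a n * (unit_ball_volume * r n ^ 3)) sums (16 * unit_ball_volume / \<rho>)"
    by (simp only: m2)
  have a: "a n \<ge> 0" "r n \<ge> 0" for n using assms by (auto simp: a_def r_def)
  note R = integral_le_sum_cballs[OF mf nn cover a b]
  show "integrable lborel (\<lambda>x. indicator (- ball p \<rho>) x / norm (x - p) ^ 4)"
    using R(1) by (simp add: f_def[abs_def])
  show "(LINT x|lborel. indicator (- ball p \<rho>) x / norm (x - p) ^ 4) \<le> 16 * unit_ball_volume / \<rho>"
    using R(2) by (simp add: f_def[abs_def])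
qed

section \<open>A weak divergence theorem at a continuously differentiable boundary\<close>

lemma has_derivative_imp_directional:
  fixes f :: "'a::real_normed_vector \<Rightarrow> real"
  assumes "(f has_derivative f') (at x)"
  shows "((\<lambda>t. f (x + t *\<^sub>R e)) has_real_derivative f' e) (at 0)"
proof -
  have l: "linear f'" using assms has_derivative_linear by blast
  have "((\<lambda>t::real. x + t *\<^sub>R e) has_derivative (\<lambda>t. t *\<^sub>R e)) (at 0)"
    by (auto intro!: derivative_eq_intros)
  from has_derivative_compose[OF this, of f f'] assms
  have "((\<lambda>t. f (x + t *\<^sub>R e)) has_derivative (\<lambda>t. f' (t *\<^sub>R e))) (at 0)" by simp
  then show ?thesis
    unfolding has_field_derivative_def
    by (rule has_derivative_eq_rhs) (simp add: fun_eq_iff linear_cmul[OF l] mult.commute)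
qed

text \<open>The last hypothesis asks for 0 on a whole neighbourhood of each point off
  \<open>Q\<close>, not only for limit 0; functions with a cut-off provide this, and derivatives
  extend under the same condition.\<close>

lemma continuous_on_extend_0:
  fixes h :: "'a::real_normed_vector \<Rightarrow> 'b::real_normed_vector"
  assumes "open Q" "continuous_on Q h"
    and "\<And>x. x \<notin> Q \<Longrightarrow> \<exists>U. open U \<and> x \<in> U \<and> (\<forall>y\<in>U \<inter> Q. h y = 0)"
  shows "continuous_on UNIV (\<lambda>x. if x \<in> Q then h x else 0)"
proof (rule continuous_at_imp_continuous_on, rule ballI)
  fix x
  let ?f = "\<lambda>x. if x \<in> Q then h x else 0"
  show "isCont ?f x"
  proof (cases "x \<in> Q")
    case True
    have "isCont h x" using assms(1,2) True by (simp add: continuous_on_eq_continuous_at)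
    then have "(h \<longlongrightarrow> ?f x) (at x)" using True by (simp add: isCont_def)
    then have "(?f \<longlongrightarrow> ?f x) (at x)"
      by (rule Lim_transform_within_open[OF _ assms(1) True]) simp
    then show ?thesis by (simp only: isCont_def)
  next
    case False
    from assms(3)[OF False] obtain U where U: "open U" "x \<in> U" "\<forall>y\<in>U \<inter> Q. h y = 0" by blast
    have "((\<lambda>_. 0) \<longlongrightarrow> ?f x) (at x)" using False by simp
    then have "(?f \<longlongrightarrow> ?f x) (at x)"
      by (rule Lim_transform_within_open[OF _ U(1,2)]) (use U(3) in auto)
    then show ?thesis by (simp only: isCont_def)
  qed
qed

lemma has_derivative_extend_0:
  fixes h :: "'a::real_normed_vector \<Rightarrow> 'b::real_normed_vector"
  assumes "open Q" "x \<in> Q \<Longrightarrow> (h has_derivative h') (at x)"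
    and "x \<notin> Q \<Longrightarrow> \<exists>U. open U \<and> x \<in> U \<and> (\<forall>y\<in>U \<inter> Q. h y = 0)"
  shows "((\<lambda>x. if x \<in> Q then h x else 0) has_derivative (if x \<in> Q then h' else (\<lambda>_. 0))) (at x)"
proof (cases "x \<in> Q")
  case True
  have "((\<lambda>x. if x \<in> Q then h x else 0) has_derivative h') (at x)"
    by (rule has_derivative_transform_within_open[OF assms(2) assms(1)]) (use True in auto)
  then show ?thesis using True by simp
next
  case False
  from assms(3)[OF False] obtain U where U: "open U" "x \<in> U" "\<forall>y\<in>U \<inter> Q. h y = 0" by blast
  have "((\<lambda>x. if x \<in> Q then h x else 0) has_derivative (\<lambda>_. 0)) (at x)"
    by (rule has_derivative_transform_within_open[of "\<lambda>_. 0" _ _ _ U]) (use U in auto)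
  then show ?thesis using False by simp
qed

lemma abs_integral_le_measure:
  fixes f :: "'a::euclidean_space \<Rightarrow> real"
  assumes "integrable lborel f" "A \<in> sets borel" "A \<subseteq> cball p R"
    and "\<And>x. \<bar>f x\<bar> \<le> K * indicator A x"
  shows "\<bar>LINT x|lborel. f x\<bar> \<le> K * measure lborel A"
proof -
  have "emeasure lborel A \<le> emeasure lborel (cball p R)"
    using assms by (intro emeasure_mono) auto
  then have fin: "emeasure lborel A < \<infinity>" using emeasure_lborel_cball_finite[of p R] by (rule le_less_trans)
  have "\<bar>LINT x|lborel. f x\<bar> \<le> (LINT x|lborel. \<bar>f x\<bar>)" by (rule integral_abs_bound)
  also have "\<dots> \<le> (LINT x|lborel. K * indicator A x)"
    using assms fin by (intro integral_mono integrable_mult_right integrable_real_indicator) auto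
  also have "\<dots> = K * measure lborel A" using assms fin by simp
  finally show ?thesis .
qed

lemma has_derivative_unique_inner:
  fixes a b :: "'a::euclidean_space"
  assumes "(f has_derivative (\<lambda>h. a \<bullet> h)) (at x)" "(f has_derivative (\<lambda>h. b \<bullet> h)) (at x)"
  shows "a = b"
  using has_derivative_unique[OF assms] by (simp add: fun_eq_iff vector_eq_rdot)

lemma gradient_support:
  fixes psi :: "'a::euclidean_space \<Rightarrow> real"
  assumes "\<And>x. (psi has_derivative (\<lambda>h. gpsi x \<bullet> h)) (at x)" "\<And>x. x \<notin> cball p \<rho> \<Longrightarrow> psi x = 0"
    and "x \<notin> cball p \<rho>"
  shows "gpsi x = 0"
proof -
  have "((\<lambda>_. 0) has_derivative (\<lambda>h. gpsi x \<bullet> h)) (at x)"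
    by (rule has_derivative_transform_within_open[OF assms(1), of "- cball p \<rho>"]) (use assms in auto)
  moreover have "((\<lambda>_. 0::real) has_derivative (\<lambda>h. (0::'a) \<bullet> h)) (at x)" by simp
  ultimately show ?thesis by (rule has_derivative_unique_inner)
qed

text \<open>The direction \<open>e\<close> is transversal to the level sets of \<open>phi\<close>;
  this quantifies how fast a walk along \<open>e\<close> leaves \<open>D\<close>.\<close>

lemma increment_ge:
  fixes phi :: "'a::euclidean_space \<Rightarrow> real"
  assumes "\<And>x. x \<in> ball p r \<Longrightarrow> (phi has_derivative (\<lambda>h. g x \<bullet> h)) (at x)"
    and "\<And>x. x \<in> ball p r \<Longrightarrow> a \<le> g x \<bullet> e"
    and "x \<in> ball p r" "x + t *\<^sub>R e \<in> ball p r" "t \<ge> 0"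
  shows "phi (x + t *\<^sub>R e) \<ge> phi x + a * t"
proof -
  have seg: "x + \<tau> *\<^sub>R e \<in> ball p r" if "0 \<le> \<tau>" "\<tau> \<le> t" for \<tau>
  proof (cases "t = 0")
    case False
    have "(1 - \<tau> / t) *\<^sub>R x + (\<tau> / t) *\<^sub>R (x + t *\<^sub>R e) \<in> ball p r"
      by (intro convexD[OF convex_ball]) (use assms that False in auto)
    moreover have "(1 - \<tau> / t) *\<^sub>R x + (\<tau> / t) *\<^sub>R (x + t *\<^sub>R e) = x + \<tau> *\<^sub>R e"
      using False by (simp add: algebra_simps)
    ultimately show ?thesis by simp
  qed (use that assms in auto)
  have "((\<lambda>\<tau>. phi (x + \<tau> *\<^sub>R e) - a * \<tau>) has_real_derivative g (x + \<tau> *\<^sub>R e) \<bullet> e - a) (at \<tau>)"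
    if "0 \<le> \<tau>" "\<tau> \<le> t" for \<tau>
  proof -
    have "((\<lambda>s. phi (x + \<tau> *\<^sub>R e + s *\<^sub>R e)) has_real_derivative g (x + \<tau> *\<^sub>R e) \<bullet> e) (at 0)"
      by (rule has_derivative_imp_directional[OF assms(1)[OF seg[OF that]]])
    then have "((\<lambda>\<tau>. phi (x + \<tau> *\<^sub>R e)) has_real_derivative g (x + \<tau> *\<^sub>R e) \<bullet> e) (at \<tau>)"
      using DERIV_shift[of "\<lambda>s. phi (x + s *\<^sub>R e)" _ 0 \<tau>] by (simp add: algebra_simps)
    then show ?thesis by (auto intro!: derivative_eq_intros)
  qed
  then have "phi (x + 0 *\<^sub>R e) - a * 0 \<le> phi (x + t *\<^sub>R e) - a * t"
    using assms(2)[OF seg] by (intro DERIV_nonneg_imp_nondecreasing[OF assms(5)]) (metis diff_ge_0_iff_ge)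
  then show ?thesis by simp
qed

text \<open>A step of length 4/(N a) along \<open>e\<close> raises \<open>phi\<close> by at least
  4/N, the width of the strip, so translates by multiples of it are disjoint. About N of them fit
  into the larger ball, whence measure O(1/N). The number 4 matches the place where the cut-off in
  \<open>weak_divergence\<close> becomes 1.\<close>

lemma measure_strip_le:
  fixes phi :: "'a::euclidean_space \<Rightarrow> real"
  assumes phi: "\<And>x. x \<in> ball p r \<Longrightarrow> (phi has_derivative (\<lambda>h. g x \<bullet> h)) (at x)"
    and e: "norm e = 1" "a > 0" "\<And>x. x \<in> ball p r \<Longrightarrow> a \<le> g x \<bullet> e"
    and "\<rho> < r"
  shows "\<exists>C\<ge>0. \<forall>n::nat. real (Suc n) * measure lborel {x \<in> cball p \<rho>. - 4 / real (Suc n) < phi x \<and> phi x < 0} \<le> C"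
proof -
  define A where "A n = {x \<in> cball p \<rho>. - 4 / real (Suc n) < phi x \<and> phi x < 0}" for n :: nat
  define \<rho>' where "\<rho>' = (r - \<rho>) / 2"
  have \<rho>': "\<rho>' > 0" "\<rho> + \<rho>' < r" using assms by (auto simp: \<rho>'_def field_simps)
  have cphi: "continuous_on (ball p r) phi"
    using phi by (meson continuous_at_imp_continuous_on has_derivative_continuous)
  have Ab: "A n \<in> sets borel" for n
  proof -
    have "open (ball p r \<inter> phi -` {- 4 / real (Suc n)<..<0})"
      by (rule continuous_open_preimage[OF cphi]) auto
    moreover have "A n = cball p \<rho> \<inter> (ball p r \<inter> phi -` {- 4 / real (Suc n)<..<0})"
      using assms(5) by (auto simp: A_def)
    ultimately show ?thesis by auto
  qed
  define V where "V = measure lborel (cball p (\<rho> + \<rho>'))"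
  have V: "V \<ge> 0" by (simp add: V_def)
  define C where "C = 8 * V / (\<rho>' * a) + 8 / (\<rho>' * a) * measure lborel (cball p \<rho>)"
  have "real (Suc n) * measure lborel (A n) \<le> C" for n
  proof -
    define N where "N = real (Suc n)"
    have N: "N > 0" by (simp add: N_def)
    have mA: "measure lborel (A n) \<le> measure lborel (cball p \<rho>)"
      by (rule measure_mono_fmeasurable) (use Ab in \<open>auto simp: A_def fmeasurable_def emeasure_lborel_cball_finite[unfolded infinity_ennreal_def]\<close>)
    show ?thesis
    \<comment> \<open>If fewer than two translates fit, then \<open>N\<close> is bounded and the
      second summand of \<open>C\<close> suffices. Otherwise rounding down to an integer costs at
      most a factor 2.\<close>
    proof (cases "\<rho>' * N * a / 4 \<ge> 2")
      case False
      then have "N \<le> 8 / (\<rho>' * a)" using \<rho>' e by (simp add: field_simps)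
      then have "N * measure lborel (A n) \<le> 8 / (\<rho>' * a) * measure lborel (cball p \<rho>)"
        using mA N \<rho>' e by (intro mult_mono) auto
      moreover have "8 * V / (\<rho>' * a) \<ge> 0" using V \<rho>' e by simp
      ultimately show ?thesis unfolding C_def N_def[symmetric] by linarith
    next
      case True
      define m where "m = nat \<lfloor>\<rho>' * N * a / 4\<rfloor>"
      define t where "t = 4 / (N * a)"
      have t: "t > 0" using N e by (simp add: t_def)
      have m1: "real m \<le> \<rho>' * N * a / 4" and m2: "real m \<ge> \<rho>' * N * a / 8"
        unfolding m_def using True by linarith+
      have mt: "real m * t \<le> \<rho>'"
      proof -
        have "real m * t \<le> \<rho>' * N * a / 4 * t" using m1 t by (intro mult_right_mono) auto
        also have "\<dots> = \<rho>'" using N e by (simp add: t_def field_simps)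
        finally show ?thesis .
      qed
      have disj: "x + real j *\<^sub>R (t *\<^sub>R e) \<notin> A n" if "x \<in> A n" "j > 0" "j < m" for x j
      proof -
        have "real j * t \<le> real m * t" using that t by (intro mult_right_mono) auto
        then have jt: "real j * t \<le> \<rho>'" using mt by simp
        have "norm (x + real j *\<^sub>R (t *\<^sub>R e) - p) \<le> norm (x - p) + real j * t"
          using norm_triangle_ineq[of "x - p" "real j *\<^sub>R (t *\<^sub>R e)"] e t by (simp add: algebra_simps)
        then have b: "x \<in> ball p r" "x + (real j * t) *\<^sub>R e \<in> ball p r"
          using that jt \<rho>' assms(5) by (auto simp: A_def dist_norm norm_minus_commute)
        have "phi (x + (real j * t) *\<^sub>R e) \<ge> phi x + a * (real j * t)"
          by (rule increment_ge[OF phi e(3) b]) (use t in auto)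
        moreover have "a * (real j * t) \<ge> a * t" using that e t by simp
        moreover have "a * t = 4 / N" using e N by (simp add: t_def)
        moreover have "phi x > - 4 / N" using that by (auto simp: A_def N_def)
        ultimately have "phi (x + (real j * t) *\<^sub>R e) > 0" by linarith
        then show ?thesis by (auto simp: A_def)
      qed
      have "real m * measure lborel (A n) \<le> V"
        unfolding V_def
        by (rule measure_disjoint_translates[where v = "t *\<^sub>R e"])
          (use Ab disj mt e t in \<open>auto simp: A_def\<close>)
      moreover have "\<rho>' * N * a / 8 * measure lborel (A n) \<le> real m * measure lborel (A n)"
        by (intro mult_right_mono m2) auto
      ultimately have "\<rho>' * N * a / 8 * measure lborel (A n) \<le> V" by linarith
      then have "N * measure lborel (A n) \<le> 8 * V / (\<rho>' * a)"
        using \<rho>' e by (simp add: field_simps)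
      moreover have "8 / (\<rho>' * a) * measure lborel (cball p \<rho>) \<ge> 0" using \<rho>' e by simp
      ultimately show ?thesis unfolding C_def N_def[symmetric] by linarith
    qed
  qed
  moreover have "C \<ge> 0" using V \<rho>' e by (simp add: C_def)
  ultimately show ?thesis unfolding A_def by blast
qed

text \<open>Multiply by a cut-off \<open>step (- N phi - 1)\<close> that vanishes near the boundary
  and integrate by parts inside \<open>D\<close>. The gradient of the cut-off is of order N on a
  strip of measure O(1/N), and there \<open>F\<close> is uniformly small, being continuous and 0
  outside \<open>D\<close>; so no boundary term survives. The bound is imposed on the divergence
  alone because single second derivatives of u may be unbounded near S.\<close>

lemma weak_divergence:
  fixes D :: "'a::euclidean_space set" and F :: "'a \<Rightarrow> 'a"
  assumes oD: "open D"
    and phi: "\<And>x. x \<in> ball p r \<Longrightarrow> (phi has_derivative (\<lambda>h. g x \<bullet> h)) (at x)"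
    and cg: "continuous_on (ball p r) g"
    and Dphi: "D \<inter> ball p r = {x \<in> ball p r. phi x < 0}"
    and e: "norm e = 1" "a > 0" "\<And>x. x \<in> ball p r \<Longrightarrow> a \<le> g x \<bullet> e"
    and cF: "continuous_on UNIV F" and F0: "\<And>x. x \<notin> D \<Longrightarrow> F x = 0"
    and dF: "\<And>x. x \<in> D \<inter> ball p r \<Longrightarrow> (F has_derivative F' x) (at x)"
    and cF': "\<And>b. b \<in> Basis \<Longrightarrow> continuous_on (D \<inter> ball p r) (\<lambda>x. F' x b)"
    and f: "\<And>x. x \<in> D \<inter> ball p r \<Longrightarrow> (\<Sum>b\<in>Basis. F' x b \<bullet> b) = f x"
    and Bf: "\<And>x. x \<in> D \<inter> ball p r \<Longrightarrow> \<bar>f x\<bar> \<le> Bf"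
    and psi: "\<And>x. (psi has_derivative (\<lambda>h. gpsi x \<bullet> h)) (at x)"
    and cgpsi: "continuous_on UNIV gpsi"
    and supp: "\<And>x. x \<notin> cball p \<rho> \<Longrightarrow> psi x = 0" and \<rho>: "\<rho> < r"
  shows "integrable lborel (\<lambda>x. indicator D x * (f x * psi x))"
    "(LINT x|lborel. F x \<bullet> gpsi x) = - (LINT x|lborel. indicator D x * (f x * psi x))"
proof -
  define Q where "Q = D \<inter> ball p r"
  have oQ: "open Q" using oD by (auto simp: Q_def)
  have QD: "x \<in> Q \<longleftrightarrow> x \<in> ball p r \<and> phi x < 0" for x using Dphi by (auto simp: Q_def)
  have cphi: "continuous_on (ball p r) phi"
    using phi by (meson continuous_at_imp_continuous_on has_derivative_continuous)
  have cpsi: "continuous_on UNIV psi"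
    using psi by (meson continuous_at_imp_continuous_on has_derivative_continuous)
  have gsupp: "gpsi x = 0" if "x \<notin> cball p \<rho>" for x
    by (rule gradient_support[OF psi supp that])
  define N where "N n = real (Suc n)" for n
  have N: "N n > 0" for n by (simp add: N_def)
  \<comment> \<open>The shift by 1 makes the cut-off vanish as soon as
    \<open>phi x > - 1 / N n\<close>, a neighbourhood of the boundary; it equals 1 once
    \<open>phi x \<le> - 4 / N n\<close>.\<close>
  define s where "s n x = - N n * phi x - 1" for n x
  have cs: "continuous_on Q (s n)" for n
    unfolding s_def[abs_def] using cphi
    by (intro continuous_intros continuous_on_subset[OF cphi]) (auto simp: QD)
  have cstep: "continuous_on Q (\<lambda>x. step (s n x))" "continuous_on Q (\<lambda>x. step' (s n x))" for n
    by (intro continuous_on_compose2[OF continuous_step(1)] continuous_on_compose2[OF continuous_step(2)] cs; simp)+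
  have cQ: "continuous_on Q psi" "continuous_on Q gpsi" "continuous_on Q F" "continuous_on Q g" 
    "b \<in> Basis \<Longrightarrow> continuous_on Q (\<lambda>x. F' x b)" for b
    using continuous_on_subset[OF cpsi] continuous_on_subset[OF cgpsi] continuous_on_subset[OF cF]
      continuous_on_subset[OF cg, of Q] cF' by (auto simp: Q_def)
  \<comment> \<open>A point off \<open>Q\<close> is either outside the support of \<open>psi\<close>
    or in the ball with \<open>phi \<ge> 0\<close>; near it the gradient of \<open>psi\<close> or
    the derivative of the cut-off vanishes as well.\<close>
  have U: "\<exists>U. open U \<and> x \<in> U \<and> (\<forall>y\<in>U \<inter> Q. (psi y = 0 \<and> gpsi y = 0) \<or> (step (s n y) = 0 \<and> step' (s n y) = 0))"
    if "x \<notin> Q" for x n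
  proof (cases "x \<in> cball p \<rho>")
    case True
    then have xb: "x \<in> ball p r" using \<rho> by auto
    then have "phi x \<ge> 0" using that QD by force
    have "open (ball p r \<inter> phi -` {- 1 / N n<..})"
      by (rule continuous_open_preimage[OF cphi]) auto
    moreover have "x \<in> ball p r \<inter> phi -` {- 1 / N n<..}"
      using xb \<open>phi x \<ge> 0\<close> N[of n] by (auto simp: less_le_trans[of _ 0])
    moreover have "step (s n y) = 0 \<and> step' (s n y) = 0" if "y \<in> ball p r \<inter> phi -` {- 1 / N n<..}" for y
    proof -
      have "s n y \<le> 0" using that N[of n] by (auto simp: s_def field_simps)
      then show ?thesis by (simp add: step_eq_0 step'_eq_0)
    qed
    ultimately show ?thesis by blast
  next
    case False
    then show ?thesis by (intro exI[of _ "- cball p \<rho>"]) (use supp gsupp in auto)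
  qed
  have UP: "\<exists>U. open U \<and> x \<in> U \<and> (\<forall>y\<in>U \<inter> Q. P y)"
    if "x \<notin> Q" and P: "\<And>y. (psi y = 0 \<and> gpsi y = 0) \<or> (step (s n y) = 0 \<and> step' (s n y) = 0) \<Longrightarrow> P y" for x n P
  proof -
    from U[OF that(1), of n] obtain U where "open U" "x \<in> U"
      "\<forall>y\<in>U \<inter> Q. (psi y = 0 \<and> gpsi y = 0) \<or> (step (s n y) = 0 \<and> step' (s n y) = 0)" by blast
    then show ?thesis using P by (intro exI[of _ U]) blast
  qed
  \<comment> \<open>The three terms of the divergence of cut-off times \<open>psi\<close> times
    \<open>F\<close>. The last one contains the derivative of the cut-off and enters with a minus
    sign.\<close>
  define z1 z2 z3 where "z1 n x = step (s n x) * psi x * (\<Sum>b\<in>Basis. F' x b \<bullet> b)"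
    and "z2 n x = step (s n x) * (F x \<bullet> gpsi x)"
    and "z3 n x = step' (s n x) * N n * psi x * (F x \<bullet> g x)" for n x
  define e1 where "e1 z n x = (if x \<in> Q then z n x else 0)" for z :: "nat \<Rightarrow> 'a \<Rightarrow> real" and n x
  have cz: "continuous_on UNIV (e1 z1 n)" "continuous_on UNIV (e1 z2 n)" "continuous_on UNIV (e1 z3 n)" for n
  proof -
    show "continuous_on UNIV (e1 z1 n)" unfolding e1_def[abs_def]
    proof (rule continuous_on_extend_0[OF oQ])
      show "continuous_on Q (z1 n)" unfolding z1_def[abs_def]
        by (intro continuous_intros cstep cQ) auto
      show "\<exists>U. open U \<and> x \<in> U \<and> (\<forall>y\<in>U \<inter> Q. z1 n y = 0)" if "x \<notin> Q" for x
        by (rule UP[OF that, of n]) (auto simp: z1_def)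
    qed
    show "continuous_on UNIV (e1 z2 n)" unfolding e1_def[abs_def]
    proof (rule continuous_on_extend_0[OF oQ])
      show "continuous_on Q (z2 n)" unfolding z2_def[abs_def]
        by (intro continuous_intros cstep cQ)
      show "\<exists>U. open U \<and> x \<in> U \<and> (\<forall>y\<in>U \<inter> Q. z2 n y = 0)" if "x \<notin> Q" for x
        by (rule UP[OF that, of n]) (auto simp: z2_def)
    qed
    show "continuous_on UNIV (e1 z3 n)" unfolding e1_def[abs_def]
    proof (rule continuous_on_extend_0[OF oQ])
      show "continuous_on Q (z3 n)" unfolding z3_def[abs_def]
        by (intro continuous_intros cstep cQ)
      show "\<exists>U. open U \<and> x \<in> U \<and> (\<forall>y\<in>U \<inter> Q. z3 n y = 0)" if "x \<notin> Q" for x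
        by (rule UP[OF that, of n]) (auto simp: z3_def)
    qed
  qed
  have sz: "e1 z1 n x = 0" "e1 z2 n x = 0" "e1 z3 n x = 0" if "x \<notin> cball p \<rho>" for n x
    using supp[OF that] gsupp[OF that] by (auto simp: e1_def z1_def z2_def z3_def)
  have iz: "integrable lborel (e1 z1 n)" "integrable lborel (e1 z2 n)" "integrable lborel (e1 z3 n)" for n
    by (rule integrable_continuous_support[OF cz(1) sz(1)], simp,
        rule integrable_continuous_support[OF cz(2) sz(2)], simp,
        rule integrable_continuous_support[OF cz(3) sz(3)], simp)
  have ibp: "(LINT x|lborel. e1 z1 n x) + (LINT x|lborel. e1 z2 n x) - (LINT x|lborel. e1 z3 n x) = 0" for n
  proof -
    define w where "w b x = step (s n x) * psi x * (F x \<bullet> b)" for b x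
    define dw where "dw b x = step (s n x) * psi x * (F' x b \<bullet> b) + step (s n x) * (gpsi x \<bullet> b) * (F x \<bullet> b)
        - step' (s n x) * N n * psi x * (g x \<bullet> b) * (F x \<bullet> b)" for b x
    have Uw: "\<exists>U. open U \<and> x \<in> U \<and> (\<forall>y\<in>U \<inter> Q. w b y = 0)" "\<exists>U. open U \<and> x \<in> U \<and> (\<forall>y\<in>U \<inter> Q. dw b y = 0)"
      if "x \<notin> Q" for x b by (rule UP[OF that, of n]; auto simp: w_def dw_def)+
    have cw: "continuous_on UNIV (\<lambda>x. if x \<in> Q then w b x else 0)" for b
      by (rule continuous_on_extend_0[OF oQ _ Uw(1)])
        (auto simp: w_def[abs_def] intro!: continuous_intros cstep cQ)
    have cdw: "continuous_on UNIV (\<lambda>x. if x \<in> Q then dw b x else 0)" if "b \<in> Basis" for b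
      by (rule continuous_on_extend_0[OF oQ _ Uw(2)])
        (auto simp: dw_def[abs_def] intro!: continuous_intros cstep cQ that)
    have dw: "((\<lambda>t. (\<lambda>x. if x \<in> Q then w b x else 0) (x + t *\<^sub>R b)) has_real_derivative (if x \<in> Q then dw b x else 0)) (at 0)" for b x
    proof -
      have "(w b has_derivative (\<lambda>h. step (s n x) * psi x * (F' x h \<bullet> b) + step (s n x) * (gpsi x \<bullet> h) * (F x \<bullet> b)
        - step' (s n x) * N n * psi x * (g x \<bullet> h) * (F x \<bullet> b))) (at x)" if "x \<in> Q"
      proof -
        have "x \<in> ball p r" "x \<in> D \<inter> ball p r" using that by (auto simp: Q_def)
        have ds: "(s n has_derivative (\<lambda>h. - N n * (g x \<bullet> h))) (at x)"
          unfolding s_def[abs_def] by (auto intro!: derivative_eq_intros phi \<open>x \<in> ball p r\<close>)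
        have dst: "((\<lambda>x. step (s n x)) has_derivative (\<lambda>h. step' (s n x) * (- N n * (g x \<bullet> h)))) (at x)"
          using has_derivative_compose[OF ds, of step "\<lambda>h. step' (s n x) * h"] DERIV_step
          by (simp add: has_field_derivative_def)
        have dFb: "((\<lambda>x. F x \<bullet> b) has_derivative (\<lambda>h. F' x h \<bullet> b)) (at x)"
          by (rule has_derivative_inner_left[OF dF[OF \<open>x \<in> D \<inter> ball p r\<close>]])
        show ?thesis unfolding w_def[abs_def]
          by (rule has_derivative_eq_rhs[OF has_derivative_mult[OF has_derivative_mult[OF dst psi] dFb]])
            (simp add: fun_eq_iff algebra_simps)
      qed
      from has_derivative_imp_directional[OF has_derivative_extend_0[OF oQ this Uw(1)], of b]
      show ?thesis by (auto simp: dw_def split: if_splits)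
    qed
    have sw: "(if x \<in> Q then w b x else 0) = 0" if "x \<notin> cball p \<rho>" for b x
      using supp[OF that] by (simp add: w_def)
    have sdw: "(if x \<in> Q then dw b x else 0) = 0" if "x \<notin> cball p \<rho>" for b x
      using supp[OF that] gsupp[OF that] by (simp add: dw_def)
    have int0: "(LINT x|lborel. (if x \<in> Q then dw b x else 0)) = 0" if "b \<in> Basis" for b
      by (rule integral_directional_derivative_eq_0[where p = p and R = \<rho>, OF dw cw cdw[OF that] sw])
    have "0 = (\<Sum>b\<in>Basis. LINT x|lborel. (if x \<in> Q then dw b x else 0))"
      by (simp add: int0)
    also have "\<dots> = (LINT x|lborel. (\<Sum>b\<in>Basis. (if x \<in> Q then dw b x else 0)))"
      by (rule Bochner_Integration.integral_sum[symmetric])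
        (rule integrable_continuous_support[OF cdw sdw])
    also have "\<dots> = (LINT x|lborel. e1 z1 n x + e1 z2 n x - e1 z3 n x)"
    proof (rule Bochner_Integration.integral_cong[OF refl])
      fix x
      have "(\<Sum>b\<in>Basis. dw b x) = z1 n x + z2 n x - z3 n x"
        unfolding dw_def z1_def z2_def z3_def
        by (subst (1 2) euclidean_inner)
          (simp add: sum.distrib sum_subtractf sum_distrib_left mult.assoc mult.commute mult.left_commute)
      then show "(\<Sum>b\<in>Basis. (if x \<in> Q then dw b x else 0)) = e1 z1 n x + e1 z2 n x - e1 z3 n x"
        by (simp add: e1_def)
    qed
    also have "\<dots> = (LINT x|lborel. e1 z1 n x) + (LINT x|lborel. e1 z2 n x) - (LINT x|lborel. e1 z3 n x)"
      using iz by simp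
    finally show ?thesis by simp
  qed
  obtain Bp where Bp: "Bp \<ge> 0" "\<And>x. \<bar>psi x\<bar> \<le> Bp"
    using bounded_continuous_support[OF cpsi supp] by blast
  have step_lim: "eventually (\<lambda>n. step (s n x) = 1) sequentially" if "x \<in> Q" for x
  proof -
    have ph: "phi x < 0" using that QD by auto
    obtain m :: nat where m: "real m > 4 / (- phi x)" using reals_Archimedean2 by blast
    have "step (s n x) = 1" if "n \<ge> m" for n
    proof (rule step_eq_1)
      have "N n > 4 / (- phi x)" using m that by (simp add: N_def)
      then show "3 \<le> s n x" using ph by (simp add: s_def field_simps)
    qed
    then show ?thesis by (auto simp: eventually_sequentially)
  qed
  have ic: "integrable lborel (\<lambda>x. K * indicator (cball p \<rho>) x)" for K :: real
    by (intro integrable_mult_right integrable_real_indicator)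
      (auto simp: emeasure_lborel_cball_finite[unfolded infinity_ennreal_def])
  have lim1: "(\<lambda>n. e1 z1 n x) \<longlonglongrightarrow> indicator D x * (f x * psi x)" for x
  proof (cases "x \<in> Q")
    case True
    have "eventually (\<lambda>n. e1 z1 n x = indicator D x * (f x * psi x)) sequentially"
      using step_lim[OF True] by eventually_elim (use True f in \<open>auto simp: e1_def z1_def Q_def\<close>)
    then show ?thesis by (rule tendsto_eventually)
  next
    case False
    then have 0: "indicator D x * (f x * psi x) = 0" using supp[of x] \<rho> by (cases "x \<in> cball p \<rho>") (auto simp: Q_def)
    show ?thesis unfolding 0 using False by (simp add: e1_def)
  qed
  have b1: "norm (e1 z1 n x) \<le> \<bar>Bf\<bar> * Bp * indicator (cball p \<rho>) x" for n x
  proof (cases "x \<in> Q \<and> x \<in> cball p \<rho>")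
    case True
    then have "\<bar>f x\<bar> \<le> \<bar>Bf\<bar>" using Bf[of x] by (simp add: Q_def)
    then have "\<bar>step (s n x)\<bar> * \<bar>psi x\<bar> * \<bar>f x\<bar> \<le> 1 * Bp * \<bar>Bf\<bar>"
      using step_bounds[of "s n x"] Bp by (intro mult_mono) auto
    then show ?thesis using True f[of x] by (simp add: e1_def z1_def abs_mult mult.commute Q_def)
  next
    case False
    then show ?thesis using sz(1)[of x n] by (auto simp: e1_def indicator_def Bp)
  qed
  have m1: "e1 z1 n \<in> borel_measurable lborel" "e1 z2 n \<in> borel_measurable lborel" for n
    using borel_measurable_continuous_onI[OF cz(1)] borel_measurable_continuous_onI[OF cz(2)] by auto
  have ml1: "(\<lambda>x. indicator D x * (f x * psi x)) \<in> borel_measurable lborel"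
    by (rule borel_measurable_LIMSEQ_real[OF lim1 m1(1)])
  show "integrable lborel (\<lambda>x. indicator D x * (f x * psi x))"
    by (rule integrable_dominated_convergence[OF ml1 m1(1) ic AE_I2[OF lim1] AE_I2[OF b1]])
  have I1: "(\<lambda>n. LINT x|lborel. e1 z1 n x) \<longlonglongrightarrow> (LINT x|lborel. indicator D x * (f x * psi x))"
    by (rule integral_dominated_convergence[OF ml1 m1(1) ic AE_I2[OF lim1] AE_I2[OF b1]])
  obtain B2 where B2: "\<And>x. \<bar>F x \<bullet> gpsi x\<bar> \<le> B2" "B2 \<ge> 0"
  proof (rule bounded_continuous_support[of "\<lambda>x. F x \<bullet> gpsi x" p \<rho>])
    show "continuous_on UNIV (\<lambda>x. F x \<bullet> gpsi x)" using cF cgpsi by (intro continuous_intros)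
  qed (use gsupp in auto)
  have lim2: "(\<lambda>n. e1 z2 n x) \<longlonglongrightarrow> F x \<bullet> gpsi x" for x
  proof (cases "x \<in> Q")
    case True
    have "eventually (\<lambda>n. e1 z2 n x = F x \<bullet> gpsi x) sequentially"
      using step_lim[OF True] by eventually_elim (use True in \<open>auto simp: e1_def z2_def\<close>)
    then show ?thesis by (rule tendsto_eventually)
  next
    case False
    then have "F x \<bullet> gpsi x = 0" using gsupp[of x] F0[of x] \<rho> by (cases "x \<in> cball p \<rho>") (auto simp: Q_def)
    then show ?thesis using False by (simp add: e1_def)
  qed
  have b2: "norm (e1 z2 n x) \<le> B2 * indicator (cball p \<rho>) x" for n x
  proof (cases "x \<in> Q \<and> x \<in> cball p \<rho>")
    case True
    have "\<bar>step (s n x)\<bar> * \<bar>F x \<bullet> gpsi x\<bar> \<le> 1 * B2"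
      using step_bounds[of "s n x"] B2 by (intro mult_mono) auto
    then show ?thesis using True by (simp add: e1_def z2_def abs_mult)
  next
    case False
    then show ?thesis using sz(2)[of x n] by (auto simp: e1_def indicator_def B2)
  qed
  have I2: "(\<lambda>n. LINT x|lborel. e1 z2 n x) \<longlonglongrightarrow> (LINT x|lborel. F x \<bullet> gpsi x)"
    by (rule integral_dominated_convergence[OF borel_measurable_LIMSEQ_real[OF lim2 m1(2)] m1(2) ic AE_I2[OF lim2] AE_I2[OF b2]])
  define A where "A n = {x \<in> cball p \<rho>. - 4 / real (Suc n) < phi x \<and> phi x < 0}" for n :: nat
  obtain C where C: "C \<ge> 0" "\<And>n. N n * measure lborel (A n) \<le> C"
    using measure_strip_le[OF phi e \<rho>] unfolding A_def N_def by blast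
  have Ab: "A n \<in> sets borel" for n
  proof -
    have "open (ball p r \<inter> phi -` {- 4 / real (Suc n)<..<0})"
      by (rule continuous_open_preimage[OF cphi]) auto
    moreover have "A n = cball p \<rho> \<inter> (ball p r \<inter> phi -` {- 4 / real (Suc n)<..<0})"
      using \<rho> by (auto simp: A_def)
    ultimately show ?thesis by auto
  qed
  obtain Bs where Bs: "Bs > 0" "\<And>t. \<bar>step' t\<bar> \<le> Bs" using step'_step''_bounded by metis
  have "compact (g ` cball p \<rho>)"
    using \<rho> by (intro compact_continuous_image continuous_on_subset[OF cg]) auto
  then obtain Bg where Bg: "\<And>x. x \<in> cball p \<rho> \<Longrightarrow> norm (g x) \<le> Bg"
    using compact_imp_bounded bounded_iff by (metis imageI)
  have I3: "(\<lambda>n. LINT x|lborel. e1 z3 n x) \<longlonglongrightarrow> 0"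
  proof (rule LIMSEQ_I)
    fix \<epsilon> :: real assume "\<epsilon> > 0"
    \<comment> \<open>The final bound is (K - 1) * eps / (2 K); the added 1 keeps the division
      legitimate when the product is 0.\<close>
    define K where "K = Bs * Bp * \<bar>Bg\<bar> * C + 1"
    have K: "K > 0" unfolding K_def using Bs Bp C by (intro add_nonneg_pos mult_nonneg_nonneg) auto
    have "uniformly_continuous_on (cball p r) F"
      by (intro compact_uniformly_continuous continuous_on_subset[OF cF]) auto
    then obtain \<delta> where \<delta>: "\<delta> > 0" "\<And>x y. x \<in> cball p r \<Longrightarrow> y \<in> cball p r \<Longrightarrow> dist y x < \<delta> \<Longrightarrow> dist (F y) (F x) < \<epsilon> / (2 * K)"
      unfolding uniformly_continuous_on_def using \<open>\<epsilon> > 0\<close> K by (metis divide_pos_pos mult_pos_pos zero_less_numeral)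
    obtain m :: nat where m: "real m > 4 / (a * min \<delta> (r - \<rho>))" using reals_Archimedean2 by blast
    have "norm ((LINT x|lborel. e1 z3 n x) - 0) < \<epsilon>" if "n \<ge> m" for n
    proof -
      define t where "t = 4 / (a * N n)"
      have t: "t > 0" using e N by (simp add: t_def)
      have "N n > 4 / (a * min \<delta> (r - \<rho>))" using m that by (simp add: N_def)
      moreover have "min \<delta> (r - \<rho>) > 0" using \<rho> \<delta>(1) by simp
      moreover have "4 / (a * N n) < M" if "N n > 4 / (a * M)" "M > 0" for M
        using e(2) N[of n] that by (simp add: field_simps)
      ultimately have tm: "t < min \<delta> (r - \<rho>)" unfolding t_def by blast
      \<comment> \<open>Moving by \<open>t\<close> along \<open>e\<close> raises \<open>phi\<close>
        by 4/N, so the new point is outside \<open>D\<close>, where \<open>F\<close> is 0. Uniform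
        continuity carries the smallness back to \<open>x\<close>.\<close>
      have FA: "norm (F x) \<le> \<epsilon> / (2 * K)" if x: "x \<in> A n" for x
      proof -
        have "norm (x + t *\<^sub>R e - p) \<le> norm (x - p) + t"
          using norm_triangle_ineq[of "x - p" "t *\<^sub>R e"] e t by (simp add: algebra_simps)
        then have b: "x \<in> ball p r" "x + t *\<^sub>R e \<in> ball p r"
          using x tm \<rho> by (auto simp: A_def dist_norm norm_minus_commute)
        have "phi (x + t *\<^sub>R e) \<ge> phi x + a * t"
          by (rule increment_ge[OF phi e(3) b]) (use t in auto)
        moreover have "a * t = 4 / N n" using e N[of n] by (simp add: t_def)
        ultimately have "phi (x + t *\<^sub>R e) > 0" using x by (auto simp: A_def N_def)
        then have "x + t *\<^sub>R e \<notin> D" using b QD[of "x + t *\<^sub>R e"] by (auto simp: Q_def)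
        then have "F (x + t *\<^sub>R e) = 0" by (rule F0)
        moreover have "dist (x + t *\<^sub>R e) x < \<delta>" using e t tm by (simp add: dist_norm)
        ultimately show ?thesis using \<delta>(2)[of x "x + t *\<^sub>R e"] b by (simp add: dist_norm less_imp_le)
      qed
      have "\<bar>e1 z3 n x\<bar> \<le> (Bs * N n * Bp * (\<epsilon> / (2 * K) * \<bar>Bg\<bar>)) * indicator (A n) x" for x
      proof (cases "x \<in> A n")
        case True
        have "\<bar>F x \<bullet> g x\<bar> \<le> norm (F x) * norm (g x)" by (rule Cauchy_Schwarz_ineq2)
        also have "\<dots> \<le> \<epsilon> / (2 * K) * \<bar>Bg\<bar>"
          using FA[OF True] Bg[of x] True \<open>\<epsilon> > 0\<close> K by (intro mult_mono) (auto simp: A_def intro: order_trans[OF Bg])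
        finally have "\<bar>step' (s n x)\<bar> * N n * \<bar>psi x\<bar> * \<bar>F x \<bullet> g x\<bar> \<le> Bs * N n * Bp * (\<epsilon> / (2 * K) * \<bar>Bg\<bar>)"
          using Bs Bp N[of n] by (intro mult_mono mult_nonneg_nonneg) auto
        moreover have "\<bar>e1 z3 n x\<bar> \<le> \<bar>step' (s n x)\<bar> * N n * \<bar>psi x\<bar> * \<bar>F x \<bullet> g x\<bar>"
          using N[of n] by (simp add: e1_def z3_def abs_mult)
        ultimately show ?thesis using True by simp
      next
        case False
        have "e1 z3 n x = 0"
        proof (cases "x \<in> Q \<and> x \<in> cball p \<rho>")
          case True
          then have "phi x \<le> - 4 / N n" using False QD by (auto simp: A_def N_def)
          then have "s n x \<ge> 3" using N[of n] by (simp add: s_def field_simps)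
          then show ?thesis by (simp add: e1_def z3_def step'_eq_0)
        qed (use sz(3)[of x n] in \<open>auto simp: e1_def\<close>)
        then show ?thesis using False by simp
      qed
      moreover have "A n \<subseteq> cball p \<rho>" by (auto simp: A_def)
      ultimately have "\<bar>LINT x|lborel. e1 z3 n x\<bar> \<le> (Bs * N n * Bp * (\<epsilon> / (2 * K) * \<bar>Bg\<bar>)) * measure lborel (A n)"
        by (intro abs_integral_le_measure[OF iz(3) Ab])
      also have "\<dots> = (Bs * Bp * \<bar>Bg\<bar>) * (\<epsilon> / (2 * K)) * (N n * measure lborel (A n))" by simp
      also have "\<dots> \<le> (Bs * Bp * \<bar>Bg\<bar>) * (\<epsilon> / (2 * K)) * C"
        using Bs Bp K \<open>\<epsilon> > 0\<close> by (intro mult_left_mono C mult_nonneg_nonneg) auto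
      also have "\<dots> = (K - 1) * (\<epsilon> / (2 * K))" by (simp add: K_def)
      also have "\<dots> \<le> K * (\<epsilon> / (2 * K))" using K \<open>\<epsilon> > 0\<close> by (intro mult_right_mono) auto
      also have "\<dots> < \<epsilon>" using K \<open>\<epsilon> > 0\<close> by simp
      finally show ?thesis by simp
    qed
    then show "\<exists>no. \<forall>n\<ge>no. norm ((LINT x|lborel. e1 z3 n x) - 0) < \<epsilon>" by blast
  qed
  have "(\<lambda>n. (LINT x|lborel. e1 z1 n x) + (LINT x|lborel. e1 z2 n x) - (LINT x|lborel. e1 z3 n x))
      \<longlonglongrightarrow> (LINT x|lborel. indicator D x * (f x * psi x)) + (LINT x|lborel. F x \<bullet> gpsi x) - 0"
    by (intro tendsto_intros I1 I2 I3)
  then show "(LINT x|lborel. F x \<bullet> gpsi x) = - (LINT x|lborel. indicator D x * (f x * psi x))"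
    unfolding ibp by (simp add: LIMSEQ_const_iff)
qed

section \<open>The Newtonian potential and its third differences\<close>

text \<open>The potential 1/|z| smoothed at its pole, so that integration by parts is classical. The
  estimates used later are uniform in \<open>\<delta>\<close>, which tends to 0 at the end.\<close>

definition newt :: "real \<Rightarrow> real^3 \<Rightarrow> real" where
  "newt \<delta> z = (z \<bullet> z + \<delta>\<^sup>2) powr (- 1/2)"

definition newt_grad :: "real \<Rightarrow> real^3 \<Rightarrow> real^3" where
  "newt_grad \<delta> z = (- ((z \<bullet> z + \<delta>\<^sup>2) powr (- 3/2))) *\<^sub>R z"

definition newt_hess :: "real \<Rightarrow> real^3 \<Rightarrow> real^3 \<Rightarrow> real^3 \<Rightarrow> real" where
  "newt_hess \<delta> z h b = 3 * (z \<bullet> z + \<delta>\<^sup>2) powr (- 5/2) * (z \<bullet> h) * (z \<bullet> b) - (z \<bullet> z + \<delta>\<^sup>2) powr (- 3/2) * (h \<bullet> b)"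

definition newt_bump :: "real \<Rightarrow> real^3 \<Rightarrow> real" where
  "newt_bump \<delta> z = 3 * \<delta>\<^sup>2 * (z \<bullet> z + \<delta>\<^sup>2) powr (- 5/2)"

lemma sq_pos: "\<delta> \<noteq> 0 \<Longrightarrow> z \<bullet> z + \<delta>\<^sup>2 > 0" for z :: "'a::real_inner"
  by (simp add: add_nonneg_pos)

lemma DERIV_shift_powr:
  "\<delta> \<noteq> 0 \<Longrightarrow> ((\<lambda>s. (s + \<delta>\<^sup>2) powr a) has_real_derivative a * (z \<bullet> z + \<delta>\<^sup>2) powr (a - 1)) (at (z \<bullet> z))"
  for z :: "'a::real_inner"
  using sq_pos[of \<delta> z] by (auto intro!: derivative_eq_intros simp: powr_diff)

lemma newt_has_derivative:
  assumes "\<delta> \<noteq> 0"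
  shows "(newt \<delta> has_derivative (\<lambda>h. newt_grad \<delta> z \<bullet> h)) (at z)"
  unfolding newt_def[abs_def] newt_grad_def
  by (rule has_derivative_eq_rhs[OF has_derivative_radial[OF DERIV_shift_powr[OF assms]]])
    (simp add: fun_eq_iff)

lemma newt_grad_has_derivative:
  assumes "\<delta> \<noteq> 0"
  shows "((\<lambda>z. newt_grad \<delta> z \<bullet> b) has_derivative (\<lambda>h. newt_hess \<delta> z h b)) (at z)"
proof -
  have "((\<lambda>z. (- ((z \<bullet> z + \<delta>\<^sup>2) powr (- 3/2))) * (z \<bullet> b)) has_derivative
     (\<lambda>h. (- ((z \<bullet> z + \<delta>\<^sup>2) powr (- 3/2))) * (h \<bullet> b) + (- (2 * (- 3/2 * (z \<bullet> z + \<delta>\<^sup>2) powr (- 3/2 - 1)) * (z \<bullet> h))) * (z \<bullet> b))) (at z)"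
    by (intro has_derivative_mult has_derivative_minus has_derivative_radial[OF DERIV_shift_powr[OF assms]]
        has_derivative_inner_left has_derivative_ident)
  then show ?thesis
    unfolding newt_grad_def newt_hess_def inner_scaleR_left
    by (rule has_derivative_eq_rhs) (simp add: fun_eq_iff algebra_simps)
qed

lemma continuous_newt:
  assumes "\<delta> \<noteq> 0"
  shows "continuous_on UNIV (newt \<delta>)" "continuous_on UNIV (newt_grad \<delta>)"
    "continuous_on UNIV (\<lambda>z. newt_hess \<delta> z h b)" "continuous_on UNIV (newt_bump \<delta>)"
proof -
  have ne: "z \<bullet> z + \<delta>\<^sup>2 \<noteq> 0" for z :: "real^3" by (metis less_irrefl sq_pos[OF assms])
  show "continuous_on UNIV (newt \<delta>)" "continuous_on UNIV (newt_grad \<delta>)"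
    unfolding newt_def[abs_def] newt_grad_def[abs_def] by (intro continuous_intros; use ne in auto)+
  show "continuous_on UNIV (\<lambda>z. newt_hess \<delta> z h b)" "continuous_on UNIV (newt_bump \<delta>)"
    unfolding newt_hess_def[abs_def] newt_bump_def[abs_def] by (intro continuous_intros; use ne in auto)+
qed

text \<open>With q = |z|^2 + delta^2 the trace is 3 q^(-5/2) |z|^2 - 3 q^(-3/2) = 3 q^(-5/2) (|z|^2
  - q). The two coefficients agree because the dimension is three.\<close>

lemma newt_laplacian:
  assumes "\<delta> \<noteq> 0"
  shows "(\<Sum>b\<in>Basis. newt_hess \<delta> z b b) = - newt_bump \<delta> z"
proof -
  let ?q = "z \<bullet> z + \<delta>\<^sup>2"
  have q: "?q powr (- 3/2) = ?q * ?q powr (- 5/2)"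
    using powr_mult_base[of ?q "- 5/2"] sq_pos[OF assms, of z] by simp
  have "(\<Sum>b\<in>Basis. newt_hess \<delta> z b b) =
      3 * ?q powr (- 5/2) * (\<Sum>b\<in>Basis. (z \<bullet> b) * (z \<bullet> b)) - (\<Sum>b\<in>(Basis::(real^3) set). ?q powr (- 3/2))"
    by (simp add: newt_hess_def sum_subtractf sum_distrib_left mult.assoc)
  also have "(\<Sum>b\<in>Basis. (z \<bullet> b) * (z \<bullet> b)) = z \<bullet> z" by (rule euclidean_inner[symmetric])
  also have "(\<Sum>b\<in>(Basis::(real^3) set). ?q powr (- 3/2)) = 3 * ?q powr (- 3/2)" by simp
  finally show ?thesis unfolding newt_bump_def q by (simp add: algebra_simps)
qed

lemma newt_bounds:
  shows "0 \<le> newt \<delta> z" "z \<noteq> 0 \<Longrightarrow> newt \<delta> z \<le> 1 / norm z"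
proof -
  show "0 \<le> newt \<delta> z" by (simp add: newt_def)
  assume "z \<noteq> 0"
  then have "newt \<delta> z \<le> (z \<bullet> z) powr (- 1/2)"
    unfolding newt_def by (intro powr_mono2') auto
  also have "\<dots> = 1 / norm z"
    using \<open>z \<noteq> 0\<close> by (simp add: powr_minus_divide powr_half_sqrt norm_eq_sqrt_inner)
  finally show "newt \<delta> z \<le> 1 / norm z" .
qed

text \<open>The value is 4 pi; by scaling it is the total mass of \<open>newt_bump \<delta>\<close>
  for every nonzero \<open>\<delta>\<close>.\<close>

definition newt_mass :: real where
  "newt_mass = (LINT z|lborel. 3 * ((z::real^3) \<bullet> z + 1) powr (- 5/2))"

lemma newt_mass_integrable: "integrable lborel (\<lambda>z::real^3. 3 * (z \<bullet> z + 1) powr (- 5/2))"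
proof (rule Bochner_Integration.integrable_bound)
  show "integrable lborel (\<lambda>z::real^3. 3 * indicator (cball 0 1) z + 3 * (indicator (- ball 0 1) z / norm (z - 0) ^ 4))"
    by (intro Bochner_Integration.integrable_add integrable_mult_right integrable_real_indicator integral_inverse_norm_power4(1))
      (auto simp: emeasure_lborel_cball_finite[unfolded infinity_ennreal_def])
  have "continuous_on UNIV (\<lambda>z::real^3. 3 * (z \<bullet> z + 1) powr (- 5/2))"
    by (intro continuous_intros) (auto simp: add_nonneg_eq_0_iff)
  then show "(\<lambda>z::real^3. 3 * (z \<bullet> z + 1) powr (- 5/2)) \<in> borel_measurable lborel"
    using borel_measurable_continuous_onI by simp
  have "3 * (z \<bullet> z + 1) powr (- 5/2) \<le> 3 * indicator (cball 0 1) z + 3 * (indicator (- ball 0 1) z / norm (z - 0) ^ 4)"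
    for z :: "real^3"
  proof (cases "norm z < 1")
    case True
    have "(z \<bullet> z + 1) powr (- 5/2) \<le> 1 powr (- 5/2)" by (intro powr_mono2') auto
    then show ?thesis using True by auto
  next
    case False
    have p: "z \<bullet> z + 1 \<ge> 1" by simp
    \<comment> \<open>The decay is weakened from the fifth to the fourth inverse power, for which
      the tail integral is available.\<close>
    have "(z \<bullet> z + 1) powr (- 5/2) \<le> (z \<bullet> z + 1) powr (- 2)" using p by (intro powr_mono) auto
    also have "\<dots> \<le> (z \<bullet> z) powr (- 2)" using False by (intro powr_mono2') auto
    also have "\<dots> = 1 / norm z ^ 4"
      using False by (simp add: powr_minus_divide dot_square_norm flip: power_mult)
    finally have "(z \<bullet> z + 1) powr (- 5/2) \<le> 1 / norm z ^ 4" .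
    moreover have "0 \<le> 3 * (indicator (cball 0 1) z :: real)" by simp
    moreover have i: "indicator (- ball 0 1) z = (1::real)" using False by simp
    ultimately show ?thesis unfolding diff_0_right i by linarith
  qed
  then show "AE z::real^3 in lborel. norm (3 * (z \<bullet> z + 1) powr (- 5/2))
      \<le> norm (3 * indicator (cball 0 1) z + 3 * (indicator (- ball 0 1) z / norm (z - 0) ^ 4))"
    by (intro AE_I2) (force intro: order_trans)
qed

lemma newt_mass_pos: "newt_mass > 0"
proof -
  have "(LINT z|lborel. (3 * 2 powr (- 5/2) :: real) * indicator (ball (0::real^3) 1) z) \<le> newt_mass"
    unfolding newt_mass_def
  proof (rule integral_mono[OF _ newt_mass_integrable])
    show "integrable lborel (\<lambda>z. (3 * 2 powr (- 5/2) :: real) * indicator (ball (0::real^3) 1) z)"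
      by (intro integrable_mult_right integrable_real_indicator)
        (auto simp: emeasure_lborel_ball_finite[unfolded infinity_ennreal_def])
    show "3 * 2 powr (- 5/2) * indicator (ball 0 1) z \<le> 3 * (z \<bullet> z + 1) powr (- 5/2)" for z :: "real^3"
    proof (cases "norm z < 1")
      case True
      then have "z \<bullet> z \<le> 1" by (simp add: dot_square_norm power_le_one)
      then have "2 powr (- 5/2) \<le> (z \<bullet> z + 1) powr (- 5/2)"
        by (intro powr_mono2') (auto simp: add_nonneg_pos)
      then show ?thesis using True by simp
    qed simp
  qed
  moreover have "(LINT z|lborel. (3 * 2 powr (- 5/2) :: real) * indicator (ball (0::real^3) 1) z) = 3 * 2 powr (- 5/2) * measure lborel (ball (0::real^3) 1)"
    by simp
  moreover have "measure lborel (ball (0::real^3) 1) > 0" using content_ball_pos[of 1 "0::real^3"] by simp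
  ultimately show ?thesis by (smt (verit) mult_pos_pos powr_gt_zero zero_less_numeral)
qed

lemma integral_scale:
  fixes F :: "'a::euclidean_space \<Rightarrow> real"
  assumes "F \<in> borel_measurable borel" "c > 0"
  shows "(LINT y|lborel. F y) = (LINT z|lborel. c ^ DIM('a) * F (x + c *\<^sub>R z))"
proof -
  have "(LINT y|lborel. F y) = (LINT y|density (distr lborel borel (\<lambda>z. x + c *\<^sub>R z)) (\<lambda>_. ennreal (\<bar>c\<bar> ^ DIM('a))). F y)"
    by (subst lborel_affine[of c x]) (use assms in auto)
  also have "\<dots> = (LINT y|distr lborel borel (\<lambda>z. x + c *\<^sub>R z). c ^ DIM('a) * F y)"
    using assms by (subst integral_density) auto
  also have "\<dots> = (LINT z|lborel. c ^ DIM('a) * F (x + c *\<^sub>R z))"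
    using assms by (subst integral_distr) auto
  finally show ?thesis .
qed

text \<open>The substitution y = x + delta z turns the bump into a fixed integrable profile and
  moves the parameter into the argument of \<open>f\<close>, where continuity and boundedness allow
  dominated convergence.\<close>

lemma newt_bump_approximate_identity:
  fixes f :: "real^3 \<Rightarrow> real"
  assumes cf: "continuous_on UNIV f" and B: "\<And>y. \<bar>f y\<bar> \<le> B"
  shows "(\<lambda>n. LINT y|lborel. f y * newt_bump (1 / real (Suc n)) (y - x)) \<longlonglongrightarrow> newt_mass * f x"
proof -
  define \<delta> where "\<delta> n = 1 / real (Suc n)" for n
  have \<delta>: "\<delta> n > 0" for n by (simp add: \<delta>_def)
  have \<delta>0: "\<delta> \<longlonglongrightarrow> 0" unfolding \<delta>_def using LIMSEQ_Suc[OF lim_1_over_n] by simp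
  have eq: "(LINT y|lborel. f y * newt_bump (\<delta> n) (y - x)) = (LINT z|lborel. f (x + \<delta> n *\<^sub>R z) * (3 * (z \<bullet> z + 1) powr (- 5/2)))" for n
  proof -
    have "continuous_on UNIV (\<lambda>y. f y * newt_bump (\<delta> n) (y - x))"
      using \<delta>[of n] by (intro continuous_intros cf continuous_on_compose2[OF continuous_newt(4)]) auto
    then have m: "(\<lambda>y. f y * newt_bump (\<delta> n) (y - x)) \<in> borel_measurable borel"
      by (rule borel_measurable_continuous_onI)
    have "\<delta> n ^ 3 * newt_bump (\<delta> n) (\<delta> n *\<^sub>R z) = 3 * (z \<bullet> z + 1) powr (- 5/2)" for z :: "real^3"
    proof -
      have "(\<delta> n *\<^sub>R z) \<bullet> (\<delta> n *\<^sub>R z) + (\<delta> n)\<^sup>2 = (\<delta> n)\<^sup>2 * (z \<bullet> z + 1)"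
        by (simp add: power2_eq_square algebra_simps)
      moreover have "((\<delta> n)\<^sup>2 * (z \<bullet> z + 1)) powr (- 5/2) = ((\<delta> n)\<^sup>2) powr (- 5/2) * (z \<bullet> z + 1) powr (- 5/2)"
        by (simp add: powr_mult)
      moreover have "((\<delta> n)\<^sup>2) powr (- 5/2) = 1 / \<delta> n ^ 5"
      proof -
        have "((\<delta> n)\<^sup>2) powr (- 5/2) = \<delta> n powr (- 5)"
          using \<delta>[of n] by (simp add: powr_powr flip: powr_numeral)
        also have "\<dots> = 1 / \<delta> n ^ 5" using \<delta>[of n] by (simp add: powr_minus_divide)
        finally show ?thesis .
      qed
      ultimately show ?thesis using \<delta>[of n] by (simp add: newt_bump_def power_numeral_reduce)
    qed
    then have "\<delta> n ^ DIM(real^3) * (f (x + \<delta> n *\<^sub>R z) * newt_bump (\<delta> n) (x + \<delta> n *\<^sub>R z - x)) = f (x + \<delta> n *\<^sub>R z) * (3 * (z \<bullet> z + 1) powr (- 5/2))" for z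
      by (simp add: mult.left_commute)
    then show ?thesis
      by (subst integral_scale[OF m \<delta>[of n], of x]) (simp only:)
  qed
  have "(\<lambda>n. LINT z|lborel. f (x + \<delta> n *\<^sub>R z) * (3 * (z \<bullet> z + 1) powr (- 5/2)))
      \<longlonglongrightarrow> (LINT z|lborel. f x * (3 * ((z::real^3) \<bullet> z + 1) powr (- 5/2)))"
  proof (rule integral_dominated_convergence[where w = "\<lambda>z. B * (3 * (z \<bullet> z + 1) powr (- 5/2))"])
    have mm: "(\<lambda>z::real^3. 3 * (z \<bullet> z + 1) powr (- 5/2)) \<in> borel_measurable lborel"
      using newt_mass_integrable by auto
    then show "(\<lambda>z::real^3. f x * (3 * (z \<bullet> z + 1) powr (- 5/2))) \<in> borel_measurable lborel" by measurable
    have "(\<lambda>z. f (x + \<delta> n *\<^sub>R z)) \<in> borel_measurable lborel" for n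
    proof -
      have "continuous_on UNIV (\<lambda>z. f (x + \<delta> n *\<^sub>R z))"
        by (intro continuous_intros continuous_on_compose2[OF cf]) auto
      then show ?thesis using borel_measurable_continuous_onI by simp
    qed
    from borel_measurable_times[OF this mm]
    show "(\<lambda>z. f (x + \<delta> n *\<^sub>R z) * (3 * (z \<bullet> z + 1) powr (- 5/2))) \<in> borel_measurable lborel" for n .
    show "integrable lborel (\<lambda>z::real^3. B * (3 * (z \<bullet> z + 1) powr (- 5/2)))"
      by (rule integrable_mult_right[OF newt_mass_integrable])
    show "AE z in lborel. (\<lambda>n. f (x + \<delta> n *\<^sub>R z) * (3 * (z \<bullet> z + 1) powr (- 5/2))) \<longlonglongrightarrow> f x * (3 * (z \<bullet> z + 1) powr (- 5/2))"
    proof (rule AE_I2)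
      fix z :: "real^3"
      have "isCont f x" using cf by (simp add: continuous_on_eq_continuous_at)
      moreover have "(\<lambda>n. x + \<delta> n *\<^sub>R z) \<longlonglongrightarrow> x"
        using tendsto_add[OF tendsto_const tendsto_scaleR[OF \<delta>0 tendsto_const]] by fastforce
      ultimately have "(\<lambda>n. f (x + \<delta> n *\<^sub>R z)) \<longlonglongrightarrow> f x" by (rule isCont_tendsto_compose)
      then show "(\<lambda>n. f (x + \<delta> n *\<^sub>R z) * (3 * (z \<bullet> z + 1) powr (- 5/2))) \<longlonglongrightarrow> f x * (3 * (z \<bullet> z + 1) powr (- 5/2))"
        by (intro tendsto_intros)
    qed
    show "AE z in lborel. norm (f (x + \<delta> n *\<^sub>R z) * (3 * (z \<bullet> z + 1) powr (- 5/2))) \<le> B * (3 * (z \<bullet> z + 1) powr (- 5/2))" for n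
      using B by (intro AE_I2) (simp add: abs_mult mult_right_mono)
  qed
  moreover have "(LINT z|lborel. f x * (3 * ((z::real^3) \<bullet> z + 1) powr (- 5/2))) = newt_mass * f x"
    by (simp add: newt_mass_def mult.commute)
  ultimately have "(\<lambda>n. LINT y|lborel. f y * newt_bump (\<delta> n) (y - x)) \<longlonglongrightarrow> newt_mass * f x"
    unfolding eq by (simp only:)
  then show ?thesis unfolding \<delta>_def .
qed

text \<open>A third difference of the regularised Newtonian potential gains three powers of the distance:
  it decays like the inverse fourth power and is integrable at infinity.\<close>

definition kern :: "real \<Rightarrow> real^3 \<Rightarrow> real^3 \<Rightarrow> real^3 \<Rightarrow> real" where
  "kern \<delta> x v y = newt \<delta> (y - x) - 3 * newt \<delta> (y - (x + v)) + 3 * newt \<delta> (y - (x + 2 *\<^sub>R v)) - newt \<delta> (y - (x + 3 *\<^sub>R v))"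

text \<open>The weights 1, -3, 3, -1 annihilate polynomials of degree at most two, so only the
  Taylor remainders at T, 2T, 3T are left. Their coefficients 1/2, 4 and 9/2 add up to 9.\<close>

lemma third_difference_bound:
  fixes h :: "nat \<Rightarrow> real \<Rightarrow> real"
  assumes d: "\<And>m t. m < 3 \<Longrightarrow> 0 \<le> t \<Longrightarrow> t \<le> 3 * T \<Longrightarrow> (h m has_real_derivative h (Suc m) t) (at t)"
    and B: "\<And>t. 0 \<le> t \<Longrightarrow> t \<le> 3 * T \<Longrightarrow> \<bar>h 3 t\<bar> \<le> B" and T: "T > 0"
  shows "\<bar>h 0 0 - 3 * h 0 T + 3 * h 0 (2 * T) - h 0 (3 * T)\<bar> \<le> 9 * T ^ 3 * B"
proof -
  have tay: "\<exists>r. \<bar>r\<bar> \<le> B \<and> h 0 a = h 0 0 + h 1 0 * a + h 2 0 / 2 * a\<^sup>2 + r / 6 * a ^ 3" if "0 < a" "a \<le> 3 * T" for a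
  proof -
    have "\<exists>t>0. t < a \<and> h 0 a = (\<Sum>m<3. (h m 0 / fact m) * a ^ m) + (h 3 t / fact 3) * a ^ 3"
      by (rule Maclaurin) (use that d in auto)
    then obtain t where t: "0 < t" "t < a" "h 0 a = (\<Sum>m<3. (h m 0 / fact m) * a ^ m) + (h 3 t / fact 3) * a ^ 3" by blast
    have "h 0 a = h 0 0 + h 1 0 * a + h 2 0 / 2 * a\<^sup>2 + h 3 t / 6 * a ^ 3"
      unfolding t(3) by (simp add: numeral_eq_Suc)
    then show ?thesis using B[of t] t that by force
  qed
  obtain r1 where r1: "\<bar>r1\<bar> \<le> B" "h 0 T = h 0 0 + h 1 0 * T + h 2 0 / 2 * T\<^sup>2 + r1 / 6 * T ^ 3"
    using tay[of T] T by auto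
  obtain r2 where r2: "\<bar>r2\<bar> \<le> B" "h 0 (2*T) = h 0 0 + h 1 0 * (2*T) + h 2 0 / 2 * (2*T)\<^sup>2 + r2 / 6 * (2*T) ^ 3"
    using tay[of "2*T"] T by auto
  obtain r3 where r3: "\<bar>r3\<bar> \<le> B" "h 0 (3*T) = h 0 0 + h 1 0 * (3*T) + h 2 0 / 2 * (3*T)\<^sup>2 + r3 / 6 * (3*T) ^ 3"
    using tay[of "3*T"] T by auto
  have "h 0 0 - 3 * h 0 T + 3 * h 0 (2 * T) - h 0 (3 * T) = (- r1/2 + 4 * r2 - 9/2 * r3) * T ^ 3"
    unfolding r1(2) r2(2) r3(2) by (simp add: algebra_simps power2_eq_square power3_eq_cube)
  moreover have "\<bar>- r1/2 + 4 * r2 - 9/2 * r3\<bar> \<le> 9 * B" using r1(1) r2(1) r3(1) by (simp add: abs_if split: if_splits)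
  moreover have "\<bar>(- r1/2 + 4 * r2 - 9/2 * r3) * T ^ 3\<bar> = \<bar>- r1/2 + 4 * r2 - 9/2 * r3\<bar> * T ^ 3"
    using T by (simp add: abs_mult)
  ultimately show ?thesis using T mult_right_mono[of "\<bar>- r1/2 + 4 * r2 - 9/2 * r3\<bar>" "9 * B" "T ^ 3"]
    by (simp add: mult.commute mult.left_commute)
qed

text \<open>The third difference is taken along the line of poles. There the third derivative of
  q^(-1/2) is 9 (t - alpha) q^(-5/2) - 15 (t - alpha)^3 q^(-7/2), up to 24 q^(-2) in size because |t
  - alpha| is at most q^(1/2). Together with the factor 9 this gives 216.\<close>

lemma kern_far_bound:
  fixes n :: "real^3"
  assumes \<delta>: "\<delta> \<noteq> 0" and n: "norm n = 1" and T: "T > 0" and \<rho>: "\<rho> > 0"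
    and far: "\<And>t. 0 \<le> t \<Longrightarrow> t \<le> 3 * T \<Longrightarrow> norm (y - x - t *\<^sub>R n) \<ge> \<rho>"
  shows "\<bar>kern \<delta> x (T *\<^sub>R n) y\<bar> \<le> 216 * T ^ 3 / \<rho> ^ 4"
proof -
  define \<alpha> where "\<alpha> = (y - x) \<bullet> n"
  define q where "q t = (y - x - t *\<^sub>R n) \<bullet> (y - x - t *\<^sub>R n) + \<delta>\<^sup>2" for t
  have q: "q t > 0" for t unfolding q_def by (rule sq_pos[OF \<delta>])
  have nn: "n \<bullet> n = 1" using n by (simp add: dot_square_norm)
  have q2: "q t = (t - \<alpha>)\<^sup>2 + ((y - x) \<bullet> (y - x) - \<alpha>\<^sup>2 + \<delta>\<^sup>2)" for t
    unfolding q_def \<alpha>_def using nn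
    by (simp add: inner_diff_left inner_diff_right inner_commute power2_eq_square algebra_simps)
  have beta: "(y - x) \<bullet> (y - x) - \<alpha>\<^sup>2 \<ge> 0"
    using Cauchy_Schwarz_ineq[of "y - x" n] nn by (simp add: \<alpha>_def)
  have ta: "\<bar>t - \<alpha>\<bar> \<le> q t powr (1/2)" for t
  proof -
    have "(t - \<alpha>)\<^sup>2 \<le> q t" using beta zero_le_power2[of \<delta>] unfolding q2 by linarith
    then have "sqrt ((t - \<alpha>)\<^sup>2) \<le> sqrt (q t)" by (rule real_sqrt_le_mono)
    then show ?thesis using q[of t] by (simp add: powr_half_sqrt)
  qed
  have dq: "(q has_real_derivative 2 * (t - \<alpha>)) (at t)" for t
    unfolding q2[abs_def] by (auto intro!: derivative_eq_intros)
  have dqp: "((\<lambda>t. q t powr a) has_real_derivative a * q t powr (a - 1) * (2 * (t - \<alpha>))) (at t)" for a t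
    using DERIV_chain2[OF has_real_derivative_powr dq] q[of t] by blast
  \<comment> \<open>The function q^(-1/2) and its first three derivatives in t.\<close>
  define h where "h m = (if m = 0 then (\<lambda>t. q t powr (- 1/2))
     else if m = 1 then (\<lambda>t. - (t - \<alpha>) * q t powr (- 3/2))
     else if m = 2 then (\<lambda>t. - (q t powr (- 3/2)) + 3 * (t - \<alpha>)\<^sup>2 * q t powr (- 5/2))
     else (\<lambda>t. 9 * (t - \<alpha>) * q t powr (- 5/2) - 15 * (t - \<alpha>) ^ 3 * q t powr (- 7/2)))" for m :: nat
  have d: "(h m has_real_derivative h (Suc m) t) (at t)" if "m < 3" for m t
  proof -
    have "m = 0 \<or> m = 1 \<or> m = 2" using that by auto
    then show ?thesis
    proof (elim disjE)
      assume m: "m = 0"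
      show ?thesis unfolding m h_def
        using DERIV_cong[OF dqp[of "- 1/2" t], of "- (t - \<alpha>) * q t powr (- 3/2)"] by (simp add: field_simps)
    next
      assume m: "m = 1"
      have "((\<lambda>t. - (t - \<alpha>) * q t powr (- 3/2)) has_real_derivative
         (- 1) * q t powr (- 3/2) + (- 3/2 * q t powr (- 3/2 - 1) * (2 * (t - \<alpha>))) * (- (t - \<alpha>))) (at t)"
        by (rule DERIV_mult[OF _ dqp]) (auto intro!: derivative_eq_intros)
      then have "((\<lambda>t. - (t - \<alpha>) * q t powr (- 3/2)) has_real_derivative
         - (q t powr (- 3/2)) + 3 * (t - \<alpha>)\<^sup>2 * q t powr (- 5/2)) (at t)"
        by (rule DERIV_cong) (simp add: power2_eq_square field_simps)
      then show ?thesis unfolding m h_def by simp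
    next
      assume m: "m = 2"
      have "((\<lambda>t. 3 * (t - \<alpha>)\<^sup>2 * q t powr (- 5/2)) has_real_derivative
         (6 * (t - \<alpha>)) * q t powr (- 5/2) + (- 5/2 * q t powr (- 5/2 - 1) * (2 * (t - \<alpha>))) * (3 * (t - \<alpha>)\<^sup>2)) (at t)"
        by (rule DERIV_mult[OF _ dqp]) (auto intro!: derivative_eq_intros)
      from DERIV_add[OF DERIV_minus[OF dqp[of "- 3/2" t]] this]
      have "((\<lambda>t. - (q t powr (- 3/2)) + 3 * (t - \<alpha>)\<^sup>2 * q t powr (- 5/2)) has_real_derivative
          9 * (t - \<alpha>) * q t powr (- 5/2) - 15 * (t - \<alpha>) ^ 3 * q t powr (- 7/2)) (at t)"
        by (rule DERIV_cong) (simp add: power2_eq_square power3_eq_cube field_simps)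
      then show ?thesis unfolding m h_def by simp
    qed
  qed
  have B: "\<bar>h 3 t\<bar> \<le> 24 / \<rho> ^ 4" if "0 \<le> t" "t \<le> 3 * T" for t
  proof -
    have 1: "\<bar>t - \<alpha>\<bar> * q t powr (- 5/2) \<le> q t powr (- 2)"
      using mult_right_mono[OF ta, of "q t powr (- 5/2)" t] q[of t] by (simp flip: powr_add)
    have "\<bar>t - \<alpha>\<bar> ^ 3 \<le> (q t powr (1/2)) ^ 3" by (intro power_mono ta) auto
    also have "\<dots> = q t powr (3/2)" using q[of t] by (simp add: powr_powr flip: powr_numeral)
    finally have 2: "\<bar>t - \<alpha>\<bar> ^ 3 * q t powr (- 7/2) \<le> q t powr (- 2)"
      using mult_right_mono[of "\<bar>t - \<alpha>\<bar> ^ 3" "q t powr (3/2)" "q t powr (- 7/2)"] q[of t] by (simp flip: powr_add)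
    define u where "u = t - \<alpha>"
    have h3: "h 3 t = 9 * u * q t powr (- 5/2) - 15 * u ^ 3 * q t powr (- 7/2)" by (simp add: h_def u_def)
    have "\<bar>h 3 t\<bar> \<le> 9 * (\<bar>t - \<alpha>\<bar> * q t powr (- 5/2)) + 15 * (\<bar>t - \<alpha>\<bar> ^ 3 * q t powr (- 7/2))"
      unfolding h3 u_def[symmetric]
      using abs_triangle_ineq4[of "9 * u * q t powr (- 5/2)" "15 * u ^ 3 * q t powr (- 7/2)"]
      by (simp add: abs_mult power_abs)
    also have "\<dots> \<le> 24 * q t powr (- 2)" using 1 2 by linarith
    also have "q t powr (- 2) \<le> (\<rho>\<^sup>2) powr (- 2)"
    proof -
      have "\<rho>\<^sup>2 \<le> (norm (y - x - t *\<^sub>R n))\<^sup>2" using far[OF that] \<rho> by (intro power_mono) auto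
      then have "\<rho>\<^sup>2 \<le> q t" unfolding q_def power2_norm_eq_inner using zero_le_power2[of \<delta>] by linarith
      then show ?thesis using \<rho> by (intro powr_mono2') auto
    qed
    also have "(\<rho>\<^sup>2) powr (- 2) = 1 / \<rho> ^ 4" using \<rho> by (simp add: powr_minus_divide flip: power_mult)
    finally show ?thesis by simp
  qed
  have "\<bar>h 0 0 - 3 * h 0 T + 3 * h 0 (2 * T) - h 0 (3 * T)\<bar> \<le> 9 * T ^ 3 * (24 / \<rho> ^ 4)"
    by (rule third_difference_bound[OF d B T]) auto
  moreover have "kern \<delta> x (T *\<^sub>R n) y = h 0 0 - 3 * h 0 T + 3 * h 0 (2 * T) - h 0 (3 * T)"
    unfolding kern_def newt_def h_def q_def by (simp add: algebra_simps)
  ultimately show ?thesis by simp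
qed

text \<open>Shifts by 3a along the normal separate copies of a slab of width 2a. At least rho/(6a)
  copies fit into the ball of radius 2 rho, and 6 * 8 = 48.\<close>

lemma measure_slab_le:
  fixes n :: "real^3"
  assumes n: "norm n = 1" and a: "0 < a" "6 * a \<le> \<rho>"
  shows "measure lborel {y \<in> cball s \<rho>. \<bar>n \<bullet> (y - s)\<bar> \<le> a} \<le> 48 * unit_ball_volume * a * \<rho>\<^sup>2"
proof -
  define A where "A = {y \<in> cball s \<rho>. \<bar>n \<bullet> (y - s)\<bar> \<le> a}"
  have "closed {y. \<bar>n \<bullet> (y - s)\<bar> \<le> a}"
    by (intro closed_Collect_le continuous_intros)
  moreover have "A = cball s \<rho> \<inter> {y. \<bar>n \<bullet> (y - s)\<bar> \<le> a}" by (auto simp: A_def)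
  ultimately have Ab: "A \<in> sets borel" by auto
  have nn: "n \<bullet> n = 1" using n by (simp add: dot_square_norm)
  define m where "m = nat \<lfloor>\<rho> / (3 * a)\<rfloor>"
  have r2: "\<rho> / (3 * a) \<ge> 2" using a by (simp add: field_simps)
  have m1: "real m \<le> \<rho> / (3 * a)" and m2: "real m \<ge> \<rho> / (6 * a)"
    unfolding m_def using r2 by (auto simp: field_simps) linarith+
  have "real m * measure lborel A \<le> measure lborel (cball s (\<rho> + \<rho>))"
  proof (rule measure_disjoint_translates[OF Ab, where v = "(3 * a) *\<^sub>R n"])
    show "A \<subseteq> cball s \<rho>" by (auto simp: A_def)
    show "real m * norm ((3 * a) *\<^sub>R n) \<le> \<rho>" using m1 n a by (simp add: field_simps)
    fix x j assume x: "x \<in> A" and j: "0 < j" "j < m"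
    have "n \<bullet> (x + real j *\<^sub>R ((3 * a) *\<^sub>R n) - s) = n \<bullet> (x - s) + real j * (3 * a)"
      using nn by (simp add: inner_diff_right inner_add_right)
    moreover have "real j * (3 * a) \<ge> 3 * a" using j a by simp
    moreover have "\<bar>n \<bullet> (x - s)\<bar> \<le> a" using x by (simp add: A_def)
    ultimately have "\<not> \<bar>n \<bullet> (x + real j *\<^sub>R ((3 * a) *\<^sub>R n) - s)\<bar> \<le> a" using a by linarith
    then show "x + real j *\<^sub>R ((3 * a) *\<^sub>R n) \<notin> A" unfolding A_def by blast
  qed
  also have "\<dots> = unit_ball_volume * (2 * \<rho>) ^ 3" using a by (subst measure_cball3) auto
  finally have "real m * measure lborel A \<le> unit_ball_volume * (2 * \<rho>) ^ 3" .
  moreover have "\<rho> / (6 * a) * measure lborel A \<le> real m * measure lborel A"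
    by (intro mult_right_mono m2) auto
  ultimately have "\<rho> / (6 * a) * measure lborel A \<le> unit_ball_volume * (2 * \<rho>) ^ 3" by linarith
  moreover have "\<rho> > 0" using a by linarith
  ultimately have "measure lborel A \<le> 48 * unit_ball_volume * a * \<rho>\<^sup>2"
    using a by (simp add: field_simps power2_eq_square power3_eq_cube)
  then show ?thesis by (simp add: A_def)
qed

text \<open>The bound does not depend on \<open>\<delta>\<close>. The poles are excluded because a
  division by zero would make the right-hand side too small.\<close>

lemma kern_near_bound:
  assumes "\<And>j. j \<in> {0,1,2,3::real} \<Longrightarrow> y \<noteq> x + j *\<^sub>R v"
  shows "\<bar>kern \<delta> x v y\<bar> \<le> 1 / norm (y - x) + 3 / norm (y - (x + v)) + 3 / norm (y - (x + 2 *\<^sub>R v)) + 1 / norm (y - (x + 3 *\<^sub>R v))"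
proof -
  have b: "0 \<le> newt \<delta> (y - (x + j *\<^sub>R v)) \<and> newt \<delta> (y - (x + j *\<^sub>R v)) \<le> 1 / norm (y - (x + j *\<^sub>R v))" if "j \<in> {0,1,2,3}" for j :: real
    using newt_bounds(1)[of \<delta> "y - (x + j *\<^sub>R v)"] newt_bounds(2)[of "y - (x + j *\<^sub>R v)" \<delta>] assms[OF that] by auto
  show ?thesis
    using b[of 0] b[of 1] b[of 2] b[of 3] unfolding kern_def
    by (simp add: abs_if del: abs_divide) 
qed

text \<open>The number is 3456000 * 16. Here 3456000 = 216 * 10^3 * 2^4 comes from the third
  difference with step 10 d, taken at distance at least half of |y - s|, and 16 from the tail
  integral.\<close>

definition far_const :: real where "far_const = 55296000 * unit_ball_volume"

text \<open>Three regions: within theta d of a pole the singularity integrates to O((theta d)^2),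
  with weights 1 + 3 + 3 + 1 = 8; in the rest of the ball of radius L d the kernel is at most
  8/(theta d), so the size of \<open>A\<close> decides; farther out the third difference gives d^3 /
  r^4 with integral O(d^2 / L). The parameters stay free because different densities need different
  choices.\<close>

lemma kern_integral_bound:
  fixes n :: "real^3"
  assumes x: "norm (x - s) \<le> 2 * d" and n: "norm n = 1" and d: "d > 0" and \<theta>: "\<theta> > 0" and L: "L \<ge> 64"
    and \<delta>: "\<delta> \<noteq> 0" and A: "A \<in> sets borel" and mf: "f \<in> borel_measurable borel" and B: "B \<ge> 0"
    and f: "\<And>y. \<bar>f y\<bar> \<le> B * \<bar>kern \<delta> x ((10 * d) *\<^sub>R n) y\<bar> * indicator A y"
  shows "integrable lborel f"
    "(LINT y|lborel. \<bar>f y\<bar>) \<le> B * (24 * unit_ball_volume * (\<theta> * d)\<^sup>2 + 8 / (\<theta> * d) * measure lborel (A \<inter> cball s (L * d)) + far_const * d\<^sup>2 / L)"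
proof -
  define v where "v = (10 * d) *\<^sub>R n"
  define P where "P p y = indicator (cball p (\<theta> * d)) y / norm (y - p)" for p y :: "real^3"
  define Q where "Q y = indicator (- ball s (L * d)) y / norm (y - s) ^ 4" for y :: "real^3"
  define A' where "A' = A \<inter> cball s (L * d)"
  have td: "\<theta> * d > 0" "L * d > 0" using \<theta> d L by auto
  have A'b: "A' \<in> sets borel" using A by (auto simp: A'_def)
  have "emeasure lborel A' \<le> emeasure lborel (cball s (L * d))"
    using A'b by (intro emeasure_mono) (auto simp: A'_def)
  then have A'f: "emeasure lborel A' < \<infinity>" using emeasure_lborel_cball_finite[of s "L * d"] by (rule le_less_trans)
  have iP: "integrable lborel (P p)" "(LINT y|lborel. P p y) \<le> 3 * unit_ball_volume * (\<theta> * d)\<^sup>2" for p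
    using integral_inverse_norm[OF td(1), of p] by (auto simp: P_def[abs_def])
  have iQ: "integrable lborel Q" "(LINT y|lborel. Q y) \<le> 16 * unit_ball_volume / (L * d)"
    using integral_inverse_norm_power4[OF td(2), of s] by (auto simp: Q_def[abs_def])
  have iA: "integrable lborel (\<lambda>y. indicator A' y :: real)"
    using A'b A'f by (intro integrable_real_indicator) auto
  define g where "g y = B * (P x y + 3 * P (x + v) y + 3 * P (x + 2 *\<^sub>R v) y + P (x + 3 *\<^sub>R v) y
      + 8 / (\<theta> * d) * indicator A' y + 3456000 * d ^ 3 * Q y)" for y
  have ig: "integrable lborel g" unfolding g_def[abs_def]
    by (intro integrable_mult_right Bochner_Integration.integrable_add iP(1) iQ(1) iA)
  have Pn: "P p y \<ge> 0" "Q y \<ge> 0" for p y by (auto simp: P_def Q_def)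
  have fg: "AE y in lborel. \<bar>f y\<bar> \<le> g y"
  proof -
    \<comment> \<open>The four poles form a null set, so the pointwise bound is only claimed away
      from them.\<close>
    have "AE y in lborel. y \<noteq> x \<and> y \<noteq> x + v \<and> y \<noteq> x + 2 *\<^sub>R v \<and> y \<noteq> x + 3 *\<^sub>R v"
      by (intro AE_conjI AE_lborel_singleton)
    then show ?thesis
    proof (rule eventually_mono)
      fix y assume ne: "y \<noteq> x \<and> y \<noteq> x + v \<and> y \<noteq> x + 2 *\<^sub>R v \<and> y \<noteq> x + 3 *\<^sub>R v"
      have K: "\<bar>kern \<delta> x v y\<bar> \<le> P x y + 3 * P (x + v) y + 3 * P (x + 2 *\<^sub>R v) y + P (x + 3 *\<^sub>R v) y
        + 8 / (\<theta> * d) * indicator A' y + 3456000 * d ^ 3 * Q y" if "y \<in> A"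
      proof (cases "y \<in> cball s (L * d)")
        case True
        then have A'y: "indicator A' y = (1::real)" using that by (simp add: A'_def)
        have P: "1 / norm (y - p) \<le> P p y + 1 / (\<theta> * d)" for p
        proof (cases "y \<in> cball p (\<theta> * d)")
          case True then show ?thesis using td by (simp add: P_def)
        next
          case False
          then have "norm (y - p) > \<theta> * d" by (simp add: dist_norm norm_minus_commute)
          then have "1 / norm (y - p) \<le> 1 / (\<theta> * d)" using frac_le[of 1 1 "\<theta> * d" "norm (y - p)"] td by simp
          then show ?thesis using False by (simp add: P_def)
        qed
        have nej: "y \<noteq> x + j *\<^sub>R v" if "j \<in> {0,1,2,3}" for j :: real using ne that by auto
        have "\<bar>kern \<delta> x v y\<bar> \<le> 1 / norm (y - x) + 3 * (1 / norm (y - (x + v))) + 3 * (1 / norm (y - (x + 2 *\<^sub>R v))) + 1 / norm (y - (x + 3 *\<^sub>R v))"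
          using kern_near_bound[of y x v \<delta>, OF nej] by simp
        also have "\<dots> \<le> P x y + 3 * P (x + v) y + 3 * P (x + 2 *\<^sub>R v) y + P (x + 3 *\<^sub>R v) y + 8 * (1 / (\<theta> * d))"
          using P[of x] P[of "x + v"] P[of "x + 2 *\<^sub>R v"] P[of "x + 3 *\<^sub>R v"] by argo
        also have "\<dots> \<le> P x y + 3 * P (x + v) y + 3 * P (x + 2 *\<^sub>R v) y + P (x + 3 *\<^sub>R v) y + 8 * (1 / (\<theta> * d)) + 3456000 * d ^ 3 * Q y"
          using Pn(2)[of y] d by simp
        finally show ?thesis using A'y by simp
      next
        case False
        define \<rho> where "\<rho> = norm (y - s)"
        have \<rho>: "\<rho> > L * d" using False by (simp add: \<rho>_def dist_norm norm_minus_commute)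
        have "L * d \<ge> 64 * d" using L d by (intro mult_right_mono) auto
        \<comment> \<open>All poles lie within 2 d + 30 d = 32 d of \<open>s\<close>, so beyond 64 d
          the segment of poles stays at distance at least half of |y - s|.\<close>
        then have \<rho>64: "\<rho> \<ge> 64 * d" using \<rho> by linarith
        have far: "norm (y - x - t *\<^sub>R n) \<ge> \<rho> / 2" if "0 \<le> t" "t \<le> 3 * (10 * d)" for t
        proof -
          have "norm (y - s) \<le> norm (y - x - t *\<^sub>R n) + norm (x - s) + norm (t *\<^sub>R n)"
            using norm_triangle_ineq[of "y - x - t *\<^sub>R n" "x - s + t *\<^sub>R n"] norm_triangle_ineq[of "x - s" "t *\<^sub>R n"]
            by (simp add: algebra_simps)
          then show ?thesis using that x n \<rho>64 by (simp add: \<rho>_def)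
        qed
        have "\<bar>kern \<delta> x v y\<bar> \<le> 216 * (10 * d) ^ 3 / (\<rho> / 2) ^ 4"
          unfolding v_def by (rule kern_far_bound[OF \<delta> n _ _ far]) (use d \<rho>64 in auto)
        also have "\<dots> = 3456000 * d ^ 3 * Q y"
          using False \<rho> by (simp add: Q_def \<rho>_def power_divide power_mult_distrib)
        also have "\<dots> \<le> P x y + 3 * P (x + v) y + 3 * P (x + 2 *\<^sub>R v) y + P (x + 3 *\<^sub>R v) y
        + 8 / (\<theta> * d) * indicator A' y + 3456000 * d ^ 3 * Q y"
          using Pn td by simp
        finally show ?thesis .
      qed
      show "\<bar>f y\<bar> \<le> g y"
      proof (cases "y \<in> A")
        case True
        have "\<bar>f y\<bar> \<le> B * \<bar>kern \<delta> x v y\<bar>" using f[of y] True by (simp add: v_def)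
        also have "\<dots> \<le> g y" unfolding g_def by (intro mult_left_mono K True B)
        finally show ?thesis .
      next
        case False
        have "g y \<ge> 0" unfolding g_def using Pn B td d
          by (intro mult_nonneg_nonneg add_nonneg_nonneg) auto
        then show ?thesis using f[of y] False by simp
      qed
    qed
  qed
  show int: "integrable lborel f"
    by (rule Bochner_Integration.integrable_bound[OF ig]) (use mf fg in auto)
  have "(LINT y|lborel. \<bar>f y\<bar>) \<le> (LINT y|lborel. g y)"
    by (rule integral_mono_AE[OF _ ig fg]) (use int in auto)
  also have "\<dots> = B * ((LINT y|lborel. P x y) + 3 * (LINT y|lborel. P (x + v) y) + 3 * (LINT y|lborel. P (x + 2 *\<^sub>R v) y)
      + (LINT y|lborel. P (x + 3 *\<^sub>R v) y) + 8 / (\<theta> * d) * measure lborel A' + 3456000 * d ^ 3 * (LINT y|lborel. Q y))"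
    unfolding g_def using iP(1) iQ(1) iA A'b A'f by simp
  also have "\<dots> \<le> B * (24 * unit_ball_volume * (\<theta> * d)\<^sup>2 + 8 / (\<theta> * d) * measure lborel A' + far_const * d\<^sup>2 / L)"
  proof (rule mult_left_mono[OF _ B])
    have "3456000 * d ^ 3 * (LINT y|lborel. Q y) \<le> 3456000 * d ^ 3 * (16 * unit_ball_volume / (L * d))"
      by (intro mult_left_mono iQ(2)) (use d in auto)
    also have "\<dots> = far_const * d\<^sup>2 / L"
      using d L by (simp add: far_const_def field_simps power2_eq_square power3_eq_cube)
    finally have "3456000 * d ^ 3 * (LINT y|lborel. Q y) \<le> far_const * d\<^sup>2 / L" .
    then show "(LINT y|lborel. P x y) + 3 * (LINT y|lborel. P (x + v) y) + 3 * (LINT y|lborel. P (x + 2 *\<^sub>R v) y)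
      + (LINT y|lborel. P (x + 3 *\<^sub>R v) y) + 8 / (\<theta> * d) * measure lborel A' + 3456000 * d ^ 3 * (LINT y|lborel. Q y)
      \<le> 24 * unit_ball_volume * (\<theta> * d)\<^sup>2 + 8 / (\<theta> * d) * measure lborel A' + far_const * d\<^sup>2 / L"
      using iP(2)[of x] iP(2)[of "x + v"] iP(2)[of "x + 2 *\<^sub>R v"] iP(2)[of "x + 3 *\<^sub>R v"] by argo
  qed
  finally show "(LINT y|lborel. \<bar>f y\<bar>) \<le> B * (24 * unit_ball_volume * (\<theta> * d)\<^sup>2 + 8 / (\<theta> * d) * measure lborel (A \<inter> cball s (L * d)) + far_const * d\<^sup>2 / L)"
    by (simp add: A'_def)
qed

section \<open>A radial cut-off and Green's identity\<close>

text \<open>The argument of \<open>step\<close> is at least 3 for |y - s| up to R/2 and at most 0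
  beyond R. It depends on the squared distance, so there is no singularity at the centre.\<close>

definition cutoff :: "real^3 \<Rightarrow> real \<Rightarrow> real^3 \<Rightarrow> real" where
  "cutoff s R y = step (4 - 4 / R\<^sup>2 * ((y - s) \<bullet> (y - s)))"

definition cutoff_grad :: "real^3 \<Rightarrow> real \<Rightarrow> real^3 \<Rightarrow> real^3" where
  "cutoff_grad s R y = (- 8 / R\<^sup>2 * step' (4 - 4 / R\<^sup>2 * ((y - s) \<bullet> (y - s)))) *\<^sub>R (y - s)"

definition cutoff_hess :: "real^3 \<Rightarrow> real \<Rightarrow> real^3 \<Rightarrow> real^3 \<Rightarrow> real^3 \<Rightarrow> real" where
  "cutoff_hess s R y h b = 64 / R ^ 4 * step'' (4 - 4 / R\<^sup>2 * ((y - s) \<bullet> (y - s))) * ((y - s) \<bullet> h) * ((y - s) \<bullet> b)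
     - 8 / R\<^sup>2 * step' (4 - 4 / R\<^sup>2 * ((y - s) \<bullet> (y - s))) * (h \<bullet> b)"

lemma cutoff_arg_has_derivative:
  "((\<lambda>y. 4 - 4 / R\<^sup>2 * ((y - s) \<bullet> (y - s))) has_derivative (\<lambda>h. - 8 / R\<^sup>2 * ((y - s) \<bullet> h))) (at (y::real^3))"
proof -
  have "((\<lambda>y. (y - s) \<bullet> (y - s)) has_derivative (\<lambda>h. 2 * ((y - s) \<bullet> h))) (at y)"
    by (auto intro!: derivative_eq_intros simp: fun_eq_iff inner_commute)
  from has_derivative_diff[OF has_derivative_const has_derivative_mult_right[OF this]]
  show ?thesis by (rule has_derivative_eq_rhs) (simp add: fun_eq_iff)
qed

lemma cutoff_has_derivative: "(cutoff s R has_derivative (\<lambda>h. cutoff_grad s R y \<bullet> h)) (at y)"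
proof -
  have "(step has_derivative (\<lambda>h. step' t * h)) (at t)" for t
    using DERIV_step unfolding has_field_derivative_def .
  from has_derivative_compose[OF cutoff_arg_has_derivative this]
  show ?thesis unfolding cutoff_def[abs_def] cutoff_grad_def
    by (rule has_derivative_eq_rhs) (simp add: fun_eq_iff)
qed

lemma cutoff_grad_has_derivative:
  "((\<lambda>y. cutoff_grad s R y \<bullet> b) has_derivative (\<lambda>h. cutoff_hess s R y h b)) (at y)"
proof -
  have "(step' has_derivative (\<lambda>h. step'' t * h)) (at t)" for t
    using DERIV_step' unfolding has_field_derivative_def .
  from has_derivative_compose[OF cutoff_arg_has_derivative this, of R s y]
  have "((\<lambda>y. (- 8 / R\<^sup>2 * step' (4 - 4 / R\<^sup>2 * ((y - s) \<bullet> (y - s)))) * ((y - s) \<bullet> b)) has_derivative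
     (\<lambda>h. (- 8 / R\<^sup>2 * step' (4 - 4 / R\<^sup>2 * ((y - s) \<bullet> (y - s)))) * (h \<bullet> b) +
       (- 8 / R\<^sup>2 * (step'' (4 - 4 / R\<^sup>2 * ((y - s) \<bullet> (y - s))) * (- 8 / R\<^sup>2 * ((y - s) \<bullet> h)))) * ((y - s) \<bullet> b))) (at y)"
    by (intro has_derivative_mult has_derivative_mult_right has_derivative_inner_left)
      (auto intro!: derivative_eq_intros)
  then show ?thesis unfolding cutoff_grad_def inner_scaleR_left cutoff_hess_def
    by (rule has_derivative_eq_rhs) (simp add: fun_eq_iff power2_eq_square power4_eq_xxxx)
qed

lemma continuous_cutoff:
  "continuous_on UNIV (cutoff s R)" "continuous_on UNIV (cutoff_grad s R)"
  "continuous_on UNIV (\<lambda>y. cutoff_hess s R y h b)"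
  unfolding cutoff_def[abs_def] cutoff_grad_def[abs_def] cutoff_hess_def[abs_def]
  by (intro continuous_intros continuous_on_compose2[OF continuous_step(1)]
      continuous_on_compose2[OF continuous_step(2)] continuous_on_compose2[OF continuous_step(3)]; simp)+

lemma cutoff_outside:
  assumes "R > 0" "y \<notin> cball s R"
  shows "cutoff s R y = 0" "cutoff_grad s R y = 0" "cutoff_hess s R y h b = 0"
proof -
  have "norm (y - s) > R" using assms by (simp add: dist_norm norm_minus_commute)
  then have "R\<^sup>2 \<le> (y - s) \<bullet> (y - s)" using assms by (simp add: dot_square_norm power_mono)
  then have "4 - 4 / R\<^sup>2 * ((y - s) \<bullet> (y - s)) \<le> 0" using assms by (simp add: field_simps)
  then show "cutoff s R y = 0" "cutoff_grad s R y = 0" "cutoff_hess s R y h b = 0"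
    by (auto simp: cutoff_def cutoff_grad_def cutoff_hess_def step_eq_0 step'_eq_0 step''_eq_0)
qed

lemma cutoff_inside:
  assumes "R > 0" "y \<in> cball s (R/2)"
  shows "cutoff s R y = 1" "cutoff_grad s R y = 0" "cutoff_hess s R y h b = 0"
proof -
  have "norm (y - s) \<le> R/2" using assms by (simp add: dist_norm norm_minus_commute)
  then have "(y - s) \<bullet> (y - s) \<le> (R/2)\<^sup>2" unfolding dot_square_norm by (rule power_mono) simp
  then have "4 - 4 / R\<^sup>2 * ((y - s) \<bullet> (y - s)) \<ge> 3" using assms by (simp add: field_simps power2_eq_square)
  then show "cutoff s R y = 1" "cutoff_grad s R y = 0" "cutoff_hess s R y h b = 0"
    by (auto simp: cutoff_def cutoff_grad_def cutoff_hess_def step_eq_1 step'_eq_0 step''_eq_0)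
qed

lemma cutoff_range: "0 \<le> cutoff s R y" "cutoff s R y \<le> 1"
  by (auto simp: cutoff_def step_bounds)

text \<open>The field w (c grad K - K grad c) has compact support, so its divergence integrates to
  0. Since \<open>w\<close> is only C^1, its gradient is paired with grad (c K), an admissible test
  field for a weak equation; rewriting -K as K - 2 K there leaves the term with factor 2, supported
  where the cut-off varies.\<close>

lemma cutoff_green:
  fixes w :: "real^3 \<Rightarrow> real"
  assumes w: "\<And>y. (w has_derivative (\<lambda>h. W y \<bullet> h)) (at y)" and cW: "continuous_on UNIV W"
    and K: "\<And>y. (K has_derivative (\<lambda>h. gK y \<bullet> h)) (at y)" and cgK: "continuous_on UNIV gK"
    and gK: "\<And>y b. ((\<lambda>y. gK y \<bullet> b) has_derivative (\<lambda>h. hK y h b)) (at y)"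
    and chK: "\<And>b. continuous_on UNIV (\<lambda>y. hK y b b)" and R: "R > 0"
  shows "(LINT y|lborel. cutoff s R y * w y * (\<Sum>b\<in>Basis. hK y b b)) =
     (LINT y|lborel. K y * (w y * (\<Sum>b\<in>Basis. cutoff_hess s R y b b) + 2 * (W y \<bullet> cutoff_grad s R y)))
     - (LINT y|lborel. W y \<bullet> (cutoff s R y *\<^sub>R gK y + K y *\<^sub>R cutoff_grad s R y))"
    "integrable lborel (\<lambda>y. K y * (w y * (\<Sum>b\<in>Basis. cutoff_hess s R y b b) + 2 * (W y \<bullet> cutoff_grad s R y)))"
proof -
  let ?c = "cutoff s R" and ?g = "cutoff_grad s R" and ?h = "cutoff_hess s R"
  have cw: "continuous_on UNIV w" using w by (meson continuous_at_imp_continuous_on has_derivative_continuous)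
  have cK: "continuous_on UNIV K" using K by (meson continuous_at_imp_continuous_on has_derivative_continuous)
  define f where "f b y = w y * (?c y * (gK y \<bullet> b) - K y * (?g y \<bullet> b))" for b y
  define f' where "f' b y = w y * (?c y * hK y b b - K y * ?h y b b) + (W y \<bullet> b) * (?c y * (gK y \<bullet> b) - K y * (?g y \<bullet> b))" for b y
  have df: "((\<lambda>t. f b (y + t *\<^sub>R b)) has_real_derivative f' b y) (at 0)" for b y
  proof -
    have "(f b has_derivative (\<lambda>h. w y * ((?c y * hK y h b + (?g y \<bullet> h) * (gK y \<bullet> b)) - (K y * ?h y h b + (gK y \<bullet> h) * (?g y \<bullet> b)))
       + (W y \<bullet> h) * (?c y * (gK y \<bullet> b) - K y * (?g y \<bullet> b)))) (at y)"
      unfolding f_def[abs_def]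
      by (intro has_derivative_mult has_derivative_diff w K gK cutoff_has_derivative cutoff_grad_has_derivative)
    from has_derivative_imp_directional[OF this, of b] show ?thesis
      by (simp add: f'_def mult.commute)
  qed
  have cf: "continuous_on UNIV (f b)" "continuous_on UNIV (f' b)" for b
    unfolding f_def[abs_def] f'_def[abs_def]
    by (intro continuous_intros cw cW cK cgK chK continuous_cutoff)+
  have sf: "f b y = 0" "f' b y = 0" if "y \<notin> cball s R" for b y
    using cutoff_outside[OF R that] by (auto simp: f_def f'_def)
  have int0: "(LINT y|lborel. f' b y) = 0" for b
    by (rule integral_directional_derivative_eq_0[OF df cf sf(1)])
  let ?A = "\<lambda>y. ?c y * w y * (\<Sum>b\<in>Basis. hK y b b)"
  let ?B = "\<lambda>y. K y * (w y * (\<Sum>b\<in>Basis. ?h y b b) + 2 * (W y \<bullet> ?g y))"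
  let ?C = "\<lambda>y. W y \<bullet> (?c y *\<^sub>R gK y + K y *\<^sub>R ?g y)"
  have iA: "integrable lborel ?A"
    by (rule integrable_continuous_support[of _ s R])
      (auto intro!: continuous_intros cw cW cK cgK chK continuous_cutoff simp: cutoff_outside[OF R])
  show iB: "integrable lborel ?B"
    by (rule integrable_continuous_support[of _ s R])
      (auto intro!: continuous_intros cw cW cK cgK chK continuous_cutoff simp: cutoff_outside[OF R])
  have iC: "integrable lborel ?C"
    by (rule integrable_continuous_support[of _ s R])
      (auto intro!: continuous_intros cw cW cK cgK chK continuous_cutoff simp: cutoff_outside[OF R])
  have "0 = (\<Sum>b\<in>Basis. LINT y|lborel. f' b y)" by (simp add: int0)
  also have "\<dots> = (LINT y|lborel. (\<Sum>b\<in>Basis. f' b y))"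
    by (rule Bochner_Integration.integral_sum[symmetric]) (rule integrable_continuous_support[OF cf(2) sf(2)])
  also have "\<dots> = (LINT y|lborel. ?A y - ?B y + ?C y)"
  proof (rule Bochner_Integration.integral_cong[OF refl])
    fix y
    show "(\<Sum>b\<in>Basis. f' b y) = ?A y - ?B y + ?C y"
      unfolding f'_def inner_add_right inner_scaleR_right
      by (subst (1 2 3) euclidean_inner)
        (simp add: sum.distrib sum_subtractf sum_distrib_left algebra_simps)
  qed
  also have "\<dots> = (LINT y|lborel. ?A y) - (LINT y|lborel. ?B y) + (LINT y|lborel. ?C y)"
    using iA iB iC by simp
  finally show "(LINT y|lborel. ?A y) = (LINT y|lborel. ?B y) - (LINT y|lborel. ?C y)" by simp
qed

definition kern_grad :: "real \<Rightarrow> real^3 \<Rightarrow> real^3 \<Rightarrow> real^3 \<Rightarrow> real^3" where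
  "kern_grad \<delta> x v y = newt_grad \<delta> (y - x) - 3 *\<^sub>R newt_grad \<delta> (y - (x + v))
     + 3 *\<^sub>R newt_grad \<delta> (y - (x + 2 *\<^sub>R v)) - newt_grad \<delta> (y - (x + 3 *\<^sub>R v))"

definition kern_hess :: "real \<Rightarrow> real^3 \<Rightarrow> real^3 \<Rightarrow> real^3 \<Rightarrow> real^3 \<Rightarrow> real^3 \<Rightarrow> real" where
  "kern_hess \<delta> x v y h b = newt_hess \<delta> (y - x) h b - 3 * newt_hess \<delta> (y - (x + v)) h b
     + 3 * newt_hess \<delta> (y - (x + 2 *\<^sub>R v)) h b - newt_hess \<delta> (y - (x + 3 *\<^sub>R v)) h b"

lemma has_derivative_translate:
  assumes "(f has_derivative f') (at (y - p))"
  shows "((\<lambda>y. f (y - p)) has_derivative f') (at (y::'a::real_normed_vector))"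
proof -
  have "((\<lambda>y. y - p) has_derivative (\<lambda>h. h)) (at y)" by (auto intro!: derivative_eq_intros)
  from has_derivative_compose[OF this assms] show ?thesis .
qed

lemma kern_derivatives:
  assumes "\<delta> \<noteq> 0"
  shows "(kern \<delta> x v has_derivative (\<lambda>h. kern_grad \<delta> x v y \<bullet> h)) (at y)"
    "((\<lambda>y. kern_grad \<delta> x v y \<bullet> b) has_derivative (\<lambda>h. kern_hess \<delta> x v y h b)) (at y)"
    "continuous_on UNIV (kern \<delta> x v)" "continuous_on UNIV (kern_grad \<delta> x v)"
    "continuous_on UNIV (\<lambda>y. kern_hess \<delta> x v y h b)"
proof -
  note d = has_derivative_translate[OF newt_has_derivative[OF assms]]
  note d2 = has_derivative_translate[OF newt_grad_has_derivative[OF assms]]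
  show "(kern \<delta> x v has_derivative (\<lambda>h. kern_grad \<delta> x v y \<bullet> h)) (at y)"
    unfolding kern_def[abs_def] kern_grad_def
    by (rule has_derivative_eq_rhs[OF has_derivative_diff[OF has_derivative_add[OF has_derivative_diff[OF d
        has_derivative_mult_right[OF d]] has_derivative_mult_right[OF d]] d]])
      (simp add: fun_eq_iff inner_diff_left inner_add_left)
  show "((\<lambda>y. kern_grad \<delta> x v y \<bullet> b) has_derivative (\<lambda>h. kern_hess \<delta> x v y h b)) (at y)"
    unfolding kern_grad_def kern_hess_def inner_diff_left inner_add_left inner_scaleR_left
    by (intro has_derivative_diff has_derivative_add has_derivative_mult_right d2)
  show "continuous_on UNIV (kern \<delta> x v)" "continuous_on UNIV (kern_grad \<delta> x v)"
    "continuous_on UNIV (\<lambda>y. kern_hess \<delta> x v y h b)"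
    unfolding kern_def[abs_def] kern_grad_def[abs_def] kern_hess_def[abs_def]
    by (intro continuous_intros continuous_on_compose2[OF continuous_newt(1)[OF assms]]
      continuous_on_compose2[OF continuous_newt(2)[OF assms]] continuous_on_compose2[OF continuous_newt(3)[OF assms]]; simp)+
qed

lemma kern_laplacian:
  assumes "\<delta> \<noteq> 0"
  shows "(\<Sum>b\<in>Basis. kern_hess \<delta> x v y b b) = - (newt_bump \<delta> (y - x) - 3 * newt_bump \<delta> (y - (x + v))
     + 3 * newt_bump \<delta> (y - (x + 2 *\<^sub>R v)) - newt_bump \<delta> (y - (x + 3 *\<^sub>R v)))"
  unfolding kern_hess_def
  by (simp add: sum.distrib sum_subtractf sum_distrib_left[symmetric] newt_laplacian[OF assms])

text \<open>Pair \<open>w\<close> with the third difference of the potential: since \<open>w\<close> vanishes at the three shifted poles,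
  only the pole at \<open>x\<close> contributes. The set \<open>T\<close> will be the thin cone where \<open>D\<close> and the half-space differ.\<close>

lemma third_difference_estimate:
  fixes w :: "real^3 \<Rightarrow> real" and n :: "real^3"
  assumes w: "\<And>y. (w has_derivative (\<lambda>h. W y \<bullet> h)) (at y)" and cW: "continuous_on UNIV W"
    and weak: "\<And>psi gpsi. (\<And>y. (psi has_derivative (\<lambda>h. gpsi y \<bullet> h)) (at y)) \<Longrightarrow> continuous_on UNIV gpsi \<Longrightarrow>
       (\<And>y. y \<notin> cball s R \<Longrightarrow> psi y = 0) \<Longrightarrow>
       integrable lborel (\<lambda>y. G y * psi y) \<and> (LINT y|lborel. W y \<bullet> gpsi y) = - (LINT y|lborel. G y * psi y)"
    and G: "\<And>y. y \<in> cball s R \<Longrightarrow> \<bar>G y\<bar> \<le> c1 * indicator T y + c2" and T: "T \<in> sets borel"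
    and c: "c1 \<ge> 0" "c2 \<ge> 0"
    and CR: "\<And>y. y \<in> cball s R \<Longrightarrow> \<bar>w y * (\<Sum>b\<in>Basis. cutoff_hess s R y b b) + 2 * (W y \<bullet> cutoff_grad s R y)\<bar> \<le> CR" "CR \<ge> 0"
    and n: "norm n = 1" and d: "d > 0" "128 * d \<le> R" and x: "norm (x - s) \<le> 2 * d"
    and w0: "\<And>j. j \<in> {1,2,3} \<Longrightarrow> w (x + (10 * d * j) *\<^sub>R n) = 0"
    and \<theta>: "\<theta> > 0" and L: "L \<ge> 64"
  shows "newt_mass * \<bar>w x\<bar> \<le>
      c1 * (24 * unit_ball_volume * (\<theta> * d)\<^sup>2 + 8 / (\<theta> * d) * measure lborel (T \<inter> cball s R \<inter> cball s (L * d)) + far_const * d\<^sup>2 / L)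
    + c2 * (24 * unit_ball_volume * d\<^sup>2 + 8 * unit_ball_volume * 64 ^ 3 * d\<^sup>2 + far_const * d\<^sup>2)
    + CR * (24 * unit_ball_volume * d ^ 4 + 2 * far_const * d ^ 3 / R)" (is "_ \<le> ?rhs")
proof -
  have R: "R > 0" using d by linarith
  define v where "v = (10 * d) *\<^sub>R n"
  have cw: "continuous_on UNIV w" using w by (meson continuous_at_imp_continuous_on has_derivative_continuous)
  have ccw: "continuous_on UNIV (\<lambda>y. cutoff s R y * w y)" by (intro continuous_intros cw continuous_cutoff)
  obtain B where B: "\<And>y. \<bar>cutoff s R y * w y\<bar> \<le> B"
  proof (rule bounded_continuous_support[OF ccw, of s R])
    show "cutoff s R y * w y = 0" if "y \<notin> cball s R" for y using cutoff_outside(1)[OF R that] by simp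
  qed auto
  \<comment> \<open>For each \<open>\<delta>\<close> the right-hand side is the same, so the limit
    may be taken afterwards.\<close>
  have A: "\<bar>LINT y|lborel. cutoff s R y * w y * (\<Sum>b\<in>Basis. kern_hess \<delta> x v y b b)\<bar> \<le> ?rhs" if \<delta>: "\<delta> \<noteq> 0" for \<delta>
  proof -
    let ?k = "kern \<delta> x v"
    note kd = kern_derivatives[OF \<delta>, of x v]
    define f1 where "f1 y = ?k y * (w y * (\<Sum>b\<in>Basis. cutoff_hess s R y b b) + 2 * (W y \<bullet> cutoff_grad s R y))" for y
    define f2 where "f2 y = G y * (cutoff s R y * ?k y)" for y
    have i2: "integrable lborel f2" and
      e2: "(LINT y|lborel. W y \<bullet> (cutoff s R y *\<^sub>R kern_grad \<delta> x v y + ?k y *\<^sub>R cutoff_grad s R y)) = - (LINT y|lborel. f2 y)"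
    proof -
      have p1: "((\<lambda>y. cutoff s R y * ?k y) has_derivative (\<lambda>h. (cutoff s R y *\<^sub>R kern_grad \<delta> x v y + ?k y *\<^sub>R cutoff_grad s R y) \<bullet> h)) (at y)" for y
        by (rule has_derivative_eq_rhs[OF has_derivative_mult[OF cutoff_has_derivative kd(1)]])
          (simp add: fun_eq_iff inner_add_left)
      have p2: "continuous_on UNIV (\<lambda>y. cutoff s R y *\<^sub>R kern_grad \<delta> x v y + ?k y *\<^sub>R cutoff_grad s R y)"
        by (intro continuous_intros continuous_cutoff kd)
      have p3: "cutoff s R y * ?k y = 0" if "y \<notin> cball s R" for y using cutoff_outside[OF R that] by simp
      note wk = weak[OF p1 p2 p3]
      show "integrable lborel f2" unfolding f2_def[abs_def] using wk by (rule conjunct1)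
      show "(LINT y|lborel. W y \<bullet> (cutoff s R y *\<^sub>R kern_grad \<delta> x v y + ?k y *\<^sub>R cutoff_grad s R y)) = - (LINT y|lborel. f2 y)"
        unfolding f2_def[abs_def] using wk by (rule conjunct2)
    qed
    note gr = cutoff_green[OF w cW kd(1) kd(4) kd(2) kd(5) R, of s]
    have i1: "integrable lborel f1" unfolding f1_def[abs_def] by (rule gr(2))
    have eq: "(LINT y|lborel. cutoff s R y * w y * (\<Sum>b\<in>Basis. kern_hess \<delta> x v y b b)) = (LINT y|lborel. f1 y) + (LINT y|lborel. f2 y)"
      unfolding gr(1) e2 f1_def by simp
    define E where "E = cball s R - cball s (R/2)"
    define a1 where "a1 y = c1 * \<bar>?k y\<bar> * indicator (T \<inter> cball s R) y" for y
    define a2 where "a2 y = c2 * \<bar>?k y\<bar> * indicator (cball s R) y" for y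
    define a3 where "a3 y = CR * \<bar>?k y\<bar> * indicator E y" for y
    have mk: "?k \<in> borel_measurable borel" by (rule borel_measurable_continuous_onI[OF kd(3)])
    have Eb: "E \<in> sets borel" "T \<inter> cball s R \<in> sets borel" using T by (auto simp: E_def)
    have m: "a1 \<in> borel_measurable borel" "a2 \<in> borel_measurable borel" "a3 \<in> borel_measurable borel"
      unfolding a1_def[abs_def] a2_def[abs_def] a3_def[abs_def]
      by (intro borel_measurable_times borel_measurable_const borel_measurable_abs mk borel_measurable_indicator Eb; simp)+
    have ne: "\<bar>a1 y\<bar> = a1 y" "\<bar>a2 y\<bar> = a2 y" "\<bar>a3 y\<bar> = a3 y" for y
      using c CR(2) by (auto simp: a1_def a2_def a3_def)
    \<comment> \<open>Used three times: with the given theta and L for the thin set, with 1 and 64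
      for the uniformly bounded remainder, and with d and R/(2d) for the annulus where the cut-off
      varies.\<close>
    note kb = kern_integral_bound[OF x n d(1) _ _ \<delta>, folded v_def]
    have k1: "integrable lborel a1" "(LINT y|lborel. a1 y) \<le> c1 * (24 * unit_ball_volume * (\<theta> * d)\<^sup>2 + 8 / (\<theta> * d) * measure lborel (T \<inter> cball s R \<inter> cball s (L * d)) + far_const * d\<^sup>2 / L)"
      using kb[OF \<theta> L Eb(2) m(1) c(1)] unfolding ne by (auto simp: a1_def)
    have k2: "integrable lborel a2" "(LINT y|lborel. a2 y) \<le> c2 * (24 * unit_ball_volume * (1 * d)\<^sup>2 + 8 / (1 * d) * measure lborel (cball s R \<inter> cball s (64 * d)) + far_const * d\<^sup>2 / 64)"
      using kb[of 1 64 "cball s R", OF _ _ _ m(2) c(2)] unfolding ne by (auto simp: a2_def)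
    \<comment> \<open>With this L the inner ball has radius R/2 and misses the annulus
      \<open>E\<close>, so the measure term is 0 and only the orders d^4 and d^3 / R remain.\<close>
    have "R / (2 * d) \<ge> 64" using d by (simp add: field_simps)
    then have k3: "integrable lborel a3" "(LINT y|lborel. a3 y) \<le> CR * (24 * unit_ball_volume * (d * d)\<^sup>2 + 8 / (d * d) * measure lborel (E \<inter> cball s (R / (2 * d) * d)) + far_const * d\<^sup>2 / (R / (2 * d)))"
      using kb[of d "R / (2 * d)" E, OF _ _ Eb(1) m(3) CR(2)] d(1) unfolding ne by (auto simp: a3_def)
    have "cball s R \<inter> cball s (64 * d) = cball s (64 * d)" using d by auto
    then have m2: "measure lborel (cball s R \<inter> cball s (64 * d)) = unit_ball_volume * (64 * d) ^ 3"
      using d by (simp add: measure_cball3)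
    have "E \<inter> cball s (R / (2 * d) * d) = {}" using d by (auto simp: E_def)
    then have m3: "measure lborel (E \<inter> cball s (R / (2 * d) * d)) = 0" by (simp only: measure_empty)
    have fc: "far_const \<ge> 0" using unit_ball_volume_nonneg by (simp add: far_const_def)
    have k2': "(LINT y|lborel. a2 y) \<le> c2 * (24 * unit_ball_volume * d\<^sup>2 + 8 * unit_ball_volume * 64 ^ 3 * d\<^sup>2 + far_const * d\<^sup>2)"
    proof (rule order_trans[OF k2(2)], rule mult_left_mono[OF _ c(2)])
      have "8 / (1 * d) * measure lborel (cball s R \<inter> cball s (64 * d)) = 8 * unit_ball_volume * 64 ^ 3 * d\<^sup>2"
        unfolding m2 using d(1) by (simp add: field_simps power2_eq_square power3_eq_cube)
      moreover have "far_const * d\<^sup>2 / 64 \<le> far_const * d\<^sup>2" using fc by simp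
      ultimately show "24 * unit_ball_volume * (1 * d)\<^sup>2 + 8 / (1 * d) * measure lborel (cball s R \<inter> cball s (64 * d)) + far_const * d\<^sup>2 / 64
        \<le> 24 * unit_ball_volume * d\<^sup>2 + 8 * unit_ball_volume * 64 ^ 3 * d\<^sup>2 + far_const * d\<^sup>2" by simp
    qed
    have k3': "(LINT y|lborel. a3 y) \<le> CR * (24 * unit_ball_volume * d ^ 4 + 2 * far_const * d ^ 3 / R)"
    proof (rule order_trans[OF k3(2)], rule mult_left_mono[OF _ CR(2)])
      have "far_const * d\<^sup>2 / (R / (2 * d)) = 2 * far_const * d ^ 3 / R"
        using d(1) R by (simp add: field_simps power2_eq_square power3_eq_cube)
      then show "24 * unit_ball_volume * (d * d)\<^sup>2 + 8 / (d * d) * measure lborel (E \<inter> cball s (R / (2 * d) * d)) + far_const * d\<^sup>2 / (R / (2 * d))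
        \<le> 24 * unit_ball_volume * d ^ 4 + 2 * far_const * d ^ 3 / R"
        unfolding m3 by (simp add: power2_eq_square power3_eq_cube power4_eq_xxxx mult.commute mult.left_commute)
    qed
    have p1: "\<bar>f1 y\<bar> \<le> a3 y" for y
    proof (cases "y \<in> E")
      case True
      then have "\<bar>?k y\<bar> * \<bar>w y * (\<Sum>b\<in>Basis. cutoff_hess s R y b b) + 2 * (W y \<bullet> cutoff_grad s R y)\<bar> \<le> \<bar>?k y\<bar> * CR"
        by (intro mult_left_mono CR(1)) (auto simp: E_def)
      then show ?thesis using True by (simp add: f1_def a3_def abs_mult mult.commute)
    next
      case False
      then have "cutoff_grad s R y = 0 \<and> (\<forall>b. cutoff_hess s R y b b = 0)"
        using cutoff_outside[OF R, of y s] cutoff_inside[OF R, of y s] by (auto simp: E_def)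
      then show ?thesis using False by (simp add: f1_def a3_def)
    qed
    have p2: "\<bar>f2 y\<bar> \<le> a1 y + a2 y" for y
    proof (cases "y \<in> cball s R")
      case True
      have "\<bar>G y\<bar> * (\<bar>cutoff s R y\<bar> * \<bar>?k y\<bar>) \<le> (c1 * indicator T y + c2) * (1 * \<bar>?k y\<bar>)"
        using cutoff_range[of s R y] c
        by (intro mult_mono G True) (auto intro!: mult_nonneg_nonneg add_nonneg_nonneg)
      then show ?thesis using True by (simp add: f2_def a1_def a2_def abs_mult algebra_simps indicator_inter_arith)
    next
      case False
      then show ?thesis using cutoff_outside(1)[OF R False] by (simp add: f2_def a1_def a2_def)
    qed
    have "\<bar>(LINT y|lborel. f1 y) + (LINT y|lborel. f2 y)\<bar> \<le> (LINT y|lborel. \<bar>f1 y\<bar>) + (LINT y|lborel. \<bar>f2 y\<bar>)"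
      using integral_abs_bound[of lborel f1] integral_abs_bound[of lborel f2] by linarith
    also have "(LINT y|lborel. \<bar>f1 y\<bar>) \<le> (LINT y|lborel. a3 y)"
      by (intro integral_mono integrable_abs i1 k3 p1)
    also have "(LINT y|lborel. \<bar>f2 y\<bar>) \<le> (LINT y|lborel. a1 y + a2 y)"
      by (intro integral_mono integrable_abs i2 Bochner_Integration.integrable_add k1 k2 p2)
    also have "\<dots> = (LINT y|lborel. a1 y) + (LINT y|lborel. a2 y)" using k1 k2 by simp
    finally show ?thesis unfolding eq using k1(2) k2' k3' by linarith
  qed
  define cc where "cc y = cutoff s R y * w y" for y
  \<comment> \<open>Up to sign, the Laplacian of the kernel is the third difference of bumps at the
    poles; each pairing tends to \<open>newt_mass\<close> times the value at its pole.\<close>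
  define F where "F p n = (LINT y|lborel. cc y * newt_bump (1 / real (Suc n)) (y - p))" for p n
  have F: "F p \<longlonglongrightarrow> newt_mass * cc p" for p
    unfolding F_def cc_def by (rule newt_bump_approximate_identity[OF ccw B])
  have iF: "integrable lborel (\<lambda>y. cc y * newt_bump \<delta> (y - p))" if "\<delta> \<noteq> 0" for \<delta> p
    by (rule integrable_continuous_support[of _ s R])
      (auto simp: cc_def cutoff_outside[OF R] intro!: continuous_intros cw continuous_cutoff continuous_on_compose2[OF continuous_newt(4)[OF that]])
  have FA: "\<bar>F x m - 3 * F (x + v) m + 3 * F (x + 2 *\<^sub>R v) m - F (x + 3 *\<^sub>R v) m\<bar> \<le> ?rhs" for m
  proof -
    have \<delta>: "1 / real (Suc m) \<noteq> 0" by simp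
    have "(LINT y|lborel. cutoff s R y * w y * (\<Sum>b\<in>Basis. kern_hess (1 / real (Suc m)) x v y b b)) =
      (LINT y|lborel. - (cc y * newt_bump (1 / real (Suc m)) (y - x) - 3 * (cc y * newt_bump (1 / real (Suc m)) (y - (x + v)))
     + 3 * (cc y * newt_bump (1 / real (Suc m)) (y - (x + 2 *\<^sub>R v))) - cc y * newt_bump (1 / real (Suc m)) (y - (x + 3 *\<^sub>R v))))"
      unfolding kern_laplacian[OF \<delta>] cc_def by (simp add: algebra_simps)
    also have "\<dots> = - (F x m - 3 * F (x + v) m + 3 * F (x + 2 *\<^sub>R v) m - F (x + 3 *\<^sub>R v) m)"
      unfolding F_def using iF[OF \<delta>] by simp
    finally show ?thesis using A[OF \<delta>] by simp
  qed
  have "(\<lambda>m. \<bar>F x m - 3 * F (x + v) m + 3 * F (x + 2 *\<^sub>R v) m - F (x + 3 *\<^sub>R v) m\<bar>) \<longlonglongrightarrow>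
     \<bar>newt_mass * cc x - 3 * (newt_mass * cc (x + v)) + 3 * (newt_mass * cc (x + 2 *\<^sub>R v)) - newt_mass * cc (x + 3 *\<^sub>R v)\<bar>"
    by (intro tendsto_intros F)
  then have le: "\<bar>newt_mass * cc x - 3 * (newt_mass * cc (x + v)) + 3 * (newt_mass * cc (x + 2 *\<^sub>R v)) - newt_mass * cc (x + 3 *\<^sub>R v)\<bar> \<le> ?rhs"
    by (rule LIMSEQ_le_const2) (use FA in blast)
  have "cc (x + v) = 0" "cc (x + 2 *\<^sub>R v) = 0" "cc (x + 3 *\<^sub>R v) = 0"
    using w0[of 1] w0[of 2] w0[of 3] by (simp_all add: cc_def v_def mult.commute mult.left_commute)
  moreover have "cc x = w x"
    using cutoff_inside(1)[OF R, of x s] x d by (simp add: cc_def dist_norm norm_minus_commute)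
  ultimately show ?thesis using le newt_mass_pos by (simp add: abs_mult)
qed

section \<open>Interior regularity\<close>

text \<open>A bridge: differentiation under the integral is carried out with the gauge integral over
  a box, everything else with the Lebesgue integral.\<close>

lemma integral_cbox_eq_lborel:
  fixes f :: "'a::euclidean_space \<Rightarrow> real"
  assumes f: "integrable lborel f" "\<And>z. z \<notin> cbox a b \<Longrightarrow> f z = 0" and g: "\<And>z. z \<in> cbox a b \<Longrightarrow> f z = g z"
  shows "integral (cbox a b) g = (LINT z|lborel. f z)"
proof -
  have "(f has_integral (LINT z|lborel. f z)) UNIV" by (rule has_integral_integral_lborel[OF f(1)])
  moreover have "(\<lambda>z. if z \<in> cbox a b then f z else 0) = f" using f(2) by auto
  ultimately have "(f has_integral (LINT z|lborel. f z)) (cbox a b)"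
    using has_integral_restrict_UNIV[of "cbox a b" f "LINT z|lborel. f z"] by simp
  then have "(g has_integral (LINT z|lborel. f z)) (cbox a b)"
    by (rule has_integral_eq[rotated]) (use g in auto)
  then show ?thesis by (rule integral_unique)
qed

lemma DERIV_max_0_one_minus:
  "((\<lambda>s::real. (max 0 (1 - s)) ^ Suc (Suc n)) has_real_derivative - (real (Suc (Suc n)) * (max 0 (1 - s)) ^ Suc n)) (at s)"
proof -
  have g: "((\<lambda>s::real. 1 - s) has_real_derivative - 1) (at s)" by (auto intro!: derivative_eq_intros)
  have f: "((\<lambda>y. max 0 y ^ Suc (Suc n)) has_real_derivative real (Suc (Suc n)) * max 0 (1 - s) ^ Suc n) (at (1 - s))"
    by (rule DERIV_max_0_power)
  show ?thesis using DERIV_chain2[OF f g] by simp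
qed

text \<open>To be evaluated at |z|^2. The exponent 5 leaves a square after three differentiations,
  so the third derivatives of the kernel are still continuous.\<close>

definition bump :: "real \<Rightarrow> real" where "bump s = (max 0 (1 - s)) ^ 5"

lemma cbox_One_norm: "z \<in> cbox (- One) (One::'a::euclidean_space) \<Longrightarrow> norm z \<le> real DIM('a)"
proof -
  assume z: "z \<in> cbox (- One) (One::'a)"
  have "norm z \<le> (\<Sum>b\<in>Basis. \<bar>z \<bullet> b\<bar>)" by (rule norm_le_l1)
  also have "\<dots> \<le> (\<Sum>b\<in>(Basis::'a set). 1)" using z by (intro sum_mono) (auto simp: mem_box abs_le_iff)
  finally show ?thesis by simp
qed

lemma cball_subset_cbox_One: "cball 0 1 \<subseteq> cbox (- One) (One::'a::euclidean_space)"
proof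
  fix z :: 'a assume "z \<in> cball 0 1"
  then have "\<bar>z \<bullet> b\<bar> \<le> 1" if "b \<in> Basis" for b using Basis_le_norm[OF that, of z] by simp
  then show "z \<in> cbox (- One) One" by (force simp: mem_box abs_le_iff)
qed

lemma bump_eq_0: "z \<notin> ball (0::'a::euclidean_space) 1 \<Longrightarrow> bump (z \<bullet> z) = 0"
  by (simp add: bump_def dot_square_norm)

lemma continuous_bump: "continuous_on UNIV (\<lambda>z::'a::euclidean_space. bump (z \<bullet> z))"
  unfolding bump_def by (intro continuous_intros)

definition bump_mass :: "'a::euclidean_space itself \<Rightarrow> real" where
  "bump_mass _ = (LINT z|lborel. bump ((z::'a) \<bullet> z))"

lemma bump_integrable: "integrable lborel (\<lambda>z::'a::euclidean_space. bump (z \<bullet> z))"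
  by (rule integrable_continuous_support[OF continuous_bump, of 0 1]) (simp add: bump_def dot_square_norm)

lemma bump_mass_pos: "bump_mass TYPE('a::euclidean_space) > 0"
proof -
  have "(LINT z|lborel. (1/2) ^ 5 * indicator (ball (0::'a) (1/2)) z) \<le> bump_mass TYPE('a)"
    unfolding bump_mass_def
  proof (rule integral_mono[OF _ bump_integrable])
    show "integrable lborel (\<lambda>z. (1/2) ^ 5 * indicator (ball (0::'a) (1/2)) z :: real)"
      by (intro integrable_mult_right integrable_real_indicator)
        (auto simp: emeasure_lborel_ball_finite[unfolded infinity_ennreal_def])
    show "(1/2) ^ 5 * indicator (ball 0 (1/2)) z \<le> bump (z \<bullet> z)" for z :: 'a
    proof (cases "norm z < 1/2")
      case True
      then have "norm z ^ 2 \<le> (1/2)^2" by (intro power_mono) auto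
      then have "1/2 \<le> max 0 (1 - z \<bullet> z)" by (simp add: dot_square_norm power2_eq_square)
      then have "(1/2) ^ 5 \<le> bump (z \<bullet> z)" unfolding bump_def by (rule power_mono) simp
      then show ?thesis using True by simp
    qed (simp add: bump_def)
  qed
  moreover have "measure lborel (ball (0::'a) (1/2)) > 0" using content_ball_pos[of "1/2" "0::'a"] by simp
  then have "0 < (1/2) ^ 5 * measure lborel (ball (0::'a) (1/2))" by (intro mult_pos_pos) auto
  moreover have "(LINT z|lborel. (1/2) ^ 5 * indicator (ball (0::'a) (1/2)) z) = (1/2) ^ 5 * measure lborel (ball (0::'a) (1/2))"
    by simp
  ultimately show ?thesis by linarith
qed

text \<open>The dimension is left open because the application lives in
  \<open>(real^3) \<times> real\<close>.\<close>

locale harmonic =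
  fixes U :: "'a::euclidean_space set" and V :: "'a \<Rightarrow> real" and g :: "'a \<Rightarrow> 'a" and H :: "'a \<Rightarrow> 'a \<Rightarrow> 'a"
  assumes oU: "open U"
    and dV: "\<And>x. x \<in> U \<Longrightarrow> (V has_derivative (\<lambda>h. g x \<bullet> h)) (at x)"
    and dg: "\<And>x. x \<in> U \<Longrightarrow> (g has_derivative H x) (at x)"
    and cH: "\<And>b. b \<in> Basis \<Longrightarrow> continuous_on U (\<lambda>x. H x b)"
    and laplace: "\<And>x. x \<in> U \<Longrightarrow> (\<Sum>b\<in>Basis. H x b \<bullet> b) = 0"
begin

lemma cV: "continuous_on U V" and cg: "continuous_on U g"
  using dV dg by (meson continuous_at_imp_continuous_on has_derivative_continuous)+

text \<open>The weight \<open>bump (z \<bullet> z)\<close> times z is the gradient of a compactly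
  supported radial function \<open>S\<close>. Moving the derivative onto \<open>g\<close> produces
  the Laplacian of \<open>V\<close>, which is 0.\<close>

lemma mean_value_flux:
  fixes X :: 'a
  assumes sub: "\<And>z. z \<in> cball 0 1 \<Longrightarrow> X + c *\<^sub>R z \<in> U"
  defines "f \<equiv> \<lambda>z. if X + c *\<^sub>R z \<in> U then bump (z \<bullet> z) * (g (X + c *\<^sub>R z) \<bullet> z) else 0"
  shows "integrable lborel f" "(LINT z|lborel. f z) = 0"
proof -
  define Q where "Q = {z. X + c *\<^sub>R z \<in> U}"
  have Qv: "Q = (\<lambda>z. X + c *\<^sub>R z) -` U" by (auto simp: Q_def)
  have oQ: "open Q" unfolding Qv by (intro open_vimage oU continuous_intros)
  have UQ: "\<exists>U. open U \<and> z \<in> U \<and> (\<forall>y\<in>U \<inter> Q. P y)" if "z \<notin> Q" and P: "\<And>y. y \<notin> cball 0 1 \<Longrightarrow> P y" for z P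
    using that sub by (intro exI[of _ "- cball 0 1"]) (auto simp: Q_def)
  \<comment> \<open>Differentiating (1 - |z|^2)^6 gives -12 (1 - |z|^2)^5 z, hence the factor
    -1/12.\<close>
  define S where "S z = - (1/12) * (max 0 (1 - z \<bullet> z)) ^ 6" for z :: 'a
  have S0: "S z = 0" "bump (z \<bullet> z) = 0" if "z \<notin> cball 0 1" for z :: 'a
    using that by (auto simp: S_def bump_def dot_square_norm)
  have dS: "(S has_derivative (\<lambda>h. bump (z \<bullet> z) * (z \<bullet> h))) (at z)" for z
  proof -
    have "((\<lambda>s. - (1/12) * (max 0 (1 - s)) ^ 6) has_real_derivative (1/2) * bump (z \<bullet> z)) (at (z \<bullet> z))"
      using DERIV_cmult[OF DERIV_max_0_one_minus[of 4 "z \<bullet> z"], of "- (1/12)"] by (simp add: bump_def numeral_eq_Suc)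
    from has_derivative_radial[OF this] show ?thesis
      unfolding S_def[abs_def] by (rule has_derivative_eq_rhs) simp
  qed
  have cS: "continuous_on A S" for A unfolding S_def[abs_def] by (intro continuous_intros)
  have cB: "continuous_on A (\<lambda>z::'a. bump (z \<bullet> z))" for A by (rule continuous_on_subset[OF continuous_bump]) simp
  have caff: "continuous_on Q (\<lambda>z. X + c *\<^sub>R z)" "(\<lambda>z. X + c *\<^sub>R z) ` Q \<subseteq> U" by (auto simp: Q_def intro!: continuous_intros)
  have cgQ: "continuous_on Q (\<lambda>z. g (X + c *\<^sub>R z))" by (rule continuous_on_compose2[OF cg caff])
  have cHQ: "continuous_on Q (\<lambda>z. H (X + c *\<^sub>R z) b)" if "b \<in> Basis" for b by (rule continuous_on_compose2[OF cH[OF that] caff])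
  define w where "w b z = S z * (g (X + c *\<^sub>R z) \<bullet> b)" for b z
  define w' where "w' b z = bump (z \<bullet> z) * (z \<bullet> b) * (g (X + c *\<^sub>R z) \<bullet> b) + S z * (c * (H (X + c *\<^sub>R z) b \<bullet> b))" for b z
  have cw: "continuous_on UNIV (\<lambda>z. if z \<in> Q then w b z else 0)" for b
    by (rule continuous_on_extend_0[OF oQ]) (unfold w_def, intro continuous_intros cS cgQ, rule UQ, auto simp: S0)
  have cw': "continuous_on UNIV (\<lambda>z. if z \<in> Q then w' b z else 0)" if "b \<in> Basis" for b
    by (rule continuous_on_extend_0[OF oQ]) (unfold w'_def, intro continuous_intros cS cB cgQ cHQ that, rule UQ, auto simp: S0)
  have dw: "((\<lambda>t. (\<lambda>z. if z \<in> Q then w b z else 0) (z + t *\<^sub>R b)) has_real_derivative (if z \<in> Q then w' b z else 0)) (at 0)" for b z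
  proof -
    have 1: "(w b has_derivative (\<lambda>h. S z * (H (X + c *\<^sub>R z) (c *\<^sub>R h) \<bullet> b) + (bump (z \<bullet> z) * (z \<bullet> h)) * (g (X + c *\<^sub>R z) \<bullet> b))) (at z)" if "z \<in> Q"
    proof -
      have "((\<lambda>z. X + c *\<^sub>R z) has_derivative (\<lambda>h. c *\<^sub>R h)) (at z)" by (auto intro!: derivative_eq_intros)
      from has_derivative_compose[OF this dg] that
      have "((\<lambda>z. g (X + c *\<^sub>R z)) has_derivative (\<lambda>h. H (X + c *\<^sub>R z) (c *\<^sub>R h))) (at z)" by (simp add: Q_def)
      from has_derivative_mult[OF dS has_derivative_inner_left[OF this]] show ?thesis unfolding w_def[abs_def] .
    qed
    have 2: "\<exists>U. open U \<and> z \<in> U \<and> (\<forall>y\<in>U \<inter> Q. w b y = 0)" if "z \<notin> Q" by (rule UQ[OF that]) (simp add: w_def S0)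
    have l: "linear (H (X + c *\<^sub>R z))" if "z \<in> Q" using dg[of "X + c *\<^sub>R z"] that has_derivative_linear by (auto simp: Q_def)
    from has_derivative_imp_directional[OF has_derivative_extend_0[OF oQ 1 2], of b]
    show ?thesis by (auto simp: w'_def linear_cmul[OF l] algebra_simps split: if_splits)
  qed
  have s: "(if z \<in> Q then w b z else 0) = 0" "(if z \<in> Q then w' b z else 0) = 0" if "z \<notin> cball 0 1" for b z
    using S0[OF that] by (auto simp: w_def w'_def)
  have int0: "(LINT z|lborel. (if z \<in> Q then w' b z else 0)) = 0" if "b \<in> Basis" for b
    by (rule integral_directional_derivative_eq_0[where p = 0 and R = 1, OF dw cw cw'[OF that] s(1)])
  have feq: "f z = (\<Sum>b\<in>Basis. if z \<in> Q then w' b z else 0)" for z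
  proof (cases "z \<in> Q")
    case True
    have "(\<Sum>b\<in>Basis. w' b z) = bump (z \<bullet> z) * (\<Sum>b\<in>Basis. (g (X + c *\<^sub>R z) \<bullet> b) * (z \<bullet> b)) + S z * c * (\<Sum>b\<in>Basis. H (X + c *\<^sub>R z) b \<bullet> b)"
      by (simp add: w'_def sum.distrib sum_distrib_left mult.assoc mult.commute mult.left_commute)
    also have "\<dots> = f z" using True laplace[of "X + c *\<^sub>R z"] unfolding euclidean_inner[symmetric] by (simp add: f_def Q_def)
    finally show ?thesis using True by simp
  qed (simp add: f_def Q_def)
  have iw: "integrable lborel (\<lambda>z. if z \<in> Q then w' b z else 0)" if "b \<in> Basis" for b
    by (rule integrable_continuous_support[where p = 0 and R = 1, OF cw'[OF that] s(2)])
  show "integrable lborel f" unfolding feq[abs_def] by (intro Bochner_Integration.integrable_sum iw)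
  show "(LINT z|lborel. f z) = 0" unfolding feq[abs_def]
    by (subst Bochner_Integration.integral_sum) (auto simp: int0 iw)
qed

text \<open>The average of V(X + t epsilon z) against the bump has t-derivative epsilon times the
  flux above, which is 0; so its value at t = 1 equals that at t = 0, the mass times
  \<open>V X\<close>.\<close>

lemma mean_value:
  fixes X :: 'a
  assumes sub: "cball X (\<epsilon> * real DIM('a)) \<subseteq> U" and \<epsilon>: "\<epsilon> > 0"
  defines "F \<equiv> \<lambda>z. if X + \<epsilon> *\<^sub>R z \<in> U then V (X + \<epsilon> *\<^sub>R z) * bump (z \<bullet> z) else 0"
  shows "continuous_on UNIV F" "(LINT z|lborel. F z) = bump_mass TYPE('a) * V X"
proof -
  \<comment> \<open>The box contains the unit ball, and its points have norm up to the dimension;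
    this explains the radius in the hypothesis.\<close>
  let ?C = "cbox (- One) (One::'a)"
  have inU: "X + (t * \<epsilon>) *\<^sub>R z \<in> U" if "0 \<le> t" "t \<le> 1" "z \<in> ?C" for t z
  proof -
    have "norm ((t * \<epsilon>) *\<^sub>R z) \<le> \<epsilon> * real DIM('a)"
      using that \<epsilon> cbox_One_norm[OF that(3)] mult_mono[of "t * \<epsilon>" \<epsilon> "norm z" "real DIM('a)"]
      by (simp add: abs_mult mult_left_le_one_le)
    then show ?thesis using sub by (auto simp: dist_norm)
  qed
  define \<Phi> where "\<Phi> t = integral ?C (\<lambda>z. V (X + (t * \<epsilon>) *\<^sub>R z) * bump (z \<bullet> z))" for t
  define W where "W t z = (g (X + (t * \<epsilon>) *\<^sub>R z) \<bullet> (\<epsilon> *\<^sub>R z)) * bump (z \<bullet> z)" for t z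
  have cB: "continuous_on A (\<lambda>z::'a. bump (z \<bullet> z))" for A by (rule continuous_on_subset[OF continuous_bump]) simp
  have dPhi: "(\<Phi> has_field_derivative integral ?C (W t)) (at t within {0..1})" if t: "t \<in> {0..1}" for t
    unfolding \<Phi>_def[abs_def]
  proof (rule leibniz_rule_field_derivative[OF _ _ _ t])
    fix t z assume tz: "t \<in> {0..1::real}" "z \<in> ?C"
    have "((\<lambda>t. X + (t * \<epsilon>) *\<^sub>R z) has_derivative (\<lambda>h. (h * \<epsilon>) *\<^sub>R z)) (at t)" by (auto intro!: derivative_eq_intros)
    from has_derivative_compose[OF this dV[OF inU[of t z]]] tz
    have "((\<lambda>t. V (X + (t * \<epsilon>) *\<^sub>R z)) has_derivative (\<lambda>h. g (X + (t * \<epsilon>) *\<^sub>R z) \<bullet> ((h * \<epsilon>) *\<^sub>R z))) (at t)" by simp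
    then have "((\<lambda>t. V (X + (t * \<epsilon>) *\<^sub>R z)) has_field_derivative g (X + (t * \<epsilon>) *\<^sub>R z) \<bullet> (\<epsilon> *\<^sub>R z)) (at t)"
      unfolding has_field_derivative_def by (rule has_derivative_eq_rhs) (simp add: fun_eq_iff)
    from DERIV_cmult_right[OF this, of "bump (z \<bullet> z)"]
    show "((\<lambda>t. V (X + (t * \<epsilon>) *\<^sub>R z) * bump (z \<bullet> z)) has_field_derivative W t z) (at t within {0..1})"
      unfolding W_def by (rule has_field_derivative_at_within)
  next
    fix t assume t: "t \<in> {0..1::real}"
    have "continuous_on ?C (\<lambda>z. V (X + (t * \<epsilon>) *\<^sub>R z) * bump (z \<bullet> z))"
      by (intro continuous_on_mult cB continuous_on_compose2[OF cV] continuous_intros) (use inU t in auto)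
    then show "(\<lambda>z. V (X + (t * \<epsilon>) *\<^sub>R z) * bump (z \<bullet> z)) integrable_on ?C" by (rule integrable_continuous)
  next
    have "continuous_on ({0..1} \<times> ?C) (\<lambda>p. (g (X + (fst p * \<epsilon>) *\<^sub>R snd p) \<bullet> (\<epsilon> *\<^sub>R snd p)) * bump (snd p \<bullet> snd p))"
      by (intro continuous_on_mult continuous_on_inner continuous_on_compose2[OF continuous_bump] continuous_on_compose2[OF cg] continuous_intros)
        (use inU in auto)
    then show "continuous_on ({0..1} \<times> ?C) (\<lambda>(t, z). W t z)" by (simp add: W_def split_beta)
  qed simp
  have W0: "integral ?C (W t) = 0" if t: "t \<in> {0..1}" for t
  proof -
    define f where "f z = (if X + (t * \<epsilon>) *\<^sub>R z \<in> U then bump (z \<bullet> z) * (g (X + (t * \<epsilon>) *\<^sub>R z) \<bullet> z) else 0)" for z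
    have s: "X + (t * \<epsilon>) *\<^sub>R z \<in> U" if "z \<in> cball 0 1" for z
      using inU[of t z] t that cball_subset_cbox_One by auto
    have f: "integrable lborel f" "(LINT z|lborel. f z) = 0"
      using mean_value_flux[OF s] unfolding f_def[abs_def] by auto
    have "integral ?C (W t) = (LINT z|lborel. \<epsilon> * f z)"
    proof (rule integral_cbox_eq_lborel)
      show "integrable lborel (\<lambda>z. \<epsilon> * f z)" using f(1) by simp
      show "\<epsilon> * f z = 0" if "z \<notin> ?C" for z
      proof -
        have "z \<notin> ball 0 1" using that cball_subset_cbox_One ball_subset_cball by blast
        then show ?thesis using bump_eq_0[of z] by (simp add: f_def)
      qed
      show "\<epsilon> * f z = W t z" if "z \<in> ?C" for z
        using inU[of t z] t that by (simp add: f_def W_def)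
    qed
    then show ?thesis using f(2) by simp
  qed
  have "\<exists>c. \<forall>t\<in>{0..1}. \<Phi> t = c"
    by (rule has_field_derivative_zero_constant) (use dPhi W0 in auto)
  then have Phi: "\<Phi> 1 = \<Phi> 0" by force
  define Q where "Q = {z. X + \<epsilon> *\<^sub>R z \<in> U}"
  have Qv: "Q = (\<lambda>z. X + \<epsilon> *\<^sub>R z) -` U" by (auto simp: Q_def)
  have oQ: "open Q" unfolding Qv by (intro open_vimage oU continuous_intros)
  have Q1: "cball 0 1 \<subseteq> Q"
    using inU[of 1] cball_subset_cbox_One by (auto simp: Q_def)
  have "continuous_on UNIV (\<lambda>z. if z \<in> Q then V (X + \<epsilon> *\<^sub>R z) * bump (z \<bullet> z) else 0)"
  proof (rule continuous_on_extend_0[OF oQ])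
    show "continuous_on Q (\<lambda>z. V (X + \<epsilon> *\<^sub>R z) * bump (z \<bullet> z))"
      by (intro continuous_on_mult cB continuous_on_compose2[OF cV] continuous_intros) (auto simp: Q_def)
    show "\<exists>U. open U \<and> z \<in> U \<and> (\<forall>y\<in>U \<inter> Q. V (X + \<epsilon> *\<^sub>R y) * bump (y \<bullet> y) = 0)" if "z \<notin> Q" for z
      using that Q1 by (intro exI[of _ "- cball 0 1"]) (auto simp: bump_eq_0)
  qed
  then show cF: "continuous_on UNIV F" by (simp add: F_def Q_def)
  have F0: "F z = 0" if "z \<notin> cball 0 1" for z using that bump_eq_0[of z] by (simp add: F_def)
  have iF: "integrable lborel F" by (rule integrable_continuous_support[OF cF F0])
  have "\<Phi> 1 = (LINT z|lborel. F z)"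
    unfolding \<Phi>_def
  proof (rule integral_cbox_eq_lborel[OF iF])
    show "F z = 0" if "z \<notin> ?C" for z using that F0[of z] cball_subset_cbox_One by blast
    show "F z = V (X + (1 * \<epsilon>) *\<^sub>R z) * bump (z \<bullet> z)" if "z \<in> ?C" for z using inU[of 1 z] that by (simp add: F_def)
  qed
  moreover have "\<Phi> 0 = (LINT z|lborel. V X * bump ((z::'a) \<bullet> z))"
    unfolding \<Phi>_def
  proof (rule integral_cbox_eq_lborel)
    show "integrable lborel (\<lambda>z::'a. V X * bump (z \<bullet> z))" by (intro integrable_mult_right bump_integrable)
    show "V X * bump (z \<bullet> z) = 0" if "z \<notin> ?C" for z
    proof -
      have "z \<notin> ball 0 1" using that cball_subset_cbox_One ball_subset_cball by blast
      then show ?thesis using bump_eq_0[of z] by simp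
    qed
  qed simp
  ultimately show "(LINT z|lborel. F z) = bump_mass TYPE('a) * V X"
    using Phi by (simp add: bump_mass_def mult.commute)
qed

end

section \<open>Convolution with compactly supported kernels\<close>

lemma uniformly_continuous_support:
  fixes f :: "'a::euclidean_space \<Rightarrow> 'b::real_normed_vector"
  assumes "continuous_on UNIV f" "\<And>x. x \<notin> cball p R \<Longrightarrow> f x = 0"
  shows "uniformly_continuous_on UNIV f"
  unfolding uniformly_continuous_on_def
proof (intro allI impI)
  fix e :: real assume e: "e > 0"
  have "uniformly_continuous_on (cball p (R + 1)) f"
    by (intro compact_uniformly_continuous continuous_on_subset[OF assms(1)]) auto
  then obtain d where d: "d > 0" "\<And>x y. x \<in> cball p (R + 1) \<Longrightarrow> y \<in> cball p (R + 1) \<Longrightarrow> dist y x < d \<Longrightarrow> dist (f y) (f x) < e"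
    unfolding uniformly_continuous_on_def using e by metis
  have "dist (f y) (f x) < e" if xy: "dist y x < min d 1" for x y
  proof (cases "x \<in> cball p (R + 1) \<and> y \<in> cball p (R + 1)")
    case True
    then show ?thesis using d(2)[of x y] xy by auto
  next
    case False
    have "dist p x \<le> dist p y + dist y x" "dist p y \<le> dist p x + dist y x"
      using dist_triangle[of p x y] dist_triangle[of p y x] by (simp_all add: dist_commute)
    then have "x \<notin> cball p R" "y \<notin> cball p R" using False xy by auto
    then show ?thesis using assms(2) e by simp
  qed
  then show "\<exists>d>0. \<forall>x\<in>UNIV. \<forall>x'\<in>UNIV. dist x' x < d \<longrightarrow> dist (f x') (f x) < e"
    using d(1) by (intro exI[of _ "min d 1"]) auto
qed

lemma integrable_convolution:
  fixes f \<phi> :: "'a::euclidean_space \<Rightarrow> real"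
  assumes f: "integrable lborel f" and c: "continuous_on UNIV \<phi>" and s: "\<And>x. x \<notin> cball p R \<Longrightarrow> \<phi> x = 0"
  shows "integrable lborel (\<lambda>y. f y * \<phi> (y - x))"
proof -
  obtain B where B: "\<And>x. \<bar>\<phi> x\<bar> \<le> B" using bounded_continuous_support[OF c s] by blast
  have "continuous_on UNIV (\<lambda>y. \<phi> (y - x))" by (intro continuous_on_compose2[OF c] continuous_intros) auto
  then have m: "(\<lambda>y. \<phi> (y - x)) \<in> borel_measurable lborel" using borel_measurable_continuous_onI by simp
  show ?thesis
  proof (rule Bochner_Integration.integrable_bound[of lborel "\<lambda>y. B * f y"])
    show "integrable lborel (\<lambda>y. B * f y)" using f by simp
    show "(\<lambda>y. f y * \<phi> (y - x)) \<in> borel_measurable lborel" using f m by auto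
    show "AE y in lborel. norm (f y * \<phi> (y - x)) \<le> norm (B * f y)"
    proof (rule AE_I2)
      fix y
      have "\<bar>\<phi> (y - x)\<bar> * \<bar>f y\<bar> \<le> \<bar>B\<bar> * \<bar>f y\<bar>" using B[of "y - x"] by (intro mult_right_mono) auto
      then show "norm (f y * \<phi> (y - x)) \<le> norm (B * f y)" by (simp add: abs_mult mult.commute)
    qed
  qed
qed

lemma convolution_continuous:
  fixes f \<phi> :: "'a::euclidean_space \<Rightarrow> real"
  assumes f: "integrable lborel f" and c: "continuous_on UNIV \<phi>" and s: "\<And>x. x \<notin> cball p R \<Longrightarrow> \<phi> x = 0"
  shows "continuous_on UNIV (\<lambda>x. LINT y|lborel. f y * \<phi> (y - x))"
  unfolding continuous_on_iff
proof (intro ballI allI impI)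
  fix x :: 'a and e :: real assume e: "e > 0"
  define I where "I = (LINT y|lborel. \<bar>f y\<bar>) + 1"
  have I: "I > 0" by (simp add: I_def add_nonneg_pos)
  obtain d where d: "d > 0" "\<And>x y. dist y x < d \<Longrightarrow> dist (\<phi> y) (\<phi> x) < e / I"
    using uniformly_continuous_support[OF c s] e I unfolding uniformly_continuous_on_def
    by (metis UNIV_I divide_pos_pos)
  note ic = integrable_convolution[OF f c s]
  have "dist (LINT y|lborel. f y * \<phi> (y - x')) (LINT y|lborel. f y * \<phi> (y - x)) < e" if x': "dist x' x < d" for x'
  proof -
    have "\<bar>f y * \<phi> (y - x') - f y * \<phi> (y - x)\<bar> \<le> e / I * \<bar>f y\<bar>" for y
    proof -
      have "dist (y - x') (y - x) < d" using x' by (simp add: dist_norm norm_minus_commute)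
      then have "\<bar>\<phi> (y - x') - \<phi> (y - x)\<bar> \<le> e / I" using d(2) by (force simp: dist_real_def)
      then have "\<bar>f y\<bar> * \<bar>\<phi> (y - x') - \<phi> (y - x)\<bar> \<le> \<bar>f y\<bar> * (e / I)" by (intro mult_left_mono) auto
      then show ?thesis by (simp add: abs_mult[symmetric] right_diff_distrib mult.commute)
    qed
    then have "(LINT y|lborel. \<bar>f y * \<phi> (y - x') - f y * \<phi> (y - x)\<bar>) \<le> (LINT y|lborel. e / I * \<bar>f y\<bar>)"
      using f by (intro integral_mono integrable_abs Bochner_Integration.integrable_diff ic) auto
    also have "\<dots> = e / I * (I - 1)" by (simp add: I_def)
    also have "\<dots> < e" using e I by (simp add: field_simps)
    finally have "(LINT y|lborel. \<bar>f y * \<phi> (y - x') - f y * \<phi> (y - x)\<bar>) < e" .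
    then have "\<bar>LINT y|lborel. f y * \<phi> (y - x') - f y * \<phi> (y - x)\<bar> < e"
      using integral_abs_bound[of lborel "\<lambda>y. f y * \<phi> (y - x') - f y * \<phi> (y - x)"] by linarith
    then show ?thesis using ic by (simp add: dist_real_def)
  qed
  then show "\<exists>d>0. \<forall>x'\<in>UNIV. dist x' x < d \<longrightarrow> dist (LINT y|lborel. f y * \<phi> (y - x')) (LINT y|lborel. f y * \<phi> (y - x)) < e"
    using d(1) by blast
qed

text \<open>The first-order remainder of the kernel is small uniformly in its argument, because the
  gradient is uniformly continuous; integrability of \<open>f\<close> then suffices. The minus sign
  comes from y - x.\<close>

lemma convolution_has_derivative:
  fixes f \<phi> :: "'a::euclidean_space \<Rightarrow> real"
  assumes f: "integrable lborel f" and d: "\<And>z. (\<phi> has_derivative (\<lambda>h. g z \<bullet> h)) (at z)"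
    and cg: "continuous_on UNIV g" and s: "\<And>x. x \<notin> cball p R \<Longrightarrow> \<phi> x = 0"
  shows "((\<lambda>x. LINT y|lborel. f y * \<phi> (y - x)) has_derivative (\<lambda>h. - (LINT y|lborel. f y * (g (y - x) \<bullet> h)))) (at x)"
proof -
  have c: "continuous_on UNIV \<phi>" using d by (meson continuous_at_imp_continuous_on has_derivative_continuous)
  have sg: "g x = 0" if "x \<notin> cball p R" for x by (rule gradient_support[OF d s that])
  note ic = integrable_convolution[OF f c s]
  have icg: "integrable lborel (\<lambda>y. f y * (g (y - x) \<bullet> h))" for h x
    by (rule integrable_convolution[OF f, of "\<lambda>z. g z \<bullet> h" p R]) (auto intro!: continuous_intros cg simp: sg)
  define I where "I = (LINT y|lborel. \<bar>f y\<bar>) + 1"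
  have I: "I > 0" by (simp add: I_def add_nonneg_pos)
  have lin: "linear (\<lambda>h. - (LINT y|lborel. f y * (g (y - x) \<bullet> h)))"
  proof (rule linearI)
    fix h k
    have "(LINT y|lborel. f y * (g (y - x) \<bullet> (h + k))) = (LINT y|lborel. f y * (g (y - x) \<bullet> h) + f y * (g (y - x) \<bullet> k))"
      by (simp add: inner_add_right distrib_left)
    then show "- (LINT y|lborel. f y * (g (y - x) \<bullet> (h + k))) = - (LINT y|lborel. f y * (g (y - x) \<bullet> h)) + - (LINT y|lborel. f y * (g (y - x) \<bullet> k))"
      using icg by simp
    fix r :: real
    have "(LINT y|lborel. f y * (g (y - x) \<bullet> (r *\<^sub>R h))) = (LINT y|lborel. r * (f y * (g (y - x) \<bullet> h)))"
      by (simp add: mult.left_commute)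
    then show "- (LINT y|lborel. f y * (g (y - x) \<bullet> (r *\<^sub>R h))) = r *\<^sub>R - (LINT y|lborel. f y * (g (y - x) \<bullet> h))"
      by simp
  qed
  show ?thesis
    unfolding has_derivative_at_alt
  proof (intro conjI allI impI)
    show "bounded_linear (\<lambda>h. - (LINT y|lborel. f y * (g (y - x) \<bullet> h)))"
      using lin linear_conv_bounded_linear by blast
    fix e :: real assume e: "e > 0"
    obtain d' where d': "d' > 0" "\<And>x y. dist y x < d' \<Longrightarrow> dist (g y) (g x) < e / I"
      using uniformly_continuous_support[OF cg sg] e I unfolding uniformly_continuous_on_def
      by (metis UNIV_I divide_pos_pos)
    have bd: "\<bar>\<phi> (z - h) - \<phi> z + g z \<bullet> h\<bar> \<le> e / I * norm h" if h: "norm h < d'" for z h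
    proof -
      \<comment> \<open>After the linear part at \<open>z\<close> is subtracted, the derivative on
        the ball is g w - g z, which is small.\<close>
      have "norm ((\<lambda>w. \<phi> w - g z \<bullet> w) (z - h) - (\<lambda>w. \<phi> w - g z \<bullet> w) z) \<le> e / I * norm (z - h - z)"
      proof (rule differentiable_bound[where S = "ball z d'" and f' = "\<lambda>w k. (g w - g z) \<bullet> k"])
        show "((\<lambda>w. \<phi> w - g z \<bullet> w) has_derivative (\<lambda>k. (g w - g z) \<bullet> k)) (at w within ball z d')" for w
          by (auto intro!: derivative_eq_intros has_derivative_at_withinI[OF d] simp: inner_diff_left)
        show "onorm (\<lambda>k. (g w - g z) \<bullet> k) \<le> e / I" if "w \<in> ball z d'" for w
        proof (rule onorm_le)
          fix k
          have "norm ((g w - g z) \<bullet> k) \<le> norm (g w - g z) * norm k" by (simp add: Cauchy_Schwarz_ineq2)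
          also have "\<dots> \<le> e / I * norm k"
            using d'(2)[of w z] that by (intro mult_right_mono) (auto simp: dist_norm dist_commute norm_minus_commute less_imp_le)
          finally show "norm ((g w - g z) \<bullet> k) \<le> e / I * norm k" .
        qed
      qed (use h d' in \<open>auto simp: dist_norm\<close>)
      then show ?thesis by (simp add: inner_diff_right algebra_simps)
    qed
    have "norm ((LINT y|lborel. f y * \<phi> (y - x')) - (LINT y|lborel. f y * \<phi> (y - x)) - - (LINT y|lborel. f y * (g (y - x) \<bullet> (x' - x)))) \<le> e * norm (x' - x)"
      if x': "norm (x' - x) < d'" for x'
    proof -
      let ?q = "\<lambda>y. f y * \<phi> (y - x') - f y * \<phi> (y - x) + f y * (g (y - x) \<bullet> (x' - x))"
      have iq: "integrable lborel ?q" by (intro Bochner_Integration.integrable_add Bochner_Integration.integrable_diff ic icg)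
      have "\<bar>?q y\<bar> \<le> e / I * norm (x' - x) * \<bar>f y\<bar>" for y
      proof -
        have "?q y = f y * (\<phi> (y - x - (x' - x)) - \<phi> (y - x) + g (y - x) \<bullet> (x' - x))"
          by (simp add: algebra_simps)
        then have "\<bar>?q y\<bar> = \<bar>f y\<bar> * \<bar>\<phi> (y - x - (x' - x)) - \<phi> (y - x) + g (y - x) \<bullet> (x' - x)\<bar>" by (simp only: abs_mult)
        also have "\<dots> \<le> \<bar>f y\<bar> * (e / I * norm (x' - x))" by (intro mult_left_mono bd x') auto
        finally show ?thesis by (simp add: mult.commute)
      qed
      then have "(LINT y|lborel. \<bar>?q y\<bar>) \<le> (LINT y|lborel. e / I * norm (x' - x) * \<bar>f y\<bar>)"
        using f iq by (intro integral_mono) auto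
      also have "\<dots> = e * norm (x' - x) * ((I - 1) / I)" by (simp add: I_def)
      also have "\<dots> \<le> e * norm (x' - x) * 1"
        using e I by (intro mult_left_mono) (auto simp: field_simps)
      finally have "\<bar>LINT y|lborel. ?q y\<bar> \<le> e * norm (x' - x)"
        using integral_abs_bound[of lborel ?q] by linarith
      then show ?thesis using ic icg by simp
    qed
    then show "\<exists>d>0. \<forall>y. norm (y - x) < d \<longrightarrow> norm ((LINT ya|lborel. f ya * \<phi> (ya - y)) - (LINT y|lborel. f y * \<phi> (y - x)) -
      - (LINT ya|lborel. f ya * (g (ya - x) \<bullet> (y - x)))) \<le> e * norm (y - x)"
      using d'(1) by blast
  qed
qed

text \<open>The numbered kernels are the partial derivatives of \<open>bump_kernel\<close> in the directions \<open>a\<close>, \<open>b\<close>, \<open>c\<close>;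
  written out, they are visibly symmetric.\<close>

definition bump_pow :: "real \<Rightarrow> nat \<Rightarrow> 'a::euclidean_space \<Rightarrow> real" where
  "bump_pow \<epsilon> m z = (max 0 (1 - z \<bullet> z / \<epsilon>\<^sup>2)) ^ m"

definition bump_kernel :: "real \<Rightarrow> 'a::euclidean_space \<Rightarrow> real" where
  "bump_kernel \<epsilon> z = bump_pow \<epsilon> 5 z"

definition bump_kernel_1 :: "real \<Rightarrow> 'a::euclidean_space \<Rightarrow> 'a \<Rightarrow> real" where
  "bump_kernel_1 \<epsilon> a z = - 10 / \<epsilon>\<^sup>2 * bump_pow \<epsilon> 4 z * (z \<bullet> a)"

definition bump_kernel_2 :: "real \<Rightarrow> 'a::euclidean_space \<Rightarrow> 'a \<Rightarrow> 'a \<Rightarrow> real" where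
  "bump_kernel_2 \<epsilon> a b z = 80 / \<epsilon> ^ 4 * bump_pow \<epsilon> 3 z * (z \<bullet> a) * (z \<bullet> b) - 10 / \<epsilon>\<^sup>2 * bump_pow \<epsilon> 4 z * (a \<bullet> b)"

definition bump_kernel_3 :: "real \<Rightarrow> 'a::euclidean_space \<Rightarrow> 'a \<Rightarrow> 'a \<Rightarrow> 'a \<Rightarrow> real" where
  "bump_kernel_3 \<epsilon> a b c z = - 480 / \<epsilon> ^ 6 * bump_pow \<epsilon> 2 z * (z \<bullet> a) * (z \<bullet> b) * (z \<bullet> c)
     + 80 / \<epsilon> ^ 4 * bump_pow \<epsilon> 3 z * ((a \<bullet> b) * (z \<bullet> c) + (a \<bullet> c) * (z \<bullet> b) + (b \<bullet> c) * (z \<bullet> a))"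

lemma bump_pow_has_derivative:
  fixes z :: "'a::euclidean_space"
  assumes "\<epsilon> > 0"
  shows "(bump_pow \<epsilon> (Suc (Suc m)) has_derivative (\<lambda>h. - (2 * real (Suc (Suc m)) / \<epsilon>\<^sup>2) * bump_pow \<epsilon> (Suc m) z * (z \<bullet> h))) (at z)"
proof -
  have "((\<lambda>s::real. s / \<epsilon>\<^sup>2) has_real_derivative 1 / \<epsilon>\<^sup>2) (at (z \<bullet> z))"
    by (rule DERIV_cdivide[OF DERIV_ident])
  from has_derivative_radial[OF DERIV_chain2[OF DERIV_max_0_one_minus this]]
  show ?thesis unfolding bump_pow_def[abs_def]
    by (rule has_derivative_eq_rhs) (simp add: fun_eq_iff)
qed

lemma continuous_bump_pow: "continuous_on UNIV (bump_pow \<epsilon> m)"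
  unfolding bump_pow_def[abs_def] divide_inverse by (intro continuous_intros)

lemma bump_pow_eq_0: "\<epsilon> > 0 \<Longrightarrow> m > 0 \<Longrightarrow> z \<notin> cball 0 \<epsilon> \<Longrightarrow> bump_pow \<epsilon> m z = 0"
proof -
  assume a: "\<epsilon> > 0" "m > 0" "z \<notin> cball 0 \<epsilon>"
  then have "\<epsilon>\<^sup>2 \<le> z \<bullet> z" by (simp add: dot_square_norm power_mono)
  then have "max 0 (1 - z \<bullet> z / \<epsilon>\<^sup>2) = 0" using a by (simp add: field_simps)
  then show ?thesis using a by (simp add: bump_pow_def)
qed

lemma bump_pow_range: "0 \<le> bump_pow \<epsilon> m z" "bump_pow \<epsilon> m z \<le> 1"
  by (auto simp: bump_pow_def intro!: power_le_one)

lemma kernel_outside: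
  assumes "\<epsilon> > 0" "z \<notin> cball 0 \<epsilon>"
  shows "bump_kernel \<epsilon> z = 0" "bump_kernel_1 \<epsilon> a z = 0" "bump_kernel_2 \<epsilon> a b z = 0" "bump_kernel_3 \<epsilon> a b c z = 0"
  using assms by (auto simp: bump_kernel_def bump_kernel_1_def bump_kernel_2_def bump_kernel_3_def bump_pow_eq_0)

lemma continuous_kernel:
  "continuous_on UNIV (bump_kernel \<epsilon>)" "continuous_on UNIV (bump_kernel_1 \<epsilon> a)" "continuous_on UNIV (bump_kernel_2 \<epsilon> a b)" "continuous_on UNIV (bump_kernel_3 \<epsilon> a b c)"
  unfolding bump_kernel_def[abs_def] bump_kernel_1_def[abs_def] bump_kernel_2_def[abs_def] bump_kernel_3_def[abs_def]
  by (intro continuous_intros continuous_bump_pow)+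

lemma bump_kernel_has_derivative:
  assumes "\<epsilon> > 0"
  shows "(bump_kernel \<epsilon> has_derivative (\<lambda>h. ((- 10 / \<epsilon>\<^sup>2 * bump_pow \<epsilon> 4 z) *\<^sub>R z) \<bullet> h)) (at z)"
proof -
  have "(bump_pow \<epsilon> 5 has_derivative (\<lambda>h. - (10 / \<epsilon>\<^sup>2) * bump_pow \<epsilon> 4 z * (z \<bullet> h))) (at z)"
    using bump_pow_has_derivative[OF assms, of 3 z] by (simp add: numeral_eq_Suc)
  then show ?thesis unfolding bump_kernel_def[abs_def] by (rule has_derivative_eq_rhs) (simp add: fun_eq_iff)
qed

lemma bump_kernel_1_has_derivative:
  assumes "\<epsilon> > 0"
  shows "(bump_kernel_1 \<epsilon> a has_derivative (\<lambda>h. ((80 / \<epsilon> ^ 4 * bump_pow \<epsilon> 3 z * (z \<bullet> a)) *\<^sub>R z - (10 / \<epsilon>\<^sup>2 * bump_pow \<epsilon> 4 z) *\<^sub>R a) \<bullet> h)) (at z)"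
proof -
  have "(bump_pow \<epsilon> 4 has_derivative (\<lambda>h. - (8 / \<epsilon>\<^sup>2) * bump_pow \<epsilon> 3 z * (z \<bullet> h))) (at z)"
    using bump_pow_has_derivative[OF assms, of 2 z] by (simp add: numeral_eq_Suc)
  from has_derivative_mult[OF has_derivative_mult_right[OF this, of "- 10 / \<epsilon>\<^sup>2"] has_derivative_inner_left[OF has_derivative_ident, of a]]
  show ?thesis unfolding bump_kernel_1_def[abs_def]
    by (rule has_derivative_eq_rhs)
      (simp add: fun_eq_iff inner_diff_left inner_commute power2_eq_square power4_eq_xxxx algebra_simps)
qed

lemma bump_kernel_2_has_derivative:
  assumes "\<epsilon> > 0"
  shows "(bump_kernel_2 \<epsilon> a b has_derivative (\<lambda>h. ((- 480 / \<epsilon> ^ 6 * bump_pow \<epsilon> 2 z * (z \<bullet> a) * (z \<bullet> b)) *\<^sub>R z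
     + (80 / \<epsilon> ^ 4 * bump_pow \<epsilon> 3 z) *\<^sub>R ((a \<bullet> b) *\<^sub>R z + (z \<bullet> b) *\<^sub>R a + (z \<bullet> a) *\<^sub>R b)) \<bullet> h)) (at z)"
proof -
  have d4: "(bump_pow \<epsilon> 4 has_derivative (\<lambda>h. - (8 / \<epsilon>\<^sup>2) * bump_pow \<epsilon> 3 z * (z \<bullet> h))) (at z)"
    using bump_pow_has_derivative[OF assms, of 2 z] by (simp add: numeral_eq_Suc)
  have d3: "(bump_pow \<epsilon> 3 has_derivative (\<lambda>h. - (6 / \<epsilon>\<^sup>2) * bump_pow \<epsilon> 2 z * (z \<bullet> h))) (at z)"
    using bump_pow_has_derivative[OF assms, of 1 z] by (simp add: numeral_eq_Suc)
  note i = has_derivative_inner_left[OF has_derivative_ident]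
  note 1 = has_derivative_mult[OF has_derivative_mult[OF has_derivative_mult_right[OF d3, of "80 / \<epsilon> ^ 4"] i[of a]] i[of b]]
  note 2 = has_derivative_mult_left[OF has_derivative_mult_right[OF d4, of "10 / \<epsilon>\<^sup>2"], of "a \<bullet> b"]
  define e where "e = 1 / \<epsilon>\<^sup>2"
  have e: "10 / \<epsilon>\<^sup>2 = 10 * e" "8 / \<epsilon>\<^sup>2 = 8 * e" "6 / \<epsilon>\<^sup>2 = 6 * e" "80 / \<epsilon> ^ 4 = 80 * (e * e)"
    "- 480 / \<epsilon> ^ 6 = - 480 * (e * e * e)"
    using assms by (simp_all add: e_def flip: power_add)
  show ?thesis unfolding bump_kernel_2_def[abs_def]
    by (rule has_derivative_eq_rhs[OF has_derivative_diff[OF 1 2]], unfold e)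
      (simp add: fun_eq_iff inner_add_left inner_commute algebra_simps)
qed

text \<open>On the support both inner products with z gain a factor epsilon, so the two terms
  contribute 80 and 10.\<close>

lemma bump_kernel_2_bound:
  assumes "\<epsilon> > 0"
  shows "\<bar>bump_kernel_2 \<epsilon> a b z\<bar> \<le> 90 / \<epsilon>\<^sup>2 * norm a * norm b * indicator (cball 0 \<epsilon>) z"
proof (cases "z \<in> cball 0 \<epsilon>")
  case True
  then have z: "norm z \<le> \<epsilon>" by simp
  have "\<bar>z \<bullet> a\<bar> \<le> norm z * norm a" "\<bar>z \<bullet> b\<bar> \<le> norm z * norm b" by (rule Cauchy_Schwarz_ineq2)+
  then have za: "\<bar>z \<bullet> a\<bar> \<le> \<epsilon> * norm a" "\<bar>z \<bullet> b\<bar> \<le> \<epsilon> * norm b"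
    using mult_right_mono[OF z, of "norm a"] mult_right_mono[OF z, of "norm b"] by auto
  have "80 / \<epsilon> ^ 4 * bump_pow \<epsilon> 3 z * \<bar>z \<bullet> a\<bar> * \<bar>z \<bullet> b\<bar> \<le> 80 / \<epsilon> ^ 4 * 1 * (\<epsilon> * norm a) * (\<epsilon> * norm b)"
    using assms bump_pow_range[of \<epsilon> 3 z] za by (intro mult_mono) auto
  also have "\<dots> = 80 / \<epsilon>\<^sup>2 * norm a * norm b" using assms by (simp add: field_simps power2_eq_square power4_eq_xxxx)
  finally have 1: "80 / \<epsilon> ^ 4 * bump_pow \<epsilon> 3 z * \<bar>z \<bullet> a\<bar> * \<bar>z \<bullet> b\<bar> \<le> 80 / \<epsilon>\<^sup>2 * norm a * norm b" .
  have "10 / \<epsilon>\<^sup>2 * bump_pow \<epsilon> 4 z * \<bar>a \<bullet> b\<bar> \<le> 10 / \<epsilon>\<^sup>2 * 1 * (norm a * norm b)"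
    using assms bump_pow_range[of \<epsilon> 4 z] Cauchy_Schwarz_ineq2[of a b] by (intro mult_mono) auto
  then have 2: "10 / \<epsilon>\<^sup>2 * bump_pow \<epsilon> 4 z * \<bar>a \<bullet> b\<bar> \<le> 10 / \<epsilon>\<^sup>2 * norm a * norm b" by (simp add: mult.assoc)
  have "\<bar>bump_kernel_2 \<epsilon> a b z\<bar> \<le> \<bar>80 / \<epsilon> ^ 4 * bump_pow \<epsilon> 3 z * (z \<bullet> a) * (z \<bullet> b)\<bar> + \<bar>10 / \<epsilon>\<^sup>2 * bump_pow \<epsilon> 4 z * (a \<bullet> b)\<bar>"
    unfolding bump_kernel_2_def by (rule abs_triangle_ineq4)
  also have "\<dots> = 80 / \<epsilon> ^ 4 * bump_pow \<epsilon> 3 z * \<bar>z \<bullet> a\<bar> * \<bar>z \<bullet> b\<bar> + 10 / \<epsilon>\<^sup>2 * bump_pow \<epsilon> 4 z * \<bar>a \<bullet> b\<bar>"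
    using assms bump_pow_range(1)[of \<epsilon> 3 z] bump_pow_range(1)[of \<epsilon> 4 z] by (simp add: abs_mult)
  also have "\<dots> \<le> 80 / \<epsilon>\<^sup>2 * norm a * norm b + 10 / \<epsilon>\<^sup>2 * norm a * norm b" using 1 2 by (rule add_mono)
  also have "\<dots> = 90 / \<epsilon>\<^sup>2 * norm a * norm b" using assms by (simp add: field_simps)
  finally show ?thesis using True by simp
qed (use kernel_outside(3)[OF assms] in simp)

context harmonic begin

text \<open>By the mean value property \<open>V\<close> is near \<open>X0\<close> a multiple of its
  own convolution with \<open>bump_kernel\<close>, so all derivatives fall on the kernel. That
  yields third derivatives, makes the symmetries those of the explicit kernels, and bounds
  \<open>H\<close> by the supremum of \<open>V\<close> on a ball.\<close>

lemma third_derivatives: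
  fixes X0 :: 'a
  assumes sub: "cball X0 (2 * \<epsilon> * real DIM('a)) \<subseteq> U" and \<epsilon>: "\<epsilon> > 0"
  shows "\<exists>T. \<forall>X\<in>ball X0 \<epsilon>. \<forall>a b. ((\<lambda>X. H X a \<bullet> b) has_derivative T X a b) (at X) \<and> H X a \<bullet> b = H X b \<bullet> a \<and>
      (\<forall>c. continuous_on (ball X0 \<epsilon>) (\<lambda>X. T X a b c) \<and> T X a b c = T X b a c \<and> T X a b c = T X a c b)"
    and "(\<And>X. X \<in> cball X0 \<epsilon> \<Longrightarrow> \<bar>V X\<bar> \<le> B) \<Longrightarrow>
      \<bar>H X0 a \<bullet> b\<bar> \<le> 90 * unit_ball_vol (real DIM('a)) / bump_mass TYPE('a) * B / \<epsilon>\<^sup>2 * norm a * norm b"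
proof -
  let ?r = "2 * \<epsilon> * real DIM('a)"
  \<comment> \<open>Truncation makes \<open>V\<close> integrable on the whole space. The radius
    covers every ball that the mean value property needs at centres within epsilon of
    \<open>X0\<close>.\<close>
  define f where "f Y = (if Y \<in> cball X0 ?r then V Y else 0)" for Y
  define C where "C = 1 / (bump_mass TYPE('a) * \<epsilon> ^ DIM('a))"
  have C: "C > 0" using bump_mass_pos[where 'a='a] \<epsilon> by (simp add: C_def)
  have dim: "real DIM('a) \<ge> 1" using DIM_positive[where 'a='a] by linarith
  have re: "2 * \<epsilon> \<le> ?r" using dim \<epsilon> by simp
  have fi: "integrable lborel f"
  proof -
    have "integrable lborel (\<lambda>x. indicator (cball X0 ?r) x *\<^sub>R V x)"
      by (intro borel_integrable_compact continuous_on_subset[OF cV sub]) auto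
    moreover have "(\<lambda>x. indicator (cball X0 ?r) x *\<^sub>R V x) = f" by (auto simp: f_def indicator_def fun_eq_iff)
    ultimately show ?thesis by simp
  qed
  note ko = kernel_outside[OF \<epsilon>]
  have rep: "V X = C * (LINT Y|lborel. f Y * bump_kernel \<epsilon> (Y - X))" if X: "X \<in> ball X0 \<epsilon>" for X
  proof -
    have "cball X (\<epsilon> * real DIM('a)) \<subseteq> cball X0 ?r"
    proof
      fix y assume "y \<in> cball X (\<epsilon> * real DIM('a))"
      moreover have "\<epsilon> \<le> \<epsilon> * real DIM('a)" using \<epsilon> dim by simp
      ultimately show "y \<in> cball X0 ?r" using X dist_triangle[of X0 y X] by (simp add: dist_commute)
    qed
    then have s: "cball X (\<epsilon> * real DIM('a)) \<subseteq> U" using sub by blast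
    define F where "F z = (if X + \<epsilon> *\<^sub>R z \<in> U then V (X + \<epsilon> *\<^sub>R z) * bump (z \<bullet> z) else 0)" for z
    have mv: "(LINT z|lborel. F z) = bump_mass TYPE('a) * V X"
      using mean_value(2)[OF s \<epsilon>] unfolding F_def .
    have "integrable lborel (\<lambda>Y. f Y * bump_kernel \<epsilon> (Y - X))"
      by (rule integrable_convolution[OF fi continuous_kernel(1) ko(1)])
    then have m: "(\<lambda>Y. f Y * bump_kernel \<epsilon> (Y - X)) \<in> borel_measurable borel" by auto
    have "f (X + \<epsilon> *\<^sub>R z) * bump_kernel \<epsilon> (X + \<epsilon> *\<^sub>R z - X) = F z" for z
    proof -
      have "bump_kernel \<epsilon> (\<epsilon> *\<^sub>R z) = bump (z \<bullet> z)"
        using \<epsilon> by (simp add: bump_kernel_def bump_pow_def bump_def power2_eq_square)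
      moreover have "X + \<epsilon> *\<^sub>R z \<in> cball X0 ?r" if "z \<in> ball 0 1"
      proof -
        have "norm (\<epsilon> *\<^sub>R z) \<le> \<epsilon>" using that \<epsilon> by (simp add: mult_left_le)
        then have "X + \<epsilon> *\<^sub>R z \<in> cball X0 (2 * \<epsilon>)"
          using X dist_triangle[of X0 "X + \<epsilon> *\<^sub>R z" X] by (simp add: dist_norm)
        then show ?thesis using re by simp
      qed
      ultimately show ?thesis using sub bump_eq_0[of z] by (cases "z \<in> ball 0 1") (auto simp: F_def f_def)
    qed
    then have "(LINT Y|lborel. f Y * bump_kernel \<epsilon> (Y - X)) = (LINT z|lborel. \<epsilon> ^ DIM('a) * F z)"
      by (subst integral_scale[OF m \<epsilon>, of X]) simp
    also have "\<dots> = \<epsilon> ^ DIM('a) * (bump_mass TYPE('a) * V X)" by (simp add: mv)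
    finally show ?thesis using \<epsilon> bump_mass_pos[where 'a='a] by (simp add: C_def)
  qed
  have inU: "X \<in> U" if "X \<in> ball X0 \<epsilon>" for X
  proof -
    have "dist X0 X \<le> ?r" using that re \<epsilon> unfolding mem_ball by linarith
    then have "X \<in> cball X0 ?r" by simp
    then show ?thesis using sub by blast
  qed
  have g: "g X \<bullet> h = - (C * (LINT Y|lborel. f Y * bump_kernel_1 \<epsilon> h (Y - X)))" if X: "X \<in> ball X0 \<epsilon>" for X h
  proof -
    have cont: "continuous_on UNIV (\<lambda>z::'a. (- 10 / \<epsilon>\<^sup>2 * bump_pow \<epsilon> 4 z) *\<^sub>R z)" by (intro continuous_intros continuous_bump_pow)
    have "((\<lambda>X. C * (LINT Y|lborel. f Y * bump_kernel \<epsilon> (Y - X))) has_derivative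
       (\<lambda>h. C * - (LINT Y|lborel. f Y * (((- 10 / \<epsilon>\<^sup>2 * bump_pow \<epsilon> 4 (Y - X)) *\<^sub>R (Y - X)) \<bullet> h)))) (at X)"
      by (rule has_derivative_mult_right[OF convolution_has_derivative[OF fi bump_kernel_has_derivative[OF \<epsilon>] cont ko(1)]])
    then have "(V has_derivative (\<lambda>h. C * - (LINT Y|lborel. f Y * (((- 10 / \<epsilon>\<^sup>2 * bump_pow \<epsilon> 4 (Y - X)) *\<^sub>R (Y - X)) \<bullet> h)))) (at X)"
      by (rule has_derivative_transform_within_open[OF _ open_ball X]) (simp add: rep)
    \<comment> \<open>The given gradient and the derivative of the convolution are derivatives of
      the same function, hence equal. The same comparison identifies \<open>H\<close> below.\<close>
    from fun_cong[OF has_derivative_unique[OF this dV[OF inU[OF X]]], of h] show ?thesis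
      by (simp add: bump_kernel_1_def mult.assoc)
  qed
  have HH: "H X h \<bullet> a = C * (LINT Y|lborel. f Y * bump_kernel_2 \<epsilon> a h (Y - X))" if X: "X \<in> ball X0 \<epsilon>" for X a h
  proof -
    have cont: "continuous_on UNIV (\<lambda>z::'a. ((80 / \<epsilon> ^ 4 * bump_pow \<epsilon> 3 z * (z \<bullet> a)) *\<^sub>R z - (10 / \<epsilon>\<^sup>2 * bump_pow \<epsilon> 4 z) *\<^sub>R a))"
      by (intro continuous_intros continuous_bump_pow)
    have "((\<lambda>X. - (C * (LINT Y|lborel. f Y * bump_kernel_1 \<epsilon> a (Y - X)))) has_derivative
       (\<lambda>h. - (C * - (LINT Y|lborel. f Y * (((80 / \<epsilon> ^ 4 * bump_pow \<epsilon> 3 (Y - X) * ((Y - X) \<bullet> a)) *\<^sub>R (Y - X) - (10 / \<epsilon>\<^sup>2 * bump_pow \<epsilon> 4 (Y - X)) *\<^sub>R a) \<bullet> h))))) (at X)"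
      by (rule has_derivative_minus[OF has_derivative_mult_right[OF convolution_has_derivative[OF fi bump_kernel_1_has_derivative[OF \<epsilon>] cont ko(2)]]])
    then have "((\<lambda>X. g X \<bullet> a) has_derivative (\<lambda>h. - (C * - (LINT Y|lborel. f Y * (((80 / \<epsilon> ^ 4 * bump_pow \<epsilon> 3 (Y - X) * ((Y - X) \<bullet> a)) *\<^sub>R (Y - X) - (10 / \<epsilon>\<^sup>2 * bump_pow \<epsilon> 4 (Y - X)) *\<^sub>R a) \<bullet> h))))) (at X)"
      by (rule has_derivative_transform_within_open[OF _ open_ball X]) (simp add: g)
    from fun_cong[OF has_derivative_unique[OF this has_derivative_inner_left[OF dg[OF inU[OF X]]]], of h]
    show ?thesis by (simp add: bump_kernel_2_def inner_diff_left mult.assoc)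
  qed
  define T where "T X a b c = - (C * (LINT Y|lborel. f Y * bump_kernel_3 \<epsilon> a b c (Y - X)))" for X a b c
  have dT: "((\<lambda>X. H X a \<bullet> b) has_derivative T X a b) (at X)" if X: "X \<in> ball X0 \<epsilon>" for X a b
  proof -
    have cont: "continuous_on UNIV (\<lambda>z::'a. (- 480 / \<epsilon> ^ 6 * bump_pow \<epsilon> 2 z * (z \<bullet> b) * (z \<bullet> a)) *\<^sub>R z
     + (80 / \<epsilon> ^ 4 * bump_pow \<epsilon> 3 z) *\<^sub>R ((b \<bullet> a) *\<^sub>R z + (z \<bullet> a) *\<^sub>R b + (z \<bullet> b) *\<^sub>R a))"
      by (intro continuous_intros continuous_bump_pow)
    have "((\<lambda>X. C * (LINT Y|lborel. f Y * bump_kernel_2 \<epsilon> b a (Y - X))) has_derivative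
       (\<lambda>h. C * - (LINT Y|lborel. f Y * (((- 480 / \<epsilon> ^ 6 * bump_pow \<epsilon> 2 (Y - X) * ((Y - X) \<bullet> b) * ((Y - X) \<bullet> a)) *\<^sub>R (Y - X)
     + (80 / \<epsilon> ^ 4 * bump_pow \<epsilon> 3 (Y - X)) *\<^sub>R ((b \<bullet> a) *\<^sub>R (Y - X) + ((Y - X) \<bullet> a) *\<^sub>R b + ((Y - X) \<bullet> b) *\<^sub>R a)) \<bullet> h)))) (at X)"
      by (rule has_derivative_mult_right[OF convolution_has_derivative[OF fi bump_kernel_2_has_derivative[OF \<epsilon>] cont ko(3)]])
    then have "((\<lambda>X. H X a \<bullet> b) has_derivative
       (\<lambda>h. C * - (LINT Y|lborel. f Y * (((- 480 / \<epsilon> ^ 6 * bump_pow \<epsilon> 2 (Y - X) * ((Y - X) \<bullet> b) * ((Y - X) \<bullet> a)) *\<^sub>R (Y - X)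
     + (80 / \<epsilon> ^ 4 * bump_pow \<epsilon> 3 (Y - X)) *\<^sub>R ((b \<bullet> a) *\<^sub>R (Y - X) + ((Y - X) \<bullet> a) *\<^sub>R b + ((Y - X) \<bullet> b) *\<^sub>R a)) \<bullet> h)))) (at X)"
      by (rule has_derivative_transform_within_open[OF _ open_ball X]) (simp add: HH)
    then show ?thesis
    proof (rule has_derivative_eq_rhs, intro ext)
      fix h
      have "((- 480 / \<epsilon> ^ 6 * bump_pow \<epsilon> 2 z * (z \<bullet> b) * (z \<bullet> a)) *\<^sub>R z
          + (80 / \<epsilon> ^ 4 * bump_pow \<epsilon> 3 z) *\<^sub>R ((b \<bullet> a) *\<^sub>R z + (z \<bullet> a) *\<^sub>R b + (z \<bullet> b) *\<^sub>R a)) \<bullet> h = bump_kernel_3 \<epsilon> a b h z" for z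
        by (simp add: bump_kernel_3_def inner_add_left inner_add_right inner_diff_right inner_commute algebra_simps add_divide_distrib)
      then show "C * - (LINT Y|lborel. f Y * (((- 480 / \<epsilon> ^ 6 * bump_pow \<epsilon> 2 (Y - X) * ((Y - X) \<bullet> b) * ((Y - X) \<bullet> a)) *\<^sub>R (Y - X)
     + (80 / \<epsilon> ^ 4 * bump_pow \<epsilon> 3 (Y - X)) *\<^sub>R ((b \<bullet> a) *\<^sub>R (Y - X) + ((Y - X) \<bullet> a) *\<^sub>R b + ((Y - X) \<bullet> b) *\<^sub>R a)) \<bullet> h)) = T X a b h"
        by (simp add: T_def)
    qed
  qed
  have k2s: "bump_kernel_2 \<epsilon> a b z = bump_kernel_2 \<epsilon> b a z" for a b z :: 'a by (simp add: bump_kernel_2_def inner_commute)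
  have k3s: "bump_kernel_3 \<epsilon> a b c z = bump_kernel_3 \<epsilon> b a c z" "bump_kernel_3 \<epsilon> a b c z = bump_kernel_3 \<epsilon> a c b z" for a b c z :: 'a
    by (simp_all add: bump_kernel_3_def inner_commute add.commute add.left_commute mult.commute mult.left_commute)
  have cT: "continuous_on (ball X0 \<epsilon>) (\<lambda>X. T X a b c)" for a b c
    unfolding T_def
    by (intro continuous_intros continuous_on_subset[OF convolution_continuous[OF fi continuous_kernel(4), of 0 \<epsilon>]])
      (use ko(4) in auto)
  show "\<exists>T. \<forall>X\<in>ball X0 \<epsilon>. \<forall>a b. ((\<lambda>X. H X a \<bullet> b) has_derivative T X a b) (at X) \<and> H X a \<bullet> b = H X b \<bullet> a \<and>
      (\<forall>c. continuous_on (ball X0 \<epsilon>) (\<lambda>X. T X a b c) \<and> T X a b c = T X b a c \<and> T X a b c = T X a c b)"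
    using dT cT HH k2s k3s by (intro exI[of _ T]) (auto simp: T_def)
  assume B: "\<And>X. X \<in> cball X0 \<epsilon> \<Longrightarrow> \<bar>V X\<bar> \<le> B"
  define q where "q Y = f Y * bump_kernel_2 \<epsilon> b a (Y - X0)" for Y
  have iq: "integrable lborel q" unfolding q_def[abs_def] by (rule integrable_convolution[OF fi continuous_kernel(3) ko(3)])
  have "\<bar>q Y\<bar> \<le> (B * (90 / \<epsilon>\<^sup>2 * norm a * norm b)) * indicator (cball X0 \<epsilon>) Y" for Y
  proof (cases "Y \<in> cball X0 \<epsilon>")
    case True
    then have "dist X0 Y \<le> ?r" using re \<epsilon> unfolding mem_cball by linarith
    then have "Y \<in> cball X0 ?r" by simp
    then have "\<bar>f Y\<bar> \<le> B" using B[OF True] by (simp add: f_def)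
    moreover have "\<bar>bump_kernel_2 \<epsilon> b a (Y - X0)\<bar> \<le> 90 / \<epsilon>\<^sup>2 * norm a * norm b"
      using bump_kernel_2_bound[OF \<epsilon>, of b a "Y - X0"] True by (simp add: dist_norm norm_minus_commute mult.commute mult.left_commute)
    ultimately have "\<bar>f Y\<bar> * \<bar>bump_kernel_2 \<epsilon> b a (Y - X0)\<bar> \<le> B * (90 / \<epsilon>\<^sup>2 * norm a * norm b)"
      by (intro mult_mono) auto
    then show ?thesis using True by (simp add: q_def abs_mult)
  next
    case False
    then have "Y - X0 \<notin> cball 0 \<epsilon>" by (simp add: dist_norm norm_minus_commute)
    from ko(3)[OF this, of b a] show ?thesis using False by (simp add: q_def)
  qed
  from abs_integral_le_measure[OF iq _ _ this]
  have "\<bar>LINT Y|lborel. q Y\<bar> \<le> (B * (90 / \<epsilon>\<^sup>2 * norm a * norm b)) * measure lborel (cball X0 \<epsilon>)" by auto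
  also have "measure lborel (cball X0 \<epsilon>) = unit_ball_vol (real DIM('a)) * \<epsilon> ^ DIM('a)"
    using \<epsilon> content_cball[of \<epsilon> X0] by simp
  finally have "C * \<bar>LINT Y|lborel. q Y\<bar> \<le> C * ((B * (90 / \<epsilon>\<^sup>2 * norm a * norm b)) * (unit_ball_vol (real DIM('a)) * \<epsilon> ^ DIM('a)))"
    using C by (intro mult_left_mono) auto
  also have "\<dots> = 90 * unit_ball_vol (real DIM('a)) / bump_mass TYPE('a) * B / \<epsilon>\<^sup>2 * norm a * norm b"
    using \<epsilon> bump_mass_pos[where 'a='a] by (simp add: C_def)
  finally show "\<bar>H X0 a \<bullet> b\<bar> \<le> 90 * unit_ball_vol (real DIM('a)) / bump_mass TYPE('a) * B / \<epsilon>\<^sup>2 * norm a * norm b"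
    using HH[of X0 a b] \<epsilon> C by (simp add: q_def[symmetric] abs_mult)
qed

end

text \<open>If \<open>v\<close> solves the Helmholtz equation, then \<open>exp (k t) * v x\<close> is harmonic in one more variable.\<close>

definition helm_const :: "real \<Rightarrow> real" where
  "helm_const k = 90 * unit_ball_vol (real DIM((real^3) \<times> real)) / bump_mass TYPE((real^3) \<times> real) * exp \<bar>k\<bar>"

lemma helm_const_nonneg: "helm_const k \<ge> 0"
  using bump_mass_pos[where 'a="(real^3) \<times> real"] by (simp add: helm_const_def)

text \<open>Restricting the four-dimensional result to t = 0 gives back \<open>v\<close> and its
  derivatives. The radius 8 epsilon is 2 epsilon times the dimension 4, and epsilon at most 1 bounds
  exp (k t) by exp |k|.\<close>

lemma helmholtz_interior:
  fixes v :: "real^3 \<Rightarrow> real"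
  assumes oD: "open D"
    and dv: "\<And>x. x \<in> D \<Longrightarrow> (v has_derivative (\<lambda>h. g x \<bullet> h)) (at x)"
    and dg: "\<And>x. x \<in> D \<Longrightarrow> (g has_derivative H x) (at x)"
    and cH: "\<And>b. b \<in> Basis \<Longrightarrow> continuous_on D (\<lambda>x. H x b)"
    and lap: "\<And>x. x \<in> D \<Longrightarrow> (\<Sum>b\<in>Basis. H x b \<bullet> b) = - (k\<^sup>2 * v x)"
    and sub: "cball x0 (8 * \<epsilon>) \<subseteq> D" and \<epsilon>: "\<epsilon> > 0"
  shows "\<exists>T. \<forall>x\<in>ball x0 \<epsilon>. \<forall>a b. ((\<lambda>x. H x a \<bullet> b) has_derivative T x a b) (at x) \<and> H x a \<bullet> b = H x b \<bullet> a \<and>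
      (\<forall>c. continuous_on (ball x0 \<epsilon>) (\<lambda>x. T x a b c) \<and> T x a b c = T x b a c \<and> T x a b c = T x a c b)"
    and "\<epsilon> \<le> 1 \<Longrightarrow> (\<And>x. x \<in> cball x0 \<epsilon> \<Longrightarrow> \<bar>v x\<bar> \<le> B) \<Longrightarrow>
      \<bar>H x0 a \<bullet> b\<bar> \<le> helm_const k * B / \<epsilon>\<^sup>2 * norm a * norm b"
proof -
  define V where "V p = exp (k * snd p) * v (fst p)" for p :: "(real^3) \<times> real"
  define gV where "gV p = (exp (k * snd p) *\<^sub>R g (fst p), k * exp (k * snd p) * v (fst p))" for p :: "(real^3) \<times> real"
  define HV where "HV p q = (exp (k * snd p) *\<^sub>R H (fst p) (fst q) + (k * snd q * exp (k * snd p)) *\<^sub>R g (fst p),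
      k * exp (k * snd p) * (g (fst p) \<bullet> fst q) + k\<^sup>2 * snd q * exp (k * snd p) * v (fst p))" for p q :: "(real^3) \<times> real"
  define U where "U = D \<times> (UNIV :: real set)"
  have lin: "linear (H x)" if "x \<in> D" for x using dg[OF that] has_derivative_linear by blast
  have cv: "continuous_on D v" using dv by (meson continuous_at_imp_continuous_on has_derivative_continuous)
  have cg: "continuous_on D g" using dg by (meson continuous_at_imp_continuous_on has_derivative_continuous)
  have de: "((\<lambda>p. exp (k * snd p)) has_derivative (\<lambda>q. k * snd q * exp (k * snd p))) (at p)" for p :: "(real^3) \<times> real"
    by (auto intro!: derivative_eq_intros)
  have df: "((\<lambda>p. v (fst p)) has_derivative (\<lambda>q. g (fst p) \<bullet> fst q)) (at p)"
    "((\<lambda>p. g (fst p)) has_derivative (\<lambda>q. H (fst p) (fst q))) (at p)" if "p \<in> U" for p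
    using has_derivative_compose[OF has_derivative_fst[OF has_derivative_ident] dv]
      has_derivative_compose[OF has_derivative_fst[OF has_derivative_ident] dg] that by (auto simp: U_def)
  interpret harmonic U V gV HV
  proof
    show "open U" unfolding U_def by (intro open_Times oD open_UNIV)
    show "(V has_derivative (\<lambda>h. gV p \<bullet> h)) (at p)" if "p \<in> U" for p
      unfolding V_def[abs_def] gV_def
      by (rule has_derivative_eq_rhs[OF has_derivative_mult[OF de df(1)[OF that]]])
        (auto simp: fun_eq_iff inner_prod_def)
    show "(gV has_derivative HV p) (at p)" if "p \<in> U" for p
      unfolding gV_def[abs_def]
      by (rule has_derivative_eq_rhs[OF has_derivative_Pair[OF has_derivative_scaleR[OF de df(2)[OF that]]
            has_derivative_mult[OF has_derivative_mult_right[OF de] df(1)[OF that]]]])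
        (auto simp: fun_eq_iff HV_def power2_eq_square)
    show "continuous_on U (\<lambda>p. HV p b)" if "b \<in> Basis" for b
    proof -
      have cfs: "continuous_on U (\<lambda>p. v (fst p))" "continuous_on U (\<lambda>p. g (fst p))"
        by (rule continuous_on_compose2[OF cv continuous_on_fst[OF continuous_on_id]], auto simp: U_def)
          (rule continuous_on_compose2[OF cg continuous_on_fst[OF continuous_on_id]], auto)
      have "continuous_on U (\<lambda>p. H (fst p) (fst b))"
      proof (cases "fst b = 0")
        case True
        have "H (fst p) (fst b) = 0" if "p \<in> U" for p
          using linear_0[OF lin[of "fst p"]] that True by (auto simp: U_def)
        then show ?thesis using continuous_on_cong[of U U "\<lambda>p. H (fst p) (fst b)" "\<lambda>_. 0"] by simp
      next
        case False
        then have "fst b \<in> Basis" using that by (auto simp: Basis_prod_def)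
        show ?thesis
          by (rule continuous_on_compose2[OF cH[OF \<open>fst b \<in> Basis\<close>] continuous_on_fst[OF continuous_on_id]]) (auto simp: U_def)
      qed
      then show ?thesis unfolding HV_def by (intro continuous_intros cfs)
    qed
    show "(\<Sum>b\<in>Basis. HV p b \<bullet> b) = 0" if "p \<in> U" for p
    proof -
      have p: "fst p \<in> D" using that by (auto simp: U_def)
      have H0: "H (fst p) 0 = 0" using linear_0[OF lin[OF p]] .
      \<comment> \<open>The spatial directions contribute -k^2 times the function, the added
        direction +k^2 times it.\<close>
      have "(\<Sum>b\<in>Basis. HV p b \<bullet> b) = (\<Sum>b\<in>Basis. HV p (b, 0) \<bullet> (b, 0)) + (\<Sum>b\<in>Basis. HV p (0, b) \<bullet> (0, b))"
        unfolding Basis_prod_def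
        by (subst sum.union_disjoint) (auto simp: sum.reindex inj_on_def)
      also have "\<dots> = exp (k * snd p) * (\<Sum>b\<in>Basis. H (fst p) b \<bullet> b) + k\<^sup>2 * exp (k * snd p) * v (fst p)"
        by (simp add: HV_def inner_prod_def sum_distrib_left)
      also have "\<dots> = 0" using lap[OF p] by simp
      finally show ?thesis .
    qed
  qed
  have dim: "real DIM((real^3) \<times> real) = 4" by simp
  have sub': "cball (x0, 0) (2 * \<epsilon> * real DIM((real^3) \<times> real)) \<subseteq> U"
  proof
    fix p assume "p \<in> cball (x0, 0::real) (2 * \<epsilon> * real DIM((real^3) \<times> real))"
    then have "dist (x0, 0) p \<le> 8 * \<epsilon>" by simp
    then have "dist x0 (fst p) \<le> 8 * \<epsilon>" using dist_fst_le[of "(x0, 0)" p] by simp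
    then show "p \<in> U" using sub by (cases p) (auto simp: U_def)
  qed
  from third_derivatives(1)[OF sub' \<epsilon>] obtain T where T0: "\<forall>X\<in>ball (x0, 0) \<epsilon>. \<forall>a b. ((\<lambda>X. HV X a \<bullet> b) has_derivative T X a b) (at X) \<and> HV X a \<bullet> b = HV X b \<bullet> a \<and>
      (\<forall>c. continuous_on (ball (x0, 0) \<epsilon>) (\<lambda>X. T X a b c) \<and> T X a b c = T X b a c \<and> T X a b c = T X a c b)"
    by (rule exE)
  have T: "((\<lambda>X. HV X a \<bullet> b) has_derivative T X a b) (at X) \<and> HV X a \<bullet> b = HV X b \<bullet> a \<and>
      continuous_on (ball (x0, 0) \<epsilon>) (\<lambda>X. T X a b c) \<and> T X a b c = T X b a c \<and> T X a b c = T X a c b"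
    if X: "X \<in> ball (x0, 0) \<epsilon>" for X a b c
  proof -
    note * = bspec[OF T0 X, THEN spec, of a, THEN spec, of b]
    show ?thesis
      by (rule conjI[OF conjunct1[OF *] conjI[OF conjunct1[OF conjunct2[OF *]] spec[OF conjunct2[OF conjunct2[OF *]], of c]]])
  qed
  have HV0: "HV (x, 0) (a, 0) \<bullet> (b, 0) = H x a \<bullet> b" for x a b by (simp add: HV_def inner_prod_def)
  have inb: "(x, 0) \<in> ball (x0, 0) \<epsilon>" if "x \<in> ball x0 \<epsilon>" for x using that by (simp add: dist_Pair_Pair)
  have m1: "((\<lambda>x. H x a \<bullet> b) has_derivative (\<lambda>c. T (x, 0) (a, 0) (b, 0) (c, 0))) (at x)" if "x \<in> ball x0 \<epsilon>" for x a b
  proof -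
    have "((\<lambda>x::real^3. (x, 0::real)) has_derivative (\<lambda>c. (c, 0))) (at x)" by (auto intro!: derivative_eq_intros)
    from has_derivative_compose[OF this conjunct1[OF T[OF inb[OF that], of "(a, 0)" "(b, 0)"]]]
    have "((\<lambda>x. HV (x, 0) (a, 0) \<bullet> (b, 0)) has_derivative (\<lambda>c. T (x, 0) (a, 0) (b, 0) (c, 0))) (at x)" .
    then show ?thesis unfolding HV0 .
  qed
  have m2: "continuous_on (ball x0 \<epsilon>) (\<lambda>x. T (x, 0) (a, 0) (b, 0) (c, 0))" for a b c
  proof -
    have "continuous_on (ball (x0, 0) \<epsilon>) (\<lambda>X. T X (a, 0) (b, 0) (c, 0))"
      using T[of "(x0, 0)" "(a, 0)" "(b, 0)" "(c, 0)"] \<epsilon> by simp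
    then show ?thesis by (rule continuous_on_compose2) (use inb in \<open>auto intro!: continuous_intros\<close>)
  qed
  have m3: "H x a \<bullet> b = H x b \<bullet> a" if "x \<in> ball x0 \<epsilon>" for x a b
    using T[OF inb[OF that], of "(a, 0)" "(b, 0)"] unfolding HV0 by simp
  have m4: "T (x, 0) (a, 0) (b, 0) (c, 0) = T (x, 0) (b, 0) (a, 0) (c, 0) \<and> T (x, 0) (a, 0) (b, 0) (c, 0) = T (x, 0) (a, 0) (c, 0) (b, 0)"
    if "x \<in> ball x0 \<epsilon>" for x a b c
    using T[OF inb[OF that], of "(a, 0)" "(b, 0)" "(c, 0)"] by simp
  show "\<exists>T. \<forall>x\<in>ball x0 \<epsilon>. \<forall>a b. ((\<lambda>x. H x a \<bullet> b) has_derivative T x a b) (at x) \<and> H x a \<bullet> b = H x b \<bullet> a \<and>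
      (\<forall>c. continuous_on (ball x0 \<epsilon>) (\<lambda>x. T x a b c) \<and> T x a b c = T x b a c \<and> T x a b c = T x a c b)"
    by (intro exI[of _ "\<lambda>x a b c. T (x, 0) (a, 0) (b, 0) (c, 0)"] ballI allI conjI) (use m1 m2 m3 m4 in blast)+
  assume e1: "\<epsilon> \<le> 1" and B: "\<And>x. x \<in> cball x0 \<epsilon> \<Longrightarrow> \<bar>v x\<bar> \<le> B"
  have "\<bar>V X\<bar> \<le> exp \<bar>k\<bar> * B" if "X \<in> cball (x0, 0) \<epsilon>" for X
  proof -
    have "dist x0 (fst X) \<le> \<epsilon>" "dist 0 (snd X) \<le> \<epsilon>"
      using that dist_fst_le[of "(x0, 0)" X] dist_snd_le[of "(x0, 0)" X] by auto
    then have "\<bar>v (fst X)\<bar> \<le> B" "\<bar>snd X\<bar> \<le> 1" using B e1 by auto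
    moreover have "k * snd X \<le> \<bar>k\<bar>"
      using \<open>\<bar>snd X\<bar> \<le> 1\<close> mult_left_mono[of "\<bar>snd X\<bar>" 1 "\<bar>k\<bar>"] abs_ge_self[of "k * snd X"] by (simp add: abs_mult)
    ultimately have "exp (k * snd X) * \<bar>v (fst X)\<bar> \<le> exp \<bar>k\<bar> * B" by (intro mult_mono) auto
    then show ?thesis by (simp add: V_def abs_mult)
  qed
  from third_derivatives(2)[OF sub' \<epsilon> this, of "(a, 0)" "(b, 0)"]
  show "\<bar>H x0 a \<bullet> b\<bar> \<le> helm_const k * B / \<epsilon>\<^sup>2 * norm a * norm b"
    unfolding HV0 helm_const_def by (simp add: norm_Pair mult.assoc mult.commute)
qed

section \<open>Geometry of the boundary\<close>

text \<open>Separated from \<open>N\<close> so that a single chart, through its normalised gradient,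
  supplies a normal at every boundary point near its centre.\<close>

definition chart :: "(real^3) set \<Rightarrow> real^3 \<Rightarrow> real \<Rightarrow> (real^3 \<Rightarrow> real) \<Rightarrow> (real^3 \<Rightarrow> real^3) \<Rightarrow> bool" where
  "chart D s r phi g \<longleftrightarrow> r > 0 \<and> (\<forall>x\<in>ball s r. (phi has_derivative (\<lambda>h. g x \<bullet> h)) (at x)) \<and>
     continuous_on (ball s r) g \<and> g s \<noteq> 0 \<and> D \<inter> ball s r = {x \<in> ball s r. phi x < 0}"

lemma C1_boundary_chart:
  assumes "C1_boundary_outward_normal D N" "s \<in> frontier D"
  obtains r phi g where "chart D s r phi g" "N s = (1 / norm (g s)) *\<^sub>R g s"
proof -
  from assms have "\<exists>r>0. \<exists>(phi::real^3 \<Rightarrow> real) (g::real^3 \<Rightarrow> real^3).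
        (\<forall>x\<in>ball s r. (phi has_derivative (\<lambda>h. g x \<bullet> h)) (at x)) \<and>
        continuous_on (ball s r) g \<and> g s \<noteq> 0 \<and>
        D \<inter> ball s r = {x \<in> ball s r. phi x < 0} \<and>
        N s = (1 / norm (g s)) *\<^sub>R g s"
    unfolding C1_boundary_outward_normal_def by (rule bspec)
  then show ?thesis by (elim exE conjE) (rule that, auto simp: chart_def)
qed

text \<open>A positive value would persist nearby by continuity, but points of \<open>D\<close>,
  where \<open>phi\<close> is negative, accumulate at \<open>x\<close>.\<close>

lemma chart_frontier:
  assumes ch: "chart D s r phi g" and oD: "open D" and x: "x \<in> frontier D" "x \<in> ball s r"
  shows "phi x = 0"
proof -
  have c: "isCont phi x" using ch x has_derivative_continuous unfolding chart_def by blast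
  have Dphi: "y \<in> D \<longleftrightarrow> phi y < 0" if "y \<in> ball s r" for y using ch that unfolding chart_def by blast
  have "x \<notin> D" using x oD by (simp add: frontier_def interior_open)
  then have 1: "phi x \<ge> 0" using Dphi x(2) by force
  have "phi x \<le> 0"
  proof (rule ccontr)
    assume p: "\<not> phi x \<le> 0"
    from c[unfolded continuous_at_eps_delta, rule_format, of "phi x"] p
    obtain \<delta> where \<delta>: "\<delta> > 0" "\<And>y. dist y x < \<delta> \<Longrightarrow> dist (phi y) (phi x) < phi x" by auto
    have "x \<in> closure D" using x by (simp add: frontier_def)
    moreover have "min \<delta> (r - dist s x) > 0" using \<delta> x by simp
    ultimately obtain y where y: "y \<in> D" "dist y x < min \<delta> (r - dist s x)"
      unfolding closure_approachable by blast
    then have "y \<in> ball s r" using dist_triangle[of s y x] by (simp add: dist_commute)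
    then have "phi y < 0" using Dphi y by simp
    moreover have "dist (phi y) (phi x) < phi x" using \<delta> y by simp
    ultimately show False using p by (simp add: dist_real_def)
  qed
  then show ?thesis using 1 by simp
qed

lemma chart_ray:
  assumes ch: "chart D s r phi g" and oD: "open D" and s: "s \<in> frontier D"
  shows "g s \<bullet> v < 0 \<Longrightarrow> \<exists>T>0. \<forall>t. 0 < t \<and> t < T \<longrightarrow> s + t *\<^sub>R v \<in> D"
    and "g s \<bullet> v > 0 \<Longrightarrow> \<exists>T>0. \<forall>t. 0 < t \<and> t < T \<longrightarrow> s + t *\<^sub>R v \<notin> D"
proof -
  have r: "r > 0" using ch by (simp add: chart_def)
  have p0: "phi s = 0" using chart_frontier[OF ch oD s] r by simp
  have d: "((\<lambda>t. phi (s + t *\<^sub>R v)) has_real_derivative g s \<bullet> v) (at 0)"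
    by (rule has_derivative_imp_directional) (use ch r in \<open>auto simp: chart_def\<close>)
  define T0 where "T0 = r / (norm v + 1)"
  have T0: "T0 > 0" using r by (simp add: T0_def add_nonneg_pos)
  have inb: "s + t *\<^sub>R v \<in> ball s r" if "0 < t" "t < T0" for t
  proof -
    have "t * norm v \<le> t * (norm v + 1)" using that by simp
    also have "\<dots> < T0 * (norm v + 1)" using that by (intro mult_strict_right_mono) (auto simp: add_nonneg_pos)
    also have "\<dots> = r" by (simp add: T0_def add_nonneg_eq_0_iff)
    finally show ?thesis using that by (simp add: dist_norm)
  qed
  have D: "s + t *\<^sub>R v \<in> D \<longleftrightarrow> phi (s + t *\<^sub>R v) < 0" if "0 < t" "t < T0" for t
    using ch inb[OF that] unfolding chart_def by blast
  show "\<exists>T>0. \<forall>t. 0 < t \<and> t < T \<longrightarrow> s + t *\<^sub>R v \<in> D" if sg: "g s \<bullet> v < 0"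
  proof -
    obtain T where "T > 0" "\<And>h. 0 < h \<Longrightarrow> h < T \<Longrightarrow> phi (s + (0 + h) *\<^sub>R v) < phi (s + 0 *\<^sub>R v)"
      using DERIV_neg_dec_right[OF d sg] by blast
    then show ?thesis using T0 D p0 by (intro exI[of _ "min T T0"]) auto
  qed
  show "\<exists>T>0. \<forall>t. 0 < t \<and> t < T \<longrightarrow> s + t *\<^sub>R v \<notin> D" if sg: "g s \<bullet> v > 0"
  proof -
    obtain T where "T > 0" "\<And>h. 0 < h \<Longrightarrow> h < T \<Longrightarrow> phi (s + (0 + h) *\<^sub>R v) > phi (s + 0 *\<^sub>R v)"
      using DERIV_pos_inc_right[OF d sg] by blast
    then show ?thesis using T0 D p0 by (intro exI[of _ "min T T0"]) force
  qed
qed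

text \<open>The direction \<open>w\<close> may vary with t as long as it stays bounded and
  \<open>L w\<close> is fixed; this is needed when the points of the set are found by a crossing
  argument and not along one ray.\<close>

lemma has_derivative_within_ray_bound:
  fixes f :: "'a::real_normed_vector \<Rightarrow> real"
  assumes d: "(f has_derivative L) (at s within S)" and C: "C > 0"
    and seq: "\<And>e. e > 0 \<Longrightarrow> \<exists>t w. 0 < t \<and> t < e \<and> norm w \<le> C \<and> s + t *\<^sub>R w \<in> S \<and> f (s + t *\<^sub>R w) = f s \<and> L w = l"
  shows "l = 0"
proof (rule ccontr)
  assume l: "l \<noteq> 0"
  define e where "e = \<bar>l\<bar> / (2 * C)"
  have e: "e > 0" using l C by (simp add: e_def)
  obtain \<delta> where \<delta>: "\<delta> > 0" "\<And>y. y \<in> S \<Longrightarrow> norm (y - s) < \<delta> \<Longrightarrow> norm (f y - f s - L (y - s)) \<le> e * norm (y - s)"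
    using d e unfolding has_derivative_within_alt by meson
  have lin: "linear L" using d has_derivative_linear by blast
  obtain t w where tw: "0 < t" "t < \<delta> / C" "norm w \<le> C" "s + t *\<^sub>R w \<in> S" "f (s + t *\<^sub>R w) = f s" "L w = l"
    using seq[of "\<delta> / C"] \<delta>(1) C by auto
  have "t * norm w \<le> t * C" using tw by simp
  moreover have "t * C < \<delta>" using tw C by (simp add: field_simps)
  moreover have "norm (t *\<^sub>R w) = t * norm w" using tw by simp
  ultimately have "norm (t *\<^sub>R w) < \<delta>" by linarith
  then have "\<bar>L (t *\<^sub>R w)\<bar> \<le> e * norm (t *\<^sub>R w)" using \<delta>(2)[OF tw(4)] tw(5) by simp
  then have "t * \<bar>l\<bar> \<le> t * (e * norm w)" using tw by (simp add: linear_cmul[OF lin] abs_mult)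
  then have "\<bar>l\<bar> \<le> e * norm w" using tw by simp
  also have "\<dots> \<le> e * C" using tw e by simp
  also have "\<dots> = \<bar>l\<bar> / 2" using C by (simp add: e_def)
  finally show False using l by simp
qed

text \<open>Two derivatives agree on directions that point into \<open>D\<close>, and every vector
  is a difference of two such directions. This gives \<open>normal_deriv\<close>, which is based on
  a chosen derivative, a definite value on the boundary.\<close>

lemma chart_derivative_unique:
  fixes f :: "real^3 \<Rightarrow> real"
  assumes ch: "chart D s r phi g" and oD: "open D" and s: "s \<in> frontier D"
    and A: "(f has_derivative A) (at s within closure D)" and B: "(f has_derivative B) (at s within closure D)"
  shows "A = B"
proof
  fix h
  have z: "((\<lambda>_. 0) has_derivative (\<lambda>h. A h - B h)) (at s within closure D)"
    using has_derivative_diff[OF A B] by simp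
  have AB: "A v - B v = 0" if v: "g s \<bullet> v < 0" for v
  proof (rule has_derivative_within_ray_bound[OF z, of "norm v + 1"])
    show "norm v + 1 > 0" by (simp add: add_nonneg_pos)
    fix e :: real assume e: "e > 0"
    obtain T where T: "T > 0" "\<And>t. 0 < t \<Longrightarrow> t < T \<Longrightarrow> s + t *\<^sub>R v \<in> D" using chart_ray(1)[OF ch oD s v] by blast
    have "s + (min e T / 2) *\<^sub>R v \<in> closure D" using T e closure_subset[of D] by (auto simp: min_def)
    then show "\<exists>t w. 0 < t \<and> t < e \<and> norm w \<le> norm v + 1 \<and> s + t *\<^sub>R w \<in> closure D \<and> 0 = 0 \<and> A w - B w = A v - B v"
      using e T(1) by (intro exI[of _ "min e T / 2"] exI[of _ v]) auto
  qed
  have g0: "g s \<bullet> g s > 0" using ch by (simp add: chart_def)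
  \<comment> \<open>Large enough that both h - m g and -m g point into \<open>D\<close>.\<close>
  define m where "m = (\<bar>g s \<bullet> h\<bar> + 1) / (g s \<bullet> g s)"
  have m: "m * (g s \<bullet> g s) = \<bar>g s \<bullet> h\<bar> + 1" using g0 by (simp add: m_def)
  have "g s \<bullet> (h - m *\<^sub>R g s) < 0" "g s \<bullet> (- (m *\<^sub>R g s)) < 0"
    using m abs_ge_self[of "g s \<bullet> h"] by (auto simp: inner_diff_right)
  from AB[OF this(1)] AB[OF this(2)] show "A h = B h"
    using has_derivative_linear[OF A] has_derivative_linear[OF B]
    by (simp add: linear_diff linear_neg)
qed

text \<open>If \<open>a\<close> is tangential, a short segment from s + t (a - g) inside
  \<open>D\<close> to s + t (a + g) outside meets the boundary at s + t w with a . w = a . a. There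
  f is 0 as at \<open>s\<close>, so |a|^2 must be 0.\<close>

lemma chart_gradient_eq_0:
  fixes f :: "real^3 \<Rightarrow> real"
  assumes ch: "chart D s r phi g" and oD: "open D" and s: "s \<in> frontier D"
    and d: "(f has_derivative (\<lambda>h. a \<bullet> h)) (at s within closure D)"
    and f0: "\<And>x. x \<in> frontier D \<Longrightarrow> f x = 0" and n: "a \<bullet> g s = 0"
  shows "a = 0"
proof -
  have g0: "g s \<bullet> g s > 0" using ch by (simp add: chart_def)
  have "a \<bullet> a = 0"
  proof (rule has_derivative_within_ray_bound[OF d, of "norm a + norm (g s) + 1"])
    show "norm a + norm (g s) + 1 > 0" by (simp add: add_nonneg_pos)
    fix e :: real assume e: "e > 0"
    have "g s \<bullet> (a - g s) < 0" "g s \<bullet> (a + g s) > 0" using n g0 by (auto simp: inner_diff_right inner_add_right inner_commute)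
    then obtain T1 T2 where T: "T1 > 0" "\<And>t. 0 < t \<Longrightarrow> t < T1 \<Longrightarrow> s + t *\<^sub>R (a - g s) \<in> D"
      "T2 > 0" "\<And>t. 0 < t \<Longrightarrow> t < T2 \<Longrightarrow> s + t *\<^sub>R (a + g s) \<notin> D"
      using chart_ray[OF ch oD s] by metis
    define t where "t = min e (min T1 T2) / 2"
    have t: "0 < t" "t < e" "t < T1" "t < T2" using e T by (auto simp: t_def)
    let ?S = "closed_segment (s + t *\<^sub>R (a - g s)) (s + t *\<^sub>R (a + g s))"
    have "?S \<inter> frontier D \<noteq> {}"
    proof (rule connected_Int_frontier)
      show "connected ?S" by simp
      show "?S \<inter> D \<noteq> {}" using T(2)[OF t(1) t(3)] by auto
      show "?S - D \<noteq> {}" using T(4)[OF t(1) t(4)] by auto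
    qed
    then obtain z where z: "z \<in> frontier D" "z \<in> ?S" by blast
    then obtain m where m: "0 \<le> m" "m \<le> 1" "z = (1 - m) *\<^sub>R (s + t *\<^sub>R (a - g s)) + m *\<^sub>R (s + t *\<^sub>R (a + g s))"
      by (auto simp: in_segment)
    define w where "w = a + (2 * m - 1) *\<^sub>R g s"
    have zw: "z = s + t *\<^sub>R w" unfolding m(3) w_def by (simp add: vec_eq_iff algebra_simps)
    have "norm w \<le> norm a + norm ((2 * m - 1) *\<^sub>R g s)" unfolding w_def by (rule norm_triangle_ineq)
    moreover have "norm ((2 * m - 1) *\<^sub>R g s) \<le> norm (g s)" using m by (simp add: mult_left_le_one_le abs_le_iff)
    ultimately have nw: "norm w \<le> norm a + norm (g s) + 1" by linarith
    have "a \<bullet> w = a \<bullet> a" using n by (simp add: w_def inner_add_right)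
    then show "\<exists>t w. 0 < t \<and> t < e \<and> norm w \<le> norm a + norm (g s) + 1 \<and> s + t *\<^sub>R w \<in> closure D \<and> f (s + t *\<^sub>R w) = f s \<and> a \<bullet> w = a \<bullet> a"
      using t nw z f0[OF z(1)] f0[OF s] unfolding zw
      by (intro exI[of _ t] exI[of _ w]) (auto simp: frontier_def)
  qed
  then show ?thesis by simp
qed

lemma normalize_diff_le:
  fixes a b :: "'a::real_normed_vector"
  assumes "b \<noteq> 0"
  shows "norm ((1 / norm a) *\<^sub>R a - (1 / norm b) *\<^sub>R b) \<le> 2 * norm (a - b) / norm b"
proof (cases "a = 0")
  case True
  then show ?thesis using assms by simp
next
  case False
  have "(1 / norm a) *\<^sub>R a - (1 / norm b) *\<^sub>R b = (1 / norm b) *\<^sub>R (a - b) + (1 / norm a - 1 / norm b) *\<^sub>R a"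
    by (simp add: algebra_simps)
  then have "norm ((1 / norm a) *\<^sub>R a - (1 / norm b) *\<^sub>R b) \<le> norm ((1 / norm b) *\<^sub>R (a - b)) + norm ((1 / norm a - 1 / norm b) *\<^sub>R a)"
    by (metis norm_triangle_ineq)
  also have "norm ((1 / norm a - 1 / norm b) *\<^sub>R a) = \<bar>norm b - norm a\<bar> / norm b"
    using False assms by (simp add: abs_if field_simps)
  also have "\<dots> \<le> norm (a - b) / norm b"
    using norm_triangle_ineq3[of b a] by (intro divide_right_mono) (auto simp: norm_minus_commute)
  finally show ?thesis by simp
qed

text \<open>The point is the uniformity: one radius \<open>\<rho>\<close> serves all boundary points \<open>s\<close> near \<open>s0\<close>.\<close>

lemma chart_thin:
  assumes ch: "chart D s0 r phi g" and oD: "open D" and \<omega>: "0 < \<omega>" "\<omega> \<le> 1"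
  obtains \<rho> where "\<rho> > 0" "\<rho> \<le> r"
    "\<And>x. x \<in> ball s0 \<rho> \<Longrightarrow> g x \<bullet> ((1 / norm (g s0)) *\<^sub>R g s0) \<ge> norm (g s0) / 2"
    "\<And>x. x \<in> ball s0 \<rho> \<Longrightarrow> g x \<noteq> 0"
    "\<And>x. x \<in> ball s0 \<rho> \<Longrightarrow> norm ((1 / norm (g x)) *\<^sub>R g x - (1 / norm (g s0)) *\<^sub>R g s0) \<le> \<omega>"
    "\<And>s y. s \<in> frontier D \<Longrightarrow> s \<in> ball s0 \<rho> \<Longrightarrow> y \<in> ball s0 \<rho> \<Longrightarrow>
       (y \<in> D \<and> ((1 / norm (g s)) *\<^sub>R g s) \<bullet> (y - s) \<ge> 0) \<or> (y \<notin> D \<and> ((1 / norm (g s)) *\<^sub>R g s) \<bullet> (y - s) \<le> 0) \<or> y \<in> frontier D \<Longrightarrow>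
       \<bar>((1 / norm (g s)) *\<^sub>R g s) \<bullet> (y - s)\<bar> \<le> \<omega> * norm (y - s)"
proof -
  have r: "r > 0" and g0: "g s0 \<noteq> 0" and cg: "continuous_on (ball s0 r) g" 
    and dphi: "\<And>x. x \<in> ball s0 r \<Longrightarrow> (phi has_derivative (\<lambda>h. g x \<bullet> h)) (at x)"
    and Dphi: "D \<inter> ball s0 r = {x \<in> ball s0 r. phi x < 0}" using ch by (auto simp: chart_def)
  define m where "m = norm (g s0)"
  have m: "m > 0" using g0 by (simp add: m_def)
  \<comment> \<open>The gradient varies by at most 2 epsilon near \<open>s0\<close> while its length
    stays above m/2; the quotient is omega/2.\<close>
  define \<epsilon> where "\<epsilon> = \<omega> * m / 8"
  have \<epsilon>: "\<epsilon> > 0" "\<epsilon> \<le> m / 8" using \<omega> m by (auto simp: \<epsilon>_def)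
  have "isCont g s0" using cg r by (simp add: continuous_on_eq_continuous_at)
  then obtain \<delta> where \<delta>: "\<delta> > 0" "\<And>x. dist x s0 < \<delta> \<Longrightarrow> dist (g x) (g s0) < \<epsilon>"
    using \<epsilon>(1) unfolding continuous_at_eps_delta by blast
  define \<rho> where "\<rho> = min \<delta> r"
  have \<rho>: "\<rho> > 0" "\<rho> \<le> r" using \<delta> r by (auto simp: \<rho>_def)
  have gd: "norm (g x - g s0) \<le> \<epsilon>" if "x \<in> ball s0 \<rho>" for x
    using \<delta>(2)[of x] that by (simp add: \<rho>_def dist_norm norm_minus_commute less_imp_le)
  have gn: "norm (g x) \<ge> m / 2" if "x \<in> ball s0 \<rho>" for x
    using norm_triangle_ineq2[of "g s0" "g s0 - g x"] gd[OF that] \<epsilon> by (simp add: m_def norm_minus_commute)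
  show ?thesis
  proof (rule that[OF \<rho>])
    fix x assume x: "x \<in> ball s0 \<rho>"
    have "g x \<bullet> ((1 / m) *\<^sub>R g s0) = (g x - g s0) \<bullet> ((1 / m) *\<^sub>R g s0) + g s0 \<bullet> ((1 / m) *\<^sub>R g s0)"
      by (simp add: inner_diff_left diff_divide_distrib)
    moreover have n1: "norm ((1 / m) *\<^sub>R g s0) = 1" using m by (simp add: m_def)
    have "\<bar>(g x - g s0) \<bullet> ((1 / m) *\<^sub>R g s0)\<bar> \<le> norm (g x - g s0)"
      using Cauchy_Schwarz_ineq2[of "g x - g s0" "(1 / m) *\<^sub>R g s0"] unfolding n1 by simp
    moreover have "g s0 \<bullet> ((1 / m) *\<^sub>R g s0) = m" using m by (simp add: m_def dot_square_norm power2_eq_square)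
    ultimately show "g x \<bullet> ((1 / norm (g s0)) *\<^sub>R g s0) \<ge> norm (g s0) / 2"
      using gd[OF x] \<epsilon> m unfolding m_def[symmetric] by linarith
    show "g x \<noteq> 0" using gn[OF x] m by auto
    have "norm ((1 / norm (g x)) *\<^sub>R g x - (1 / norm (g s0)) *\<^sub>R g s0) \<le> 2 * norm (g x - g s0) / norm (g s0)"
      by (rule normalize_diff_le[OF g0])
    also have "\<dots> \<le> 2 * \<epsilon> / m" unfolding m_def[symmetric] using gd[OF x] m by (intro divide_right_mono) auto
    also have "\<dots> \<le> \<omega>" using m \<omega> by (simp add: \<epsilon>_def)
    finally show "norm ((1 / norm (g x)) *\<^sub>R g x - (1 / norm (g s0)) *\<^sub>R g s0) \<le> \<omega>" .
  next
    fix s y assume s: "s \<in> frontier D" "s \<in> ball s0 \<rho>" and y: "y \<in> ball s0 \<rho>"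
      and c: "(y \<in> D \<and> ((1 / norm (g s)) *\<^sub>R g s) \<bullet> (y - s) \<ge> 0) \<or> (y \<notin> D \<and> ((1 / norm (g s)) *\<^sub>R g s) \<bullet> (y - s) \<le> 0) \<or> y \<in> frontier D"
    have sb: "s \<in> ball s0 r" "y \<in> ball s0 r" using s y \<rho> by auto
    have ps: "phi s = 0" by (rule chart_frontier[OF ch oD s(1) sb(1)])
    \<comment> \<open>Subtracting the linear part at the moving point \<open>s\<close>, not at
      \<open>s0\<close>, gives an error proportional to |y - s| with the same constant for all
      \<open>s\<close>.\<close>
    have "norm ((\<lambda>z. phi z - g s \<bullet> z) y - (\<lambda>z. phi z - g s \<bullet> z) s) \<le> (2 * \<epsilon>) * norm (y - s)"
    proof (rule differentiable_bound[where S = "ball s0 \<rho>" and f' = "\<lambda>z k. (g z - g s) \<bullet> k"])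
      fix z assume z: "z \<in> ball s0 \<rho>"
      then have zr: "z \<in> ball s0 r" using \<rho> by auto
      show "((\<lambda>z. phi z - g s \<bullet> z) has_derivative (\<lambda>k. (g z - g s) \<bullet> k)) (at z within ball s0 \<rho>)"
        by (auto intro!: derivative_eq_intros has_derivative_at_withinI[OF dphi[OF zr]] simp: inner_diff_left)
      show "onorm (\<lambda>k. (g z - g s) \<bullet> k) \<le> 2 * \<epsilon>"
      proof (rule onorm_le)
        fix k :: "real^3"
        have "norm (g z - g s) \<le> norm (g z - g s0) + norm (g s - g s0)"
          using norm_triangle_ineq4[of "g z - g s0" "g s - g s0"] by simp
        then have "norm (g z - g s) \<le> 2 * \<epsilon>" using gd[OF z] gd[OF s(2)] by simp
        then have "norm (g z - g s) * norm k \<le> 2 * \<epsilon> * norm k" by (intro mult_right_mono) auto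
        moreover have "norm ((g z - g s) \<bullet> k) \<le> norm (g z - g s) * norm k" by (simp add: Cauchy_Schwarz_ineq2)
        ultimately show "norm ((g z - g s) \<bullet> k) \<le> 2 * \<epsilon> * norm k" by linarith
      qed
    qed (use y s in auto)
    then have ap: "\<bar>phi y - g s \<bullet> (y - s)\<bar> \<le> 2 * \<epsilon> * norm (y - s)"
      using ps by (simp add: inner_diff_right algebra_simps)
    define q where "q = g s \<bullet> (y - s)"
    have gs: "norm (g s) \<ge> m / 2" "norm (g s) > 0" using gn[OF s(2)] m by auto
    have nq: "((1 / norm (g s)) *\<^sub>R g s) \<bullet> (y - s) = q / norm (g s)" by (simp add: q_def)
    \<comment> \<open>Whenever \<open>phi\<close> and its linear part disagree in sign, the linear
      part is no larger than the linearisation error. Points of the boundary count through phi =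
      0.\<close>
    have "(phi y < 0 \<and> q \<ge> 0) \<or> (phi y \<ge> 0 \<and> q \<le> 0) \<or> phi y = 0"
    proof -
      have yD: "y \<in> D \<longleftrightarrow> phi y < 0" using Dphi sb(2) by blast
      have "q / norm (g s) \<ge> 0 \<longleftrightarrow> q \<ge> 0" "q / norm (g s) \<le> 0 \<longleftrightarrow> q \<le> 0"
        using gs(2) by (simp_all add: zero_le_divide_iff divide_le_0_iff)
      then show ?thesis using c chart_frontier[OF ch oD _ sb(2)] unfolding nq yD not_less by blast
    qed
    then have "\<bar>q\<bar> \<le> 2 * \<epsilon> * norm (y - s)" using ap unfolding q_def[symmetric] by linarith
    then have "\<bar>q\<bar> / norm (g s) \<le> 2 * \<epsilon> * norm (y - s) / (m / 2)"
      using gs m \<epsilon> by (intro frac_le) auto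
    also have "\<dots> \<le> \<omega> * norm (y - s)" using m \<omega> by (simp add: \<epsilon>_def mult_right_mono)
    finally show "\<bar>((1 / norm (g s)) *\<^sub>R g s) \<bullet> (y - s)\<bar> \<le> \<omega> * norm (y - s)"
      unfolding nq using gs by simp
  qed
qed

section \<open>Second derivatives at the boundary\<close>

text \<open>The solution of the overdetermined problem in the half-space \<open>n \<bullet> (y - s) < 0\<close>, extended by \<open>0\<close>.\<close>

definition half_sol :: "real \<Rightarrow> real \<Rightarrow> real^3 \<Rightarrow> real^3 \<Rightarrow> real^3 \<Rightarrow> real" where
  "half_sol c k n s y = c / k\<^sup>2 * (1 - cos (k * min 0 (n \<bullet> (y - s))))"

definition half_sol_grad :: "real \<Rightarrow> real \<Rightarrow> real^3 \<Rightarrow> real^3 \<Rightarrow> real^3 \<Rightarrow> real^3" where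
  "half_sol_grad c k n s y = (c / k * sin (k * min 0 (n \<bullet> (y - s)))) *\<^sub>R n"

text \<open>The profile 1 - cos (k t) vanishes to second order at 0, so cutting it off for t > 0
  keeps it C^1. At t = 0 the quotient is dominated by that of the uncut profile.\<close>

lemma DERIV_half_line_profile:
  fixes c k :: real
  assumes k: "k > 0"
  shows "((\<lambda>t. c / k\<^sup>2 * (1 - cos (k * min 0 t))) has_real_derivative c / k * sin (k * min 0 t)) (at t)"
proof -
  have p: "((\<lambda>t. c / k\<^sup>2 * (1 - cos (k * t))) has_real_derivative c / k * sin (k * t)) (at t)" for t
    using k by (auto intro!: derivative_eq_intros simp: power2_eq_square)
  consider "t < 0" | "t > 0" | "t = 0" by linarith
  then show ?thesis
  proof cases
    case 1
    have "((\<lambda>t. c / k\<^sup>2 * (1 - cos (k * min 0 t))) has_real_derivative c / k * sin (k * t)) (at t)"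
      by (rule has_field_derivative_transform_within_open[OF p, where S = "{..<0}"]) (use 1 in auto)
    then show ?thesis using 1 by simp
  next
    case 2
    have "((\<lambda>t. c / k\<^sup>2 * (1 - cos (k * min 0 t))) has_real_derivative 0) (at t)"
      by (rule has_field_derivative_transform_within_open[of "\<lambda>_. 0" _ _ "{0<..}"]) (use 2 in auto)
    then show ?thesis using 2 by simp
  next
    case 3
    have "((\<lambda>h. c / k\<^sup>2 * (1 - cos (k * h)) / h) \<longlongrightarrow> 0) (at 0)"
      using p[of 0] by (simp add: DERIV_def)
    then have lim: "((\<lambda>h. \<bar>c / k\<^sup>2 * (1 - cos (k * h)) / h\<bar>) \<longlongrightarrow> 0) (at 0)" by (rule tendsto_rabs_zero)
    have "norm (c / k\<^sup>2 * (1 - cos (k * min 0 h)) / h) \<le> \<bar>c / k\<^sup>2 * (1 - cos (k * h)) / h\<bar>" for h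
      by (cases "h < 0") (auto simp: min_def)
    then have "((\<lambda>h. c / k\<^sup>2 * (1 - cos (k * min 0 h)) / h) \<longlongrightarrow> 0) (at 0)"
      by (intro Lim_null_comparison[OF always_eventually lim]) auto
    then show ?thesis using 3 by (simp add: DERIV_def)
  qed
qed

lemma half_sol_has_derivative:
  assumes "k > 0"
  shows "(half_sol c k n s has_derivative (\<lambda>h. half_sol_grad c k n s y \<bullet> h)) (at y)"
proof -
  have "((\<lambda>y. n \<bullet> (y - s)) has_derivative (\<lambda>h. n \<bullet> h)) (at y)"
    by (auto intro!: derivative_eq_intros)
  from has_derivative_compose[OF this DERIV_half_line_profile[OF assms, of c, unfolded has_field_derivative_def]]
  show ?thesis unfolding half_sol_def[abs_def] half_sol_grad_def by (rule has_derivative_eq_rhs) (simp add: fun_eq_iff)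
qed

lemma continuous_half_sol_grad: "continuous_on UNIV (half_sol_grad c k n s)"
  unfolding half_sol_grad_def[abs_def] by (intro continuous_intros)

lemma half_sol_eq_0: "n \<bullet> (y - s) \<ge> 0 \<Longrightarrow> half_sol c k n s y = 0" "n \<bullet> (y - s) \<ge> 0 \<Longrightarrow> half_sol_grad c k n s y = 0"
  by (simp_all add: half_sol_def half_sol_grad_def)

lemma norm_half_sol_grad_le:
  assumes "norm n = 1" "k > 0"
  shows "norm (half_sol_grad c k n s y) \<le> \<bar>c\<bar> / k"
proof -
  have "\<bar>c\<bar> / k * \<bar>sin (k * min 0 (n \<bullet> (y - s)))\<bar> \<le> \<bar>c\<bar> / k * 1"
    using assms by (intro mult_left_mono) auto
  then show ?thesis using assms by (simp add: half_sol_grad_def abs_mult)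
qed

text \<open>The half-space has the linear defining function n . (y - s), so
  \<open>weak_divergence\<close> applies with e = n and a = 1. The density c cos is c - k^2 times
  the solution on the half-space.\<close>

lemma half_sol_weak:
  fixes n :: "real^3"
  assumes n: "norm n = 1" and k: "k > 0"
    and psi: "\<And>x. (psi has_derivative (\<lambda>h. gpsi x \<bullet> h)) (at x)" and cgpsi: "continuous_on UNIV gpsi"
    and supp: "\<And>x. x \<notin> cball s R \<Longrightarrow> psi x = 0"
  shows "integrable lborel (\<lambda>x. indicator {y. n \<bullet> (y - s) < 0} x * (c * cos (k * (n \<bullet> (x - s))) * psi x))"
    "(LINT x|lborel. half_sol_grad c k n s x \<bullet> gpsi x) = - (LINT x|lborel. indicator {y. n \<bullet> (y - s) < 0} x * (c * cos (k * (n \<bullet> (x - s))) * psi x))"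
proof -
  let ?H = "{y. n \<bullet> (y - s) < 0}"
  have nn: "n \<bullet> n = 1" using n by (simp add: dot_square_norm)
  have oH: "open ?H" by (intro open_Collect_less continuous_intros)
  have d: "(half_sol_grad c k n s has_derivative (\<lambda>h. (c * cos (k * (n \<bullet> (x - s))) * (n \<bullet> h)) *\<^sub>R n)) (at x)"
    if "x \<in> ?H \<inter> ball s (\<bar>R\<bar> + 1)" for x
  proof -
    have "((\<lambda>y. (c / k * sin (k * (n \<bullet> (y - s)))) *\<^sub>R n) has_derivative (\<lambda>h. (c * cos (k * (n \<bullet> (x - s))) * (n \<bullet> h)) *\<^sub>R n)) (at x)"
      using k by (auto intro!: derivative_eq_intros simp: fun_eq_iff)
    then show ?thesis
      by (rule has_derivative_transform_within_open[OF _ oH]) (use that in \<open>auto simp: half_sol_grad_def\<close>)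
  qed
  have cF': "continuous_on (?H \<inter> ball s (\<bar>R\<bar> + 1)) (\<lambda>x. (c * cos (k * (n \<bullet> (x - s))) * (n \<bullet> b)) *\<^sub>R n)" for b
    by (intro continuous_intros)
  have sm: "(\<Sum>b\<in>Basis. ((c * cos (k * (n \<bullet> (x - s))) * (n \<bullet> b)) *\<^sub>R n) \<bullet> b) = c * cos (k * (n \<bullet> (x - s)))" for x
  proof -
    have "(\<Sum>b\<in>Basis. ((c * cos (k * (n \<bullet> (x - s))) * (n \<bullet> b)) *\<^sub>R n) \<bullet> b) = c * cos (k * (n \<bullet> (x - s))) * (\<Sum>b\<in>Basis. (n \<bullet> b) * (n \<bullet> b))"
      by (simp add: sum_distrib_left mult.assoc)
    also have "\<dots> = c * cos (k * (n \<bullet> (x - s)))" unfolding euclidean_inner[symmetric] nn by simp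
    finally show ?thesis .
  qed
  have bf: "\<bar>c * cos (k * (n \<bullet> (x - s)))\<bar> \<le> \<bar>c\<bar>" for x
    using mult_left_mono[of "\<bar>cos (k * (n \<bullet> (x - s)))\<bar>" 1 "\<bar>c\<bar>"] by (simp add: abs_mult)
  note wd = weak_divergence[OF oH, where p = s and r = "\<bar>R\<bar> + 1" and phi = "\<lambda>y. n \<bullet> (y - s)" and g = "\<lambda>_. n" and e = n and a = 1
      and F = "half_sol_grad c k n s" and F' = "\<lambda>x h. (c * cos (k * (n \<bullet> (x - s))) * (n \<bullet> h)) *\<^sub>R n"
      and f = "\<lambda>x. c * cos (k * (n \<bullet> (x - s)))" and Bf = "\<bar>c\<bar>" and psi = psi and gpsi = gpsi and \<rho> = R,
      OF _ _ _ n _ _ continuous_half_sol_grad _ d cF' sm bf psi cgpsi supp]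
  show "integrable lborel (\<lambda>x. indicator ?H x * (c * cos (k * (n \<bullet> (x - s))) * psi x))"
    by (rule wd(1)) (auto intro!: derivative_eq_intros half_sol_eq_0 simp: nn)
  show "(LINT x|lborel. half_sol_grad c k n s x \<bullet> gpsi x) = - (LINT x|lborel. indicator ?H x * (c * cos (k * (n \<bullet> (x - s))) * psi x))"
    by (rule wd(2)) (auto intro!: derivative_eq_intros half_sol_eq_0 simp: nn)
qed

section \<open>The extension by zero and its weak equation\<close>

text \<open>Both boundary conditions are condensed into \<open>u = 0\<close> and
  \<open>G = 0\<close> on the frontier, where \<open>G\<close> is the gradient up to the boundary.
  The Hessian is a map, so that it can be applied to position-dependent vectors.\<close>

locale overdetermined =
  fixes D :: "(real^3) set" and u :: "real^3 \<Rightarrow> real" and G :: "real^3 \<Rightarrow> real^3"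
    and H :: "real^3 \<Rightarrow> real^3 \<Rightarrow> real^3" and k c :: real
  assumes oD: "open D" and bD: "bounded D" and k: "k > 0"
    and charts: "\<And>s. s \<in> frontier D \<Longrightarrow> \<exists>r phi g. chart D s r phi g"
    and cG: "continuous_on (closure D) G"
    and du: "\<And>x. x \<in> closure D \<Longrightarrow> (u has_derivative (\<lambda>h. G x \<bullet> h)) (at x within closure D)"
    and u0: "\<And>s. s \<in> frontier D \<Longrightarrow> u s = 0" and G0: "\<And>s. s \<in> frontier D \<Longrightarrow> G s = 0"
    and dG: "\<And>x. x \<in> D \<Longrightarrow> (G has_derivative H x) (at x)"
    and cH: "\<And>b. continuous_on D (\<lambda>x. H x b)"
    and lap: "\<And>x. x \<in> D \<Longrightarrow> (\<Sum>b\<in>Basis. H x b \<bullet> b) = c - k\<^sup>2 * u x"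
begin

definition ut where "ut x = (if x \<in> D then u x else 0)"
definition Gt where "Gt x = (if x \<in> D then G x else 0)"

lemma frontier_notin: "s \<in> frontier D \<Longrightarrow> s \<notin> D"
  using oD by (simp add: frontier_def interior_open)

lemma du_at: "x \<in> D \<Longrightarrow> (u has_derivative (\<lambda>h. G x \<bullet> h)) (at x)"
proof -
  assume x: "x \<in> D"
  then have "x \<in> interior (closure D)" using oD interior_maximal closure_subset by blast
  then have "at x within closure D = at x" by (rule at_within_interior)
  then show ?thesis using du[of x] x closure_subset by fastforce
qed

text \<open>At a boundary point \<open>u\<close> and its one-sided gradient are 0, so
  \<open>u\<close> is o(|y - x|) within the closure; outside, the extension is 0 anyway.\<close>

lemma ut_has_derivative: "(ut has_derivative (\<lambda>h. Gt x \<bullet> h)) (at x)"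
proof -
  consider "x \<in> D" | "x \<in> frontier D" | "x \<notin> closure D" using closure_Un_frontier[of D] by blast
  then show ?thesis
  proof cases
    case 1
    have "(ut has_derivative (\<lambda>h. G x \<bullet> h)) (at x)"
      by (rule has_derivative_transform_within_open[OF du_at[OF 1] oD 1]) (simp add: ut_def)
    then show ?thesis using 1 by (simp add: Gt_def)
  next
    case 2
    have x: "x \<in> closure D" "x \<notin> D" using 2 frontier_notin by (auto simp: frontier_def)
    have "(u has_derivative (\<lambda>h. 0)) (at x within closure D)" using du[OF x(1)] G0[OF 2] by simp
    then have *: "\<And>e. e > 0 \<Longrightarrow> \<exists>d>0. \<forall>y\<in>closure D. norm (y - x) < d \<longrightarrow> norm (u y) \<le> e * norm (y - x)"
      unfolding has_derivative_within_alt using u0[OF 2] by simp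
    have "(ut has_derivative (\<lambda>h. 0)) (at x)"
      unfolding has_derivative_at_alt
    proof (intro conjI allI impI)
      show "bounded_linear (\<lambda>h::real^3. 0::real)" by simp
      fix e :: real assume e: "e > 0"
      obtain d where d: "d > 0" "\<forall>y\<in>closure D. norm (y - x) < d \<longrightarrow> norm (u y) \<le> e * norm (y - x)"
        using *[OF e] by blast
      have "norm (ut y - ut x - 0) \<le> e * norm (y - x)" if "norm (y - x) < d" for y
        using d(2) that x(2) e closure_subset[of D] by (cases "y \<in> D") (auto simp: ut_def)
      then show "\<exists>d>0. \<forall>y. norm (y - x) < d \<longrightarrow> norm (ut y - ut x - 0) \<le> e * norm (y - x)" using d(1) by blast
    qed
    then show ?thesis using x by (simp add: Gt_def)
  next
    case 3
    have "(ut has_derivative (\<lambda>h. 0)) (at x)"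
      by (rule has_derivative_transform_within_open[of "\<lambda>_. 0" _ _ _ "- closure D"])
        (use 3 closure_subset[of D] in \<open>auto simp: ut_def\<close>)
    then show ?thesis using 3 closure_subset[of D] by (auto simp: Gt_def)
  qed
qed

lemma continuous_Gt: "continuous_on UNIV Gt"
proof -
  have 1: "Gt x = G x" if "x \<in> closure D" for x
    using that G0[of x] by (auto simp: Gt_def frontier_def interior_open[OF oD])
  have "continuous_on (closure D) Gt" using continuous_on_cong[of "closure D" "closure D" Gt G] 1 cG by simp
  moreover have "continuous_on (- D) Gt"
    using continuous_on_cong[of "- D" "- D" Gt "\<lambda>_. 0"] by (simp add: Gt_def)
  ultimately have "continuous_on (closure D \<union> - D) Gt"
    by (intro continuous_on_closed_Un) (use oD in auto)
  moreover have "closure D \<union> - D = UNIV" using closure_subset[of D] by auto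
  ultimately show ?thesis by simp
qed

lemma ut_outside: "x \<notin> D \<Longrightarrow> ut x = 0" and Gt_outside: "x \<notin> D \<Longrightarrow> Gt x = 0"
  by (simp_all add: ut_def Gt_def)

lemma bounds: obtains B where "B > 0" "\<And>x. norm (Gt x) \<le> B" "\<And>x. \<bar>c - k\<^sup>2 * ut x\<bar> \<le> B"
proof -
  obtain R where "\<And>x. x \<in> D \<Longrightarrow> norm x \<le> R" using bD unfolding bounded_iff by blast
  then have R: "D \<subseteq> cball 0 R" by auto
  have cu: "continuous_on UNIV ut"
    using ut_has_derivative by (meson continuous_at_imp_continuous_on has_derivative_continuous)
  obtain B1 where B1: "\<And>x. \<bar>ut x\<bar> \<le> B1"
    using bounded_continuous_support[OF cu, of 0 R] ut_outside R by (metis subsetD)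
  have cn: "continuous_on UNIV (\<lambda>x. norm (Gt x))" by (intro continuous_intros continuous_Gt)
  obtain B2 where B2: "\<And>x. \<bar>norm (Gt x)\<bar> \<le> B2"
    using bounded_continuous_support[OF cn, of 0 R] Gt_outside R by (metis norm_zero subsetD)
  have B10: "B1 \<ge> 0" "B2 \<ge> 0" using B1[of 0] B2[of 0] by linarith+
  have "\<bar>c - k\<^sup>2 * ut x\<bar> \<le> \<bar>c\<bar> + k\<^sup>2 * B1" for x
  proof -
    have "\<bar>c - k\<^sup>2 * ut x\<bar> \<le> \<bar>c\<bar> + \<bar>k\<^sup>2 * ut x\<bar>" by (rule abs_triangle_ineq4)
    also have "\<bar>k\<^sup>2 * ut x\<bar> \<le> k\<^sup>2 * B1" using B1[of x] by (simp add: abs_mult mult_left_mono)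
    finally show ?thesis by simp
  qed
  note bb = this
  have p: "k\<^sup>2 * B1 \<ge> 0" using B10 by simp
  have b2: "\<bar>c - k\<^sup>2 * ut x\<bar> \<le> 1 + B2 + \<bar>c\<bar> + k\<^sup>2 * B1" for x
    using bb[of x] B10 by linarith
  have b1: "norm (Gt x) \<le> 1 + B2 + \<bar>c\<bar> + k\<^sup>2 * B1" for x
    using B2[of x] B10 p by linarith
  have "1 + B2 + \<bar>c\<bar> + k\<^sup>2 * B1 > 0" using B10 p by linarith
  then show ?thesis using that b1 b2 by blast
qed

text \<open>The divergence of the extended gradient is c - k^2 u inside \<open>D\<close>, a bounded
  function, although nothing is yet known about the Hessian near the boundary.\<close>

lemma ut_weak:
  assumes ch: "chart D s0 r phi g" and sub: "ball s r' \<subseteq> ball s0 r" and e: "norm e = 1" "a > 0"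
    "\<And>x. x \<in> ball s r' \<Longrightarrow> a \<le> g x \<bullet> e"
    and psi: "\<And>x. (psi has_derivative (\<lambda>h. gpsi x \<bullet> h)) (at x)" and cgpsi: "continuous_on UNIV gpsi"
    and supp: "\<And>x. x \<notin> cball s R \<Longrightarrow> psi x = 0" and R: "R < r'"
  shows "integrable lborel (\<lambda>x. indicator D x * ((c - k\<^sup>2 * ut x) * psi x))"
    "(LINT x|lborel. Gt x \<bullet> gpsi x) = - (LINT x|lborel. indicator D x * ((c - k\<^sup>2 * ut x) * psi x))"
proof -
  obtain B where B: "\<And>x. \<bar>c - k\<^sup>2 * ut x\<bar> \<le> B" using bounds by metis
  have 1: "(phi has_derivative (\<lambda>h. g x \<bullet> h)) (at x)" if "x \<in> ball s r'" for x
    using ch sub that unfolding chart_def by blast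
  have 2: "continuous_on (ball s r') g" using ch sub continuous_on_subset unfolding chart_def by blast
  have 3: "D \<inter> ball s r' = {x \<in> ball s r'. phi x < 0}" using ch sub unfolding chart_def by blast
  have 4: "(Gt has_derivative H x) (at x)" if "x \<in> D \<inter> ball s r'" for x
    by (rule has_derivative_transform_within_open[OF dG oD]) (use that in \<open>auto simp: Gt_def\<close>)
  have 5: "continuous_on (D \<inter> ball s r') (\<lambda>x. H x b)" for b by (rule continuous_on_subset[OF cH]) auto
  have 6: "(\<Sum>b\<in>Basis. H x b \<bullet> b) = c - k\<^sup>2 * ut x" if "x \<in> D \<inter> ball s r'" for x
    using lap that by (simp add: ut_def)
  note wd = weak_divergence[OF oD 1 2 3 e continuous_Gt Gt_outside 4 5 6 B psi cgpsi supp R]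
  show "integrable lborel (\<lambda>x. indicator D x * ((c - k\<^sup>2 * ut x) * psi x))"
    "(LINT x|lborel. Gt x \<bullet> gpsi x) = - (LINT x|lborel. indicator D x * ((c - k\<^sup>2 * ut x) * psi x))"
    using wd by auto
qed

end

section \<open>Quadratic closeness to the half-space solution\<close>

lemma cutoff_bounds:
  assumes R: "R > 0" and B: "\<And>t. \<bar>step' t\<bar> \<le> B" "\<And>t. \<bar>step'' t\<bar> \<le> B" and y: "y \<in> cball s R"
  shows "norm (cutoff_grad s R y) \<le> 8 * B / R" "\<bar>\<Sum>b\<in>Basis. cutoff_hess s R y b b\<bar> \<le> 216 * B / R\<^sup>2"
proof -
  have B0: "B \<ge> 0" using B(1)[of 0] by linarith
  have ny: "norm (y - s) \<le> R" using y by (simp add: dist_norm norm_minus_commute)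
  let ?t = "4 - 4 / R\<^sup>2 * ((y - s) \<bullet> (y - s))"
  have "norm (cutoff_grad s R y) = 8 / R\<^sup>2 * \<bar>step' ?t\<bar> * norm (y - s)"
    by (simp add: cutoff_grad_def abs_mult)
  also have "\<dots> \<le> 8 / R\<^sup>2 * B * R" using B ny B0 R by (intro mult_mono) auto
  finally show "norm (cutoff_grad s R y) \<le> 8 * B / R" using R by (simp add: field_simps power2_eq_square)
  have "\<bar>cutoff_hess s R y b b\<bar> \<le> 72 * B / R\<^sup>2" if b: "b \<in> Basis" for b
  proof -
    have yb: "\<bar>(y - s) \<bullet> b\<bar> \<le> R" using Basis_le_norm[OF b, of "y - s"] ny by linarith
    have bb: "b \<bullet> b = 1" using b by simp
    have "\<bar>cutoff_hess s R y b b\<bar> \<le> \<bar>64 / R ^ 4 * step'' ?t * ((y - s) \<bullet> b) * ((y - s) \<bullet> b)\<bar> + \<bar>8 / R\<^sup>2 * step' ?t * (b \<bullet> b)\<bar>"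
      unfolding cutoff_hess_def by (rule abs_triangle_ineq4)
    also have "\<dots> = 64 / R ^ 4 * \<bar>step'' ?t\<bar> * \<bar>(y - s) \<bullet> b\<bar> * \<bar>(y - s) \<bullet> b\<bar> + 8 / R\<^sup>2 * \<bar>step' ?t\<bar>"
      unfolding bb by (simp add: abs_mult)
    also have "\<dots> \<le> 64 / R ^ 4 * B * R * R + 8 / R\<^sup>2 * B"
      using B yb B0 R by (intro add_mono mult_mono) auto
    also have "\<dots> = 72 * B / R\<^sup>2" using R by (simp add: field_simps power2_eq_square power4_eq_xxxx)
    finally show ?thesis .
  qed
  then have "\<bar>\<Sum>b\<in>Basis. cutoff_hess s R y b b\<bar> \<le> (\<Sum>b\<in>(Basis::(real^3) set). 72 * B / R\<^sup>2)"
    by (intro order_trans[OF sum_abs] sum_mono) auto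
  then show "\<bar>\<Sum>b\<in>Basis. cutoff_hess s R y b b\<bar> \<le> 216 * B / R\<^sup>2" by simp
qed

text \<open>Every parameter of the next estimate is chosen as b/(8 (a + 1)); the added 1 allows a =
  0. Five errors of size b/8 stay below b.\<close>

lemma eighth_bound:
  fixes a b :: real
  assumes "a \<ge> 0" "b > 0" "0 \<le> x" "x \<le> b / (8 * (a + 1))"
  shows "a * x \<le> b / 8"
proof -
  have "a * x \<le> a * (b / (8 * (a + 1)))" using assms by (intro mult_left_mono) auto
  also have "\<dots> \<le> b / 8" using assms by (simp add: field_simps)
  finally show ?thesis .
qed

context overdetermined begin

text \<open>The parameters are fixed in an order without circularity: theta and L from
  \<open>c\<close> and the target, then the opening omega of the cone, which gives the radius rho of
  validity, then the cut-off radius R, and last delta, which absorbs the constants that grow as R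
  shrinks. None of them depends on \<open>s\<close>, \<open>d\<close> or \<open>x\<close>.\<close>

lemma key_estimate:
  assumes s0: "s0 \<in> frontier D" and ch: "chart D s0 r phi g" and \<eta>: "\<eta> > 0"
  shows "\<exists>\<delta>>0. \<forall>s\<in>frontier D \<inter> ball s0 \<delta>. \<forall>d. 0 < d \<and> d < \<delta> \<longrightarrow>
     (\<forall>x\<in>cball s (2 * d). \<bar>ut x - half_sol c k ((1 / norm (g s)) *\<^sub>R g s) s x\<bar> \<le> \<eta> * d\<^sup>2)"
proof -
  obtain BG where BG: "BG > 0" "\<And>x. norm (Gt x) \<le> BG" using bounds by metis
  obtain Bs where Bs: "Bs > 0" "\<And>t. \<bar>step' t\<bar> \<le> Bs" "\<And>t. \<bar>step'' t\<bar> \<le> Bs" using step'_step''_bounded by metis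
  define \<kappa> where "\<kappa> = newt_mass * \<eta>"
  have \<kappa>: "\<kappa> > 0" using newt_mass_pos \<eta> by (simp add: \<kappa>_def)
  define V where "V = unit_ball_volume"
  have V: "V \<ge> 0" using unit_ball_volume_nonneg by (simp add: V_def)
  have Fc: "far_const \<ge> 0" using V by (simp add: far_const_def V_def)
  define C0 where "C0 = \<bar>c\<bar>"
  have C0: "C0 \<ge> 0" by (simp add: C0_def)
  \<comment> \<open>Makes the singular part of the cone integral at most kappa/8 times d^2; the next
    line does the same for the far part.\<close>
  define \<theta> where "\<theta> = min 1 (\<kappa> / (8 * (C0 * (24 * V) + 1)))"
  have \<theta>: "\<theta> > 0" "\<theta> \<le> 1" using \<kappa> C0 V by (auto simp: \<theta>_def add_nonneg_pos)
  define L where "L = 64 + 8 * C0 * far_const / \<kappa>"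
  have L: "L \<ge> 64" using C0 Fc \<kappa> by (simp add: L_def)
  \<comment> \<open>The slab volume brings 48 and the kernel bound 8 / (theta d), hence 384. The cap
    1/16 pushes the shifted poles out of \<open>D\<close>.\<close>
  define \<omega> where "\<omega> = min (1/16) (\<kappa> / (8 * (C0 * (384 * V * L ^ 3 / \<theta>) + 1)))"
  have a\<omega>: "C0 * (384 * V * L ^ 3 / \<theta>) \<ge> 0" using C0 V L \<theta> by simp
  have \<omega>16: "\<omega> \<le> 1/16" unfolding \<omega>_def by (rule min.cobounded1)
  have "\<kappa> / (8 * (C0 * (384 * V * L ^ 3 / \<theta>) + 1)) > 0" using \<kappa> a\<omega> by (intro divide_pos_pos mult_pos_pos add_nonneg_pos) auto
  then have \<omega>: "0 < \<omega>" "\<omega> \<le> 1/16" "\<omega> \<le> 1" using \<omega>16 by (auto simp: \<omega>_def)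
  obtain \<rho> where \<rho>: "\<rho> > 0" "\<rho> \<le> r"
    and gn0: "\<And>x. x \<in> ball s0 \<rho> \<Longrightarrow> g x \<bullet> ((1 / norm (g s0)) *\<^sub>R g s0) \<ge> norm (g s0) / 2"
    and gne: "\<And>x. x \<in> ball s0 \<rho> \<Longrightarrow> g x \<noteq> 0"
    and thin: "\<And>s y. s \<in> frontier D \<Longrightarrow> s \<in> ball s0 \<rho> \<Longrightarrow> y \<in> ball s0 \<rho> \<Longrightarrow>
       (y \<in> D \<and> ((1 / norm (g s)) *\<^sub>R g s) \<bullet> (y - s) \<ge> 0) \<or> (y \<notin> D \<and> ((1 / norm (g s)) *\<^sub>R g s) \<bullet> (y - s) \<le> 0) \<or> y \<in> frontier D \<Longrightarrow>
       \<bar>((1 / norm (g s)) *\<^sub>R g s) \<bullet> (y - s)\<bar> \<le> \<omega> * norm (y - s)"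
    using chart_thin[OF ch oD \<omega>(1) \<omega>(3)] by metis
  define K2 where "K2 = 24 * V + 8 * V * 64 ^ 3 + far_const"
  have K2: "K2 \<ge> 0" using V Fc by (simp add: K2_def)
  define BW where "BW = BG + C0 / k"
  have BW: "BW > 0" using BG C0 k by (simp add: BW_def add_pos_nonneg)
  \<comment> \<open>Small R makes the remainder k^2 w small on the ball, since |w| is at most BW * R
    there.\<close>
  define R where "R = min (\<rho> / 8) (\<kappa> / (8 * (k\<^sup>2 * BW * K2 + 1)))"
  have aR: "k\<^sup>2 * BW * K2 \<ge> 0" using BW K2 by simp
  have R8: "R \<le> \<rho> / 8" unfolding R_def by (rule min.cobounded1)
  have "\<kappa> / (8 * (k\<^sup>2 * BW * K2 + 1)) > 0" using \<kappa> aR by (intro divide_pos_pos mult_pos_pos add_nonneg_pos) auto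
  then have R: "R > 0" "R \<le> \<rho> / 8" using \<rho> R8 by (auto simp: R_def)
  define CR where "CR = BW * R * (216 * Bs / R\<^sup>2) + 2 * (BW * (8 * Bs / R))"
  have CR: "CR \<ge> 0" using BW R Bs by (simp add: CR_def)
  define a3 where "a3 = CR * (24 * V + 2 * far_const / R)"
  have a3: "a3 \<ge> 0" using CR V Fc R by (simp add: a3_def)
  define \<delta> where "\<delta> = min (min 1 (\<rho> / 8)) (min (R / 128) (\<kappa> / (8 * (a3 + 1))))"
  have "\<kappa> / (8 * (a3 + 1)) > 0" using \<kappa> a3 by (intro divide_pos_pos mult_pos_pos add_nonneg_pos) auto
  then have "\<delta> > 0" using \<rho> R by (auto simp: \<delta>_def)
  moreover have "\<delta> \<le> 1" "\<delta> \<le> \<rho> / 8" "\<delta> \<le> R / 128" "\<delta> \<le> \<kappa> / (8 * (a3 + 1))"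
    unfolding \<delta>_def by (meson min.cobounded1 min.cobounded2 order_trans)+
  ultimately have \<delta>: "\<delta> > 0" "\<delta> \<le> 1" "\<delta> \<le> \<rho> / 8" "\<delta> \<le> R / 128" "\<delta> \<le> \<kappa> / (8 * (a3 + 1))" by auto
  have "\<bar>ut x - half_sol c k ((1 / norm (g s)) *\<^sub>R g s) s x\<bar> \<le> \<eta> * d\<^sup>2"
    if s: "s \<in> frontier D" "s \<in> ball s0 \<delta>" and d: "0 < d" "d < \<delta>" and x: "x \<in> cball s (2 * d)" for s d x
  proof -
    define n where "n = (1 / norm (g s)) *\<^sub>R g s"
    have s\<rho>: "s \<in> ball s0 \<rho>" using s \<delta> \<rho> by auto
    have n: "norm n = 1" using gne[OF s\<rho>] by (simp add: n_def)
    have th: "\<bar>n \<bullet> (y - s)\<bar> \<le> \<omega> * norm (y - s)" if "y \<in> ball s0 \<rho>" "(y \<in> D \<and> n \<bullet> (y - s) \<ge> 0) \<or> (y \<notin> D \<and> n \<bullet> (y - s) \<le> 0)" for y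
      using thin[OF s(1) s\<rho> that(1)] that(2) unfolding n_def by blast
    have bs: "y \<in> ball s0 \<rho>" if "dist s y \<le> 2 * R" for y
      using dist_triangle[of s0 y s] that s \<delta> R \<rho> by simp
    define w where "w y = ut y - half_sol c k n s y" for y
    define W where "W y = Gt y - half_sol_grad c k n s y" for y
    have dw: "(w has_derivative (\<lambda>h. W y \<bullet> h)) (at y)" for y
      unfolding w_def[abs_def] W_def
      by (rule has_derivative_eq_rhs[OF has_derivative_diff[OF ut_has_derivative half_sol_has_derivative[OF k]]])
        (simp add: inner_diff_left)
    have cW: "continuous_on UNIV W" unfolding W_def[abs_def] by (intro continuous_intros continuous_Gt continuous_half_sol_grad)
    have WB: "norm (W y) \<le> BW" for y
      using norm_triangle_ineq4[of "Gt y" "half_sol_grad c k n s y"] BG(2)[of y] norm_half_sol_grad_le[OF n k, where c = c and s = s and y = y]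
      unfolding W_def BW_def C0_def by linarith
    have ws: "w s = 0" using s frontier_notin by (simp add: w_def ut_outside half_sol_eq_0)
    \<comment> \<open>The difference vanishes at \<open>s\<close> and is Lipschitz with constant
      \<open>BW\<close>.\<close>
    have wB: "\<bar>w y\<bar> \<le> BW * norm (y - s)" for y
    proof -
      have "norm (w y - w s) \<le> BW * norm (y - s)"
      proof (rule differentiable_bound[where S = UNIV and f' = "\<lambda>y h. W y \<bullet> h"])
        show "(w has_derivative (\<lambda>h. W z \<bullet> h)) (at z within UNIV)" for z using dw by simp
        show "onorm (\<lambda>h. W z \<bullet> h) \<le> BW" for z
        proof (rule onorm_le)
          fix h
          have "norm (W z \<bullet> h) \<le> norm (W z) * norm h" by (simp add: Cauchy_Schwarz_ineq2)
          then show "norm (W z \<bullet> h) \<le> BW * norm h" using mult_right_mono[OF WB[of z], of "norm h"] by simp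
        qed
      qed auto
      then show ?thesis using ws by simp
    qed
    have wR: "\<bar>w y\<bar> \<le> BW * R" if "y \<in> cball s R" for y
    proof -
      have "BW * norm (y - s) \<le> BW * R" using that BW by (intro mult_left_mono) (auto simp: dist_norm norm_minus_commute)
      then show ?thesis using wB[of y] by linarith
    qed
    define Gw where "Gw y = indicator D y * (c - k\<^sup>2 * ut y) - indicator {y. n \<bullet> (y - s) < 0} y * (c * cos (k * (n \<bullet> (y - s))))" for y
    have weak: "integrable lborel (\<lambda>y. Gw y * psi y) \<and> (LINT y|lborel. W y \<bullet> gpsi y) = - (LINT y|lborel. Gw y * psi y)"
      if psi: "\<And>y. (psi has_derivative (\<lambda>h. gpsi y \<bullet> h)) (at y)" and cg: "continuous_on UNIV gpsi" and sp: "\<And>y. y \<notin> cball s R \<Longrightarrow> psi y = 0" for psi gpsi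
    proof -
      have sb: "ball s (2 * R) \<subseteq> ball s0 r"
      proof
        fix y assume "y \<in> ball s (2 * R)"
        then have "y \<in> ball s0 \<rho>" by (intro bs) auto
        then show "y \<in> ball s0 r" using \<rho> by auto
      qed
      have e0: "norm ((1 / norm (g s0)) *\<^sub>R g s0) = 1" "norm (g s0) / 2 > 0" using gne[of s0] \<rho> by auto
      have ge: "norm (g s0) / 2 \<le> g x \<bullet> ((1 / norm (g s0)) *\<^sub>R g s0)" if "x \<in> ball s (2 * R)" for x
        by (rule gn0, rule bs) (use that in auto)
      note w1 = ut_weak[OF ch sb e0 ge psi cg sp]
      note w2 = half_sol_weak[OF n k psi cg sp, where c = c]
      have i1: "integrable lborel (\<lambda>x. indicator D x * ((c - k\<^sup>2 * ut x) * psi x))" by (rule w1(1)) (use R in auto)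
      have e1: "(LINT x|lborel. Gt x \<bullet> gpsi x) = - (LINT x|lborel. indicator D x * ((c - k\<^sup>2 * ut x) * psi x))"
        by (rule w1(2)) (use R in auto)
      have i2: "integrable lborel (\<lambda>x. indicator {y. n \<bullet> (y - s) < 0} x * (c * cos (k * (n \<bullet> (x - s))) * psi x))" by (rule w2(1))
      have e2: "(LINT x|lborel. half_sol_grad c k n s x \<bullet> gpsi x) = - (LINT x|lborel. indicator {y. n \<bullet> (y - s) < 0} x * (c * cos (k * (n \<bullet> (x - s))) * psi x))"
        by (rule w2(2))
      have gs0: "gpsi y = 0" if "y \<notin> cball s R" for y by (rule gradient_support[OF psi sp that])
      have iG: "integrable lborel (\<lambda>x. Gt x \<bullet> gpsi x)" "integrable lborel (\<lambda>x. half_sol_grad c k n s x \<bullet> gpsi x)"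
        by (rule integrable_continuous_support[of _ s R], intro continuous_intros continuous_Gt cg, simp add: gs0)
          (rule integrable_continuous_support[of _ s R], intro continuous_intros continuous_half_sol_grad cg, simp add: gs0)
      have eq: "Gw y * psi y = indicator D y * ((c - k\<^sup>2 * ut y) * psi y) - indicator {y. n \<bullet> (y - s) < 0} y * (c * cos (k * (n \<bullet> (y - s))) * psi y)" for y
        by (simp add: Gw_def algebra_simps)
      have "(LINT y|lborel. W y \<bullet> gpsi y) = (LINT y|lborel. Gt y \<bullet> gpsi y) - (LINT y|lborel. half_sol_grad c k n s y \<bullet> gpsi y)"
        unfolding W_def inner_diff_left using iG by simp
      also have "\<dots> = - ((LINT x|lborel. indicator D x * ((c - k\<^sup>2 * ut x) * psi x)) - (LINT x|lborel. indicator {y. n \<bullet> (y - s) < 0} x * (c * cos (k * (n \<bullet> (x - s))) * psi x)))"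
        unfolding e1 e2 by simp
      also have "\<dots> = - (LINT y|lborel. Gw y * psi y)"
        unfolding eq using i1 i2 by simp
      finally have "(LINT y|lborel. W y \<bullet> gpsi y) = - (LINT y|lborel. Gw y * psi y)" .
      moreover have "integrable lborel (\<lambda>y. Gw y * psi y)" unfolding eq using i1 i2 by simp
      ultimately show ?thesis by simp
    qed
    define T where "T = {y. \<bar>n \<bullet> (y - s)\<bar> \<le> \<omega> * norm (y - s)}"
    have "closed T" unfolding T_def by (intro closed_Collect_le continuous_intros)
    then have Tb: "T \<in> sets borel" by simp
    \<comment> \<open>Where \<open>D\<close> and the half-space agree, the constants
      \<open>c\<close> cancel and only k^2 w is left. They disagree only inside the cone
      \<open>T\<close>.\<close>
    have Gb: "\<bar>Gw y\<bar> \<le> C0 * indicator T y + k\<^sup>2 * (BW * R)" if y: "y \<in> cball s R" for y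
    proof -
      have y\<rho>: "y \<in> ball s0 \<rho>" by (rule bs) (use y R in auto)
      have hsH: "c * cos (k * (n \<bullet> (y - s))) = c - k\<^sup>2 * half_sol c k n s y" if "n \<bullet> (y - s) < 0"
        using that k by (simp add: half_sol_def right_diff_distrib)
      have Gw: "Gw y = c * (indicator D y - indicator {y. n \<bullet> (y - s) < 0} y) - k\<^sup>2 * w y"
        using hsH half_sol_eq_0(1)[where n = n and y = y and s = s and c = c and k = k] ut_outside[of y]
        by (cases "y \<in> D"; cases "n \<bullet> (y - s) < 0") (auto simp: Gw_def w_def algebra_simps)
      have "\<bar>indicator D y - indicator {y. n \<bullet> (y - s) < 0} y\<bar> \<le> (indicator T y :: real)"
        using th[OF y\<rho>] by (cases "y \<in> D"; cases "n \<bullet> (y - s) < 0") (auto simp: T_def)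
      then have "C0 * \<bar>indicator D y - indicator {y. n \<bullet> (y - s) < 0} y\<bar> \<le> C0 * indicator T y"
        using C0 by (intro mult_left_mono)
      then have "\<bar>c * (indicator D y - indicator {y. n \<bullet> (y - s) < 0} y)\<bar> \<le> C0 * indicator T y"
        by (simp only: abs_mult C0_def)
      moreover have "\<bar>k\<^sup>2 * w y\<bar> \<le> k\<^sup>2 * (BW * R)"
        using wR[OF y] by (simp add: abs_mult mult_left_mono)
      ultimately show ?thesis unfolding Gw by linarith
    qed
    have CRb: "\<bar>w y * (\<Sum>b\<in>Basis. cutoff_hess s R y b b) + 2 * (W y \<bullet> cutoff_grad s R y)\<bar> \<le> CR" if y: "y \<in> cball s R" for y
    proof -
      note cb = cutoff_bounds[OF R(1) Bs(2,3) y]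
      have "\<bar>w y\<bar> * \<bar>\<Sum>b\<in>Basis. cutoff_hess s R y b b\<bar> \<le> BW * R * (216 * Bs / R\<^sup>2)"
        using BW R by (intro mult_mono wR[OF y] cb) auto
      moreover have "\<bar>W y \<bullet> cutoff_grad s R y\<bar> \<le> BW * (8 * Bs / R)"
        using Cauchy_Schwarz_ineq2[of "W y" "cutoff_grad s R y"] mult_mono[OF WB[of y] cb(1)] BW by simp
      ultimately show ?thesis
        unfolding CR_def using abs_triangle_ineq[of "w y * (\<Sum>b\<in>Basis. cutoff_hess s R y b b)" "2 * (W y \<bullet> cutoff_grad s R y)"]
        by (simp add: abs_mult)
    qed
    have dR: "128 * d \<le> R" using d \<delta> by linarith
    have xs: "norm (x - s) \<le> 2 * d" using x by (simp add: dist_norm norm_minus_commute)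
    \<comment> \<open>A shifted pole has normal component at least 10 d - 2 d = 8 d and distance at
      most 32 d from \<open>s\<close>. If it were in \<open>D\<close>, thinness with omega at most
      1/16 would bound the normal component by 2 d.\<close>
    have w0: "w (x + (10 * d * j) *\<^sub>R n) = 0" if j: "j \<in> {1,2,3}" for j
    proof -
      define y where "y = x + (10 * d * j) *\<^sub>R n"
      have j3: "1 \<le> j" "j \<le> 3" using j by auto
      have "norm (y - s) \<le> norm (x - s) + norm ((10 * d * j) *\<^sub>R n)"
        using norm_triangle_ineq[of "x - s" "(10 * d * j) *\<^sub>R n"] by (simp add: y_def algebra_simps)
      moreover have "norm ((10 * d * j) *\<^sub>R n) \<le> 30 * d" using n d j3 by simp
      ultimately have ny: "norm (y - s) \<le> 32 * d" using xs by linarith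
      have "n \<bullet> n = 1" using n by (simp add: dot_square_norm)
      then have "n \<bullet> (y - s) = n \<bullet> (x - s) + 10 * d * j" by (simp add: y_def inner_diff_right inner_add_right)
      moreover have "\<bar>n \<bullet> (x - s)\<bar> \<le> 2 * d" using Cauchy_Schwarz_ineq2[of n "x - s"] n xs by simp
      moreover have "10 * d * j \<ge> 10 * d" using d j3 by simp
      ultimately have ns: "n \<bullet> (y - s) \<ge> 8 * d" by linarith
      have "y \<notin> D"
      proof
        assume "y \<in> D"
        moreover have "y \<in> ball s0 \<rho>" by (rule bs) (use ny dR d in \<open>auto simp: dist_norm norm_minus_commute\<close>)
        moreover have "n \<bullet> (y - s) \<ge> 0" using ns d by linarith
        ultimately have "\<bar>n \<bullet> (y - s)\<bar> \<le> \<omega> * norm (y - s)" by (intro th) auto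
        also have "\<dots> \<le> 1/16 * (32 * d)" using \<omega> ny by (intro mult_mono) auto
        finally show False using ns d by simp
      qed
      then show ?thesis using ns d unfolding y_def[symmetric] by (simp add: w_def ut_outside half_sol_eq_0)
    qed
    note est = third_difference_estimate[OF dw cW weak Gb Tb C0 _ CRb CR n d(1) dR xs w0 \<theta>(1) L]
    have E: "newt_mass * \<bar>w x\<bar> \<le>
      C0 * (24 * V * (\<theta> * d)\<^sup>2 + 8 / (\<theta> * d) * measure lborel (T \<inter> cball s R \<inter> cball s (L * d)) + far_const * d\<^sup>2 / L)
    + k\<^sup>2 * (BW * R) * (24 * V * d\<^sup>2 + 8 * V * 64 ^ 3 * d\<^sup>2 + far_const * d\<^sup>2)
    + CR * (24 * V * d ^ 4 + 2 * far_const * d ^ 3 / R)"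
      unfolding V_def by (rule est) (use BW R in auto)
    have e1: "C0 * (24 * V * (\<theta> * d)\<^sup>2) \<le> \<kappa> / 8 * d\<^sup>2"
    proof -
      have "C0 * (24 * V) * \<theta> \<le> \<kappa> / 8" by (rule eighth_bound) (use C0 V \<kappa> \<theta> in \<open>auto simp: \<theta>_def\<close>)
      moreover have "C0 * (24 * V) * \<theta>\<^sup>2 \<le> C0 * (24 * V) * \<theta>"
        using \<theta> C0 V by (intro mult_left_mono) (auto simp: power2_eq_square mult_left_le)
      ultimately have "C0 * (24 * V) * \<theta>\<^sup>2 * d\<^sup>2 \<le> \<kappa> / 8 * d\<^sup>2" by (intro mult_right_mono) auto
      then show ?thesis by (simp add: power_mult_distrib mult.assoc)
    qed
    have e2: "C0 * (8 / (\<theta> * d) * measure lborel (T \<inter> cball s R \<inter> cball s (L * d))) \<le> \<kappa> / 8 * d\<^sup>2"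
    proof -
      have Ld: "L * d > 0" using L d by simp
      \<comment> \<open>The cone truncated at radius L d lies in a slab of half-width omega L d,
        whose measure is known.\<close>
      define A where "A = {y \<in> cball s (L * d). \<bar>n \<bullet> (y - s)\<bar> \<le> \<omega> * (L * d)}"
      have "closed {y. \<bar>n \<bullet> (y - s)\<bar> \<le> \<omega> * (L * d)}" by (intro closed_Collect_le continuous_intros)
      then have "closed (cball s (L * d) \<inter> {y. \<bar>n \<bullet> (y - s)\<bar> \<le> \<omega> * (L * d)})" by (intro closed_Int) auto
      moreover have Aeq: "A = cball s (L * d) \<inter> {y. \<bar>n \<bullet> (y - s)\<bar> \<le> \<omega> * (L * d)}" by (auto simp: A_def)
      ultimately have Ac: "compact A" by (metis bounded_Int bounded_cball compact_eq_bounded_closed)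
      have "T \<inter> cball s R \<inter> cball s (L * d) \<subseteq> A"
      proof
        fix y assume y: "y \<in> T \<inter> cball s R \<inter> cball s (L * d)"
        then have "\<omega> * norm (y - s) \<le> \<omega> * (L * d)"
          using \<omega> by (intro mult_left_mono) (auto simp: dist_norm norm_minus_commute)
        then show "y \<in> A" using y by (auto simp: A_def T_def)
      qed
      then have "measure lborel (T \<inter> cball s R \<inter> cball s (L * d)) \<le> measure lborel A"
        using Tb Ac by (intro measure_mono_fmeasurable) (auto simp: fmeasurable_compact)
      also have "\<dots> \<le> 48 * unit_ball_volume * (\<omega> * (L * d)) * (L * d)\<^sup>2"
        unfolding A_def
      proof (rule measure_slab_le[OF n])
        show "0 < \<omega> * (L * d)" using \<omega> Ld by simp
        have "6 * \<omega> * (L * d) \<le> 1 * (L * d)" using \<omega> Ld by (intro mult_right_mono) auto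
        then show "6 * (\<omega> * (L * d)) \<le> L * d" by simp
      qed
      also have "\<dots> = 48 * V * \<omega> * L ^ 3 * d ^ 3" by (simp add: V_def power2_eq_square power3_eq_cube)
      finally have "C0 * (8 / (\<theta> * d) * measure lborel (T \<inter> cball s R \<inter> cball s (L * d))) \<le> C0 * (8 / (\<theta> * d) * (48 * V * \<omega> * L ^ 3 * d ^ 3))"
        using C0 \<theta> d by (intro mult_left_mono) auto
      also have "\<dots> = C0 * (384 * V * L ^ 3 / \<theta>) * \<omega> * d\<^sup>2"
        using \<theta> d by (simp add: field_simps power2_eq_square power3_eq_cube)
      also have "\<dots> \<le> \<kappa> / 8 * d\<^sup>2"
      proof (rule mult_right_mono)
        show "C0 * (384 * V * L ^ 3 / \<theta>) * \<omega> \<le> \<kappa> / 8"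
          by (rule eighth_bound[OF a\<omega> \<kappa>]) (use \<omega> in \<open>auto simp: \<omega>_def\<close>)
      qed simp
      finally show ?thesis .
    qed
    have e3: "C0 * (far_const * d\<^sup>2 / L) \<le> \<kappa> / 8 * d\<^sup>2"
    proof -
      have "C0 * far_const \<le> \<kappa> / 8 * L" using \<kappa> by (simp add: L_def field_simps)
      then have "C0 * far_const / L \<le> \<kappa> / 8" using L by (simp add: field_simps)
      then have "C0 * far_const / L * d\<^sup>2 \<le> \<kappa> / 8 * d\<^sup>2" by (intro mult_right_mono) auto
      then show ?thesis by simp
    qed
    have e4: "k\<^sup>2 * (BW * R) * (24 * V * d\<^sup>2 + 8 * V * 64 ^ 3 * d\<^sup>2 + far_const * d\<^sup>2) \<le> \<kappa> / 8 * d\<^sup>2"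
    proof -
      have "k\<^sup>2 * BW * K2 * R \<le> \<kappa> / 8" by (rule eighth_bound[OF aR \<kappa>]) (use R in \<open>auto simp: R_def\<close>)
      then have "k\<^sup>2 * BW * K2 * R * d\<^sup>2 \<le> \<kappa> / 8 * d\<^sup>2" by (intro mult_right_mono) auto
      then show ?thesis by (simp add: K2_def algebra_simps)
    qed
    have e5: "CR * (24 * V * d ^ 4 + 2 * far_const * d ^ 3 / R) \<le> \<kappa> / 8 * d\<^sup>2"
    proof -
      have d4: "d ^ 4 \<le> d ^ 3" using d \<delta> by (intro power_decreasing) auto
      have "24 * V * d ^ 4 + 2 * far_const * d ^ 3 / R \<le> 24 * V * d ^ 3 + 2 * far_const / R * d ^ 3"
        using mult_left_mono[OF d4, of "24 * V"] V by simp
      then have "CR * (24 * V * d ^ 4 + 2 * far_const * d ^ 3 / R) \<le> CR * (24 * V * d ^ 3 + 2 * far_const / R * d ^ 3)"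
        using CR by (intro mult_left_mono)
      also have "\<dots> = a3 * d * d\<^sup>2" by (simp add: a3_def power2_eq_square power3_eq_cube algebra_simps)
      also have "\<dots> \<le> \<kappa> / 8 * d\<^sup>2"
      proof (rule mult_right_mono)
        show "a3 * d \<le> \<kappa> / 8" by (rule eighth_bound[OF a3 \<kappa>]) (use d \<delta> in linarith)+
      qed simp
      finally show ?thesis .
    qed
    have "newt_mass * \<bar>w x\<bar> \<le> 5 * (\<kappa> / 8 * d\<^sup>2)"
      using E e1 e2 e3 e4 e5 unfolding distrib_left by linarith
    also have "\<dots> \<le> \<kappa> * d\<^sup>2" using mult_nonneg_nonneg[of \<kappa> "d\<^sup>2"] \<kappa> by simp
    also have "\<dots> = newt_mass * (\<eta> * d\<^sup>2)" by (simp add: \<kappa>_def)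
    finally have "\<bar>w x\<bar> \<le> \<eta> * d\<^sup>2" using newt_mass_pos by simp
    then show ?thesis by (simp add: w_def n_def)
  qed
  then show ?thesis using \<delta>(1) by blast
qed

end

section \<open>The Hessian near the boundary and the derivative of the gradient\<close>

lemma one_minus_cos_le: "\<bar>1 - cos t\<bar> \<le> \<bar>t::real\<bar>"
proof -
  have "cos (2 * (t / 2)) = 1 - 2 * (sin (t / 2))\<^sup>2" by (rule cos_double_sin)
  then have "1 - cos t = 2 * (\<bar>sin (t / 2)\<bar> * \<bar>sin (t / 2)\<bar>)" by (simp add: power2_eq_square)
  also have "\<bar>sin (t / 2)\<bar> * \<bar>sin (t / 2)\<bar> \<le> \<bar>sin (t / 2)\<bar> * 1" by (intro mult_left_mono) auto
  also have "\<bar>sin (t / 2)\<bar> \<le> \<bar>t / 2\<bar>" by (rule abs_sin_x_le_abs_x)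
  finally show ?thesis by simp
qed

lemma rank_one_diff_le:
  fixes m n a b :: "'a::real_inner"
  assumes "norm m = 1" "norm n = 1" "norm (m - n) \<le> \<omega>"
  shows "\<bar>(m \<bullet> a) * (m \<bullet> b) - (n \<bullet> a) * (n \<bullet> b)\<bar> \<le> 2 * \<omega> * norm a * norm b"
proof -
  have "\<bar>(m - n) \<bullet> a\<bar> \<le> \<omega> * norm a" "\<bar>(m - n) \<bullet> b\<bar> \<le> \<omega> * norm b"
    using Cauchy_Schwarz_ineq2[of "m - n" a] Cauchy_Schwarz_ineq2[of "m - n" b]
      mult_right_mono[OF assms(3), of "norm a"] mult_right_mono[OF assms(3), of "norm b"] by auto
  moreover have "\<bar>n \<bullet> a\<bar> \<le> norm a" "\<bar>m \<bullet> b\<bar> \<le> norm b"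
    using Cauchy_Schwarz_ineq2[of n a] Cauchy_Schwarz_ineq2[of m b] assms by auto
  ultimately have 1: "\<bar>(m - n) \<bullet> a\<bar> * \<bar>m \<bullet> b\<bar> \<le> \<omega> * norm a * norm b" 
    and 2: "\<bar>n \<bullet> a\<bar> * \<bar>(m - n) \<bullet> b\<bar> \<le> norm a * (\<omega> * norm b)"
    by (auto intro!: mult_mono intro: order_trans[OF abs_ge_zero])
  have "(m \<bullet> a) * (m \<bullet> b) - (n \<bullet> a) * (n \<bullet> b) = ((m - n) \<bullet> a) * (m \<bullet> b) + (n \<bullet> a) * ((m - n) \<bullet> b)"
    by (simp add: inner_diff_left algebra_simps)
  then have "\<bar>(m \<bullet> a) * (m \<bullet> b) - (n \<bullet> a) * (n \<bullet> b)\<bar> \<le> \<bar>(m - n) \<bullet> a\<bar> * \<bar>m \<bullet> b\<bar> + \<bar>n \<bullet> a\<bar> * \<bar>(m - n) \<bullet> b\<bar>"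
    by (metis abs_triangle_ineq abs_mult)
  then show ?thesis using 1 2 by (simp add: mult.commute mult.left_commute)
qed

context overdetermined begin

text \<open>The ball up to the nearest boundary point is connected and meets \<open>D\<close> but
  not its frontier, so it lies in \<open>D\<close>.\<close>

lemma nearest_frontier_point:
  assumes x: "x \<in> D" and s0: "s0 \<in> frontier D"
  obtains s where "s \<in> frontier D" "0 < dist x s" "ball x (dist x s) \<subseteq> D" "dist x s \<le> dist x s0"
proof -
  obtain s where s: "s \<in> frontier D" "\<And>y. y \<in> frontier D \<Longrightarrow> dist x s \<le> dist x y"
    using distance_attains_inf[of "frontier D" x] s0 by (auto simp: frontier_closed)
  have "x \<noteq> s" using frontier_notin[OF s(1)] x by auto
  moreover have "ball x (dist x s) \<subseteq> D"
  proof (rule ccontr)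
    assume "\<not> ball x (dist x s) \<subseteq> D"
    moreover have "x \<in> ball x (dist x s)" using \<open>x \<noteq> s\<close> by simp
    ultimately have "ball x (dist x s) \<inter> frontier D \<noteq> {}"
      using x by (intro connected_Int_frontier connected_ball) blast+
    then show False using s(2) by force
  qed
  ultimately show ?thesis using that[of s] s s0 by auto
qed

text \<open>The uncut profile has Laplacian c cos = c - k^2 times itself, so subtracting it from
  \<open>u\<close> removes the constant \<open>c\<close> and leaves a solution of the homogeneous
  equation.\<close>

lemma solution_helmholtz:
  assumes "D' \<subseteq> D" "open D'" and n: "norm n = 1"
  shows "\<And>y. y \<in> D' \<Longrightarrow> ((\<lambda>y. u y - c / k\<^sup>2 * (1 - cos (k * (n \<bullet> (y - s))))) has_derivative (\<lambda>h. (G y - (c / k * sin (k * (n \<bullet> (y - s)))) *\<^sub>R n) \<bullet> h)) (at y)"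
    and "\<And>y. y \<in> D' \<Longrightarrow> ((\<lambda>y. G y - (c / k * sin (k * (n \<bullet> (y - s)))) *\<^sub>R n) has_derivative (\<lambda>h. H y h - (c * cos (k * (n \<bullet> (y - s))) * (n \<bullet> h)) *\<^sub>R n)) (at y)"
    and "\<And>b. continuous_on D' (\<lambda>y. H y b - (c * cos (k * (n \<bullet> (y - s))) * (n \<bullet> b)) *\<^sub>R n)"
    and "\<And>y. y \<in> D' \<Longrightarrow> (\<Sum>b\<in>Basis. (H y b - (c * cos (k * (n \<bullet> (y - s))) * (n \<bullet> b)) *\<^sub>R n) \<bullet> b) = - (k\<^sup>2 * (u y - c / k\<^sup>2 * (1 - cos (k * (n \<bullet> (y - s))))))"
proof -
  fix y assume "y \<in> D'"
  then have y: "y \<in> D" using assms by auto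
  have d1: "((\<lambda>y. c / k\<^sup>2 * (1 - cos (k * (n \<bullet> (y - s))))) has_derivative (\<lambda>h. c / k * sin (k * (n \<bullet> (y - s))) * (n \<bullet> h))) (at y)"
    using k by (auto intro!: derivative_eq_intros simp: fun_eq_iff power2_eq_square)
  show "((\<lambda>y. u y - c / k\<^sup>2 * (1 - cos (k * (n \<bullet> (y - s))))) has_derivative (\<lambda>h. (G y - (c / k * sin (k * (n \<bullet> (y - s)))) *\<^sub>R n) \<bullet> h)) (at y)"
    by (rule has_derivative_eq_rhs[OF has_derivative_diff[OF du_at[OF y] d1]]) (simp add: fun_eq_iff inner_diff_left)
  have d2: "((\<lambda>y. (c / k * sin (k * (n \<bullet> (y - s)))) *\<^sub>R n) has_derivative (\<lambda>h. (c * cos (k * (n \<bullet> (y - s))) * (n \<bullet> h)) *\<^sub>R n)) (at y)"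
    using k by (auto intro!: derivative_eq_intros simp: fun_eq_iff)
  show "((\<lambda>y. G y - (c / k * sin (k * (n \<bullet> (y - s)))) *\<^sub>R n) has_derivative (\<lambda>h. H y h - (c * cos (k * (n \<bullet> (y - s))) * (n \<bullet> h)) *\<^sub>R n)) (at y)"
    by (rule has_derivative_diff[OF dG[OF y] d2])
  have nn: "n \<bullet> n = 1" using n by (simp add: dot_square_norm)
  have "(\<Sum>b\<in>Basis. (H y b - (c * cos (k * (n \<bullet> (y - s))) * (n \<bullet> b)) *\<^sub>R n) \<bullet> b) = (\<Sum>b\<in>Basis. H y b \<bullet> b) - c * cos (k * (n \<bullet> (y - s))) * (\<Sum>b\<in>Basis. (n \<bullet> b) * (n \<bullet> b))"
    by (simp add: inner_diff_left sum_subtractf sum_distrib_left mult.assoc)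
  also have "\<dots> = c - k\<^sup>2 * u y - c * cos (k * (n \<bullet> (y - s)))"
    unfolding euclidean_inner[symmetric] nn lap[OF y] by simp
  also have "\<dots> = - (k\<^sup>2 * (u y - c / k\<^sup>2 * (1 - cos (k * (n \<bullet> (y - s))))))"
    using k by (simp add: right_diff_distrib)
  finally show "(\<Sum>b\<in>Basis. (H y b - (c * cos (k * (n \<bullet> (y - s))) * (n \<bullet> b)) *\<^sub>R n) \<bullet> b) = - (k\<^sup>2 * (u y - c / k\<^sup>2 * (1 - cos (k * (n \<bullet> (y - s))))))" .
next
  show "continuous_on D' (\<lambda>y. H y b - (c * cos (k * (n \<bullet> (y - s))) * (n \<bullet> b)) *\<^sub>R n)" for b
    by (intro continuous_intros continuous_on_subset[OF cH assms(1)])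
qed

text \<open>For \<open>x\<close> at distance d from its nearest boundary point \<open>s\<close>, the
  comparison error of size eta' d^2 and the interior estimate at scale d/16 combine to a small bound
  independent of d. Three errors of size eta/3 remain: this one, the replacement of the cosine by 1,
  and the passage from the normal at \<open>s\<close> to that at \<open>s0\<close>.\<close>

lemma hessian_limit:
  assumes s0: "s0 \<in> frontier D" and ch: "chart D s0 r phi g" and \<eta>: "\<eta> > 0"
  defines "n0 \<equiv> (1 / norm (g s0)) *\<^sub>R g s0"
  shows "\<exists>\<delta>>0. \<forall>x\<in>D \<inter> ball s0 \<delta>. \<forall>a b. \<bar>H x a \<bullet> b - c * ((n0 \<bullet> a) * (n0 \<bullet> b))\<bar> \<le> \<eta> * norm a * norm b"
proof -
  define hc where "hc = helm_const k"
  have hc: "hc \<ge> 0" by (simp add: hc_def helm_const_nonneg)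
  \<comment> \<open>The factor 256 is 16^2, from the radius d/16 in the interior estimate.\<close>
  define \<eta>' where "\<eta>' = \<eta> / (3 * (256 * hc + 1))"
  have \<eta>': "\<eta>' > 0" "256 * hc * \<eta>' \<le> \<eta> / 3" using \<eta> hc by (auto simp: \<eta>'_def field_simps)
  define \<omega> where "\<omega> = min (1/16) (\<eta> / (6 * (\<bar>c\<bar> + 1)))"
  have "\<eta> / (6 * (\<bar>c\<bar> + 1)) > 0" using \<eta> by (simp add: add_nonneg_pos)
  then have "0 < \<omega>" by (simp add: \<omega>_def)
  moreover have "\<omega> \<le> 1/16" "\<omega> \<le> \<eta> / (6 * (\<bar>c\<bar> + 1))"
    unfolding \<omega>_def by (rule min.cobounded1, rule min.cobounded2)
  ultimately have \<omega>: "0 < \<omega>" "\<omega> \<le> 1/16" "\<omega> \<le> \<eta> / (6 * (\<bar>c\<bar> + 1))" by auto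
  have c\<omega>: "\<bar>c\<bar> * (2 * \<omega>) \<le> \<eta> / 3"
  proof -
    have "\<bar>c\<bar> * \<omega> \<le> \<bar>c\<bar> * (\<eta> / (6 * (\<bar>c\<bar> + 1)))" using \<omega> by (intro mult_left_mono) auto
    also have "\<dots> \<le> \<eta> / 6" using \<eta> by (simp add: field_simps)
    finally show ?thesis by simp
  qed
  have "\<omega> \<le> 1" using \<omega> by simp
  then obtain \<rho> where \<rho>: "\<rho> > 0" "\<rho> \<le> r"
    and gne: "\<And>x. x \<in> ball s0 \<rho> \<Longrightarrow> g x \<noteq> 0"
    and nd: "\<And>x. x \<in> ball s0 \<rho> \<Longrightarrow> norm ((1 / norm (g x)) *\<^sub>R g x - (1 / norm (g s0)) *\<^sub>R g s0) \<le> \<omega>"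
    and thin: "\<And>s y. s \<in> frontier D \<Longrightarrow> s \<in> ball s0 \<rho> \<Longrightarrow> y \<in> ball s0 \<rho> \<Longrightarrow>
       (y \<in> D \<and> ((1 / norm (g s)) *\<^sub>R g s) \<bullet> (y - s) \<ge> 0) \<or> (y \<notin> D \<and> ((1 / norm (g s)) *\<^sub>R g s) \<bullet> (y - s) \<le> 0) \<or> y \<in> frontier D \<Longrightarrow>
       \<bar>((1 / norm (g s)) *\<^sub>R g s) \<bullet> (y - s)\<bar> \<le> \<omega> * norm (y - s)"
    using chart_thin[OF ch oD \<omega>(1)] by metis
  obtain \<delta>1 where \<delta>1: "\<delta>1 > 0" and key: "\<forall>s\<in>frontier D \<inter> ball s0 \<delta>1. \<forall>d. 0 < d \<and> d < \<delta>1 \<longrightarrow>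
     (\<forall>x\<in>cball s (2 * d). \<bar>ut x - half_sol c k ((1 / norm (g s)) *\<^sub>R g s) s x\<bar> \<le> \<eta>' * d\<^sup>2)"
    using key_estimate[OF s0 ch \<eta>'(1)] by blast
  define \<delta>2 where "\<delta>2 = \<eta> / (3 * (\<bar>c\<bar> * k + 1))"
  have \<delta>2: "\<delta>2 > 0" using \<eta> k by (simp add: \<delta>2_def add_nonneg_pos)
  define \<delta> where "\<delta> = min (min (\<rho> / 8) (\<delta>1 / 2)) (min 1 \<delta>2)"
  have "\<delta> > 0" using \<rho> \<delta>1 \<delta>2 by (auto simp: \<delta>_def)
  moreover have "\<delta> \<le> \<rho> / 8" "\<delta> \<le> \<delta>1 / 2" "\<delta> \<le> 1" "\<delta> \<le> \<delta>2" by (auto simp: \<delta>_def)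
  ultimately have \<delta>: "\<delta> > 0" "\<delta> \<le> \<rho> / 8" "\<delta> \<le> \<delta>1 / 2" "\<delta> \<le> 1" "\<delta> \<le> \<delta>2" by auto
  have "\<bar>H x a \<bullet> b - c * ((n0 \<bullet> a) * (n0 \<bullet> b))\<bar> \<le> \<eta> * norm a * norm b" if x: "x \<in> D" "x \<in> ball s0 \<delta>" for x a b
  proof -
    obtain s where s: "s \<in> frontier D" "0 < dist x s" "ball x (dist x s) \<subseteq> D" "dist x s \<le> dist x s0"
      using nearest_frontier_point[OF x(1) s0] by blast
    define d where "d = dist x s"
    have d: "0 < d" "d < \<delta>" using s x by (auto simp: d_def dist_commute)
    have ss0: "dist s0 s < 2 * \<delta>" using dist_triangle[of s0 s x] d x by (simp add: d_def)
    have s\<rho>: "s \<in> ball s0 \<rho>" using ss0 \<delta> by simp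
    have s\<delta>1: "s \<in> frontier D \<inter> ball s0 \<delta>1" using ss0 \<delta> s by simp
    define n where "n = (1 / norm (g s)) *\<^sub>R g s"
    have n: "norm n = 1" using gne[OF s\<rho>] by (simp add: n_def)
    have n0: "norm n0 = 1" using gne[of s0] \<rho> by (simp add: n0_def)
    have nn0: "norm (n - n0) \<le> \<omega>" using nd[OF s\<rho>] by (simp add: n_def n0_def)
    have nn: "n \<bullet> n = 1" using n by (simp add: dot_square_norm)
    define D' where "D' = ball x d \<inter> {y. n \<bullet> (y - s) < 0}"
    have D'D: "D' \<subseteq> D" using s(3) by (auto simp: D'_def d_def)
    have oD': "open D'" unfolding D'_def by (intro open_Int open_Collect_less continuous_intros) auto
    define \<epsilon> where "\<epsilon> = d / 16"
    have \<epsilon>: "\<epsilon> > 0" "\<epsilon> \<le> 1" using d \<delta> by (auto simp: \<epsilon>_def)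
    have sub: "cball x (8 * \<epsilon>) \<subseteq> D'"
    proof
      fix y assume y: "y \<in> cball x (8 * \<epsilon>)"
      then have yx: "dist x y \<le> d / 2" by (simp add: \<epsilon>_def)
      have "n \<bullet> (y - s) < 0"
      proof (rule ccontr)
        assume "\<not> n \<bullet> (y - s) < 0"
        \<comment> \<open>If the ball of radius d/2 left the half-space, moving on by d/4 along the
          normal would stay in \<open>D\<close>, yet reach height d/4, while thinness allows at most
          2 d / 16 = d/8.\<close>
        define z where "z = y + (d / 4) *\<^sub>R n"
        have nz: "n \<bullet> (z - s) \<ge> d / 4"
          using \<open>\<not> n \<bullet> (y - s) < 0\<close> nn by (simp add: z_def inner_diff_right inner_add_right)
        have "dist y z = d / 4" using n d by (simp add: z_def dist_norm)
        then have zx: "dist x z < d" using dist_triangle[of x z y] yx d by linarith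
        then have zD: "z \<in> D" using s(3) by (auto simp: d_def)
        have zs: "dist s z < 2 * d" using dist_triangle[of s z x] zx by (simp add: d_def dist_commute)
        have "z \<in> ball s0 \<rho>" using dist_triangle[of s0 z s] zs ss0 d \<delta> by simp
        moreover have "n \<bullet> (z - s) \<ge> 0" using nz d by linarith
        ultimately have "\<bar>n \<bullet> (z - s)\<bar> \<le> \<omega> * norm (z - s)"
          using thin[OF s(1) s\<rho>, of z] zD unfolding n_def by blast
        also have "\<dots> \<le> 1/16 * (2 * d)"
          using \<omega> zs by (intro mult_mono) (auto simp: dist_norm norm_minus_commute)
        finally show False using nz d by simp
      qed
      then show "y \<in> D'" using yx d by (simp add: D'_def)
    qed
    have xD': "x \<in> D'" using sub \<epsilon> by auto
    have bd: "\<bar>u y - c / k\<^sup>2 * (1 - cos (k * (n \<bullet> (y - s))))\<bar> \<le> \<eta>' * d\<^sup>2" if "y \<in> cball x \<epsilon>" for y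
    proof -
      have y: "y \<in> D'" using that sub \<epsilon> by auto
      have "dist x y \<le> d / 16" using that by (simp add: \<epsilon>_def)
      then have "dist s y \<le> 2 * d"
        using dist_triangle[of s y x] d dist_commute[of s x] unfolding d_def by linarith
      then have "\<bar>ut y - half_sol c k n s y\<bar> \<le> \<eta>' * d\<^sup>2"
        using key s\<delta>1 d \<delta> unfolding n_def by simp
      moreover have "ut y = u y" using y D'D by (auto simp: ut_def)
      moreover have "half_sol c k n s y = c / k\<^sup>2 * (1 - cos (k * (n \<bullet> (y - s))))" using y by (simp add: half_sol_def D'_def)
      ultimately show ?thesis by simp
    qed
    note sh = solution_helmholtz[OF D'D oD' n, where s = s]
    have "\<bar>(H x a - (c * cos (k * (n \<bullet> (x - s))) * (n \<bullet> a)) *\<^sub>R n) \<bullet> b\<bar> \<le> hc * (\<eta>' * d\<^sup>2) / \<epsilon>\<^sup>2 * norm a * norm b"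
      unfolding hc_def by (rule helmholtz_interior(2)[OF oD' sh sub \<epsilon> bd])
    also have "hc * (\<eta>' * d\<^sup>2) / \<epsilon>\<^sup>2 = 256 * hc * \<eta>'" using d by (simp add: \<epsilon>_def field_simps)
    finally have 1: "\<bar>H x a \<bullet> b - c * cos (k * (n \<bullet> (x - s))) * ((n \<bullet> a) * (n \<bullet> b))\<bar> \<le> \<eta> / 3 * norm a * norm b"
      using mult_right_mono[OF \<eta>'(2), of "norm a * norm b"] by (simp add: inner_diff_left mult.assoc)
    have na: "\<bar>n \<bullet> a\<bar> * \<bar>n \<bullet> b\<bar> \<le> norm a * norm b"
      using Cauchy_Schwarz_ineq2[of n a] Cauchy_Schwarz_ineq2[of n b] n by (intro mult_mono) auto
    have "\<bar>1 - cos (k * (n \<bullet> (x - s)))\<bar> \<le> k * d"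
    proof -
      have "\<bar>n \<bullet> (x - s)\<bar> \<le> d" using Cauchy_Schwarz_ineq2[of n "x - s"] n by (simp add: d_def dist_norm)
      then have "\<bar>k * (n \<bullet> (x - s))\<bar> \<le> k * d" using k by (simp add: abs_mult)
      then show ?thesis using one_minus_cos_le[of "k * (n \<bullet> (x - s))"] by linarith
    qed
    then have "\<bar>c\<bar> * \<bar>1 - cos (k * (n \<bullet> (x - s)))\<bar> \<le> \<bar>c\<bar> * (k * d)" by (intro mult_left_mono) auto
    also have "\<dots> \<le> \<bar>c\<bar> * (k * \<delta>2)" using d \<delta> k by (intro mult_left_mono) auto
    also have "\<dots> \<le> \<eta> / 3"
    proof -
      have ck: "\<bar>c\<bar> * k \<ge> 0" using k by simp
      have "\<bar>c\<bar> * k * \<delta>2 = \<eta> / 3 * (\<bar>c\<bar> * k / (\<bar>c\<bar> * k + 1))" by (simp add: \<delta>2_def)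
      also have "\<dots> \<le> \<eta> / 3 * 1" using \<eta> ck by (intro mult_left_mono) (auto simp: divide_le_eq)
      finally show ?thesis by simp
    qed
    finally have "(\<bar>c\<bar> * \<bar>1 - cos (k * (n \<bullet> (x - s)))\<bar>) * (\<bar>n \<bullet> a\<bar> * \<bar>n \<bullet> b\<bar>) \<le> \<eta> / 3 * (norm a * norm b)"
      using \<eta> by (intro mult_mono[OF _ na]) auto
    moreover have "\<bar>c * cos (k * (n \<bullet> (x - s))) * ((n \<bullet> a) * (n \<bullet> b)) - c * ((n \<bullet> a) * (n \<bullet> b))\<bar> =
        (\<bar>c\<bar> * \<bar>1 - cos (k * (n \<bullet> (x - s)))\<bar>) * (\<bar>n \<bullet> a\<bar> * \<bar>n \<bullet> b\<bar>)"
    proof -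
      have "c * cos (k * (n \<bullet> (x - s))) * ((n \<bullet> a) * (n \<bullet> b)) - c * ((n \<bullet> a) * (n \<bullet> b)) = - (c * (1 - cos (k * (n \<bullet> (x - s)))) * ((n \<bullet> a) * (n \<bullet> b)))"
        by (simp add: algebra_simps)
      then show ?thesis by (simp only: abs_minus_cancel abs_mult)
    qed
    ultimately have 2: "\<bar>c * cos (k * (n \<bullet> (x - s))) * ((n \<bullet> a) * (n \<bullet> b)) - c * ((n \<bullet> a) * (n \<bullet> b))\<bar> \<le> \<eta> / 3 * norm a * norm b"
      by (simp only: mult.assoc)
    have "\<bar>c\<bar> * \<bar>(n \<bullet> a) * (n \<bullet> b) - (n0 \<bullet> a) * (n0 \<bullet> b)\<bar> \<le> \<bar>c\<bar> * (2 * \<omega> * norm a * norm b)"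
      by (intro mult_left_mono rank_one_diff_le n n0 nn0) auto
    also have "\<dots> \<le> \<eta> / 3 * norm a * norm b"
      using mult_right_mono[OF c\<omega>, of "norm a * norm b"] by (simp add: mult.assoc)
    finally have 3: "\<bar>c * ((n \<bullet> a) * (n \<bullet> b)) - c * ((n0 \<bullet> a) * (n0 \<bullet> b))\<bar> \<le> \<eta> / 3 * norm a * norm b"
      by (simp only: right_diff_distrib[symmetric] abs_mult)
    have "\<eta> * norm a * norm b = \<eta> / 3 * norm a * norm b + \<eta> / 3 * norm a * norm b + \<eta> / 3 * norm a * norm b" by simp
    then show ?thesis using 1 2 3 by linarith
  qed
  then show ?thesis using \<delta>(1) by blast
qed

text \<open>A segment from \<open>y\<close> to \<open>s0\<close> might leave \<open>D\<close>, so
  the Hessian limit is integrated only from \<open>y\<close> to its nearest boundary point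
  \<open>s\<close>, inside a ball contained in \<open>D\<close>. At \<open>s\<close> the gradient is
  0, and the linear term is small there because \<open>s\<close> is close to the tangent plane at
  \<open>s0\<close>.\<close>

lemma gradient_derivative_boundary:
  assumes s0: "s0 \<in> frontier D" and ch: "chart D s0 r phi g"
  defines "n0 \<equiv> (1 / norm (g s0)) *\<^sub>R g s0"
  shows "(G has_derivative (\<lambda>h. (c * (n0 \<bullet> h)) *\<^sub>R n0)) (at s0 within closure D)"
  unfolding has_derivative_within_alt
proof (intro conjI allI impI)
  show "bounded_linear (\<lambda>h. (c * (n0 \<bullet> h)) *\<^sub>R n0)"
    by (intro bounded_linear_intros)
  fix e :: real assume e: "e > 0"
  obtain \<delta>2 where \<delta>2: "\<delta>2 > 0" and hl: "\<And>x a b. x \<in> D \<Longrightarrow> x \<in> ball s0 \<delta>2 \<Longrightarrow> \<bar>H x a \<bullet> b - c * ((n0 \<bullet> a) * (n0 \<bullet> b))\<bar> \<le> e / 2 * norm a * norm b"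
    using hessian_limit[OF s0 ch, of "e / 2"] e unfolding n0_def by (metis IntI half_gt_zero)
  define \<omega> where "\<omega> = min 1 (e / (4 * (\<bar>c\<bar> + 1)))"
  have "e / (4 * (\<bar>c\<bar> + 1)) > 0" using e by (simp add: add_nonneg_pos)
  then have \<omega>: "0 < \<omega>" "\<omega> \<le> 1" "\<omega> \<le> e / (4 * (\<bar>c\<bar> + 1))" by (auto simp: \<omega>_def)
  have c\<omega>: "\<bar>c\<bar> * \<omega> \<le> e / 4"
  proof -
    have "\<bar>c\<bar> * \<omega> \<le> \<bar>c\<bar> * (e / (4 * (\<bar>c\<bar> + 1)))" using \<omega> by (intro mult_left_mono) auto
    also have "\<dots> \<le> e / 4" using e by (simp add: field_simps)
    finally show ?thesis .
  qed
  obtain \<rho> where \<rho>: "\<rho> > 0" and gne: "g s0 \<noteq> 0"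
    and thin: "\<And>y. y \<in> ball s0 \<rho> \<Longrightarrow> y \<in> frontier D \<Longrightarrow> \<bar>n0 \<bullet> (y - s0)\<bar> \<le> \<omega> * norm (y - s0)"
  proof (rule chart_thin[OF ch oD \<omega>(1,2)])
    fix \<rho> assume "\<rho> > 0" "\<And>x. x \<in> ball s0 \<rho> \<Longrightarrow> g x \<noteq> 0"
      "\<And>s y. s \<in> frontier D \<Longrightarrow> s \<in> ball s0 \<rho> \<Longrightarrow> y \<in> ball s0 \<rho> \<Longrightarrow>
       (y \<in> D \<and> ((1 / norm (g s)) *\<^sub>R g s) \<bullet> (y - s) \<ge> 0) \<or> (y \<notin> D \<and> ((1 / norm (g s)) *\<^sub>R g s) \<bullet> (y - s) \<le> 0) \<or> y \<in> frontier D \<Longrightarrow>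
       \<bar>((1 / norm (g s)) *\<^sub>R g s) \<bullet> (y - s)\<bar> \<le> \<omega> * norm (y - s)"
    then show thesis using that[of \<rho>] s0 by (simp add: n0_def)
  qed
  have n0: "norm n0 = 1" using gne by (simp add: n0_def)
  have fr: "norm ((c * (n0 \<bullet> (y - s0))) *\<^sub>R n0) \<le> e / 4 * norm (y - s0)" if "y \<in> ball s0 \<rho>" "y \<in> frontier D" for y
  proof -
    have "\<bar>c\<bar> * \<bar>n0 \<bullet> (y - s0)\<bar> \<le> \<bar>c\<bar> * (\<omega> * norm (y - s0))" by (intro mult_left_mono thin that) auto
    also have "\<dots> \<le> e / 4 * norm (y - s0)" using mult_right_mono[OF c\<omega>, of "norm (y - s0)"] by (simp add: mult.assoc)
    finally show ?thesis using n0 by (simp add: abs_mult)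
  qed
  define \<delta> where "\<delta> = min (\<delta>2 / 2) (\<rho> / 4)"
  have \<delta>: "\<delta> > 0" "\<delta> \<le> \<delta>2 / 2" "\<delta> \<le> \<rho> / 4" using \<delta>2 \<rho> by (auto simp: \<delta>_def)
  have "norm (G y - G s0 - (c * (n0 \<bullet> (y - s0))) *\<^sub>R n0) \<le> e * norm (y - s0)"
    if y: "y \<in> closure D" "norm (y - s0) < \<delta>" for y
  proof (cases "y \<in> D")
    case False
    then have yf: "y \<in> frontier D" using y by (simp add: frontier_def interior_open[OF oD])
    have "y \<in> ball s0 \<rho>" using y \<delta> \<rho> by (simp add: dist_norm norm_minus_commute)
    from fr[OF this yf] have "norm ((c * (n0 \<bullet> (y - s0))) *\<^sub>R n0) \<le> e / 4 * norm (y - s0)" .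
    also have "\<dots> \<le> e * norm (y - s0)" using e by (intro mult_right_mono) auto
    finally show ?thesis unfolding G0[OF yf] G0[OF s0] diff_self diff_0 norm_minus_cancel .
  next
    case True
    obtain s where s: "s \<in> frontier D" "0 < dist y s" "ball y (dist y s) \<subseteq> D" "dist y s \<le> dist y s0"
      using nearest_frontier_point[OF True s0] by blast
    define d where "d = dist y s"
    have dy: "d \<le> norm (y - s0)" using s(4) by (simp add: d_def dist_norm)
    define f where "f z = Gt z - (c * (n0 \<bullet> (z - s0))) *\<^sub>R n0" for z
    have cf: "isCont f s" 
    proof -
      have "continuous_on UNIV f" unfolding f_def[abs_def] by (intro continuous_intros continuous_Gt)
      then show ?thesis by (simp add: continuous_on_eq_continuous_at)
    qed
    \<comment> \<open>The endpoint \<open>s\<close> is not in the open ball, so it is approached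
      along the segment from \<open>y\<close> and reached by continuity.\<close>
    define z where "z m = s + (1 / real (Suc m)) *\<^sub>R (y - s)" for m
    have "(\<lambda>m. z m) \<longlonglongrightarrow> s + 0 *\<^sub>R (y - s)"
      unfolding z_def using LIMSEQ_Suc[OF lim_1_over_n] by (intro tendsto_intros) simp
    then have "(\<lambda>m. f (z m)) \<longlonglongrightarrow> f s" using isCont_tendsto_compose[OF cf] by simp
    then have lim: "(\<lambda>m. norm (f y - f (z m))) \<longlonglongrightarrow> norm (f y - f s)" by (intro tendsto_intros)
    have bd: "norm (f y - f (z m)) \<le> e / 2 * d" for m
    proof -
      have yz: "y - z m = (1 - 1 / real (Suc m)) *\<^sub>R (y - s)" by (simp add: z_def algebra_simps)
      have m1: "0 \<le> 1 - 1 / real (Suc m)" "1 - 1 / real (Suc m) < 1" by (auto simp: field_simps)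
      have nyz: "norm (y - z m) = (1 - 1 / real (Suc m)) * d"
        unfolding yz using m1 by (simp add: d_def dist_norm)
      have dpos: "d > 0" using s(2) by (simp add: d_def)
      have lt: "norm (y - z m) < d" unfolding nyz using m1(2) dpos by simp
      have "norm (f y - f (z m)) \<le> e / 2 * norm (y - z m)"
      proof (rule differentiable_bound[where S = "ball y d" and f' = "\<lambda>z h. H z h - (c * (n0 \<bullet> h)) *\<^sub>R n0"])
        fix q assume q: "q \<in> ball y d"
        have qD: "q \<in> D" using q s(3) by (auto simp: d_def)
        have "dist s0 q < \<delta>2" using dist_triangle[of s0 q y] q dy y \<delta> by (simp add: dist_norm norm_minus_commute)
        then have qb: "q \<in> ball s0 \<delta>2" by simp
        have "(Gt has_derivative H q) (at q)"
          by (rule has_derivative_transform_within_open[OF dG oD]) (use qD in \<open>auto simp: Gt_def\<close>)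
        then have "(f has_derivative (\<lambda>h. H q h - (c * (n0 \<bullet> h)) *\<^sub>R n0)) (at q)"
          unfolding f_def[abs_def] by (auto intro!: derivative_eq_intros)
        then show "(f has_derivative (\<lambda>h. H q h - (c * (n0 \<bullet> h)) *\<^sub>R n0)) (at q within ball y d)"
          by (rule has_derivative_at_withinI)
        show "onorm (\<lambda>h. H q h - (c * (n0 \<bullet> h)) *\<^sub>R n0) \<le> e / 2"
        proof (rule onorm_le)
          fix h
          \<comment> \<open>The bilinear bound is tested against the error vector itself, which
            turns it into a bound of its norm.\<close>
          define b where "b = H q h - (c * (n0 \<bullet> h)) *\<^sub>R n0"
          have "norm b * norm b = b \<bullet> b" by (simp add: dot_square_norm power2_eq_square)
          also have "\<dots> = H q h \<bullet> b - c * ((n0 \<bullet> h) * (n0 \<bullet> b))"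
            by (subst (1) b_def) (simp add: inner_diff_left)
          also have "\<dots> \<le> e / 2 * norm h * norm b" using hl[OF qD qb, of h b] by linarith
          finally have "norm b * norm b \<le> e / 2 * norm h * norm b" .
          then have "norm b \<le> e / 2 * norm h" using e by (cases "b = 0") auto
          then show "norm (H q h - (c * (n0 \<bullet> h)) *\<^sub>R n0) \<le> e / 2 * norm h" by (simp add: b_def)
        qed
      qed (use lt dpos in \<open>auto simp: dist_norm\<close>)
      also have "\<dots> \<le> e / 2 * d" using lt e by (intro mult_left_mono) auto
      finally show ?thesis .
    qed
    have "norm (f y - f s) \<le> e / 2 * d" by (rule LIMSEQ_le_const2[OF lim]) (use bd in auto)
    also have "\<dots> \<le> e / 2 * norm (y - s0)" using dy e by (intro mult_left_mono) auto
    finally have 1: "norm (f y - f s) \<le> e / 2 * norm (y - s0)" .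
    have ss: "norm (s - s0) \<le> 2 * norm (y - s0)"
      using norm_triangle_ineq4[of "y - s0" "y - s"] dy by (simp add: d_def dist_norm)
    then have "s \<in> ball s0 \<rho>" using y \<delta> \<rho> by (simp add: dist_norm norm_minus_commute)
    from fr[OF this s(1)] have "norm ((c * (n0 \<bullet> (s - s0))) *\<^sub>R n0) \<le> e / 4 * norm (s - s0)" .
    also have "\<dots> \<le> e / 4 * (2 * norm (y - s0))" using ss e by (intro mult_left_mono) auto
    finally have 2: "norm (f s) \<le> e / 2 * norm (y - s0)"
      using frontier_notin[OF s(1)] by (simp add: f_def Gt_def)
    have "norm (f y) \<le> norm (f y - f s) + norm (f s)" using norm_triangle_ineq[of "f y - f s" "f s"] by simp
    then have "norm (f y) \<le> e * norm (y - s0)" using 1 2 by linarith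
    then show ?thesis using True G0[OF s0] by (simp add: f_def Gt_def)
  qed
  then show "\<exists>d>0. \<forall>y\<in>closure D. norm (y - s0) < d \<longrightarrow> norm (G y - G s0 - (c * (n0 \<bullet> (y - s0))) *\<^sub>R n0) \<le> e * norm (y - s0)"
    using \<delta>(1) by blast
qed

end

section \<open>The rotation fields\<close>

lemma sum_Basis_vec: "(\<Sum>a\<in>Basis. f a) = (\<Sum>i\<in>UNIV. f (axis i (1::real) :: real^'n))"
proof -
  have B: "(Basis :: (real^'n) set) = range (\<lambda>i. axis i 1)" by (auto simp: Basis_vec_def)
  show ?thesis unfolding B by (subst sum.reindex) (auto simp: inj_on_def axis_eq_axis)
qed

context overdetermined begin

text \<open>The interior lemma produces third derivatives separately on each small ball;
  \<open>frechet_derivative\<close> gives them one name on all of \<open>D\<close>. The last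
  argument is the direction of the third differentiation.\<close>

definition T3 where "T3 x a b q = frechet_derivative (\<lambda>y. H y a \<bullet> b) (at x) q"

text \<open>Subtracting the constant c/k^2 makes \<open>u\<close> a solution of the homogeneous
  equation without changing gradient or Hessian, so the interior lemma applies.\<close>

lemma hessian_symmetric: "x \<in> D \<Longrightarrow> H x a \<bullet> b = H x b \<bullet> a"
  and hessian_has_derivative: "x \<in> D \<Longrightarrow> ((\<lambda>y. H y a \<bullet> b) has_derivative T3 x a b) (at x)"
  and T3_symmetric: "x \<in> D \<Longrightarrow> T3 x a b q = T3 x b a q" "x \<in> D \<Longrightarrow> T3 x a b q = T3 x a q b"
  and continuous_T3: "continuous_on D (\<lambda>x. T3 x a b q)"
proof -
  have loc: "\<exists>\<epsilon>>0. ball x \<epsilon> \<subseteq> D \<and> (\<forall>y\<in>ball x \<epsilon>. \<forall>a b. ((\<lambda>y. H y a \<bullet> b) has_derivative T3 y a b) (at y) \<and> H y a \<bullet> b = H y b \<bullet> a \<and>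
      (\<forall>q. continuous_on (ball x \<epsilon>) (\<lambda>y. T3 y a b q) \<and> T3 y a b q = T3 y b a q \<and> T3 y a b q = T3 y a q b))" if x: "x \<in> D" for x
  proof -
    obtain e where e: "e > 0" "cball x e \<subseteq> D" using oD x open_contains_cball by blast
    define \<epsilon> where "\<epsilon> = e / 8"
    have \<epsilon>: "\<epsilon> > 0" "cball x (8 * \<epsilon>) \<subseteq> D" "ball x \<epsilon> \<subseteq> cball x e" using e by (auto simp: \<epsilon>_def)
    have d1: "((\<lambda>y. u y - c / k\<^sup>2) has_derivative (\<lambda>h. G y \<bullet> h)) (at y)" if "y \<in> D" for y
      using has_derivative_diff[OF du_at[OF that] has_derivative_const] by simp
    have d2: "(\<Sum>b\<in>Basis. H y b \<bullet> b) = - (k\<^sup>2 * (u y - c / k\<^sup>2))" if "y \<in> D" for y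
      using lap[OF that] k by (simp add: right_diff_distrib)
    from helmholtz_interior(1)[OF oD d1 dG cH d2 \<epsilon>(2,1)] obtain T where T:
      "\<forall>y\<in>ball x \<epsilon>. \<forall>a b. ((\<lambda>y. H y a \<bullet> b) has_derivative T y a b) (at y) \<and> H y a \<bullet> b = H y b \<bullet> a \<and>
      (\<forall>q. continuous_on (ball x \<epsilon>) (\<lambda>y. T y a b q) \<and> T y a b q = T y b a q \<and> T y a b q = T y a q b)" by blast
    have TT: "T3 y a b q = T y a b q" if "y \<in> ball x \<epsilon>" for y a b q
    proof -
      have "((\<lambda>y. H y a \<bullet> b) has_derivative T y a b) (at y)" using T that by blast
      from frechet_derivative_at[OF this] show ?thesis by (simp add: T3_def)
    qed
    have TT': "T3 y a b = T y a b" if "y \<in> ball x \<epsilon>" for y a b using TT[OF that] by (intro ext)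
    have cT: "continuous_on (ball x \<epsilon>) (\<lambda>y. T3 y a b q)" for a b q
    proof -
      have "continuous_on (ball x \<epsilon>) (\<lambda>y. T y a b q)" using T \<epsilon>(1) by (meson centre_in_ball)
      then show ?thesis using continuous_on_cong[of "ball x \<epsilon>" "ball x \<epsilon>" "\<lambda>y. T3 y a b q" "\<lambda>y. T y a b q"] TT by simp
    qed
    have "ball x \<epsilon> \<subseteq> D" using \<epsilon>(3) e(2) by blast
    then show ?thesis using \<epsilon>(1) T cT by (intro exI[of _ \<epsilon>]) (simp add: TT TT')
  qed
  have pt: "((\<lambda>y. H y a \<bullet> b) has_derivative T3 x a b) (at x) \<and> H x a \<bullet> b = H x b \<bullet> a \<and>
      T3 x a b q = T3 x b a q \<and> T3 x a b q = T3 x a q b \<and> isCont (\<lambda>y. T3 y a b q) x" if x: "x \<in> D" for x a b q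
  proof -
    from loc[OF x] obtain \<epsilon> where \<epsilon>: "\<epsilon> > 0" and L: "\<forall>y\<in>ball x \<epsilon>. \<forall>a b. ((\<lambda>y. H y a \<bullet> b) has_derivative T3 y a b) (at y) \<and> H y a \<bullet> b = H y b \<bullet> a \<and>
      (\<forall>q. continuous_on (ball x \<epsilon>) (\<lambda>y. T3 y a b q) \<and> T3 y a b q = T3 y b a q \<and> T3 y a b q = T3 y a q b)" by blast
    have xb: "x \<in> ball x \<epsilon>" using \<epsilon> by simp
    note L' = L[THEN bspec, OF xb, THEN spec[of _ a], THEN spec[of _ b]]
    note L3 = conjunct2[OF conjunct2[OF L'], THEN spec[of _ q]]
    have "isCont (\<lambda>y. T3 y a b q) x"
      using conjunct1[OF L3] xb by (simp add: continuous_on_eq_continuous_at)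
    then show ?thesis
      using conjunct1[OF L'] conjunct1[OF conjunct2[OF L']] conjunct2[OF L3] by blast
  qed
  show "x \<in> D \<Longrightarrow> H x a \<bullet> b = H x b \<bullet> a"
    "x \<in> D \<Longrightarrow> ((\<lambda>y. H y a \<bullet> b) has_derivative T3 x a b) (at x)"
    "x \<in> D \<Longrightarrow> T3 x a b q = T3 x b a q" "x \<in> D \<Longrightarrow> T3 x a b q = T3 x a q b" 
    using pt by blast+
  show "continuous_on D (\<lambda>x. T3 x a b q)"
    using pt by (intro continuous_at_imp_continuous_on) blast
qed

text \<open>Differentiating the equation for the Laplacian; the constant \<open>c\<close>
  disappears.\<close>

lemma T3_trace: "x \<in> D \<Longrightarrow> (\<Sum>a\<in>Basis. T3 x a a q) = - (k\<^sup>2 * (G x \<bullet> q))"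
proof -
  assume x: "x \<in> D"
  have "((\<lambda>y. \<Sum>a\<in>Basis. H y a \<bullet> a) has_derivative (\<lambda>q. \<Sum>a\<in>Basis. T3 x a a q)) (at x)"
    by (intro has_derivative_sum hessian_has_derivative x)
  note d1 = this
  have "((\<lambda>y. c - k\<^sup>2 * u y) has_derivative (\<lambda>q. - (k\<^sup>2 * (G x \<bullet> q)))) (at x)"
    by (rule has_derivative_eq_rhs[OF has_derivative_diff[OF has_derivative_const has_derivative_mult_right[OF du_at[OF x]]]]) simp
  then have d2: "((\<lambda>y. \<Sum>a\<in>Basis. H y a \<bullet> a) has_derivative (\<lambda>q. - (k\<^sup>2 * (G x \<bullet> q)))) (at x)"
    by (rule has_derivative_transform_within_open[OF _ oD x]) (simp add: lap)
  show ?thesis by (rule fun_cong[OF has_derivative_unique[OF d1 d2]])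
qed

lemma cross3_skew: "cross3 e v \<bullet> w = - (cross3 e w \<bullet> v)" for e v w :: "real^3"
  by (simp add: cross3_def inner_vec_def sum_3 vector_3 algebra_simps)

lemma cross3_cyclic: "cross3 v e \<bullet> w = v \<bullet> cross3 e w" for e v w :: "real^3"
  by (simp add: cross3_def inner_vec_def sum_3 vector_3 algebra_simps)

lemma hessian_expand: "x \<in> D \<Longrightarrow> H x v \<bullet> w = (\<Sum>b\<in>Basis. (v \<bullet> b) * (H x b \<bullet> w))"
proof -
  assume x: "x \<in> D"
  have lin: "linear (H x)" using dG[OF x] has_derivative_linear by blast
  have "H x v = H x (\<Sum>b\<in>Basis. (v \<bullet> b) *\<^sub>R b)" by (simp add: euclidean_representation)
  also have "\<dots> = (\<Sum>b\<in>Basis. (v \<bullet> b) *\<^sub>R H x b)" by (simp add: linear_sum[OF lin] linear_cmul[OF lin])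
  finally show ?thesis by (simp add: inner_sum_left)
qed

text \<open>The trace of a symmetric times a skew-symmetric matrix vanishes.\<close>

lemma hessian_skew_trace:
  assumes x: "x \<in> D"
  shows "(\<Sum>a\<in>Basis. H x (cross3 e a) \<bullet> a) = 0"
proof -
  define S where "S = (\<Sum>a\<in>Basis. H x (cross3 e a) \<bullet> a)"
  have S1: "S = (\<Sum>a\<in>Basis. \<Sum>b\<in>Basis. (cross3 e a \<bullet> b) * (H x b \<bullet> a))"
    unfolding S_def by (simp add: hessian_expand[OF x, of "cross3 e _"])
  also have "\<dots> = (\<Sum>a\<in>Basis. \<Sum>b\<in>Basis. (cross3 e b \<bullet> a) * (H x a \<bullet> b))" by (rule sum.swap)
  also have "\<dots> = (\<Sum>a\<in>Basis. \<Sum>b\<in>Basis. - ((cross3 e a \<bullet> b) * (H x b \<bullet> a)))"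
    by (intro sum.cong refl) (metis cross3_skew hessian_symmetric[OF x] mult_minus_left)
  also have "\<dots> = - S" unfolding S1 by (simp add: sum_negf)
  finally show ?thesis by (simp add: S_def)
qed

text \<open>The component along \<open>e\<close> of the rotation field \<open>x \<times> \<nabla>u\<close>.\<close>

definition rot where "rot e x = cross3 e x \<bullet> G x"
definition rot_grad where "rot_grad e x = H x (cross3 e x) + cross3 (G x) e"
text \<open>Assembled from components, since differentiability of the Hessian is available for its
  scalar entries.\<close>

definition rot_hess where "rot_hess e x h = (\<Sum>a\<in>Basis. (H x (cross3 e h) \<bullet> a
    + (\<Sum>b\<in>Basis. (cross3 e x \<bullet> b) * T3 x b a h) + cross3 (H x h) e \<bullet> a) *\<^sub>R a)"

lemma cross3_right_has_derivative:
  "(f has_derivative f') F \<Longrightarrow> ((\<lambda>x. cross3 e (f x)) has_derivative (\<lambda>h. cross3 e (f' h))) F"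
  using bounded_linear.has_derivative[OF linear_conv_bounded_linear[THEN iffD1, OF bilinear_cross[unfolded bilinear_def, THEN conjunct1, rule_format]]] .

lemma cross3_left_has_derivative:
  "(f has_derivative f') F \<Longrightarrow> ((\<lambda>x. cross3 (f x) e) has_derivative (\<lambda>h. cross3 (f' h) e)) F"
  using bounded_linear.has_derivative[OF linear_conv_bounded_linear[THEN iffD1, OF bilinear_cross[unfolded bilinear_def, THEN conjunct2, rule_format]]] .

lemma rot_has_derivative: "x \<in> D \<Longrightarrow> (rot e has_derivative (\<lambda>h. rot_grad e x \<bullet> h)) (at x)"
proof -
  assume x: "x \<in> D"
  have "(rot e has_derivative (\<lambda>h. cross3 e x \<bullet> H x h + cross3 e h \<bullet> G x)) (at x)"
    unfolding rot_def[abs_def]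
    by (rule has_derivative_inner[OF cross3_right_has_derivative[OF has_derivative_ident] dG[OF x]])
  moreover have "cross3 e x \<bullet> H x h + cross3 e h \<bullet> G x = rot_grad e x \<bullet> h" for h
    using hessian_symmetric[OF x, of "cross3 e x" h] cross3_cyclic[of "G x" e h]
    by (simp add: rot_grad_def inner_add_left inner_add_right inner_commute)
  ultimately show ?thesis by simp
qed

lemma rot_grad_has_derivative: "x \<in> D \<Longrightarrow> (rot_grad e has_derivative rot_hess e x) (at x)"
proof -
  assume x: "x \<in> D"
  have "((\<lambda>x. rot_grad e x \<bullet> a) has_derivative (\<lambda>h. rot_hess e x h \<bullet> a)) (at x)" if a: "a \<in> Basis" for a
  proof -
    have dc: "((\<lambda>x. cross3 e x \<bullet> b) has_derivative (\<lambda>h. cross3 e h \<bullet> b)) (at x)" for b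
      by (intro has_derivative_inner_left cross3_right_has_derivative has_derivative_ident)
    have 1: "((\<lambda>x. \<Sum>b\<in>Basis. (cross3 e x \<bullet> b) * (H x b \<bullet> a)) has_derivative
      (\<lambda>h. \<Sum>b\<in>Basis. (cross3 e x \<bullet> b) * T3 x b a h + (cross3 e h \<bullet> b) * (H x b \<bullet> a))) (at x)"
      by (intro has_derivative_sum has_derivative_mult dc hessian_has_derivative x)
    have 2: "((\<lambda>x. cross3 (G x) e \<bullet> a) has_derivative (\<lambda>h. cross3 (H x h) e \<bullet> a)) (at x)"
      by (intro has_derivative_inner_left cross3_left_has_derivative dG x)
    from has_derivative_add[OF 1 2]
    have "((\<lambda>x. rot_grad e x \<bullet> a) has_derivative (\<lambda>h. (\<Sum>b\<in>Basis. (cross3 e x \<bullet> b) * T3 x b a h + (cross3 e h \<bullet> b) * (H x b \<bullet> a)) + cross3 (H x h) e \<bullet> a)) (at x)"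
      by (rule has_derivative_transform_within_open[OF _ oD x])
        (simp add: rot_grad_def inner_add_left hessian_expand[of _ "cross3 e _"])
    then show ?thesis
      by (rule has_derivative_eq_rhs)
        (simp add: fun_eq_iff rot_hess_def a sum.distrib hessian_expand[OF x, of "cross3 e _"])
  qed
  then show ?thesis using has_derivative_componentwise_within[of "rot_grad e" "rot_hess e x" x UNIV] by simp
qed

text \<open>The Laplacian commutes with rotations: the mixed terms give twice the trace of Hessian
  times skew matrix, which is 0, and what remains is the gradient of the Laplacian in the direction
  e x x.\<close>

lemma rot_laplacian: "x \<in> D \<Longrightarrow> (\<Sum>a\<in>Basis. rot_hess e x a \<bullet> a) = - (k\<^sup>2 * rot e x)"
proof -
  assume x: "x \<in> D"
  have "(\<Sum>a\<in>Basis. rot_hess e x a \<bullet> a) = (\<Sum>a\<in>Basis. H x (cross3 e a) \<bullet> a)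
     + (\<Sum>a\<in>Basis. \<Sum>b\<in>Basis. (cross3 e x \<bullet> b) * T3 x b a a) + (\<Sum>a\<in>Basis. cross3 (H x a) e \<bullet> a)"
    by (simp add: rot_hess_def sum.distrib)
  also have "(\<Sum>a\<in>Basis. cross3 (H x a) e \<bullet> a) = (\<Sum>a\<in>Basis. H x (cross3 e a) \<bullet> a)"
    by (intro sum.cong refl) (simp add: cross3_cyclic hessian_symmetric[OF x])
  also have "(\<Sum>a\<in>Basis. \<Sum>b\<in>Basis. (cross3 e x \<bullet> b) * T3 x b a a) = (\<Sum>b\<in>Basis. (cross3 e x \<bullet> b) * (\<Sum>a\<in>Basis. T3 x b a a))"
    by (subst sum.swap) (simp add: sum_distrib_left)
  also have "\<dots> = (\<Sum>b\<in>Basis. (cross3 e x \<bullet> b) * - (k\<^sup>2 * (G x \<bullet> b)))"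
  proof (intro sum.cong refl)
    fix b :: "real^3"
    have "(\<Sum>a\<in>Basis. T3 x b a a) = (\<Sum>a\<in>Basis. T3 x a a b)"
      by (intro sum.cong refl) (metis T3_symmetric[OF x])
    then show "(cross3 e x \<bullet> b) * (\<Sum>a\<in>Basis. T3 x b a a) = (cross3 e x \<bullet> b) * - (k\<^sup>2 * (G x \<bullet> b))"
      using T3_trace[OF x] by simp
  qed
  also have "\<dots> = - (k\<^sup>2 * rot e x)"
    unfolding rot_def by (subst euclidean_inner) (simp add: sum_distrib_left sum_negf mult.commute mult.left_commute)
  finally show ?thesis by (simp add: hessian_skew_trace[OF x])
qed

lemma linear_rot_hess: "x \<in> D \<Longrightarrow> linear (rot_hess e x)"
  using rot_grad_has_derivative has_derivative_linear by blast

lemma continuous_rot_hess: "continuous_on D (\<lambda>x. rot_hess e x h)"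
proof -
  have cl: "continuous_on D (\<lambda>x. cross3 (H x h) e)"
    by (intro continuous_on_cross cH continuous_on_const)
  have cr: "continuous_on D (cross3 e)"
    by (intro continuous_on_cross[of D "\<lambda>_. e" "\<lambda>x. x"] continuous_on_id continuous_on_const)
  show ?thesis unfolding rot_hess_def by (intro continuous_intros cH cl cr continuous_T3)
qed

lemma rot_has_laplacian_on: "has_laplacian_on (rot e) (\<lambda>x. 0 - k\<^sup>2 * rot e x) D"
  unfolding has_laplacian_on_def
proof (intro exI[of _ "rot_grad e"] exI[of _ "\<lambda>x. matrix (rot_hess e x)"] conjI ballI)
  have "continuous_on D (\<lambda>x. rot_hess e x (axis j 1) $ i)" for i j
    by (intro continuous_on_component continuous_rot_hess)
  then show "continuous_on D (\<lambda>x. matrix (rot_hess e x))"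
    unfolding matrix_def by (intro continuous_on_vec_lambda)
  fix x assume x: "x \<in> D"
  show "(rot e has_derivative (\<lambda>h. rot_grad e x \<bullet> h)) (at x)" by (rule rot_has_derivative[OF x])
  show "(rot_grad e has_derivative (\<lambda>h. matrix (rot_hess e x) *v h)) (at x)"
    unfolding matrix_vector_mul(2)[OF linear_rot_hess[OF x]] by (rule rot_grad_has_derivative[OF x])
  have "trace (matrix (rot_hess e x)) = (\<Sum>i\<in>UNIV. rot_hess e x (axis i 1) \<bullet> axis i 1)"
    by (simp add: trace_def matrix_def inner_axis)
  also have "\<dots> = (\<Sum>a\<in>Basis. rot_hess e x a \<bullet> a)"
    by (simp add: sum_Basis_vec)
  finally show "0 - k\<^sup>2 * rot e x = trace (matrix (rot_hess e x))" by (simp add: rot_laplacian[OF x])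
qed

text \<open>The value off \<open>D\<close> is the Hessian of the half-space model at its
  boundary.\<close>

definition hess_ext where "hess_ext N x h = (if x \<in> D then H x h else (c * (N x \<bullet> h)) *\<^sub>R N x)"

lemma G_has_derivative_closure:
  assumes N: "C1_boundary_outward_normal D N" and x: "x \<in> closure D"
  shows "(G has_derivative hess_ext N x) (at x within closure D)"
proof (cases "x \<in> D")
  case True
  then show ?thesis using has_derivative_at_withinI[OF dG[OF True]] by (simp add: hess_ext_def[abs_def])
next
  case False
  then have xf: "x \<in> frontier D" using x by (simp add: frontier_def interior_open[OF oD])
  obtain r phi g where ch: "chart D x r phi g" "N x = (1 / norm (g x)) *\<^sub>R g x"
    by (rule C1_boundary_chart[OF N xf])
  from gradient_derivative_boundary[OF xf ch(1)] show ?thesis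
    unfolding ch(2)[symmetric] using False by (simp add: hess_ext_def[abs_def])
qed

lemma hess_ext_symmetric: "hess_ext N x a \<bullet> b = hess_ext N x b \<bullet> a"
  by (cases "x \<in> D") (use hessian_symmetric[of x a b] in \<open>auto simp: hess_ext_def inner_commute\<close>)

text \<open>Every boundary value is a limit of the Hessian from inside \<open>D\<close>, and a
  function extended by its limits is continuous. Continuity of the normal need not be invoked
  separately.\<close>

lemma continuous_hess_ext:
  assumes N: "C1_boundary_outward_normal D N"
  shows "continuous_on (closure D) (\<lambda>x. hess_ext N x a \<bullet> b)"
  unfolding continuous_on_eq_continuous_within
proof
  fix x assume x: "x \<in> closure D"
  have lim: "\<exists>\<delta>>0. \<forall>y\<in>D \<inter> ball s \<delta>. \<bar>H y a \<bullet> b - hess_ext N s a \<bullet> b\<bar> < \<eta>" if s: "s \<in> frontier D" and \<eta>: "\<eta> > 0" for s \<eta>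
  proof -
    obtain r phi g where ch: "chart D s r phi g" "N s = (1 / norm (g s)) *\<^sub>R g s"
      by (rule C1_boundary_chart[OF N s])
    define \<eta>' where "\<eta>' = \<eta> / (norm a * norm b + 1)"
    have \<eta>': "\<eta>' > 0" using \<eta> by (simp add: \<eta>'_def add_nonneg_pos)
    have "\<eta>' * norm a * norm b < \<eta>' * (norm a * norm b + 1)" using \<eta>' by (simp add: mult.assoc)
    also have "\<dots> = \<eta>" by (simp add: \<eta>'_def add_nonneg_eq_0_iff)
    finally have lt: "\<eta>' * norm a * norm b < \<eta>" .
    have he: "hess_ext N s a \<bullet> b = c * ((N s \<bullet> a) * (N s \<bullet> b))"
      using frontier_notin[OF s] by (simp add: hess_ext_def)
    from hessian_limit[OF s ch(1) \<eta>'] obtain \<delta> where "\<delta> > 0"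
      "\<forall>y\<in>D \<inter> ball s \<delta>. \<forall>a b. \<bar>H y a \<bullet> b - c * ((N s \<bullet> a) * (N s \<bullet> b))\<bar> \<le> \<eta>' * norm a * norm b"
      unfolding ch(2)[symmetric] by blast
    then show ?thesis unfolding he using lt by (intro exI[of _ \<delta>]) (auto intro: le_less_trans)
  qed
  show "continuous (at x within closure D) (\<lambda>x. hess_ext N x a \<bullet> b)"
  proof (cases "x \<in> D")
    case True
    have "isCont (\<lambda>y. H y a \<bullet> b) x"
      using has_derivative_continuous[OF hessian_has_derivative[OF True]] .
    then have "((\<lambda>y. H y a \<bullet> b) \<longlongrightarrow> hess_ext N x a \<bullet> b) (at x)" using True by (simp add: isCont_def hess_ext_def)
    then have "((\<lambda>y. hess_ext N y a \<bullet> b) \<longlongrightarrow> hess_ext N x a \<bullet> b) (at x)"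
      by (rule Lim_transform_within_open[OF _ oD True]) (simp add: hess_ext_def)
    then have "isCont (\<lambda>y. hess_ext N y a \<bullet> b) x" by (simp add: isCont_def)
    then show ?thesis by (rule continuous_at_imp_continuous_at_within)
  next
    case False
    then have xf: "x \<in> frontier D" using x by (simp add: frontier_def interior_open[OF oD])
    show ?thesis unfolding continuous_within_eps_delta
    proof (intro allI impI)
      fix \<eta> :: real assume \<eta>: "\<eta> > 0"
      obtain \<delta> where \<delta>: "\<delta> > 0" "\<And>y. y \<in> D \<Longrightarrow> dist x y < \<delta> \<Longrightarrow> \<bar>H y a \<bullet> b - hess_ext N x a \<bullet> b\<bar> < \<eta> / 2"
        using lim[OF xf, of "\<eta> / 2"] \<eta> by auto
      have "dist (hess_ext N y a \<bullet> b) (hess_ext N x a \<bullet> b) < \<eta>" if y: "y \<in> closure D" "dist y x < \<delta>" for y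
      proof (cases "y \<in> D")
        case True
        then show ?thesis using \<delta>(2)[OF True] y \<eta> by (simp add: hess_ext_def dist_real_def dist_commute)
      next
        case False
        then have yf: "y \<in> frontier D" using y by (simp add: frontier_def interior_open[OF oD])
        obtain \<delta>' where \<delta>': "\<delta>' > 0" "\<And>z. z \<in> D \<Longrightarrow> dist y z < \<delta>' \<Longrightarrow> \<bar>H z a \<bullet> b - hess_ext N y a \<bullet> b\<bar> < \<eta> / 2"
          using lim[OF yf, of "\<eta> / 2"] \<eta> by auto
        \<comment> \<open>Two boundary points are compared through an interior point
          \<open>z\<close> close to \<open>y\<close>, at which both limits are within half the
          tolerance.\<close>
        have "min \<delta>' (\<delta> - dist y x) > 0" using \<delta>' y by simp
        then obtain z where z: "z \<in> D" "dist z y < min \<delta>' (\<delta> - dist y x)"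
          using y(1) unfolding closure_approachable by blast
        have "dist x z < \<delta>" using dist_triangle[of x z y] z by (simp add: dist_commute)
        then have "\<bar>H z a \<bullet> b - hess_ext N x a \<bullet> b\<bar> < \<eta> / 2" by (rule \<delta>(2)[OF z(1)])
        moreover have "\<bar>H z a \<bullet> b - hess_ext N y a \<bullet> b\<bar> < \<eta> / 2"
          using \<delta>'(2)[OF z(1)] z by (simp add: dist_commute)
        ultimately show ?thesis unfolding dist_real_def by linarith
      qed
      then show "\<exists>d>0. \<forall>y\<in>closure D. dist y x < d \<longrightarrow> dist (hess_ext N y a \<bullet> b) (hess_ext N x a \<bullet> b) < \<eta>"
        using \<delta>(1) by blast
    qed
  qed
qed

definition rot_grad_ext where "rot_grad_ext N e x = hess_ext N x (cross3 e x) + cross3 (G x) e"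

lemma rot_has_derivative_closure:
  assumes N: "C1_boundary_outward_normal D N" and x: "x \<in> closure D"
  shows "(rot e has_derivative (\<lambda>h. rot_grad_ext N e x \<bullet> h)) (at x within closure D)"
proof -
  have "(rot e has_derivative (\<lambda>h. cross3 e x \<bullet> hess_ext N x h + cross3 e h \<bullet> G x)) (at x within closure D)"
    unfolding rot_def[abs_def]
    by (rule has_derivative_inner[OF cross3_right_has_derivative[OF has_derivative_ident] G_has_derivative_closure[OF N x]])
  moreover have "cross3 e x \<bullet> hess_ext N x h + cross3 e h \<bullet> G x = rot_grad_ext N e x \<bullet> h" for h
    using hess_ext_symmetric[of N x "cross3 e x" h] cross3_cyclic[of "G x" e h]
    by (simp add: rot_grad_ext_def inner_add_left inner_add_right inner_commute)
  ultimately show ?thesis by simp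
qed

text \<open>The extended Hessian is applied to a vector that moves with x, so it is expanded in the
  basis to reduce continuity to fixed arguments.\<close>

lemma rot_C1_on_closure:
  assumes N: "C1_boundary_outward_normal D N"
  shows "C1_on_closure (rot e) D"
  unfolding C1_on_closure_def
proof (intro exI[of _ "rot_grad_ext N e"] conjI ballI)
  show "(rot e has_derivative (\<lambda>h. rot_grad_ext N e x \<bullet> h)) (at x within closure D)" if "x \<in> closure D" for x
    by (rule rot_has_derivative_closure[OF N that])
  have ex: "hess_ext N x v \<bullet> a = (\<Sum>b\<in>Basis. (v \<bullet> b) * (hess_ext N x b \<bullet> a))" if x: "x \<in> closure D" for x v a
  proof -
    have lin: "linear (hess_ext N x)" using G_has_derivative_closure[OF N x] has_derivative_linear by blast
    have "hess_ext N x v = hess_ext N x (\<Sum>b\<in>Basis. (v \<bullet> b) *\<^sub>R b)" by (simp add: euclidean_representation)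
    also have "\<dots> = (\<Sum>b\<in>Basis. (v \<bullet> b) *\<^sub>R hess_ext N x b)" by (simp add: linear_sum[OF lin] linear_cmul[OF lin])
    finally show ?thesis by (simp add: inner_sum_left)
  qed
  have "continuous_on (closure D) (\<lambda>x. rot_grad_ext N e x \<bullet> a)" for a
  proof -
    have "continuous_on (closure D) (\<lambda>x. (\<Sum>b\<in>Basis. (cross3 e x \<bullet> b) * (hess_ext N x b \<bullet> a)) + cross3 (G x) e \<bullet> a)"
      by (intro continuous_intros continuous_hess_ext[OF N] continuous_on_cross cG)
    then show ?thesis
      by (rule continuous_on_cong[THEN iffD1, rotated -1]) (simp_all add: rot_grad_ext_def inner_add_left ex)
  qed
  then show "continuous_on (closure D) (rot_grad_ext N e)" by (subst continuous_on_componentwise) blast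
qed

lemma rot_dirichlet_sol:
  assumes "C1_boundary_outward_normal D N"
  shows "dirichlet_sol D k (rot e)"
  unfolding dirichlet_sol_def helmholtz_sol_def
  using rot_C1_on_closure[OF assms] rot_has_laplacian_on G0 by (simp add: rot_def)

text \<open>The derivative picked by \<open>frechet_derivative\<close> is the given one, by
  uniqueness at boundary points.\<close>

lemma normal_deriv_eq:
  fixes f :: "real^3 \<Rightarrow> real"
  assumes s: "s \<in> frontier D" and d: "(f has_derivative A) (at s within closure D)"
  shows "normal_deriv D N f s = A (N s)"
proof -
  obtain r phi g where ch: "chart D s r phi g" using charts[OF s] by blast
  have "f differentiable (at s within closure D)" using d unfolding differentiable_def by blast
  then have "(f has_derivative frechet_derivative f (at s within closure D)) (at s within closure D)"
    by (simp add: frechet_derivative_works)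
  from chart_derivative_unique[OF ch oD s this d] show ?thesis by (simp add: normal_deriv_def)
qed

text \<open>On the boundary the gradient term drops out and c N N^T applied to e x s leaves c times
  a triple product, which is then permuted cyclically.\<close>

lemma rot_normal_deriv:
  assumes N: "C1_boundary_outward_normal D N" and s: "s \<in> frontier D"
  shows "normal_deriv D N (rot e) s = c * (e \<bullet> cross3 s (N s))"
proof -
  have sc: "s \<in> closure D" using s by (simp add: frontier_def)
  obtain r phi g where ch: "chart D s r phi g" "N s = (1 / norm (g s)) *\<^sub>R g s"
    by (rule C1_boundary_chart[OF N s])
  have "g s \<noteq> 0" using ch by (simp add: chart_def)
  then have nn: "N s \<bullet> N s = 1" unfolding ch(2) by (simp add: dot_square_norm power2_eq_square)
  have "normal_deriv D N (rot e) s = rot_grad_ext N e s \<bullet> N s"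
    by (rule normal_deriv_eq[OF s rot_has_derivative_closure[OF N sc]])
  also have "\<dots> = c * (N s \<bullet> cross3 e s)"
    using frontier_notin[OF s] nn by (simp add: rot_grad_ext_def hess_ext_def G0[OF s])
  also have "N s \<bullet> cross3 e s = e \<bullet> cross3 s (N s)"
    by (simp add: inner_commute[of "N s"] cross3_cyclic)
  finally show ?thesis .
qed

end

section \<open>Comparison with the Dirichlet solutions\<close>

text \<open>The gradient up to the boundary and the gradient inside \<open>D\<close> come from two
  separate existence statements and are identified by uniqueness. On the boundary the normal part of
  the gradient vanishes by hypothesis, the tangential part because \<open>u\<close> is 0
  there.\<close>

lemma overdetermined_intro:
  assumes D: "bounded_domain D" and N: "C1_boundary_outward_normal D N" and k: "k > 0"
    and u: "helmholtz_sol D k c u" and u0: "\<forall>s\<in>frontier D. u s = 0"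
    and un: "\<forall>s\<in>frontier D. normal_deriv D N u s = 0"
  obtains G H where "overdetermined D u G H k c"
proof -
  have oD: "open D" and bD: "bounded D" using D by (auto simp: bounded_domain_def)
  obtain G where cG: "continuous_on (closure D) G"
    and du: "\<And>x. x \<in> closure D \<Longrightarrow> (u has_derivative (\<lambda>h. G x \<bullet> h)) (at x within closure D)"
    using u unfolding helmholtz_sol_def C1_on_closure_def by blast
  obtain g Hm where cHm: "continuous_on D Hm" and dg: "\<And>x. x \<in> D \<Longrightarrow> (u has_derivative (\<lambda>h. g x \<bullet> h)) (at x) \<and>
       (g has_derivative (\<lambda>h. Hm x *v h)) (at x) \<and> c - k\<^sup>2 * u x = trace (Hm x)"
    using u unfolding helmholtz_sol_def has_laplacian_on_def by blast
  have Gg: "G x = g x" if x: "x \<in> D" for x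
  proof -
    have "x \<in> interior (closure D)" using x oD interior_maximal closure_subset by blast
    then have "at x within closure D = at x" by (rule at_within_interior)
    then have "(u has_derivative (\<lambda>h. G x \<bullet> h)) (at x)" using du[of x] x closure_subset by fastforce
    then show ?thesis using dg[OF x] has_derivative_unique_inner by blast
  qed
  have "overdetermined D u G (\<lambda>x h. Hm x *v h) k c"
  proof
    show "open D" "bounded D" "k > 0" "continuous_on (closure D) G" by fact+
    show "\<exists>r phi g. chart D s r phi g" if "s \<in> frontier D" for s
      using C1_boundary_chart[OF N that] by blast
    show "(u has_derivative (\<lambda>h. G x \<bullet> h)) (at x within closure D)" if "x \<in> closure D" for x by (rule du[OF that])
    show "u s = 0" if "s \<in> frontier D" for s using u0 that by blast
    show "G s = 0" if s: "s \<in> frontier D" for s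
    proof -
      obtain r phi gg where ch: "chart D s r phi gg" "N s = (1 / norm (gg s)) *\<^sub>R gg s"
        by (rule C1_boundary_chart[OF N s])
      have d: "(u has_derivative (\<lambda>h. G s \<bullet> h)) (at s within closure D)" using du s by (simp add: frontier_def)
      then have "(u has_derivative frechet_derivative u (at s within closure D)) (at s within closure D)"
        using frechet_derivative_works differentiable_def by blast
      from chart_derivative_unique[OF ch(1) oD s this d] have "normal_deriv D N u s = G s \<bullet> N s"
        by (simp add: normal_deriv_def)
      then have "G s \<bullet> N s = 0" using un s by simp
      moreover have "gg s \<noteq> 0" using ch by (simp add: chart_def)
      ultimately have "G s \<bullet> gg s = 0" unfolding ch(2) by simp
      from chart_gradient_eq_0[OF ch(1) oD s d _ this] show ?thesis using u0 by blast
    qed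
    show "(G has_derivative (\<lambda>h. Hm x *v h)) (at x)" if x: "x \<in> D" for x
      by (rule has_derivative_transform_within_open[OF conjunct1[OF conjunct2[OF dg[OF x]]] oD x]) (simp add: Gg)
    show "continuous_on D (\<lambda>x. Hm x *v b)" for b
      unfolding matrix_vector_mult_def
      by (intro continuous_on_vec_lambda continuous_intros continuous_on_component cHm)
    show "(\<Sum>b\<in>Basis. (Hm x *v b) \<bullet> b) = c - k\<^sup>2 * u x" if x: "x \<in> D" for x
    proof -
      have "(\<Sum>b\<in>Basis. (Hm x *v b) \<bullet> b) = (\<Sum>i\<in>UNIV. (Hm x *v axis i 1) \<bullet> axis i 1)" by (rule sum_Basis_vec)
      also have "\<dots> = trace (Hm x)" by (simp add: trace_def inner_axis matrix_vector_mult_basis column_def)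
      finally show ?thesis using dg[OF x] by simp
    qed
  qed
  then show ?thesis by (rule that)
qed

theorem theorem6:
  fixes D :: "(real^3) set" and N :: "real^3 \<Rightarrow> real^3"
    and k c :: real and u :: "real^3 \<Rightarrow> real"
    and J :: nat and uj :: "nat \<Rightarrow> real^3 \<Rightarrow> real"
  assumes "bounded_domain D"
    and "C1_boundary_outward_normal D N"
    and "k > 0"
    and "c \<noteq> 0"
    and "helmholtz_sol D k c u"
    and "\<forall>s\<in>frontier D. u s = 0"
    and "\<forall>s\<in>frontier D. normal_deriv D N u s = 0"
    and sols: "\<forall>j\<in>{1..J}. dirichlet_sol D k (uj j)"
    and indep: "\<forall>a::nat \<Rightarrow> real. (\<forall>x\<in>D. (\<Sum>j=1..J. a j * uj j x) = 0) \<longrightarrow> (\<forall>j\<in>{1..J}. a j = 0)"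
    and maximal: "\<forall>w. dirichlet_sol D k w \<longrightarrow>
        (\<exists>(a::nat \<Rightarrow> real) (b::real). (b \<noteq> 0 \<or> (\<exists>j\<in>{1..J}. a j \<noteq> 0)) \<and>
           (\<forall>x\<in>D. b * w x + (\<Sum>j=1..J. a j * uj j x) = 0))"
    and normalized: "\<forall>j\<in>{1..J}. (\<lambda>x. (uj j x)\<^sup>2) integrable_on D \<and> integral D (\<lambda>x. (uj j x)\<^sup>2) = 1"
  shows "\<exists>cc :: nat \<Rightarrow> real^3. \<forall>s\<in>frontier D.
           cross3 s (N s) = (\<Sum>j=1..J. normal_deriv D N (uj j) s *\<^sub>R cc j)"
proof -
  note N = assms(2)
  obtain G H where "overdetermined D u G H k c"
    by (rule overdetermined_intro[OF assms(1-3,5-7)])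
  then interpret overdetermined D u G H k c .
  have "\<exists>A. \<forall>x\<in>D. rot e x = (\<Sum>j=1..J. A j * uj j x)" for e
  proof -
    obtain a b where ab: "b \<noteq> 0 \<or> (\<exists>j\<in>{1..J}. a j \<noteq> 0)" "\<forall>x\<in>D. b * rot e x + (\<Sum>j=1..J. a j * uj j x) = 0"
      using maximal rot_dirichlet_sol[OF N, of e] by blast
    \<comment> \<open>Otherwise the relation supplied by maximality would be one among the
      independent \<open>uj\<close>.\<close>
    have "b \<noteq> 0"
    proof
      assume "b = 0"
      then have "\<forall>x\<in>D. (\<Sum>j=1..J. a j * uj j x) = 0" using ab(2) by simp
      then show False using indep ab(1) \<open>b = 0\<close> by blast
    qed
    have "rot e x = (\<Sum>j=1..J. (- a j / b) * uj j x)" if "x \<in> D" for x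
    proof -
      have "b * rot e x = - (\<Sum>j=1..J. a j * uj j x)" using ab(2) that by (simp add: eq_neg_iff_add_eq_0)
      then have "rot e x = - (\<Sum>j=1..J. a j * uj j x) / b" using \<open>b \<noteq> 0\<close> by (simp add: field_simps)
      then show ?thesis by (simp add: sum_divide_distrib sum_negf)
    qed
    then show ?thesis by (intro exI[of _ "\<lambda>j. - a j / b"] ballI)
  qed
  then have "\<forall>e. \<exists>A. \<forall>x\<in>D. rot e x = (\<Sum>j=1..J. A j * uj j x)" by (rule allI)
  then obtain A where A0: "\<forall>e. \<forall>x\<in>D. rot e x = (\<Sum>j=1..J. A e j * uj j x)" by (rule choice[THEN exE])
  have A: "rot e x = (\<Sum>j=1..J. A e j * uj j x)" if "x \<in> D" for e x using bspec[OF spec[OF A0] that] .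
  have nd: "c * (e \<bullet> cross3 s (N s)) = (\<Sum>j=1..J. A e j * normal_deriv D N (uj j) s)" if s: "s \<in> frontier D" for e s
  proof -
    have sc: "s \<in> closure D" using s by (simp add: frontier_def)
    have "\<exists>a. (uj j has_derivative a) (at s within closure D)" if "j \<in> {1..J}" for j
    proof -
      have "C1_on_closure (uj j) D" using sols that by (simp add: dirichlet_sol_def helmholtz_sol_def)
      then obtain Gj where "\<forall>x\<in>closure D. (uj j has_derivative (\<lambda>h. Gj x \<bullet> h)) (at x within closure D)"
        unfolding C1_on_closure_def by (elim exE conjE)
      from bspec[OF this sc] show ?thesis by (intro exI)
    qed
    then obtain a where a: "\<And>j. j \<in> {1..J} \<Longrightarrow> (uj j has_derivative a j) (at s within closure D)" by metis
    \<comment> \<open>Both sides are 0 on the frontier, so the identity holds on the closure and may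
      be differentiated one-sidedly there.\<close>
    have eq: "rot e x = (\<Sum>j=1..J. A e j * uj j x)" if "x \<in> closure D" for x
    proof (cases "x \<in> D")
      case False
      then have "x \<in> frontier D" using that by (simp add: frontier_def interior_open[OF oD])
      then show ?thesis using sols G0 by (simp add: dirichlet_sol_def rot_def)
    qed (rule A)
    have "((\<lambda>x. \<Sum>j=1..J. A e j * uj j x) has_derivative (\<lambda>h. \<Sum>j=1..J. A e j * a j h)) (at s within closure D)"
      by (intro has_derivative_sum has_derivative_mult_right a)
    then have "(rot e has_derivative (\<lambda>h. \<Sum>j=1..J. A e j * a j h)) (at s within closure D)"
      by (rule has_derivative_transform[OF sc, rotated]) (simp add: eq)
    then have "c * (e \<bullet> cross3 s (N s)) = (\<Sum>j=1..J. A e j * a j (N s))"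
      using normal_deriv_eq[OF s] rot_normal_deriv[OF N s, of e] by simp
    also have "\<dots> = (\<Sum>j=1..J. A e j * normal_deriv D N (uj j) s)"
      by (intro sum.cong refl) (simp add: normal_deriv_eq[OF s a])
    finally show ?thesis .
  qed
  \<comment> \<open>The coefficients depend on the direction \<open>e\<close> but not on the
    boundary point; taking \<open>e\<close> along the axes and dividing by \<open>c\<close> gives
    constant vectors.\<close>
  define cc :: "nat \<Rightarrow> real^3" where "cc j = (\<chi> i. A (axis i 1) j / c)" for j
  have "cross3 s (N s) = (\<Sum>j=1..J. normal_deriv D N (uj j) s *\<^sub>R cc j)" if s: "s \<in> frontier D" for s
  proof (subst vec_eq_iff, intro allI)
    fix i :: 3
    have "c * cross3 s (N s) $ i = (\<Sum>j=1..J. A (axis i 1) j * normal_deriv D N (uj j) s)"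
      using nd[OF s, of "axis i 1"] by (simp add: inner_axis')
    then have "cross3 s (N s) $ i = (\<Sum>j=1..J. A (axis i 1) j * normal_deriv D N (uj j) s) / c"
      using assms(4) by (simp add: field_simps)
    then show "cross3 s (N s) $ i = (\<Sum>j=1..J. normal_deriv D N (uj j) s *\<^sub>R cc j) $ i"
      by (simp add: cc_def sum_divide_distrib mult.commute)
  qed
  then show ?thesis by blast
qed

end
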